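(* Let $R$ be a commutative ring and let $A_\bullet$ be a perverse differential graded $R$-algebra (pDGA). The Hochschild cohomology $HH^\ast_\bullet(A)$ is a perverse Gerstenhaber algebra. More precisely, the cup product and the Gerstenhaber bracket of Hochschild cochains induce two products of perverse degree $\overline 0$, $$-\cup-:HH^m_\bullet(A)\otimes HH^p_\bullet(A)\to HH^{m+p}_\bullet(A),\qquad [-,-]:HH^m_\bullet(A)\otimes HH^p_\bullet(A)\to HH^{m+p-1}_\bullet(A),$$ such that: (a) $\cup$ is an associative and graded commutative product; (b) the suspension $(sHH^\ast_\bullet(A),[-,-])$ is a graded Lie algebra: for $f,g,h\in HH^\ast_\bullet(A)$, $$[f,g]=-(-1)^{(|f|-1)(|g|-1)}[g,f],\qquad [[f,g],h]=[f,[g,h]]-(-1)^{(|f|-1)(|g|-1)}[g,[f,h]];$$ (c) the Leibniz rule holds: $[f,g\cup h]=[f,g]\cup h+(-1)^{(|f|-1)|g|}g\cup[f,h]$.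
   Context: Perverse objects. Fix $n\in\mathbb N$. A GM $n$-perversity is a map $\overline p:\{0,\dots,n\}\to\mathbb N$ with $\overline p(0)=\overline p(1)=\overline p(2)=0$ and $\overline p(i)\le\overline p(i+1)\le\overline p(i)+1$ for $1\le i\le n-1$. They form a poset $\mathcal P_n$ (pointwise order) with least element $\overline 0$ and greatest element $\overline t$ ($\overline t(i)=i-2$ for $i\ge2$). If $\overline p+\overline q\le\overline t$, $\overline p\oplus\overline q$ denotes the smallest GM perversity $\ge\overline p+\overline q$. A perverse cochain complex (resp. perverse graded module) is a functor $Z_\bullet$ from $\mathcal P_n$ to $\mathbb Z$-graded cochain complexes of $R$-modules with differential of degree $+1$ (resp. to graded $R$-modules). Tensor product: $(Z\boxtimes Y)_{\overline r}=\operatorname{colim}_{\overline p+\overline q\le\overline r}Z_{\overline p}\otimes Y_{\overline q}$, with unit the constant functor $F_{\overline 0}(\mathbb S^0)$ with value $R$ in degree $0$. Internal Hom: $\operatorname{Hom}(Z,Y)^k_{\overline r}=\lim_{\overline p+\overline r\le\overline q}\prod_{j-i=k}\operatorname{Hom}_R(Z^i_{\overline p},Y^j_{\overline q})$ (limit over pairs $(\overline p,\overline q)$, i.e. natural families). A pDGA is a monoid for $\boxtimes$: a perverse cochain complex with associative products $A^i_{\overline p}\otimes A^j_{\overline q}\to A^{i+j}_{\overline p\oplus\overline q}$ (for $\overline p+\overline q\le\overline t$) compatible with the structure maps of the functor, a unit $1\in A^0_{\overline 0}$, and $d(ab)=(da)b+(-1)^{|a|}a\,db$. "Perverse degree $\overline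 0$" for a product means that it maps perversities $(\overline p,\overline q)$ to $\overline p\oplus\overline q$, compatibly with structure maps. Hochschild cochains. Let $\overline A_\bullet=A_\bullet/(R\cdot1)$ be the cokernel of the unit $F_{\overline0}(\mathbb S^0)\to A_\bullet$, $(s\overline A)^k=\overline A^{k+1}$, and $T(s\overline A)=\bigoplus_{k\ge0}(s\overline A)^{\boxtimes k}$, with elements written $[a_1|\dots|a_k]$ of degree $\sum_i(|a_i|-1)$; $|s(a)|=|a|-1$. Then $HC^\ast_\bullet(A)=\operatorname{Hom}(T(s\overline A),A)^\ast_\bullet$ with differential $D=d_0+d_1$, where with $\varepsilon_i=\sum_{j<i}|s(a_j)|$ $$d_0(f)[a_1|\dots|a_k]=d_Af[a_1|\dots|a_k]+\sum_{i=1}^k(-1)^{\varepsilon_i+|f|}f[a_1|\dots|d_Aa_i|\dots|a_k],$$ $$d_1(f)[a_1|\dots|a_k]=-(-1)^{(|a_1|+1)|f|}a_1f[a_2|\dots|a_k]+(-1)^{\varepsilon_k+|f|}f[a_1|\dots|a_{k-1}]a_k-\sum_{i=2}^k(-1)^{\varepsilon_i+|f|}f[a_1|\dots|a_{i-1}a_i|\dots|a_k].$$ $HH^\ast_\bullet(A)$ is the cohomology of $HC^\ast_\bullet(A)$. With $\overline\varepsilon_i=\sum_{j\le i}(|a_j|-1)$, $$(f\cup g)[a_1|\dots|a_k]=\sum_{i=0}^k(-1)^{|g|\overline\varepsilon_i}f[a_1|\dots|a_i]\,g[a_{i+1}|\dots|a_k],$$ $$(f\circ g)[a_1|\dots|a_k]=\sum_{0\le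 i\le j\le k}(-1)^{(|g|-1)\overline\varepsilon_i}f[a_1|\dots|a_i|g[a_{i+1}|\dots|a_j]|a_{j+1}|\dots|a_k],$$ and $[f,g]=f\circ g-(-1)^{(|f|-1)(|g|-1)}g\circ f$. *)

theory Defs
  imports "HOL-Algebra.Module" "HOL-Algebra.AbelCoset" "HOL-Library.FuncSet"
begin

section \<open>GM perversities\<close>

text \<open>A map with domain \<open>{0..n}\<close> is encoded as a function on \<^typ>\<open>nat\<close> that vanishes beyond \<open>n\<close>.
  The pointwise order on \<open>{0..n}\<close> is then the library order on functions.\<close>

type_synonym perv = "nat \<Rightarrow> nat"

definition GM :: "nat \<Rightarrow> perv set" where
  "GM n = {p. (\<forall>i. i \<le> 2 \<longrightarrow> p i = 0)
            \<and> (\<forall>i. 1 \<le> i \<and> i < n \<longrightarrow> p i \<le> p (i + 1) \<and> p (i + 1) \<le> p i + 1)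
            \<and> (\<forall>i>n. p i = 0)}"

definition gm_zero :: perv where
  "gm_zero = (\<lambda>i. 0)"

text \<open>The subtraction is truncated, so the values at \<open>0\<close> and \<open>1\<close> are \<open>0\<close>.\<close>

definition gm_top :: "nat \<Rightarrow> perv" where
  "gm_top n = (\<lambda>i. if i \<le> n then i - 2 else 0)"

definition psum :: "perv \<Rightarrow> perv \<Rightarrow> perv" where
  "psum p q = (\<lambda>i. p i + q i)"

definition psum_list :: "perv list \<Rightarrow> perv" where
  "psum_list ps = (\<lambda>i. \<Sum>p\<leftarrow>ps. p i)"

text \<open>The smallest GM perversity above \<open>u\<close>; meaningful for \<open>u\<close> below \<^term>\<open>gm_top n\<close>.\<close>

definition gm_hull :: "nat \<Rightarrow> perv \<Rightarrow> perv" where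
  "gm_hull n u = (THE p. p \<in> GM n \<and> u \<le> p \<and> (\<forall>q\<in>GM n. u \<le> q \<longrightarrow> p \<le> q))"

definition gm_add :: "nat \<Rightarrow> perv \<Rightarrow> perv \<Rightarrow> perv" where
  "gm_add n p q = gm_hull n (psum p q)"


section \<open>Linear maps, quotients, free modules\<close>

definition lin_maps ::
    "('r, 'x) ring_scheme \<Rightarrow> ('r, 'a, 'y) module_scheme \<Rightarrow> ('r, 'b, 'z) module_scheme \<Rightarrow> ('a \<Rightarrow> 'b) set"
  where
  "lin_maps R M N = {h \<in> hom (add_monoid M) (add_monoid N).
      \<forall>c\<in>carrier R. \<forall>x\<in>carrier M. h (c \<odot>\<^bsub>M\<^esub> x) = c \<odot>\<^bsub>N\<^esub> h x}"

text \<open>The record type of modules extends that of rings; its fields \<open>mult\<close> and \<open>one\<close> play no role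
  for modules and are left unspecified throughout.\<close>

definition quot_module :: "('r, 'a, 'y) module_scheme \<Rightarrow> 'a set \<Rightarrow> ('r, 'a set) module" where
  "quot_module M N =
     \<lparr>carrier = a_rcosets\<^bsub>M\<^esub> N, mult = undefined, one = undefined, zero = N,
      add = (\<lambda>X Y. X <+>\<^bsub>M\<^esub> Y), smult = (\<lambda>c X. N <+>\<^bsub>M\<^esub> ((\<lambda>x. c \<odot>\<^bsub>M\<^esub> x) ` X))\<rparr>"

definition submodule_span ::
    "('r, 'x) ring_scheme \<Rightarrow> ('r, 'a, 'y) module_scheme \<Rightarrow> 'a set \<Rightarrow> 'a set" where
  "submodule_span R M S = \<Inter>{N. submodule N R M \<and> S \<subseteq> N}"

definition free_module :: "('r, 'x) ring_scheme \<Rightarrow> 'w set \<Rightarrow> ('r, 'w \<Rightarrow> 'r) module" where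
  "free_module R W =
     \<lparr>carrier = {u. (\<forall>w. u w \<in> carrier R) \<and> (\<forall>w. w \<notin> W \<longrightarrow> u w = \<zero>\<^bsub>R\<^esub>) \<and> finite {w. u w \<noteq> \<zero>\<^bsub>R\<^esub>}},
      mult = undefined, one = undefined, zero = (\<lambda>w. \<zero>\<^bsub>R\<^esub>),
      add = (\<lambda>u v w. u w \<oplus>\<^bsub>R\<^esub> v w), smult = (\<lambda>c u w. c \<otimes>\<^bsub>R\<^esub> u w)\<rparr>"

definition free_gen :: "('r, 'x) ring_scheme \<Rightarrow> 'w \<Rightarrow> 'w \<Rightarrow> 'r" where
  "free_gen R w = (\<lambda>v. if v = w then \<one>\<^bsub>R\<^esub> else \<zero>\<^bsub>R\<^esub>)"

text \<open>Multiplication by \<open>(-1)\<^sup>e\<close>.\<close>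

definition sgn_mult :: "('r, 'a, 'y) module_scheme \<Rightarrow> int \<Rightarrow> 'a \<Rightarrow> 'a" where
  "sgn_mult M e x = (if even e then x else \<ominus>\<^bsub>M\<^esub> x)"


section \<open>Perverse graded modules\<close>

record ('r, 'a) pmod =
  pobj :: "perv \<Rightarrow> int \<Rightarrow> ('r, 'a) module"
  pmap :: "perv \<Rightarrow> perv \<Rightarrow> int \<Rightarrow> 'a \<Rightarrow> 'a"

locale perverse_module =
  fixes R :: "('r, 'x) ring_scheme" and n :: nat and Z :: "('r, 'a, 'z) pmod_scheme"
  assumes cring: "cring R"
    and obj: "p \<in> GM n \<Longrightarrow> module R (pobj Z p k)"
    and map: "\<lbrakk>p \<in> GM n; q \<in> GM n; p \<le> q\<rbrakk> \<Longrightarrow> pmap Z p q k \<in> lin_maps R (pobj Z p k) (pobj Z q k)"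
    and map_id: "\<lbrakk>p \<in> GM n; x \<in> carrier (pobj Z p k)\<rbrakk> \<Longrightarrow> pmap Z p p k x = x"
    and map_comp: "\<lbrakk>p \<in> GM n; q \<in> GM n; r \<in> GM n; p \<le> q; q \<le> r; x \<in> carrier (pobj Z p k)\<rbrakk>
      \<Longrightarrow> pmap Z q r k (pmap Z p q k x) = pmap Z p r k x"

text \<open>Quotient by a perverse graded submodule \<open>N\<close>: the structure map sends the class of \<open>x\<close> to the
  class of its image.\<close>

definition pquot ::
    "('r, 'a, 'z) pmod_scheme \<Rightarrow> (perv \<Rightarrow> int \<Rightarrow> 'a set) \<Rightarrow> ('r, 'a set) pmod" where
  "pquot Z N =
     \<lparr>pobj = (\<lambda>p k. quot_module (pobj Z p k) (N p k)),
      pmap = (\<lambda>p q k X. N q k <+>\<^bsub>pobj Z q k\<^esub> (pmap Z p q k ` X))\<rparr>"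

definition psusp :: "('r, 'a, 'z) pmod_scheme \<Rightarrow> ('r, 'a) pmod" where
  "psusp Z = \<lparr>pobj = (\<lambda>p k. pobj Z p (k + 1)), pmap = (\<lambda>p q k. pmap Z p q (k + 1))\<rparr>"

text \<open>A bilinear product \<open>Z\<^sub>p\<^sup>i \<times> Z\<^sub>q\<^sup>j \<rightarrow> Z\<^sub>r\<^sup>k\<close> with \<open>r = p \<oplus> q\<close> and \<open>k = i + j + e\<close>, i.e. of perverse
  degree \<open>0\<close>, natural in the perversities.\<close>

definition perverse_product ::
    "('r, 'x) ring_scheme \<Rightarrow> nat \<Rightarrow> ('r, 'a, 'z) pmod_scheme \<Rightarrow> int
      \<Rightarrow> (perv \<Rightarrow> perv \<Rightarrow> int \<Rightarrow> int \<Rightarrow> 'a \<Rightarrow> 'a \<Rightarrow> 'a) \<Rightarrow> bool" where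
  "perverse_product R n Z e \<mu> \<longleftrightarrow>
     (\<forall>p\<in>GM n. \<forall>q\<in>GM n. psum p q \<le> gm_top n \<longrightarrow> (\<forall>i j.
        (\<forall>a\<in>carrier (pobj Z p i).
           (\<lambda>b. \<mu> p q i j a b) \<in> lin_maps R (pobj Z q j) (pobj Z (gm_add n p q) (i + j + e))) \<and>
        (\<forall>b\<in>carrier (pobj Z q j).
           (\<lambda>a. \<mu> p q i j a b) \<in> lin_maps R (pobj Z p i) (pobj Z (gm_add n p q) (i + j + e))))) \<and>
     (\<forall>p\<in>GM n. \<forall>q\<in>GM n. \<forall>p'\<in>GM n. \<forall>q'\<in>GM n.
        p \<le> p' \<and> q \<le> q' \<and> psum p' q' \<le> gm_top n \<longrightarrow>
        (\<forall>i j. \<forall>a\<in>carrier (pobj Z p i). \<forall>b\<in>carrier (pobj Z q j).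
           pmap Z (gm_add n p q) (gm_add n p' q') (i + j + e) (\<mu> p q i j a b) =
           \<mu> p' q' i j (pmap Z p p' i a) (pmap Z q q' j b)))"


section \<open>Tensor algebra and internal Hom\<close>

text \<open>The degree \<open>m\<close>, perversity \<open>p\<close> part of the tensor algebra of \<open>Z\<close>, the sum over \<open>k \<ge> 0\<close> of
  \<open>colim Z\<^sub>p\<^sub>1 \<otimes> \<dots> \<otimes> Z\<^sub>p\<^sub>k\<close> over all \<open>p\<^sub>1 + \<dots> + p\<^sub>k \<le> p\<close>, is presented by generators and relations.
  Generators are the words of homogeneous elements (perversity, degree, element); the relations are
  multilinearity, defining the tensor products, and the identifications defining the colimit.
  The empty word gives the unit (\<open>k = 0\<close>). The iterated binary product has the same value: if
  \<open>p\<^sub>1 + p\<^sub>2 + p\<^sub>3 \<le> p\<close> then \<open>(p\<^sub>1 \<oplus> p\<^sub>2) + p\<^sub>3 \<le> p\<close>.\<close>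

type_synonym 'a pword = "(perv \<times> int \<times> 'a) list"

definition tensor_words :: "nat \<Rightarrow> ('r, 'a, 'z) pmod_scheme \<Rightarrow> perv \<Rightarrow> int \<Rightarrow> 'a pword set" where
  "tensor_words n Z p m =
     {w. (\<forall>(q, i, x) \<in> set w. q \<in> GM n \<and> x \<in> carrier (pobj Z q i))
       \<and> psum_list (map fst w) \<le> p \<and> (\<Sum>(q, i, x)\<leftarrow>w. i) = m}"

definition tensor_free ::
    "('r, 'x) ring_scheme \<Rightarrow> nat \<Rightarrow> ('r, 'a, 'z) pmod_scheme \<Rightarrow> ('r, 'a pword \<Rightarrow> 'r) pmod" where
  "tensor_free R n Z =
     \<lparr>pobj = (\<lambda>p m. free_module R (tensor_words n Z p m)), pmap = (\<lambda>p q m u. u)\<rparr>"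

definition tensor_rels ::
    "('r, 'x) ring_scheme \<Rightarrow> nat \<Rightarrow> ('r, 'a, 'z) pmod_scheme \<Rightarrow> perv \<Rightarrow> int \<Rightarrow> ('a pword \<Rightarrow> 'r) set" where
  "tensor_rels R n Z p m =
     (let F = pobj (tensor_free R n Z) p m; W = tensor_words n Z p m; g = free_gen R in
      submodule_span R F
       ({g (u @ [(q, i, x \<oplus>\<^bsub>pobj Z q i\<^esub> y)] @ v) \<ominus>\<^bsub>F\<^esub> (g (u @ [(q, i, x)] @ v) \<oplus>\<^bsub>F\<^esub> g (u @ [(q, i, y)] @ v))
           | u v q i x y. u @ [(q, i, x)] @ v \<in> W \<and> u @ [(q, i, y)] @ v \<in> W}
      \<union> {g (u @ [(q, i, c \<odot>\<^bsub>pobj Z q i\<^esub> x)] @ v) \<ominus>\<^bsub>F\<^esub> (c \<odot>\<^bsub>F\<^esub> g (u @ [(q, i, x)] @ v))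
           | u v q i c x. c \<in> carrier R \<and> u @ [(q, i, x)] @ v \<in> W}
      \<union> {g w' \<ominus>\<^bsub>F\<^esub> g w | w w'. w \<in> W \<and> w' \<in> W \<and>
           list_all2 (\<lambda>(q, i, x) (q', i', x'). q \<le> q' \<and> i' = i \<and> x' = pmap Z q q' i x) w w'}))"

definition tensor_algebra ::
    "('r, 'x) ring_scheme \<Rightarrow> nat \<Rightarrow> ('r, 'a, 'z) pmod_scheme \<Rightarrow> ('r, ('a pword \<Rightarrow> 'r) set) pmod" where
  "tensor_algebra R n Z = pquot (tensor_free R n Z) (tensor_rels R n Z)"

text \<open>A cochain of perversity \<open>r\<close> and degree \<open>k\<close> is one extensional function of
  \<open>(p, q, m, x)\<close> with \<open>p + r \<le> q\<close> and \<open>x\<close> in \<open>Z\<^sub>p\<close> of degree \<open>m\<close>, with values in \<open>Y\<^sub>q\<close>.\<close>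

definition hom_dom ::
    "nat \<Rightarrow> ('r, 'b, 'y) pmod_scheme \<Rightarrow> perv \<Rightarrow> (perv \<times> perv \<times> int \<times> 'b) set" where
  "hom_dom n Z r = {(p, q, m, x). p \<in> GM n \<and> q \<in> GM n \<and> psum p r \<le> q \<and> x \<in> carrier (pobj Z p m)}"

definition internal_hom ::
    "('r, 'x) ring_scheme \<Rightarrow> nat \<Rightarrow> ('r, 'b, 'y) pmod_scheme \<Rightarrow> ('r, 'a, 'z) pmod_scheme
      \<Rightarrow> ('r, perv \<times> perv \<times> int \<times> 'b \<Rightarrow> 'a) pmod" where
  "internal_hom R n Z Y =
     \<lparr>pobj = (\<lambda>r k.
        \<lparr>carrier = {f \<in> (\<Pi>\<^sub>E (p, q, m, x) \<in> hom_dom n Z r. carrier (pobj Y q (m + k))).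
            (\<forall>p\<in>GM n. \<forall>q\<in>GM n. \<forall>m. psum p r \<le> q \<longrightarrow>
               (\<lambda>x. f (p, q, m, x)) \<in> lin_maps R (pobj Z p m) (pobj Y q (m + k))) \<and>
            (\<forall>p\<in>GM n. \<forall>q\<in>GM n. \<forall>p'\<in>GM n. \<forall>q'\<in>GM n. \<forall>m. \<forall>x\<in>carrier (pobj Z p' m).
               p' \<le> p \<and> psum p r \<le> q \<and> q \<le> q' \<longrightarrow>
               f (p', q', m, x) = pmap Y q q' (m + k) (f (p, q, m, pmap Z p' p m x)))},
         mult = undefined, one = undefined,
         zero = (\<lambda>(p, q, m, x) \<in> hom_dom n Z r. \<zero>\<^bsub>pobj Y q (m + k)\<^esub>),
         add = (\<lambda>f g. \<lambda>(p, q, m, x) \<in> hom_dom n Z r.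
                  f (p, q, m, x) \<oplus>\<^bsub>pobj Y q (m + k)\<^esub> g (p, q, m, x)),
         smult = (\<lambda>c f. \<lambda>(p, q, m, x) \<in> hom_dom n Z r. c \<odot>\<^bsub>pobj Y q (m + k)\<^esub> f (p, q, m, x))\<rparr>),
      pmap = (\<lambda>r r' k f. restrict f (hom_dom n Z r'))\<rparr>"


section \<open>Perverse differential graded algebras\<close>

record ('r, 'a) pdga = "('r, 'a) pmod" +
  pdiff :: "perv \<Rightarrow> int \<Rightarrow> 'a \<Rightarrow> 'a"
  pmul :: "perv \<Rightarrow> perv \<Rightarrow> int \<Rightarrow> int \<Rightarrow> 'a \<Rightarrow> 'a \<Rightarrow> 'a"
  pone :: 'a

locale perverse_dga = perverse_module R n A
  for R :: "('r, 'x) ring_scheme" and n :: nat and A :: "('r, 'a, 'z) pdga_scheme" +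
  assumes diff: "p \<in> GM n \<Longrightarrow> pdiff A p k \<in> lin_maps R (pobj A p k) (pobj A p (k + 1))"
    and diff_diff: "\<lbrakk>p \<in> GM n; x \<in> carrier (pobj A p k)\<rbrakk>
      \<Longrightarrow> pdiff A p (k + 1) (pdiff A p k x) = \<zero>\<^bsub>pobj A p (k + 2)\<^esub>"
    and diff_map: "\<lbrakk>p \<in> GM n; q \<in> GM n; p \<le> q; x \<in> carrier (pobj A p k)\<rbrakk>
      \<Longrightarrow> pdiff A q k (pmap A p q k x) = pmap A p q (k + 1) (pdiff A p k x)"
    and mul: "perverse_product R n A 0 (pmul A)"
    and mul_assoc: "\<lbrakk>p \<in> GM n; q \<in> GM n; r \<in> GM n; psum (psum p q) r \<le> gm_top n;
        a \<in> carrier (pobj A p i); b \<in> carrier (pobj A q j); c \<in> carrier (pobj A r k)\<rbrakk>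
      \<Longrightarrow> pmul A (gm_add n p q) r (i + j) k (pmul A p q i j a b) c =
          pmul A p (gm_add n q r) i (j + k) a (pmul A q r j k b c)"
    and one: "pone A \<in> carrier (pobj A gm_zero 0)"
    and one_mul: "\<lbrakk>p \<in> GM n; a \<in> carrier (pobj A p i)\<rbrakk> \<Longrightarrow> pmul A gm_zero p 0 i (pone A) a = a"
    and mul_one: "\<lbrakk>p \<in> GM n; a \<in> carrier (pobj A p i)\<rbrakk> \<Longrightarrow> pmul A p gm_zero i 0 a (pone A) = a"
    and diff_mul: "\<lbrakk>p \<in> GM n; q \<in> GM n; psum p q \<le> gm_top n;
        a \<in> carrier (pobj A p i); b \<in> carrier (pobj A q j)\<rbrakk>
      \<Longrightarrow> pdiff A (gm_add n p q) (i + j) (pmul A p q i j a b) =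
          pmul A p q (i + 1) j (pdiff A p i a) b
          \<oplus>\<^bsub>pobj A (gm_add n p q) (i + j + 1)\<^esub>
          sgn_mult (pobj A (gm_add n p q) (i + j + 1)) i (pmul A p q i (j + 1) a (pdiff A q j b))"


section \<open>Hochschild cochains\<close>

definition unit_image ::
    "('r, 'x) ring_scheme \<Rightarrow> ('r, 'a, 'z) pdga_scheme \<Rightarrow> perv \<Rightarrow> int \<Rightarrow> 'a set" where
  "unit_image R A p k =
     (if k = 0 then {c \<odot>\<^bsub>pobj A p 0\<^esub> pmap A gm_zero p 0 (pone A) | c. c \<in> carrier R}
      else {\<zero>\<^bsub>pobj A p k\<^esub>})"

definition reduced ::
    "('r, 'x) ring_scheme \<Rightarrow> ('r, 'a, 'z) pdga_scheme \<Rightarrow> ('r, 'a set) pmod" where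
  "reduced R A = pquot A (unit_image R A)"

definition bar ::
    "('r, 'x) ring_scheme \<Rightarrow> nat \<Rightarrow> ('r, 'a, 'z) pdga_scheme \<Rightarrow> ('r, ('a set pword \<Rightarrow> 'r) set) pmod"
  where "bar R n A = tensor_algebra R n (psusp (reduced R A))"

type_synonym ('r, 'a) cochain = "perv \<times> perv \<times> int \<times> ('a set pword \<Rightarrow> 'r) set \<Rightarrow> 'a"

definition HC ::
    "('r, 'x) ring_scheme \<Rightarrow> nat \<Rightarrow> ('r, 'a, 'z) pdga_scheme \<Rightarrow> ('r, ('r, 'a) cochain) pmod" where
  "HC R n A = internal_hom R n (bar R n A) A"

text \<open>Words \<open>[a\<^sub>1|\<dots>|a\<^sub>k]\<close> are given by homogeneous elements of \<open>A\<close> together with their perversity and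
  degree.\<close>

definition word_deg :: "'a pword \<Rightarrow> int" where
  "word_deg w = (\<Sum>(p, i, a)\<leftarrow>w. i - 1)"

definition word_perv :: "nat \<Rightarrow> 'a pword \<Rightarrow> perv" where
  "word_perv n w = gm_hull n (psum_list (map fst w))"

text \<open>The words on which a cochain of perversity \<open>r\<close> is defined.\<close>

definition hoch_words :: "nat \<Rightarrow> ('r, 'a, 'z) pdga_scheme \<Rightarrow> perv \<Rightarrow> 'a pword set" where
  "hoch_words n A r =
     {w. (\<forall>(p, i, a) \<in> set w. p \<in> GM n \<and> a \<in> carrier (pobj A p i))
       \<and> psum (psum_list (map fst w)) r \<le> gm_top n}"

definition bar_word ::
    "('r, 'x) ring_scheme \<Rightarrow> nat \<Rightarrow> ('r, 'a, 'z) pdga_scheme \<Rightarrow> perv \<Rightarrow> 'a pword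
      \<Rightarrow> ('a set pword \<Rightarrow> 'r) set" where
  "bar_word R n A p w =
     (let Z = psusp (reduced R A); m = word_deg w in
      tensor_rels R n Z p m +>\<^bsub>pobj (tensor_free R n Z) p m\<^esub>
      free_gen R (map (\<lambda>(q, i, a). (q, i - 1, unit_image R A q i +>\<^bsub>pobj A q i\<^esub> a)) w))"

definition elt :: "perv \<times> int \<times> 'a \<Rightarrow> 'a" where
  "elt x = snd (snd x)"

definition hmul ::
    "nat \<Rightarrow> ('r, 'a, 'z) pdga_scheme \<Rightarrow> perv \<times> int \<times> 'a \<Rightarrow> perv \<times> int \<times> 'a \<Rightarrow> perv \<times> int \<times> 'a" where
  "hmul n A = (\<lambda>(p, i, a) (q, j, b). (gm_add n p q, i + j, pmul A p q i j a b))"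

definition hdiff :: "('r, 'a, 'z) pdga_scheme \<Rightarrow> perv \<times> int \<times> 'a \<Rightarrow> perv \<times> int \<times> 'a" where
  "hdiff A = (\<lambda>(p, i, a). (p, i + 1, pdiff A p i a))"

text \<open>The homogeneous element \<open>f[a\<^sub>1|\<dots>|a\<^sub>k]\<close> for a cochain \<open>f\<close> of perversity \<open>r\<close> and degree \<open>m\<close>. It
  is taken in the smallest possible perversity \<open>p\<^sub>1 \<oplus> \<dots> \<oplus> p\<^sub>k \<oplus> r\<close>; by naturality of \<open>f\<close> its values
  in all other perversities are images of this one.\<close>

definition hval ::
    "('r, 'x) ring_scheme \<Rightarrow> nat \<Rightarrow> ('r, 'a, 'z) pdga_scheme \<Rightarrow> perv \<Rightarrow> int \<Rightarrow> ('r, 'a) cochain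
      \<Rightarrow> 'a pword \<Rightarrow> perv \<times> int \<times> 'a" where
  "hval R n A r m f w =
     (let p = word_perv n w; q = gm_add n p r in
      (q, word_deg w + m, f (p, q, word_deg w, bar_word R n A p w)))"

text \<open>In the formulas below letters are indexed from \<open>0\<close>, so \<open>\<epsilon>\<^sub>i = \<Sum>\<^sub>j\<^sub><\<^sub>i |s(a\<^sub>j)|\<close> is
  \<open>word_deg (take i w)\<close>. All terms of a sum lie in the same module of \<open>A\<close> because \<open>\<oplus>\<close> is
  associative and commutative.\<close>

definition hoch_d0 ::
    "('r, 'x) ring_scheme \<Rightarrow> nat \<Rightarrow> ('r, 'a, 'z) pdga_scheme \<Rightarrow> perv \<Rightarrow> int \<Rightarrow> ('r, 'a) cochain
      \<Rightarrow> 'a pword \<Rightarrow> 'a" where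
  "hoch_d0 R n A r m f w =
     (let M = pobj A (gm_add n (word_perv n w) r) (word_deg w + m + 1) in
      elt (hdiff A (hval R n A r m f w)) \<oplus>\<^bsub>M\<^esub>
      (\<Oplus>\<^bsub>M\<^esub> i \<in> {..<length w}. sgn_mult M (word_deg (take i w) + m)
         (elt (hval R n A r m f (take i w @ [hdiff A (w ! i)] @ drop (i + 1) w)))))"

definition hoch_d1 ::
    "('r, 'x) ring_scheme \<Rightarrow> nat \<Rightarrow> ('r, 'a, 'z) pdga_scheme \<Rightarrow> perv \<Rightarrow> int \<Rightarrow> ('r, 'a) cochain
      \<Rightarrow> 'a pword \<Rightarrow> 'a" where
  "hoch_d1 R n A r m f w =
     (let M = pobj A (gm_add n (word_perv n w) r) (word_deg w + m + 1) in
      if w = [] then \<zero>\<^bsub>M\<^esub> else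
      \<ominus>\<^bsub>M\<^esub> sgn_mult M ((fst (snd (hd w)) + 1) * m) (elt (hmul n A (hd w) (hval R n A r m f (tl w))))
      \<oplus>\<^bsub>M\<^esub> sgn_mult M (word_deg (butlast w) + m) (elt (hmul n A (hval R n A r m f (butlast w)) (last w)))
      \<ominus>\<^bsub>M\<^esub> (\<Oplus>\<^bsub>M\<^esub> i \<in> {1..<length w}. sgn_mult M (word_deg (take i w) + m)
         (elt (hval R n A r m f (take (i - 1) w @ [hmul n A (w ! (i - 1)) (w ! i)] @ drop (i + 1) w)))))"

text \<open>A cochain is determined by its values on words. The operations are the unique cochains with
  the prescribed values.\<close>

definition cochain_of ::
    "('r, 'x) ring_scheme \<Rightarrow> nat \<Rightarrow> ('r, 'a, 'z) pdga_scheme \<Rightarrow> perv \<Rightarrow> int \<Rightarrow> ('a pword \<Rightarrow> 'a)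
      \<Rightarrow> ('r, 'a) cochain" where
  "cochain_of R n A r m \<phi> =
     (THE f. f \<in> carrier (pobj (HC R n A) r m) \<and>
        (\<forall>w\<in>hoch_words n A r. elt (hval R n A r m f w) = \<phi> w))"

definition hoch_D ::
    "('r, 'x) ring_scheme \<Rightarrow> nat \<Rightarrow> ('r, 'a, 'z) pdga_scheme \<Rightarrow> perv \<Rightarrow> int \<Rightarrow> ('r, 'a) cochain
      \<Rightarrow> ('r, 'a) cochain" where
  "hoch_D R n A r m f = cochain_of R n A r (m + 1)
     (\<lambda>w. hoch_d0 R n A r m f w
           \<oplus>\<^bsub>pobj A (gm_add n (word_perv n w) r) (word_deg w + m + 1)\<^esub> hoch_d1 R n A r m f w)"

definition hoch_cup ::
    "('r, 'x) ring_scheme \<Rightarrow> nat \<Rightarrow> ('r, 'a, 'z) pdga_scheme \<Rightarrow> perv \<Rightarrow> perv \<Rightarrow> int \<Rightarrow> int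
      \<Rightarrow> ('r, 'a) cochain \<Rightarrow> ('r, 'a) cochain \<Rightarrow> ('r, 'a) cochain" where
  "hoch_cup R n A r s m l f g = cochain_of R n A (gm_add n r s) (m + l)
     (\<lambda>w. let M = pobj A (gm_add n (word_perv n w) (gm_add n r s)) (word_deg w + (m + l)) in
        \<Oplus>\<^bsub>M\<^esub> i \<in> {..length w}. sgn_mult M (l * word_deg (take i w))
          (elt (hmul n A (hval R n A r m f (take i w)) (hval R n A s l g (drop i w)))))"

definition hoch_circ ::
    "('r, 'x) ring_scheme \<Rightarrow> nat \<Rightarrow> ('r, 'a, 'z) pdga_scheme \<Rightarrow> perv \<Rightarrow> perv \<Rightarrow> int \<Rightarrow> int
      \<Rightarrow> ('r, 'a) cochain \<Rightarrow> ('r, 'a) cochain \<Rightarrow> ('r, 'a) cochain" where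
  "hoch_circ R n A r s m l f g = cochain_of R n A (gm_add n r s) (m + l - 1)
     (\<lambda>w. let M = pobj A (gm_add n (word_perv n w) (gm_add n r s)) (word_deg w + (m + l - 1)) in
        \<Oplus>\<^bsub>M\<^esub> j \<in> {..length w}. \<Oplus>\<^bsub>M\<^esub> i \<in> {..j}. sgn_mult M ((l - 1) * word_deg (take i w))
          (elt (hval R n A r m f
             (take i w @ [hval R n A s l g (drop i (take j w))] @ drop j w))))"

definition hoch_bracket ::
    "('r, 'x) ring_scheme \<Rightarrow> nat \<Rightarrow> ('r, 'a, 'z) pdga_scheme \<Rightarrow> perv \<Rightarrow> perv \<Rightarrow> int \<Rightarrow> int
      \<Rightarrow> ('r, 'a) cochain \<Rightarrow> ('r, 'a) cochain \<Rightarrow> ('r, 'a) cochain" where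
  "hoch_bracket R n A r s m l f g =
     (let M = pobj (HC R n A) (gm_add n r s) (m + l - 1) in
      hoch_circ R n A r s m l f g \<ominus>\<^bsub>M\<^esub>
      sgn_mult M ((m - 1) * (l - 1)) (hoch_circ R n A s r l m g f))"


section \<open>Hochschild cohomology\<close>

definition hoch_cocycles ::
    "('r, 'x) ring_scheme \<Rightarrow> nat \<Rightarrow> ('r, 'a, 'z) pdga_scheme \<Rightarrow> ('r, ('r, 'a) cochain) pmod" where
  "hoch_cocycles R n A =
     \<lparr>pobj = (\<lambda>r m. (pobj (HC R n A) r m)
        \<lparr>carrier := {f \<in> carrier (pobj (HC R n A) r m).
           hoch_D R n A r m f = \<zero>\<^bsub>pobj (HC R n A) r (m + 1)\<^esub>}\<rparr>),
      pmap = pmap (HC R n A)\<rparr>"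

definition hoch_boundaries ::
    "('r, 'x) ring_scheme \<Rightarrow> nat \<Rightarrow> ('r, 'a, 'z) pdga_scheme \<Rightarrow> perv \<Rightarrow> int \<Rightarrow> ('r, 'a) cochain set" where
  "hoch_boundaries R n A r m = hoch_D R n A r (m - 1) ` carrier (pobj (HC R n A) r (m - 1))"

definition HH ::
    "('r, 'x) ring_scheme \<Rightarrow> nat \<Rightarrow> ('r, 'a, 'z) pdga_scheme \<Rightarrow> ('r, ('r, 'a) cochain set) pmod" where
  "HH R n A = pquot (hoch_cocycles R n A) (hoch_boundaries R n A)"

definition hoch_class ::
    "('r, 'x) ring_scheme \<Rightarrow> nat \<Rightarrow> ('r, 'a, 'z) pdga_scheme \<Rightarrow> perv \<Rightarrow> int \<Rightarrow> ('r, 'a) cochain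
      \<Rightarrow> ('r, 'a) cochain set" where
  "hoch_class R n A r m f =
     hoch_boundaries R n A r m +>\<^bsub>pobj (hoch_cocycles R n A) r m\<^esub> f"

text \<open>\<open>\<beta>\<close> is an operation of degree \<open>e\<close> on cochains; it restricts to cocycles and induces \<open>\<mu>\<close> on
  cohomology.\<close>

definition hoch_induces ::
    "('r, 'x) ring_scheme \<Rightarrow> nat \<Rightarrow> ('r, 'a, 'z) pdga_scheme \<Rightarrow> int
      \<Rightarrow> (perv \<Rightarrow> perv \<Rightarrow> int \<Rightarrow> int \<Rightarrow> ('r, 'a) cochain \<Rightarrow> ('r, 'a) cochain \<Rightarrow> ('r, 'a) cochain)
      \<Rightarrow> (perv \<Rightarrow> perv \<Rightarrow> int \<Rightarrow> int \<Rightarrow> ('r, 'a) cochain set \<Rightarrow> ('r, 'a) cochain set \<Rightarrow> ('r, 'a) cochain set)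
      \<Rightarrow> bool" where
  "hoch_induces R n A e \<beta> \<mu> \<longleftrightarrow>
     (\<forall>r\<in>GM n. \<forall>s\<in>GM n. psum r s \<le> gm_top n \<longrightarrow>
        (\<forall>m l. \<forall>f\<in>carrier (pobj (hoch_cocycles R n A) r m).
                \<forall>g\<in>carrier (pobj (hoch_cocycles R n A) s l).
           \<beta> r s m l f g \<in> carrier (pobj (hoch_cocycles R n A) (gm_add n r s) (m + l + e)) \<and>
           \<mu> r s m l (hoch_class R n A r m f) (hoch_class R n A s l g) =
           hoch_class R n A (gm_add n r s) (m + l + e) (\<beta> r s m l f g)))"


section \<open>Perverse Gerstenhaber algebras\<close>

locale perverse_gerstenhaber = perverse_module R n H
  for R :: "('r, 'x) ring_scheme" and n :: nat and H :: "('r, 'h, 'z) pmod_scheme" +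
  fixes cup :: "perv \<Rightarrow> perv \<Rightarrow> int \<Rightarrow> int \<Rightarrow> 'h \<Rightarrow> 'h \<Rightarrow> 'h"
    and bracket :: "perv \<Rightarrow> perv \<Rightarrow> int \<Rightarrow> int \<Rightarrow> 'h \<Rightarrow> 'h \<Rightarrow> 'h"
  assumes cup: "perverse_product R n H 0 cup"
    and bracket: "perverse_product R n H (- 1) bracket"
    and cup_assoc: "\<lbrakk>p \<in> GM n; q \<in> GM n; r \<in> GM n; psum (psum p q) r \<le> gm_top n;
        f \<in> carrier (pobj H p i); g \<in> carrier (pobj H q j); h \<in> carrier (pobj H r k)\<rbrakk>
      \<Longrightarrow> cup (gm_add n p q) r (i + j) k (cup p q i j f g) h =
          cup p (gm_add n q r) i (j + k) f (cup q r j k g h)"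
    and cup_commute: "\<lbrakk>p \<in> GM n; q \<in> GM n; psum p q \<le> gm_top n;
        f \<in> carrier (pobj H p i); g \<in> carrier (pobj H q j)\<rbrakk>
      \<Longrightarrow> cup p q i j f g = sgn_mult (pobj H (gm_add n p q) (i + j)) (i * j) (cup q p j i g f)"
    and bracket_antisym: "\<lbrakk>p \<in> GM n; q \<in> GM n; psum p q \<le> gm_top n;
        f \<in> carrier (pobj H p i); g \<in> carrier (pobj H q j)\<rbrakk>
      \<Longrightarrow> bracket p q i j f g =
          \<ominus>\<^bsub>pobj H (gm_add n p q) (i + j - 1)\<^esub>
          sgn_mult (pobj H (gm_add n p q) (i + j - 1)) ((i - 1) * (j - 1)) (bracket q p j i g f)"
    and jacobi: "\<lbrakk>p \<in> GM n; q \<in> GM n; r \<in> GM n; psum (psum p q) r \<le> gm_top n;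
        f \<in> carrier (pobj H p i); g \<in> carrier (pobj H q j); h \<in> carrier (pobj H r k);
        M = pobj H (gm_add n (gm_add n p q) r) (i + j + k - 2)\<rbrakk>
      \<Longrightarrow> bracket (gm_add n p q) r (i + j - 1) k (bracket p q i j f g) h =
          bracket p (gm_add n q r) i (j + k - 1) f (bracket q r j k g h)
          \<ominus>\<^bsub>M\<^esub> sgn_mult M ((i - 1) * (j - 1))
                (bracket q (gm_add n p r) j (i + k - 1) g (bracket p r i k f h))"
    and leibniz: "\<lbrakk>p \<in> GM n; q \<in> GM n; r \<in> GM n; psum (psum p q) r \<le> gm_top n;
        f \<in> carrier (pobj H p i); g \<in> carrier (pobj H q j); h \<in> carrier (pobj H r k);
        M = pobj H (gm_add n (gm_add n p q) r) (i + j + k - 1)\<rbrakk>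
      \<Longrightarrow> bracket p (gm_add n q r) i (j + k) f (cup q r j k g h) =
          cup (gm_add n p q) r (i + j - 1) k (bracket p q i j f g) h
          \<oplus>\<^bsub>M\<^esub> sgn_mult M ((i - 1) * j)
                (cup q (gm_add n p r) j (i + k - 1) g (bracket p r i k f h))"

end

theory Submission
  imports Defs "HOL-Library.Poly_Mapping"
begin

text \<open>
A cochain of perversity \<open>r\<close> is a family of multilinear maps between the modules of \<open>A\<close>, restricted to words
whose perversities, together with \<open>r\<close>, add up to something below the top. The proof first removes this
restriction. All modules of \<open>A\<close> are collected in one abelian group \<open>T\<close>, the finitely supported families of
components; product, differential and sign involution become additive maps on \<open>T\<close>, with the product set to \<open>0\<close>
where the sum of two perversities exceeds the top. Associativity survives because \<open>(p \<oplus> q) + r\<close> lies below the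
top exactly if \<open>p + q + r\<close> does. So \<open>T\<close> is an ordinary differential graded algebra, and a cochain becomes a
function on lists over \<open>T\<close> that is additive in every letter.

For such functions the operations are sums over deconcatenations of a word, and their identities do not mention
perversities at all. Let \<open>m\<close> be the structure cochain with \<open>m[a] = da\<close> and \<open>m[a|b] = (-1)\<^sup>|\<^sup>a\<^sup>| ab\<close>. Then
\<open>m \<circ> m = 0\<close> (\<open>mm_mm\<close>), the Hochschild differential is \<open>D = [m, -]\<close>, and the cup product is, up to sign, the
brace \<open>m{F, G}\<close> (\<open>brace_mm\<close>). Everything follows from a few brace identities.
  \<^item> The circle product is pre-Lie (\<open>pre_Lie\<close>): its associator is the sum of \<open>F{G, H}\<close> and \<open>\<plusminus>F{H, G}\<close>, hence
    graded symmetric in \<open>G\<close> and \<open>H\<close>. So the bracket satisfies the identities of a graded Lie algebra already on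
    cochains (\<open>jacobi\<close>), and \<open>D\<close> is a derivation of it (\<open>D_brk\<close>).
  \<^item> Applied to \<open>m\<close>, the same identity computes \<open>D(F \<circ> G)\<close> (\<open>D_circ\<close>). Its extra terms are the graded commutator
    of the cup product, so \<open>\<plusminus>F \<circ> G\<close> is the homotopy for graded commutativity.
  \<^item> For cocycles, \<open>D(F{G, H})\<close> is the defect of \<open>F \<circ> -\<close> from being a derivation of the cup product (\<open>D_brace\<close>);
    as \<open>- \<circ> F\<close> is one on the nose (\<open>cup_circ\<close>), the Leibniz rule holds up to this boundary (\<open>brk_cup\<close>).

The way back has two parts. A word cochain of perversity \<open>r\<close> is a multilinear function on \<open>T\<close> that sends
homogeneous elements of perversities \<open>u\<^sub>1, \<dots>, u\<^sub>k\<close> to the hull of \<open>u\<^sub>1 + \<dots> + u\<^sub>k + r\<close> and respects structure maps;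
all operations preserve this (\<open>natural_circ\<close> and its companions), where it is essential that the hull of a
monotone function may be formed before or after adding another one (\<open>gm_hull_psum\<close>). The presentation of the bar
construction by words then gives a bijection \<open>Phi\<close> with inverse \<open>iPhi\<close> between the given cochain modules and the
word cochains that vanish when a letter is the unit, and this bijection carries the prescribed formulas to \<open>cup\<close>,
\<open>circ\<close>, \<open>brk\<close> and \<open>D\<close> (\<open>hoch_cup_eq\<close>, \<open>hoch_bracket_eq\<close>, \<open>hoch_D_eq\<close>). In cohomology, both products are
instances of one construction for operations with a Leibniz formula for \<open>D\<close> (\<open>induced\<close>).
\<close>

section \<open>Sums over deconcatenations\<close>

text \<open>The sum of \<open>F x y\<close> over all factorisations \<open>w = x @ y\<close>. In the recursive form, identities between iterated sums
become rewriting problems.\<close>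

fun deconc :: "'e list \<Rightarrow> ('e list \<Rightarrow> 'e list \<Rightarrow> 'b::comm_monoid_add) \<Rightarrow> 'b" where
  "deconc [] F = F [] []"
| "deconc (a # w) F = F [] (a # w) + deconc w (\<lambda>x y. F (a # x) y)"

text \<open>A second name for the same sum. Iterated sums are brought to a normal form in which the outer sums run along
the word from left to right. A plain rule for exchanging two sums would loop; the second name marks the sums that
are still to be moved. The rules \<open>deconc_nf\<close> absorb a marked sum over a part of an outer word and move a marked
sum over an independent word outwards.\<close>

definition deconc' :: "'e list \<Rightarrow> ('e list \<Rightarrow> 'e list \<Rightarrow> 'b::comm_monoid_add) \<Rightarrow> 'b" where
  "deconc' = deconc"

lemma deconc_sum: "deconc w F = (\<Sum>i\<le>length w. F (take i w) (drop i w))"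
proof (induction w arbitrary: F)
  case (Cons a w)
  have "(\<Sum>i\<le>length (a # w). F (take i (a # w)) (drop i (a # w))) =
        F [] (a # w) + (\<Sum>i\<le>length w. F (a # take i w) (drop i w))"
    by (simp only: length_Cons sum.atMost_Suc_shift) simp
  then show ?case using Cons by simp
qed simp

lemma deconc_cong:
  "w = w' \<Longrightarrow> (\<And>x y. x @ y = w' \<Longrightarrow> F x y = G x y) \<Longrightarrow> deconc w F = deconc w' G"
  by (auto simp: deconc_sum intro!: sum.cong)

lemma deconc_add: "deconc w (\<lambda>x y. F x y + G x y) = deconc w F + deconc w G"
  by (simp add: deconc_sum sum.distrib)

lemma deconc_zero [simp]: "deconc w (\<lambda>x y. 0) = 0"
  by (simp add: deconc_sum)

lemma deconc_hom:
  assumes "h 0 = 0" and "\<And>a b. h (a + b) = h a + h b"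
  shows "h (deconc w F) = deconc w (\<lambda>x y. h (F x y))"
  by (induction w arbitrary: F) (simp_all add: assms)

lemma deconc_first:
  assumes "\<And>x y. x \<noteq> [] \<Longrightarrow> F x y = 0"
  shows "deconc w F = F [] w"
proof (cases w)
  case (Cons a v)
  have "deconc v (\<lambda>x. F (a # x)) = deconc v (\<lambda>x y. 0)"
    using assms by (intro deconc_cong) simp_all
  then show ?thesis using Cons by simp
qed simp

lemma deconc_last:
  assumes "\<And>x y. y \<noteq> [] \<Longrightarrow> F x y = 0"
  shows "deconc w F = F w []"
  using assms
proof (induction w arbitrary: F)
  case (Cons a w)
  have "deconc w (\<lambda>x y. F (a # x) y) = F (a # w) []" by (rule Cons.IH) (rule Cons.prems)
  then show ?case by (simp add: Cons.prems)
qed simp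

lemma deconc_map: "deconc (map h w) F = deconc w (\<lambda>x y. F (map h x) (map h y))"
  by (induction w arbitrary: F) simp_all

text \<open>A distinguished letter lies in the right or in the left factor. Additivity of the operations in a letter is read
off from this.\<close>

lemma deconc_snoc:
  "deconc (x @ t # z) F =
     deconc x (\<lambda>a b. F a (b @ t # z)) + deconc z (\<lambda>a b. F (x @ t # a) b)"
  by (induction x arbitrary: F) (simp_all add: add.assoc)

lemma deconc_assoc:
  "deconc w (\<lambda>a b. deconc a (\<lambda>x y. F x y b)) = deconc w (\<lambda>x r. deconc r (\<lambda>y b. F x y b))"
  by (induction w arbitrary: F) (simp_all add: deconc_add add.assoc)

lemma deconc_swap:
  "deconc w (\<lambda>a b. deconc v (\<lambda>x y. F a b x y)) = deconc v (\<lambda>x y. deconc w (\<lambda>a b. F a b x y))"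
  unfolding deconc_sum by (rule sum.swap)

lemma deconc'_right: "deconc w (\<lambda>x y. deconc' y (\<lambda>a b. F x a b)) = deconc w (\<lambda>x y. deconc y (\<lambda>a b. F x a b))"
  and deconc'_left: "deconc w (\<lambda>a b. deconc' a (\<lambda>x y. F x y b)) = deconc w (\<lambda>x r. deconc r (\<lambda>y b. F x y b))"
  and deconc'_exchange: "deconc w (\<lambda>a b. deconc' v (\<lambda>x y. G a b x y)) = deconc' v (\<lambda>x y. deconc w (\<lambda>a b. G a b x y))"
  unfolding deconc'_def by (rule refl, rule deconc_assoc, rule deconc_swap)

lemma deconc'_add: "deconc' w (\<lambda>x y. F x y + G x y) = deconc' w F + deconc' w G"
  by (simp add: deconc'_def deconc_add)

lemmas deconc_nf = deconc'_right deconc'_left deconc'_exchange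

definition sg :: "int \<Rightarrow> 'b::ab_group_add \<Rightarrow> 'b" where
  "sg e x = (if even e then x else - x)"

lemma sg_zero [simp]: "sg e 0 = 0" by (simp add: sg_def)
lemma sg_add: "sg e (x + y) = sg e x + sg e y" by (simp add: sg_def)
lemma sg_minus: "sg e (- x) = - sg e x" by (simp add: sg_def)
lemma sg_even [simp]: "even e \<Longrightarrow> sg e x = x" by (simp add: sg_def)
lemma sg_odd [simp]: "odd e \<Longrightarrow> sg e x = - x" by (simp add: sg_def)

lemma deconc_minus: "deconc w (\<lambda>x y. - F x y) = - deconc w F"
  for F :: "_ \<Rightarrow> _ \<Rightarrow> 'b::ab_group_add"
  by (simp add: deconc_sum sum_negf)

lemma deconc'_minus: "deconc' w (\<lambda>x y. - F x y) = - deconc' w F"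
  for F :: "_ \<Rightarrow> _ \<Rightarrow> 'b::ab_group_add"
  by (simp add: deconc'_def deconc_minus)

lemma deconc_diff: "deconc w (\<lambda>x y. F x y - G x y) = deconc w F - deconc w G"
  "deconc' w (\<lambda>x y. F x y - G x y) = deconc' w F - deconc' w G"
  for F :: "_ \<Rightarrow> _ \<Rightarrow> 'b::ab_group_add"
  by (simp_all add: deconc'_def deconc_sum sum_subtractf)

section \<open>Multiadditive functions on words\<close>

definition additive :: "('b::ab_group_add \<Rightarrow> 'c::ab_group_add) \<Rightarrow> bool" where
  "additive h \<longleftrightarrow> (\<forall>a b. h (a + b) = h a + h b)"

lemma additiveD: "additive h \<Longrightarrow> h (a + b) = h a + h b"
  by (simp add: additive_def)

lemma additive_zero: "additive h \<Longrightarrow> h 0 = 0"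
  using additiveD[of h 0 0] by simp

lemma additive_minus: "additive h \<Longrightarrow> h (- a) = - h a"
  using additiveD[of h a "- a"] additive_zero[of h] by (simp add: eq_neg_iff_add_eq_0 add.commute)

lemma additive_sum: "additive h \<Longrightarrow> h (sum f I) = (\<Sum>i\<in>I. h (f i))"
  by (induction I rule: infinite_finite_induct) (simp_all add: additiveD additive_zero)

lemma additive_sg: "additive h \<Longrightarrow> h (sg e a) = sg e (h a)"
  by (simp add: sg_def additive_minus)

lemma additive_deconc: "additive h \<Longrightarrow> h (deconc w F) = deconc w (\<lambda>x y. h (F x y))"
  by (rule deconc_hom) (simp_all add: additive_zero additiveD)

text \<open>A function on lists represents its homogeneous components, one for each length, at once.\<close>

definition multiadditive :: "('b::ab_group_add list \<Rightarrow> 'b) \<Rightarrow> bool" where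
  "multiadditive F \<longleftrightarrow> (\<forall>x z. additive (\<lambda>a. F (x @ a # z)))"

lemma multiadditiveI: "(\<And>x z a b. F (x @ (a + b) # z) = F (x @ a # z) + F (x @ b # z)) \<Longrightarrow> multiadditive F"
  by (simp add: multiadditive_def additive_def)

lemma multiadditiveD: "multiadditive F \<Longrightarrow> additive (\<lambda>a. F (x @ a # z))"
  by (simp add: multiadditive_def)

lemma multi_add: "multiadditive F \<Longrightarrow> F (x @ (a + b) # z) = F (x @ a # z) + F (x @ b # z)"
  by (simp add: multiadditive_def additive_def)

lemma multi_zero: "multiadditive F \<Longrightarrow> F (x @ 0 # z) = 0"
  using additive_zero[OF multiadditiveD[of F x z]] by simp

lemma multi_minus: "multiadditive F \<Longrightarrow> F (x @ (- a) # z) = - F (x @ a # z)"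
  using additive_minus[OF multiadditiveD[of F x z], of a] by simp

lemma multi_deconc:
  "multiadditive F \<Longrightarrow> F (x @ deconc w f # z) = deconc' w (\<lambda>a b. F (x @ f a b # z))"
  using additive_deconc[OF multiadditiveD[of F x z], of w f] by (simp add: deconc'_def)

lemma multi2:
  assumes "multiadditive F"
  shows "F (x @ g # y @ deconc w f # z) = deconc' w (\<lambda>a b. F (x @ g # y @ f a b # z))"
    and "F (x @ g # y @ (- a) # z) = - F (x @ g # y @ a # z)"
  using multi_deconc[OF assms, of "x @ g # y"] multi_minus[OF assms, of "x @ g # y"] by simp_all

section \<open>Cup product, circle product and braces\<close>

text \<open>A differential graded algebra in which signs are expressed by the involution \<open>s\<close>, which is \<open>(-1)\<^sup>i\<close> on degree
\<open>i\<close>. In this form the axioms are equations between additive maps and need no homogeneous elements. The element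
\<open>e\<close> is a unit only up to the projection \<open>cl\<close>: the group constructed below has more components than the algebra.\<close>

locale signed_dga =
  fixes mul :: "'t::ab_group_add \<Rightarrow> 't \<Rightarrow> 't" (infixl "\<cdot>" 70)
    and d s cl :: "'t \<Rightarrow> 't" and e :: 't
  assumes mul_l: "additive (\<lambda>a. a \<cdot> b)" and mul_r: "additive (\<lambda>b. a \<cdot> b)"
    and d: "additive d" and s: "additive s"
    and mul_assoc: "(a \<cdot> b) \<cdot> c = a \<cdot> (b \<cdot> c)"
    and s_s [simp]: "s (s a) = a" and s_mul: "s (a \<cdot> b) = s a \<cdot> s b" and s_d: "s (d a) = - d (s a)"
    and d_d: "d (d a) = 0" and d_mul: "d (a \<cdot> b) = d a \<cdot> b + s a \<cdot> d b"
    and mul_e: "a \<cdot> e = cl a" and e_mul: "e \<cdot> a = cl a" and s_e: "s e = e" and d_e: "d e = 0"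
begin

lemmas mul_add = additiveD[OF mul_l] additiveD[OF mul_r]
lemmas mul_zero [simp] = additive_zero[OF mul_l] additive_zero[OF mul_r]
lemmas mul_minus = additive_minus[OF mul_l] additive_minus[OF mul_r]
lemma mul_deconc: "deconc w f \<cdot> b = deconc' w (\<lambda>x y. f x y \<cdot> b)" "a \<cdot> deconc w f = deconc' w (\<lambda>x y. a \<cdot> f x y)"
  unfolding deconc'_def by (rule additive_deconc[OF mul_l], rule additive_deconc[OF mul_r])
lemmas s_simps = additiveD[OF s] additive_zero[OF s] additive_minus[OF s] additive_sg[OF s]
lemmas d_simps = additiveD[OF d] additive_zero[OF d] additive_minus[OF d] additive_sg[OF d]

lemma sg_mul: "sg i a \<cdot> b = sg i (a \<cdot> b)" "a \<cdot> sg i b = sg i (a \<cdot> b)"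
  by (simp_all add: sg_def mul_minus)

text \<open>On degree \<open>i\<close> this is \<open>(-1)\<^sup>i\<^sup>-\<^sup>1\<close>, the sign for moving an operator of odd degree past a suspended letter.\<close>

definition tau :: "'t \<Rightarrow> 't" where "tau a = - s a"

definition tw :: "int \<Rightarrow> 't list \<Rightarrow> 't list" where "tw i w = (if even i then w else map tau w)"

lemma tau_tau [simp]: "tau (tau a) = a" by (simp add: tau_def s_simps)
lemma tau_comp [simp]: "tau \<circ> tau = id" by (simp add: fun_eq_iff)
lemma tw_even [simp]: "even i \<Longrightarrow> tw i w = w" by (simp add: tw_def)
lemma tw_odd [simp]: "odd i \<Longrightarrow> tw i w = map tau w" by (simp add: tw_def)
lemma additive_tau: "additive tau" by (simp add: additive_def tau_def s_simps)
lemma tw_append [simp]: "tw i (x @ y) = tw i x @ tw i y" by (simp add: tw_def)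
lemma tw_Nil [simp]: "tw i [] = []" by (simp add: tw_def)
lemma length_tw [simp]: "length (tw i w) = length w" by (simp add: tw_def)
lemma tw_eq_Nil [simp]: "tw i w = [] \<longleftrightarrow> w = []" by (simp add: tw_def)

text \<open>The sign rules see the degree of a cochain only modulo \<open>2\<close>, through the degree of its values.\<close>

definition parity :: "int \<Rightarrow> ('t list \<Rightarrow> 't) \<Rightarrow> bool" where
  "parity l F \<longleftrightarrow> (\<forall>w. s (F w) = sg l (F (map tau w)))"

lemma parity_s: "parity l F \<Longrightarrow> s (F w) = sg l (F (map tau w))"
  by (simp add: parity_def)

lemma parity_tau: "parity l F \<Longrightarrow> tau (F w) = - sg l (F (map tau w))"
  by (simp add: parity_def tau_def)

definition cup :: "int \<Rightarrow> ('t list \<Rightarrow> 't) \<Rightarrow> ('t list \<Rightarrow> 't) \<Rightarrow> 't list \<Rightarrow> 't" where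
  "cup l F G w = deconc w (\<lambda>x y. F (tw l x) \<cdot> G y)"

definition circ :: "int \<Rightarrow> ('t list \<Rightarrow> 't) \<Rightarrow> ('t list \<Rightarrow> 't) \<Rightarrow> 't list \<Rightarrow> 't" where
  "circ l F G w = deconc w (\<lambda>x r. deconc r (\<lambda>y z. F (tw (l - 1) x @ G y # z)))"

text \<open>Gerstenhaber's brace \<open>F{G, H}\<close>: both \<open>G\<close> and \<open>H\<close> are inserted into \<open>F\<close>, with \<open>G\<close> to the left of \<open>H\<close>.\<close>

definition brace ::
  "int \<Rightarrow> int \<Rightarrow> ('t list \<Rightarrow> 't) \<Rightarrow> ('t list \<Rightarrow> 't) \<Rightarrow> ('t list \<Rightarrow> 't) \<Rightarrow> 't list \<Rightarrow> 't" where
  "brace l k F G H w =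
     deconc w (\<lambda>x r. deconc r (\<lambda>y r. deconc r (\<lambda>z r. deconc r (\<lambda>u v.
       F (tw (l + k) x @ G (tw (k - 1) y) # tw (k - 1) z @ H u # v)))))"

lemma cup_insert:
  "cup l F G (x @ t # z) =
     deconc' x (\<lambda>a b. F (tw l a) \<cdot> G (b @ t # z)) + deconc' z (\<lambda>a b. F (tw l (x @ t # a)) \<cdot> G b)"
  by (simp add: cup_def deconc_snoc deconc'_def)

lemma circ_insert:
  "circ l F G (x @ t # z) =
     deconc' x (\<lambda>a r. deconc' r (\<lambda>b c. F (tw (l - 1) a @ G b # c @ t # z)))
   + deconc' x (\<lambda>a b. deconc' z (\<lambda>c f. F (tw (l - 1) a @ G (b @ t # c) # f)))
   + deconc' z (\<lambda>a r. deconc' r (\<lambda>b c. F (tw (l - 1) (x @ t # a) @ G b # c)))"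
  by (simp add: circ_def deconc_snoc deconc'_def deconc_add)

lemma deconc_twist: "deconc' (map tau w) F = deconc' w (\<lambda>x y. F (map tau x) (map tau y))"
  "deconc (map tau w) F = deconc w (\<lambda>x y. F (map tau x) (map tau y))"
  by (simp_all add: deconc'_def deconc_map)

lemma tw_Cons: "tw i (a # w) = (if even i then a else tau a) # tw i w"
  by (simp add: tw_def)

lemmas expand = deconc_diff deconc_nf deconc_add deconc'_add deconc_minus deconc'_minus deconc_twist mul_deconc mul_minus

text \<open>In \<open>(F \<circ> G) \<circ> H\<close> the values of \<open>H\<close> are letters to the right of \<open>G\<close>, letters of \<open>G\<close>, or letters to its left.\<close>

lemma pre_Lie:
  assumes F: "multiadditive F" and H: "parity k H"
  shows "circ k (circ l F G) H w =
    brace l k F G H w + circ (l + k - 1) F (circ k G H) w + sg ((l - 1) * (k - 1)) (brace k l F H G w)"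
  by (cases "even l"; cases "even k")
     (simp_all add: circ_insert circ_def[of _ "circ _ _ _"] circ_def[of _ _ "circ _ _ _"] circ_def[of _ G]
       brace_def expand multi_deconc[OF F] parity_tau[OF H] multi_minus[OF F])

text \<open>The values of \<open>H\<close> are letters of \<open>F\<close> or of \<open>G\<close>.\<close>

lemma cup_circ:
  assumes F: "multiadditive F" and H: "parity k H"
  shows "circ k (cup l F G) H w =
    cup (l + k - 1) F (circ k G H) w + sg (l * (k - 1)) (cup l (circ k F H) G w)"
  by (cases "even l"; cases "even k")
     (simp_all add: circ_def[of _ "cup _ _ _"] circ_def[of _ F] circ_def[of _ G] cup_insert cup_def[of _ F "circ _ _ _"]
       cup_def[of _ "circ _ _ _"] expand parity_tau[OF H] multi_minus[OF F] tw_Cons)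

lemma cup_assoc: "cup (l + k) F (cup k G H) w = cup k (cup l F G) H w"
  by (cases "even l"; cases "even k") (simp_all add: cup_def mul_assoc expand)

text \<open>The brace with three arguments, needed only to compare two expressions in which it cancels.\<close>

definition triple ::
  "int \<Rightarrow> int \<Rightarrow> int \<Rightarrow> ('t list \<Rightarrow> 't) \<Rightarrow> ('t list \<Rightarrow> 't) \<Rightarrow> ('t list \<Rightarrow> 't) \<Rightarrow> ('t list \<Rightarrow> 't) \<Rightarrow> 't list \<Rightarrow> 't" where
  "triple l k c F G H M w =
     deconc w (\<lambda>x r. deconc r (\<lambda>y r. deconc r (\<lambda>z r. deconc r (\<lambda>u r. deconc r (\<lambda>v r. deconc r (\<lambda>p q.
       F (tw (l + k + c - 1) x @ G (tw (k + c) y) # tw (k + c) z @ H (tw (c - 1) u) # tw (c - 1) v @ M p # q)))))))"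

text \<open>The positions of \<open>M\<close> to the right of, between, and to the left of \<open>G\<close> and \<open>H\<close>.\<close>

definition triple_sum ::
  "int \<Rightarrow> int \<Rightarrow> int \<Rightarrow> ('t list \<Rightarrow> 't) \<Rightarrow> ('t list \<Rightarrow> 't) \<Rightarrow> ('t list \<Rightarrow> 't) \<Rightarrow> ('t list \<Rightarrow> 't) \<Rightarrow> 't list \<Rightarrow> 't" where
  "triple_sum l k c F G H M w = triple l k c F G H M w
     + sg ((c - 1) * (k - 1)) (triple l c k F G M H w) + sg ((c - 1) * (l + k)) (triple c l k F M G H w)"

lemma brace_insert:
  "brace l k F G H (X @ t # Z) =
     deconc' X (\<lambda>x r. deconc' r (\<lambda>y r. deconc' r (\<lambda>z r. deconc' r (\<lambda>u v.
       F (tw (l + k) x @ G (tw (k - 1) y) # tw (k - 1) z @ H u # v @ t # Z)))))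
   + deconc' X (\<lambda>x r. deconc' r (\<lambda>y r. deconc' r (\<lambda>z u. deconc' Z (\<lambda>u' v.
       F (tw (l + k) x @ G (tw (k - 1) y) # tw (k - 1) z @ H (u @ t # u') # v)))))
   + deconc' X (\<lambda>x r. deconc' r (\<lambda>y z. deconc' Z (\<lambda>z' r. deconc' r (\<lambda>u v.
       F (tw (l + k) x @ G (tw (k - 1) y) # tw (k - 1) (z @ t # z') @ H u # v)))))
   + deconc' X (\<lambda>x y. deconc' Z (\<lambda>y' r. deconc' r (\<lambda>z r. deconc' r (\<lambda>u v.
       F (tw (l + k) x @ G (tw (k - 1) (y @ t # y')) # tw (k - 1) z @ H u # v)))))
   + deconc' Z (\<lambda>x' r. deconc' r (\<lambda>y r. deconc' r (\<lambda>z r. deconc' r (\<lambda>u v.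
       F (tw (l + k) (X @ t # x') @ G (tw (k - 1) y) # tw (k - 1) z @ H u # v)))))"
  by (simp add: brace_def deconc_snoc deconc'_def deconc_add ac_simps del: tw_append)

lemma circ_insert2:
  "circ l F G (X @ t # Y @ u # Z) =
     deconc' X (\<lambda>a r. deconc' r (\<lambda>b c. F (tw (l - 1) a @ G b # c @ t # Y @ u # Z)))
   + deconc' X (\<lambda>a b. deconc' Y (\<lambda>b' c. F (tw (l - 1) a @ G (b @ t # b') # c @ u # Z)))
   + deconc' X (\<lambda>a b. deconc' Z (\<lambda>b' c. F (tw (l - 1) a @ G (b @ t # Y @ u # b') # c)))
   + deconc' Y (\<lambda>a r. deconc' r (\<lambda>b c. F (tw (l - 1) (X @ t # a) @ G b # c @ u # Z)))
   + deconc' Y (\<lambda>a b. deconc' Z (\<lambda>b' c. F (tw (l - 1) (X @ t # a) @ G (b @ u # b') # c)))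
   + deconc' Z (\<lambda>a r. deconc' r (\<lambda>b c. F (tw (l - 1) (X @ t # Y @ u # a) @ G b # c)))"
  by (simp add: circ_def deconc_snoc deconc'_def deconc_add ac_simps del: tw_append)

text \<open>The values of \<open>M\<close> are letters of \<open>F\<close>, of \<open>G\<close> or of \<open>H\<close>.\<close>

lemma brace_circ:
  assumes F: "multiadditive F" and G: "multiadditive G" and M: "parity c M"
  shows "circ c (brace l k F G H) M w = triple_sum l k c F G H M w
    + sg ((c - 1) * (k - 1)) (brace (l + c - 1) k F (circ c G M) H w)
    + brace l (k + c - 1) F G (circ c H M) w"
  by (cases "even l"; cases "even k"; cases "even c")
     (simp_all add: circ_def[of _ "brace _ _ _ _ _"] circ_def[of _ G] circ_def[of _ H] brace_insert
       brace_def[of _ _ _ "circ _ _ _"] brace_def[of _ _ _ _ "circ _ _ _"] triple_sum_def triple_def tw_Cons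
       multi_deconc[OF F] multi_deconc[OF G] parity_tau[OF M] multi_minus[OF F] multi_minus[OF G] multi2[OF F] expand)

text \<open>In \<open>(F \<circ> M){G, H}\<close>, the values of \<open>G\<close> and \<open>H\<close> are independently letters of \<open>F\<close> or of \<open>M\<close>.\<close>

lemma circ_brace:
  assumes F: "multiadditive F" and M: "multiadditive M" "parity c M" and G: "parity l G" and H: "parity k H"
  shows "brace l k (circ c F M) G H w = sg ((c - 1) * (l + k)) (triple_sum l k c F G H M w)
    + brace (c + l - 1) k F (circ l M G) H w
    + circ (c + l + k - 2) F (brace l k M G H) w
    + sg ((c - 1) * (l - 1)) (brace l (c + k - 1) F G (circ k M H) w)"
  by (cases "even l"; cases "even k"; cases "even c")
     (simp_all add: circ_insert2 circ_def[of _ F] circ_def[of _ M] brace_def triple_sum_def triple_def tw_Cons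
       multi_deconc[OF F] multi_deconc[OF M(1)] parity_tau[OF M(2)] parity_tau[OF G] parity_tau[OF H]
       multi_minus[OF F] multi_minus[OF M(1)] multi2[OF F] expand)

section \<open>The structure cochain and the differential\<close>

text \<open>The structure cochain \<open>m\<close>, of degree \<open>2\<close>. The sign in the component of length two makes \<open>m \<circ> m = 0\<close>.\<close>

definition mm :: "'t list \<Rightarrow> 't" where
  "mm w = (case w of [a] \<Rightarrow> d a | [a, b] \<Rightarrow> s a \<cdot> b | _ \<Rightarrow> 0)"

lemma mm_simps [simp]: "mm [] = 0" "mm [a] = d a" "mm [a, b] = s a \<cdot> b" "mm (a # b # c # w) = 0"
  by (simp_all add: mm_def)

lemma mm_long: "length w \<ge> 3 \<Longrightarrow> mm w = 0"
  by (auto simp: mm_def split: list.split)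

lemma multiadditive_mm: "multiadditive mm"
proof (rule multiadditiveI)
  fix x z :: "'t list" and a b :: 't
  consider "x = []" "z = []" | t where "x = [t]" "z = []" | t where "x = []" "z = [t]"
    | "length x + length z \<ge> 2"
    by (cases x; cases z; cases "tl x"; cases "tl z") auto
  then show "mm (x @ (a + b) # z) = mm (x @ a # z) + mm (x @ b # z)"
    by cases (simp_all add: mul_add d_simps s_simps mm_long)
qed

lemma parity_mm: "parity 2 mm"
proof -
  have "s (mm w) = mm (map tau w)" for w
  proof -
    consider "w = []" | a where "w = [a]" | a b where "w = [a, b]" | "length w \<ge> 3"
      by (cases w; cases "tl w"; cases "tl (tl w)") auto
    then show ?thesis
      by cases (simp_all add: s_d s_mul tau_def s_simps mul_minus d_simps mm_long)
  qed
  then show ?thesis by (simp add: parity_def)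
qed

text \<open>On words of length one, two and three this says \<open>d\<^sup>2 = 0\<close>, the Leibniz rule for \<open>d\<close>, and associativity.\<close>

lemma mm_mm: "circ 2 mm mm w = 0"
proof -
  consider "w = []" | a where "w = [a]" | a b where "w = [a, b]" | a b c where "w = [a, b, c]" | "length w \<ge> 4"
    by (cases w; cases "tl w"; cases "tl (tl w)"; cases "tl (tl (tl w))") auto
  then show ?thesis
  proof cases
    case 5
    \<comment> \<open>in a word of at least four letters, one of the two factors \<open>m\<close> has more than two arguments\<close>
    have "mm (tw 1 x @ mm y # z) = 0" if "x @ y @ z = w" for x y z
    proof (cases "length y \<ge> 3")
      case True
      then show ?thesis by (simp add: mm_long multi_zero[OF multiadditive_mm])
    next
      case False
      have "length (x @ y @ z) \<ge> 4" using 5 that by simp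
      with False show ?thesis by (intro mm_long) simp
    qed
    then have "circ 2 mm mm w = deconc w (\<lambda>x r. deconc r (\<lambda>y z. 0))"
      unfolding circ_def by (intro deconc_cong) (auto intro: deconc_cong)
    then show ?thesis by simp
  qed (simp_all add: circ_def d_simps d_d d_mul s_simps s_mul s_d tau_def mul_assoc mul_minus mul_add tw_Cons)
qed

text \<open>Only the component of length two of \<open>m\<close> has room for two arguments.\<close>

lemma brace_mm:
  assumes "parity l F"
  shows "brace l k mm F G w = sg l (cup k F G w)"
proof -
  have 1: "mm (x @ a # z @ b # v) = 0" if "x \<noteq> [] \<or> z \<noteq> [] \<or> v \<noteq> []" for x a z b v
    using that by (intro mm_long) (cases x; cases z; cases v; simp)
  have 2: "mm (a # z @ b # v) = 0" if "z \<noteq> [] \<or> v \<noteq> []" for a z b v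
    using that by (intro mm_long) (cases z; cases v; simp)
  have 3: "mm (a # b # v) = 0" if "v \<noteq> []" for a b v
    using that by (intro mm_long) (cases v; simp)
  have "brace l k mm F G w = deconc w (\<lambda>y u. mm [F (tw (k - 1) y), G u])"
    unfolding brace_def
    apply (subst deconc_first, simp add: 1)
    apply (rule deconc_cong, rule refl)
    apply (subst deconc_first, simp add: 2)
    apply (subst deconc_last, simp_all add: 3)
    done
  also have "\<dots> = sg l (cup k F G w)"
    using assms by (cases "even l"; cases "even k") (simp_all add: cup_def parity_s mul_minus deconc_minus)
  finally show ?thesis .
qed

lemma triple_mm: "triple l k c mm F G H w = 0"
proof -
  have "mm (x @ a # z @ b # v @ h # q) = 0" for x a z b v h q
    by (rule mm_long) simp
  then show ?thesis by (simp add: triple_def)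
qed

text \<open>\<open>D = [m, -]\<close>, since \<open>m\<close> has degree \<open>2\<close>.\<close>

definition D :: "int \<Rightarrow> ('t list \<Rightarrow> 't) \<Rightarrow> 't list \<Rightarrow> 't" where
  "D k F w = circ k mm F w - sg (k - 1) (circ 2 F mm w)"

lemma circ_add_left: "circ l (\<lambda>w. F w + F' w) G w = circ l F G w + circ l F' G w"
  by (simp add: circ_def deconc_add)
lemma circ_minus_left: "circ l (\<lambda>w. - F w) G w = - circ l F G w"
  by (simp add: circ_def deconc_minus)
lemma circ_diff_left: "circ l (\<lambda>w. F w - F' w) G w = circ l F G w - circ l F' G w"
  by (simp add: circ_def deconc_diff)
lemma circ_sg_left: "circ l (\<lambda>w. sg i (F w)) G w = sg i (circ l F G w)"
  by (simp add: sg_def circ_minus_left)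
lemma circ_add_right: "multiadditive F \<Longrightarrow> circ l F (\<lambda>w. G w + G' w) w = circ l F G w + circ l F G' w"
  by (simp add: circ_def deconc_add multi_add)
lemma circ_minus_right: "multiadditive F \<Longrightarrow> circ l F (\<lambda>w. - G w) w = - circ l F G w"
  by (simp add: circ_def deconc_minus multi_minus)
lemma circ_diff_right: "multiadditive F \<Longrightarrow> circ l F (\<lambda>w. G w - G' w) w = circ l F G w - circ l F G' w"
  using circ_add_right[of F l G "\<lambda>w. - G' w" w] by (simp add: circ_minus_right)
lemma circ_sg_right: "multiadditive F \<Longrightarrow> circ l F (\<lambda>w. sg i (G w)) w = sg i (circ l F G w)"
  by (simp add: sg_def circ_minus_right)
text \<open>\<open>[m, [m, F]]\<close> is expanded with the pre-Lie identity: the braces cancel in pairs and what remains contains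
\<open>m \<circ> m\<close>. This avoids the division by \<open>2\<close> in \<open>[m, [m, F]] = [[m, m], F] / 2\<close>.\<close>

lemma D_D:
  assumes F: "multiadditive F" "parity k F"
  shows "D (k + 1) (D k F) w = 0"
proof -
  note m = multiadditive_mm
  have 1: "brace 2 2 F mm mm w + circ 3 F (circ 2 mm mm) w - brace 2 2 F mm mm w = circ 2 (circ 2 F mm) mm w"
    using pre_Lie[OF F(1) parity_mm, of 2 mm w] by simp
  have 2: "circ 3 F (circ 2 mm mm) w = 0"
    by (simp add: circ_def[of _ F] mm_mm multi_zero[OF F(1)])
  have 3: "circ k (circ 2 mm mm) F w = 0"
    by (simp add: circ_def[of _ "circ 2 mm mm"] mm_mm)
  have A: "circ (k + 1) mm (circ k mm F) w = - brace 2 k mm mm F w - sg (k - 1) (brace k 2 mm F mm w)"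
    using 3 pre_Lie[OF m F(2), of 2 mm w] by (simp add: algebra_simps eq_neg_iff_add_eq_0)
  have B: "circ 2 (circ k mm F) mm w = brace k 2 mm F mm w + circ (k + 1) mm (circ 2 F mm) w
      + sg (k - 1) (brace 2 k mm mm F w)"
    using pre_Lie[OF m parity_mm, of k F w] by (simp add: add.commute)
  have C: "circ 2 (circ 2 F mm) mm w = 0" using 1 2 by simp
  show ?thesis
    unfolding D_def[abs_def] circ_diff_right[OF m] circ_sg_right[OF m] circ_sg_left circ_diff_left A B C
    by (cases "even k") (simp_all add: algebra_simps)
qed

text \<open>The pre-Lie identities for the three compositions with \<open>m\<close> leave the braces \<open>m{F, G}\<close> and \<open>m{G, F}\<close>, which are
cup products.\<close>

lemma D_circ:
  assumes F: "multiadditive F" "parity k F" and G: "parity l G"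
  shows "D (k + l - 1) (circ l F G) w = circ l (D k F) G w + sg (k - 1) (circ (l + 1) F (D l G) w)
    - sg k (cup l F G w) - sg ((k - 1) * (l - 1) + l) (cup k G F w)"
proof -
  note m = multiadditive_mm
  have A: "circ (k + l - 1) mm (circ l F G) w = circ l (circ k mm F) G w
      - sg k (cup l F G w) - sg ((k - 1) * (l - 1) + l) (cup k G F w)"
    using pre_Lie[OF m G, of k F w] brace_mm[OF F(2), of l G w] brace_mm[OF G, of k F w]
    by (cases "even k"; cases "even l") (simp_all add: algebra_simps)
  have B: "circ 2 (circ l F G) mm w = brace l 2 F G mm w + circ (l + 1) F (circ 2 G mm) w
      + sg (l - 1) (brace 2 l F mm G w)"
    using pre_Lie[OF F(1) parity_mm, of l G w] by (simp add: add.commute)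
  have C: "circ (l + 1) F (circ l mm G) w = circ l (circ 2 F mm) G w
      - brace 2 l F mm G w - sg (l - 1) (brace l 2 F G mm w)"
    using pre_Lie[OF F(1) G, of 2 mm w] by (simp add: algebra_simps)
  show ?thesis
    unfolding D_def[abs_def] circ_diff_right[OF F(1)] circ_sg_right[OF F(1)] circ_sg_left circ_diff_left A B C
    by (cases "even k"; cases "even l") (simp_all add: algebra_simps)
qed

text \<open>The identity cochain. It expresses the first and the last term of the Hochschild differential as cup products
(\<open>circ_mm\<close>), so that \<open>D_cup\<close> reduces to associativity and to derivation properties.\<close>

definition idc :: "'t list \<Rightarrow> 't" where
  "idc w = (case w of [a] \<Rightarrow> a | _ \<Rightarrow> 0)"

lemma idc_simps [simp]: "idc [] = 0" "idc [a] = a" "idc (a # b # w) = 0"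
  by (simp_all add: idc_def)

lemma idc_tau: "idc (map tau x) = tau (idc x)"
  by (auto simp: idc_def additive_zero[OF additive_tau] split: list.split)

lemma mm_context:
  "mm (x @ a # z) = (if x = [] then if z = [] then d a else 0 else 0)
     + (if x = [] then s a \<cdot> idc z else 0) + (if z = [] then s (idc x) \<cdot> a else 0)"
  by (cases x; cases z; cases "tl x"; cases "tl z") (simp_all add: mm_long s_simps)

lemma circ_mm:
  assumes "parity k F"
  shows "circ k mm F w = d (F w) - cup k idc F w + sg k (cup 1 F idc w)"
proof -
  have "circ k mm F w = deconc w (\<lambda>x r. deconc r (\<lambda>y z. if x = [] then if z = [] then d (F y) else 0 else 0))
     + deconc w (\<lambda>x r. deconc r (\<lambda>y z. if x = [] then s (F y) \<cdot> idc z else 0))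
     + deconc w (\<lambda>x r. deconc r (\<lambda>y z. if z = [] then s (idc (tw (k - 1) x)) \<cdot> F y else 0))"
    by (simp add: circ_def mm_context deconc_add)
  also have "deconc w (\<lambda>x r. deconc r (\<lambda>y z. if x = [] then if z = [] then d (F y) else 0 else 0)) = d (F w)"
    by (simp add: deconc_first deconc_last)
  also have "deconc w (\<lambda>x r. deconc r (\<lambda>y z. if x = [] then s (F y) \<cdot> idc z else 0)) = sg k (cup 1 F idc w)"
    by (cases "even k") (simp_all add: deconc_first cup_def parity_s[OF assms] mul_minus deconc_minus)
  also have "deconc w (\<lambda>x r. deconc r (\<lambda>y z. if z = [] then s (idc (tw (k - 1) x)) \<cdot> F y else 0)) = - cup k idc F w"
    by (cases "even k")
       (simp_all add: deconc_last cup_def idc_tau mul_minus deconc_minus tau_def s_simps)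
  finally show ?thesis by simp
qed

lemma parity_cup:
  assumes "parity k F" "parity l G"
  shows "parity (k + l) (cup l F G)"
  unfolding parity_def
  by (cases "even k"; cases "even l")
     (simp_all add: cup_def additive_deconc[OF s] s_mul parity_s[OF assms(1)] parity_s[OF assms(2)]
       deconc_twist mul_minus deconc_minus)

lemma cup_add_left: "cup l (\<lambda>w. F w + F' w) G w = cup l F G w + cup l F' G w"
  by (simp add: cup_def mul_add deconc_add)
lemma cup_minus_left: "cup l (\<lambda>w. - F w) G w = - cup l F G w"
  by (simp add: cup_def mul_minus deconc_minus)
lemma cup_diff_left: "cup l (\<lambda>w. F w - F' w) G w = cup l F G w - cup l F' G w"
  using cup_add_left[of l F "\<lambda>w. - F' w" G w] by (simp add: cup_minus_left)
lemma cup_sg_left: "cup l (\<lambda>w. sg i (F w)) G w = sg i (cup l F G w)"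
  by (simp add: sg_def cup_minus_left)
lemma cup_add_right: "cup l F (\<lambda>w. G w + G' w) w = cup l F G w + cup l F G' w"
  by (simp add: cup_def mul_add deconc_add)
lemma cup_minus_right: "cup l F (\<lambda>w. - G w) w = - cup l F G w"
  by (simp add: cup_def mul_minus deconc_minus)
lemma cup_diff_right: "cup l F (\<lambda>w. G w - G' w) w = cup l F G w - cup l F G' w"
  using cup_add_right[of l F G "\<lambda>w. - G' w" w] by (simp add: cup_minus_right)
lemma cup_sg_right: "cup l F (\<lambda>w. sg i (G w)) w = sg i (cup l F G w)"
  by (simp add: sg_def cup_minus_right)

lemmas cup_linear = cup_diff_left cup_add_left cup_minus_left cup_sg_left
  cup_diff_right cup_add_right cup_minus_right cup_sg_right

lemma d_cup:
  assumes "parity k F"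
  shows "d (cup l F G w) = cup l (\<lambda>w. d (F w)) G w + sg k (cup (l + 1) F (\<lambda>w. d (G w)) w)"
  by (cases "even k"; cases "even l")
     (simp_all add: cup_def additive_deconc[OF d] d_mul parity_s[OF assms] mul_minus deconc_minus deconc_add deconc_diff)

lemma D_cup:
  assumes F: "multiadditive F" "parity k F" and G: "parity l G"
  shows "D (k + l) (cup l F G) w = cup l (D k F) G w + sg k (cup (l + 1) F (D l G) w)"
proof -
  have A: "circ (k + l) mm (cup l F G) w = d (cup l F G w) - cup (k + l) idc (cup l F G) w
      + sg (k + l) (cup 1 (cup l F G) idc w)"
    by (rule circ_mm) (rule parity_cup[OF F(2) G])
  have B: "circ 2 (cup l F G) mm w = cup (l + 1) F (circ 2 G mm) w + sg l (cup l (circ 2 F mm) G w)"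
    using cup_circ[OF F(1) parity_mm, of l G w] by (simp add: add.commute)
  have F': "circ k mm F = (\<lambda>w. d (F w) - cup k idc F w + sg k (cup 1 F idc w))"
    and G': "circ l mm G = (\<lambda>w. d (G w) - cup l idc G w + sg l (cup 1 G idc w))"
    using circ_mm[OF F(2)] circ_mm[OF G] by auto
  have C: "cup (l + 1) F (cup 1 G idc) w = cup 1 (cup l F G) idc w"
    "cup l (cup k idc F) G w = cup (k + l) idc (cup l F G) w"
    "cup (l + 1) F (cup l idc G) w = cup l (cup 1 F idc) G w"
    using cup_assoc[of l 1 F G idc w] cup_assoc[of k l idc F G w] cup_assoc[of 1 l F idc G w]
    by (simp_all add: add.commute)
  show ?thesis
    unfolding D_def[abs_def] cup_linear F' G' A B C d_cup[OF F(2)]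
    by (cases "even k"; cases "even l") (simp_all add: algebra_simps)
qed

section \<open>The Leibniz homotopy and the bracket\<close>

lemma brace_sg:
  assumes F: "multiadditive F"
  shows "brace l k F (\<lambda>w. sg i (G w)) H w = sg i (brace l k F G H w)"
    and "brace l k F G (\<lambda>w. sg i (H w)) w = sg i (brace l k F G H w)"
  by (simp_all add: brace_def sg_def multi_minus[OF F] multi2[OF F] deconc_minus)

lemma brace_sg_left: "brace l k (\<lambda>w. sg i (F w)) G H w = sg i (brace l k F G H w)"
  by (simp add: brace_def sg_def deconc_minus)

lemma D_zero_circ: "(\<And>w. D k F w = 0) \<Longrightarrow> circ k mm F = (\<lambda>w. sg (k - 1) (circ 2 F mm w))"
  by (simp add: D_def fun_eq_iff)

lemma parity_circ:
  assumes F: "multiadditive F" "parity k F" and G: "parity l G"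
  shows "parity (k + l - 1) (circ l F G)"
  unfolding parity_def
  by (cases "even k"; cases "even l")
     (simp_all add: circ_def additive_deconc[OF s] parity_s[OF F(2)] parity_tau[OF G] multi_minus[OF F(1)]
       deconc_twist deconc_minus)

text \<open>In \<open>m \<circ> F{G, H}\<close> and \<open>F{G, H} \<circ> m\<close>, every term in which \<open>m\<close> meets a single cochain can be rewritten by
the cocycle conditions, and those terms cancel, as do the triple braces. The cup products remain: \<open>m{G, H}\<close>
inserted in \<open>F\<close>, and \<open>m\<close> applied to \<open>F\<close> with one argument inserted and to the other argument.\<close>

lemma D_brace:
  assumes F: "multiadditive F" "parity f F" "\<And>w. D f F w = 0"
    and G: "multiadditive G" "parity l G" "\<And>w. D l G w = 0"
    and H: "parity k H" "\<And>w. D k H w = 0"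
  shows "sg (f + l - 1) (D (f + l + k - 2) (brace l k F G H) w) =
     circ (l + k) F (cup k G H) w - cup k (circ l F G) H w
      - sg ((f - 1) * l) (cup (f + k - 1) G (circ k F H) w)"
proof -
  note m = multiadditive_mm
  note cocycle = D_zero_circ[OF F(3)] D_zero_circ[OF G(3)] D_zero_circ[OF H(2)]
  have "brace l k mm G H = (\<lambda>w. sg l (cup k G H w))"
    using brace_mm[OF G(2)] by (simp add: fun_eq_iff)
  note lin = brace_sg[OF F(1)] brace_sg_left circ_sg_right[OF F(1)] this
  have 1: "circ 2 (brace l k F G H) mm w = triple_sum l k 2 F G H mm w
     + sg (k - 1) (brace (l + 1) k F (circ 2 G mm) H w) + brace l (k + 1) F G (circ 2 H mm) w"
    using brace_circ[OF F(1) G(1) parity_mm, of l k H w] by (simp add: add.commute)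
  have 2: "brace l k (circ 2 F mm) G H w = sg (l + k) (triple_sum l k 2 F G H mm w)
     + sg (l - 1) (brace (l + 1) k F (circ 2 G mm) H w) + sg l (circ (l + k) F (cup k G H) w)
     + sg (l + k) (brace l (k + 1) F G (circ 2 H mm) w)"
    using circ_brace[OF F(1) m parity_mm G(2) H(1), of w] unfolding cocycle lin
    by (cases "even l"; cases "even k") (simp_all add: add.commute)
  have 3: "circ (f + l + k - 2) mm (brace l k F G H) w = sg (f - 1) (brace l k (circ 2 F mm) G H w)
     - sg (f + l - 1) (cup k (circ l F G) H w) - sg ((f - 1) * (l - 1) + l) (cup (f + k - 1) G (circ k F H) w)"
    using circ_brace[OF m F(1) F(2) G(2) H(1), of w] unfolding cocycle lin
      brace_mm[OF G(2)] brace_mm[OF parity_circ[OF F(1) F(2) G(2)]]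
    by (cases "even l"; cases "even k"; cases "even f")
       (simp_all add: triple_sum_def triple_mm algebra_simps)
  show ?thesis
    unfolding D_def 1 2 3
    by (cases "even l"; cases "even k"; cases "even f") (simp_all add: algebra_simps)
qed

definition brk :: "int \<Rightarrow> int \<Rightarrow> ('t list \<Rightarrow> 't) \<Rightarrow> ('t list \<Rightarrow> 't) \<Rightarrow> 't list \<Rightarrow> 't" where
  "brk k l F G w = circ l F G w - sg ((k - 1) * (l - 1)) (circ k G F w)"

text \<open>Every associator of \<open>\<circ>\<close> is symmetric by \<open>pre_Lie\<close>, so all braces cancel.\<close>

lemma jacobi:
  assumes F: "multiadditive F" "parity f F" and G: "multiadditive G" "parity l G"
    and H: "multiadditive H" "parity k H"
  shows "brk (f + l - 1) k (brk f l F G) H w = brk f (l + k - 1) F (brk l k G H) w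
     - sg ((f - 1) * (l - 1)) (brk l (f + k - 1) G (brk f k F H) w)"
proof -
  have comm: "l + f = f + l" "k + f = f + k" "k + l = l + k" by simp_all
  note pl = pre_Lie[OF F(1) G(2)] pre_Lie[OF F(1) H(2)] pre_Lie[OF G(1) F(2)] pre_Lie[OF G(1) H(2)]
    pre_Lie[OF H(1) F(2)] pre_Lie[OF H(1) G(2)]
  show ?thesis
    unfolding brk_def[abs_def] circ_diff_left circ_sg_left circ_diff_right[OF F(1)] circ_diff_right[OF G(1)]
      circ_diff_right[OF H(1)] circ_sg_right[OF F(1)] circ_sg_right[OF G(1)] circ_sg_right[OF H(1)] pl comm
    by (cases "even l"; cases "even k"; cases "even f") (simp_all add: algebra_simps)
qed

lemma D_brk:
  assumes F: "multiadditive F" "parity k F" and G: "multiadditive G" "parity l G"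
  shows "D (k + l - 1) (brk k l F G) w = brk (k + 1) l (D k F) G w + sg (k - 1) (brk k (l + 1) F (D l G) w)"
proof -
  have "D (k + l - 1) (brk k l F G) w = D (k + l - 1) (circ l F G) w
      - sg ((k - 1) * (l - 1)) (D (l + k - 1) (circ k G F) w)"
    unfolding D_def brk_def[abs_def] circ_diff_left circ_sg_left circ_diff_right[OF multiadditive_mm]
      circ_sg_right[OF multiadditive_mm]
    by (cases "even l"; cases "even k") (simp_all add: algebra_simps)
  then show ?thesis
    unfolding D_circ[OF F G(2)] D_circ[OF G F(2)] brk_def
    by (cases "even l"; cases "even k") (simp_all add: algebra_simps)
qed

lemma brk_cup:
  assumes F: "multiadditive F" "parity f F" "\<And>w. D f F w = 0"
    and G: "multiadditive G" "parity l G" "\<And>w. D l G w = 0"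
    and H: "parity k H" "\<And>w. D k H w = 0"
  shows "brk f (l + k) F (cup k G H) w = cup k (brk f l F G) H w
      + sg ((f - 1) * l) (cup (f + k - 1) G (brk f k F H) w)
      + sg (f + l - 1) (D (f + l + k - 2) (brace l k F G H) w)"
  unfolding D_brace[OF F G H] brk_def[abs_def] cup_linear cup_circ[OF G(1) F(2)]
  by (cases "even l"; cases "even k"; cases "even f") (simp_all add: algebra_simps)

section \<open>Scalars and normalisation\<close>

text \<open>Abstract multiplication by a ring element. The projection \<open>cl\<close> is also of this kind, as multiplication by
\<open>1\<close>, so that linearity and the support condition of cochains are treated by the same lemmas.\<close>

definition scalar :: "('t \<Rightarrow> 't) \<Rightarrow> bool" where
  "scalar c \<longleftrightarrow> additive c \<and> (\<forall>a b. c a \<cdot> b = c (a \<cdot> b) \<and> a \<cdot> c b = c (a \<cdot> b))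
     \<and> (\<forall>a. d (c a) = c (d a)) \<and> (\<forall>a. s (c a) = c (s a))"

definition homogeneous :: "('t \<Rightarrow> 't) \<Rightarrow> ('t list \<Rightarrow> 't) \<Rightarrow> bool" where
  "homogeneous c F \<longleftrightarrow> (\<forall>x a z. F (x @ c a # z) = c (F (x @ a # z)))"

lemma homogeneousD: "homogeneous c F \<Longrightarrow> F (x @ c a # z) = c (F (x @ a # z))"
  by (simp add: homogeneous_def)

lemma scalar_tau: "scalar c \<Longrightarrow> tau (c a) = c (tau a)"
  by (simp add: scalar_def tau_def additive_minus)

lemma scalar_deconc: "scalar c \<Longrightarrow> c (deconc' w F) = deconc' w (\<lambda>x y. c (F x y))"
  by (simp add: scalar_def deconc'_def additive_deconc)

lemma scalar_deconc2: "scalar c \<Longrightarrow> c (deconc w F) = deconc w (\<lambda>x y. c (F x y))"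
  by (simp add: scalar_def additive_deconc)

lemma homogeneous_cup:
  assumes "scalar c" "homogeneous c F" "homogeneous c G"
  shows "homogeneous c (cup l F G)"
proof -
  have *: "c a \<cdot> b = c (a \<cdot> b)" "a \<cdot> c b = c (a \<cdot> b)" for a b using assms(1) by (simp_all add: scalar_def)
  have add: "c (a + b) = c a + c b" for a b using assms(1) by (simp add: scalar_def additiveD)
  show ?thesis unfolding homogeneous_def
    by (cases "even l") (simp_all add: cup_insert scalar_deconc[OF assms(1)] add homogeneousD[OF assms(2)]
        homogeneousD[OF assms(3)] * scalar_tau[OF assms(1)])
qed

lemma homogeneous_circ:
  assumes "scalar c" "homogeneous c F" "homogeneous c G"
  shows "homogeneous c (circ l F G)"
proof -
  have add: "c (a + b) = c a + c b" for a b using assms(1) by (simp add: scalar_def additiveD)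
  have 2: "F (x @ g # y @ c a # z) = c (F (x @ g # y @ a # z))" for x g y a z
    using homogeneousD[OF assms(2), of "x @ g # y"] by simp
  show ?thesis unfolding homogeneous_def
    by (cases "even l") (simp_all add: circ_insert scalar_deconc[OF assms(1)] add homogeneousD[OF assms(2)] 2
        homogeneousD[OF assms(3)] scalar_tau[OF assms(1)])
qed

lemma homogeneous_brace:
  assumes "scalar c" "homogeneous c F" "homogeneous c G" "homogeneous c H"
  shows "homogeneous c (brace l k F G H)"
proof -
  have add: "c (a + b) = c a + c b" for a b using assms(1) by (simp add: scalar_def additiveD)
  have 2: "F (x @ g # y @ c a # z) = c (F (x @ g # y @ a # z))" for x g y a z
    using homogeneousD[OF assms(2), of "x @ g # y"] by simp
  have 3: "F (x @ g # y @ h # v @ c a # z) = c (F (x @ g # y @ h # v @ a # z))" for x g y h v a z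
    using homogeneousD[OF assms(2), of "x @ g # y @ h # v"] by simp
  show ?thesis unfolding homogeneous_def
    by (cases "even l"; cases "even k") (simp_all add: brace_insert scalar_deconc[OF assms(1)] add
        homogeneousD[OF assms(2)] 2 3
        homogeneousD[OF assms(3)] homogeneousD[OF assms(4)] scalar_tau[OF assms(1)])
qed

lemma homogeneous_mm:
  assumes "scalar c"
  shows "homogeneous c mm"
proof -
  have c: "c a \<cdot> b = c (a \<cdot> b)" "a \<cdot> c b = c (a \<cdot> b)" "d (c a) = c (d a)" "s (c a) = c (s a)"
    "c (a + b) = c a + c b" "c 0 = 0" for a b
    using assms by (simp_all add: scalar_def additiveD additive_zero)
  show ?thesis by (simp add: homogeneous_def mm_context c)
qed

lemma scalar_cup:
  assumes "scalar c"
  shows "cup l (\<lambda>w. c (F w)) G w = c (cup l F G w)" "cup l F (\<lambda>w. c (G w)) w = c (cup l F G w)"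
proof -
  have *: "c a \<cdot> b = c (a \<cdot> b)" "a \<cdot> c b = c (a \<cdot> b)" for a b using assms(1) by (simp_all add: scalar_def)
  show "cup l (\<lambda>w. c (F w)) G w = c (cup l F G w)" "cup l F (\<lambda>w. c (G w)) w = c (cup l F G w)"
    by (simp_all add: cup_def scalar_deconc2[OF assms] *)
qed

lemma scalar_circ:
  assumes "scalar c"
  shows "circ l (\<lambda>w. c (F w)) G w = c (circ l F G w)"
    "homogeneous c F \<Longrightarrow> circ l F (\<lambda>w. c (G w)) w = c (circ l F G w)"
  by (simp_all add: circ_def scalar_deconc2[OF assms] homogeneousD)

lemma scalar_brk:
  assumes "scalar c"
  shows "homogeneous c G \<Longrightarrow> brk k l (\<lambda>w. c (F w)) G w = c (brk k l F G w)"
    "homogeneous c F \<Longrightarrow> brk k l F (\<lambda>w. c (G w)) w = c (brk k l F G w)"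
proof -
  have c: "c (a - b) = c a - c b" "c (- a) = - c a" "sg i (c a) = c (sg i a)" for a b i
    using assms additiveD[of c a "- b"] by (simp_all add: scalar_def additive_minus additive_sg)
  show "homogeneous c G \<Longrightarrow> brk k l (\<lambda>w. c (F w)) G w = c (brk k l F G w)"
    "homogeneous c F \<Longrightarrow> brk k l F (\<lambda>w. c (G w)) w = c (brk k l F G w)"
    by (simp_all add: brk_def scalar_circ[OF assms] c)
qed

lemma D_scalar:
  assumes "scalar c"
  shows "D k (\<lambda>w. c (F w)) w = c (D k F w)"
proof -
  have c: "c (a - b) = c a - c b" "sg i (c a) = c (sg i a)" for a b i
    using assms additiveD[of c a "- b"] by (simp_all add: scalar_def additive_minus additive_sg)
  show ?thesis
    by (simp add: D_def scalar_circ[OF assms] homogeneous_mm[OF assms] c)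
qed

lemma D_add: "D k (\<lambda>w. F w + G w) w = D k F w + D k G w"
  by (simp add: D_def circ_add_left circ_add_right[OF multiadditive_mm] sg_add)

lemma D_minus: "D k (\<lambda>w. - F w) w = - D k F w"
  by (simp add: D_def circ_minus_left circ_minus_right[OF multiadditive_mm] sg_minus)

lemma brk_add:
  assumes "multiadditive F" "multiadditive G"
  shows "brk k l (\<lambda>w. F w + F' w) G w = brk k l F G w + brk k l F' G w"
    and "brk k l F (\<lambda>w. G w + G' w) w = brk k l F G w + brk k l F G' w"
  by (simp_all add: brk_def circ_add_left circ_add_right assms sg_add)

lemma multiadditive_cup:
  assumes "multiadditive F" "multiadditive G"
  shows "multiadditive (cup l F G)"
  by (rule multiadditiveI; cases "even l")
     (simp_all add: cup_insert multi_add[OF assms(1)] multi_add[OF assms(2)] additiveD[OF additive_tau] mul_add deconc'_add)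

lemma multiadditive_circ:
  assumes "multiadditive F" "multiadditive G"
  shows "multiadditive (circ l F G)"
proof -
  have 2: "F (x @ g # y @ (a + b) # z) = F (x @ g # y @ a # z) + F (x @ g # y @ b # z)" for x g y a b z
    using multi_add[OF assms(1), of "x @ g # y"] by simp
  show ?thesis
  by (rule multiadditiveI; cases "even l")
     (simp_all add: circ_insert multi_add[OF assms(1)] multi_add[OF assms(2)] 2 additiveD[OF additive_tau] deconc'_add)
qed

lemma multiadditive_brace:
  assumes "multiadditive F" "multiadditive G" "multiadditive H"
  shows "multiadditive (brace l k F G H)"
proof -
  have 2: "F (x @ g # y @ (a + b) # z) = F (x @ g # y @ a # z) + F (x @ g # y @ b # z)" for x g y a b z
    using multi_add[OF assms(1), of "x @ g # y"] by simp
  have 3: "F (x @ g # y @ h # u @ (a + b) # z) = F (x @ g # y @ h # u @ a # z) + F (x @ g # y @ h # u @ b # z)"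
      for x g y h u a b z
    using multi_add[OF assms(1), of "x @ g # y @ h # u"] by simp
  show ?thesis
  by (rule multiadditiveI; cases "even l"; cases "even k")
     (simp_all add: brace_insert multi_add[OF assms(1)] multi_add[OF assms(2)] multi_add[OF assms(3)] 2 3
       additiveD[OF additive_tau] deconc'_add)
qed

lemma multiadditive_plus: "multiadditive F \<Longrightarrow> multiadditive G \<Longrightarrow> multiadditive (\<lambda>w. F w + G w)"
  by (rule multiadditiveI) (simp add: multi_add)

lemma multiadditive_minus: "multiadditive F \<Longrightarrow> multiadditive (\<lambda>w. - F w)"
  by (rule multiadditiveI) (simp add: multi_add)

lemma D_alt: "D k F = (\<lambda>w. circ k mm F w + - sg (k - 1) (circ 2 F mm w))"
  by (simp add: D_def fun_eq_iff)

lemma brk_alt: "brk k l F G = (\<lambda>w. circ l F G w + - sg ((k - 1) * (l - 1)) (circ k G F w))"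
  by (simp add: brk_def fun_eq_iff)

text \<open>Cochains on the reduced algebra are the cochains that vanish when some letter is the unit.\<close>

definition normal :: "('t list \<Rightarrow> 't) \<Rightarrow> bool" where
  "normal F \<longleftrightarrow> (\<forall>x z. F (x @ e # z) = 0)"

lemma normalD: "normal F \<Longrightarrow> F (x @ e # z) = 0"
  by (simp add: normal_def)

lemma tau_e: "tau e = - e" by (simp add: tau_def s_e)

lemma normal_cup:
  assumes "multiadditive F" "normal F" "normal G"
  shows "normal (cup l F G)"
  by (cases "even l") (simp_all add: normal_def cup_insert normalD[OF assms(2)] normalD[OF assms(3)]
     tau_e multi_minus[OF assms(1)] deconc'_def)

lemma normal_circ:
  assumes "multiadditive F" "normal F" "normal G"
  shows "normal (circ l F G)"
proof -
  have 2: "F (x @ g # y @ e # z) = 0" for x g y z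
    using normalD[OF assms(2), of "x @ g # y"] by simp
  show ?thesis
  by (cases "even l") (simp_all add: normal_def circ_insert normalD[OF assms(2)] normalD[OF assms(3)]
     tau_e multi_minus[OF assms(1)] multi_zero[OF assms(1)] 2 deconc'_def)
qed

lemma normal_brace:
  assumes "multiadditive F" "multiadditive G" "normal F" "normal G" "normal H"
  shows "normal (brace l k F G H)"
proof -
  have 2: "F (x @ g # y @ e # z) = 0" for x g y z
    using normalD[OF assms(3), of "x @ g # y"] by simp
  have 3: "F (x @ g # y @ h # u @ e # z) = 0" for x g y h u z
    using normalD[OF assms(3), of "x @ g # y @ h # u"] by simp
  have 4: "F (x @ g # y @ 0 # z) = 0" for x g y z
    using multi_zero[OF assms(1), of "x @ g # y"] by simp
  show ?thesis
  by (cases "even l"; cases "even k") (simp_all add: normal_def brace_insert normalD[OF assms(3)] normalD[OF assms(4)]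
      normalD[OF assms(5)]
     tau_e multi_minus[OF assms(1)] multi_minus[OF assms(2)] multi_zero[OF assms(1)] 2 3 4 multi2[OF assms(1)] deconc'_def)
qed

lemma idc_context: "idc (x @ a # z) = (if x = [] then if z = [] then a else 0 else 0)"
  by (cases x; cases z; cases "tl x") simp_all

lemma deconc_idc_left:
  assumes "multiadditive F"
  shows "deconc z (\<lambda>a b. F (y @ idc a # b)) = (if z = [] then 0 else F (y @ z))"
proof (cases z)
  case (Cons t z')
  have "deconc z' (\<lambda>a b. F (y @ idc (t # a) # b)) = F (y @ t # z')"
    using idc_context[of "[]" t] by (subst deconc_first) (simp_all add: multi_zero[OF assms])
  then show ?thesis using Cons by (simp add: multi_zero[OF assms])
qed (simp add: multi_zero[OF assms])

lemma deconc_idc_right: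
  assumes "multiadditive F"
  shows "deconc x (\<lambda>a b. F (map tau a @ s (idc b) # z)) = (if x = [] then 0 else - F (map tau x @ z))"
proof (cases x rule: rev_cases)
  case (snoc x' t)
  have "deconc x' (\<lambda>a b. F (map tau a @ s (idc (b @ [t])) # z)) = - F (map tau x' @ tau t # z)"
    using multi_minus[OF assms, of "map tau x'" "s t" z]
    by (subst deconc_last) (simp_all add: idc_context multi_zero[OF assms] s_simps tau_def)
  then show ?thesis using multi_zero[OF assms, of "map tau x' @ [tau t]" z]
    by (simp add: snoc deconc_snoc[of x' t "[]", simplified] s_simps)
qed (use multi_zero[OF assms, of "[]" z] in \<open>simp add: s_simps\<close>)

text \<open>With a unit in the word, the two products with it that occur in \<open>D\<close> cancel against each other, or against an
outer product if the unit is the first or the last letter.\<close>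

lemma normal_D:
  assumes F: "multiadditive F" "parity k F" "normal F"
    and cl: "\<And>x a z. F (x @ cl a # z) = F (x @ a # z)" "\<And>w. cl (F w) = F w"
  shows "normal (D k F)"
proof -
  have n: "F (x @ e # z) = 0" "F (x @ (- e) # z) = 0" for x z
    using F(3) multi_minus[OF F(1), of x e z] by (simp_all add: normal_def)
  have 1: "circ k mm F (x @ e # z) = (if x = [] then - sg k (F z) else 0)
      + (if z = [] then sg k (F (map tau x)) else 0)" for x z
    by (cases "even k") (simp_all add: circ_mm[OF F(2)] n d_simps cup_insert deconc'_def idc_context tau_e
        deconc_first deconc_last e_mul mul_e cl mul_minus if_distrib[of "\<lambda>a. a \<cdot> _"] if_distrib[of "\<lambda>a. _ \<cdot> a"] cong:
            if_cong)
  have 2: "F (x @ g # y @ e # z) = 0" for x g y z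
    using n(1)[of "x @ g # y"] by simp
  have "circ 2 F mm (x @ e # z) = (if z = [] then 0 else F (map tau x @ z))
      - (if x = [] then 0 else F (map tau x @ z))" for x z
  proof -
    have "mm (b @ e # c) = (if b = [] then cl (idc c) else 0) + (if c = [] then cl (s (idc b)) else 0)" for b c
      by (simp add: mm_context d_e s_e e_mul mul_e)
    then have *: "F (a @ mm (b @ e # c) # f) = (if b = [] then F (a @ idc c # f) else 0)
        + (if c = [] then F (a @ s (idc b) # f) else 0)" for a b c f
      by (simp add: multi_add[OF F(1)] cl multi_zero[OF F(1)])
    have "deconc x (\<lambda>a b. deconc z (\<lambda>c f. if b = [] then F (map tau a @ idc c # f) else 0))
        = deconc z (\<lambda>c f. F (map tau x @ idc c # f))"
      by (subst deconc_last) simp_all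
    moreover have "deconc x (\<lambda>a b. deconc z (\<lambda>c f. if c = [] then F (map tau a @ s (idc b) # f) else 0))
        = deconc x (\<lambda>a b. F (map tau a @ s (idc b) # z))"
      by (simp add: deconc_first)
    ultimately show ?thesis
      by (simp add: circ_insert 2 n tau_e deconc'_def * deconc_add deconc_idc_left[OF F(1)] deconc_idc_right[OF F(1)])
  qed
  with 1 show ?thesis
    by (cases "even k") (simp_all add: normal_def D_def)
qed

section \<open>Explicit formulas on words\<close>

lemma cup_idc_left: "cup k idc F w = (if w = [] then 0 else hd (tw k w) \<cdot> F (tl w))"
proof (cases w)
  case (Cons a v)
  have "deconc v (\<lambda>x y. idc (tw k (a # x)) \<cdot> F y) = idc (tw k [a]) \<cdot> F v"
    by (subst deconc_first) (auto simp: tw_def idc_def split: list.split)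
  then show ?thesis using Cons by (simp add: cup_def tw_Cons)
qed (simp add: cup_def)

lemma cup_idc_right: "cup 1 F idc w = (if w = [] then 0 else F (tw 1 (butlast w)) \<cdot> last w)"
proof (cases w rule: rev_cases)
  case (snoc v b)
  have "deconc v (\<lambda>x y. F (tw 1 x) \<cdot> idc (y @ [b])) = F (tw 1 v) \<cdot> b"
    by (subst deconc_last) (auto simp: idc_def split: list.split)
  then show ?thesis using snoc by (simp add: cup_def deconc_snoc[of v b "[]", simplified])
qed (simp add: cup_def)

lemma circ_mm_right:
  assumes F: "multiadditive F"
  shows "circ 2 F mm w =
    (\<Sum>i<length w. F (tw 1 (take i w) @ d (w ! i) # drop (i + 1) w)) +
    (\<Sum>i\<in>{1..<length w}. F (tw 1 (take (i - 1) w) @ (s (w ! (i - 1)) \<cdot> w ! i) # drop (i + 1) w))"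
proof -
  have z: "F (X @ 0 # v) = 0" for X v by (rule multi_zero[OF F])
  have inner: "deconc r (\<lambda>y z. F (X @ mm y # z)) =
    (if length r \<ge> 1 then F (X @ d (r ! 0) # drop 1 r) else 0) +
    (if length r \<ge> 2 then F (X @ (s (r ! 0) \<cdot> r ! 1) # drop 2 r) else 0)" for r X
  proof (cases r)
    case (Cons a v)
    show ?thesis
    proof (cases v)
      case Nil
      then show ?thesis using Cons by (simp add: z)
    next
      case (Cons b u)
      have "deconc u (\<lambda>x y. F (X @ mm (a # b # x) # y)) = F (X @ mm [a, b] # u)"
        by (subst deconc_first) (auto simp: neq_Nil_conv z)
      then show ?thesis using \<open>r = a # v\<close> Cons by (simp add: z)
    qed
  qed (simp add: z)
  have "circ 2 F mm w = (\<Sum>i\<le>length w. (if i < length w then F (tw 1 (take i w) @ d (w ! i) # drop (i + 1) w) else 0) +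
    (if i + 1 < length w then F (tw 1 (take i w) @ (s (w ! i) \<cdot> w ! (i + 1)) # drop (i + 2) w) else 0))"
    unfolding circ_def deconc_sum[of w] inner by (rule sum.cong) (auto simp: nth_append add.commute)
  also have "\<dots> = (\<Sum>i\<le>length w. if i < length w then F (tw 1 (take i w) @ d (w ! i) # drop (i + 1) w) else 0) +
    (\<Sum>i\<le>length w. if i + 1 < length w then F (tw 1 (take i w) @ (s (w ! i) \<cdot> w ! (i + 1)) # drop (i + 2) w) else 0)"
    by (rule sum.distrib)
  also have "(\<Sum>i\<le>length w. if i < length w then F (tw 1 (take i w) @ d (w ! i) # drop (i + 1) w) else 0) =
    (\<Sum>i<length w. F (tw 1 (take i w) @ d (w ! i) # drop (i + 1) w))"
    by (rule sum.mono_neutral_cong_right) auto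
  also have "(\<Sum>i\<le>length w. if i + 1 < length w then F (tw 1 (take i w) @ (s (w ! i) \<cdot> w ! (i + 1)) # drop (i + 2) w)
      else 0) =
    (\<Sum>i\<in>{i. i + 1 < length w}. F (tw 1 (take i w) @ (s (w ! i) \<cdot> w ! (i + 1)) # drop (i + 2) w))"
    by (rule sum.mono_neutral_cong_right) auto
  also have "\<dots> = (\<Sum>i\<in>{1..<length w}. F (tw 1 (take (i - 1) w) @ (s (w ! (i - 1)) \<cdot> w ! i) # drop (i + 1) w))"
    by (rule sum.reindex_bij_witness[of _ "\<lambda>i. i - 1" "\<lambda>i. i + 1"]) auto
  finally show ?thesis .
qed

lemma circ_sum: "circ l F G w = (\<Sum>j\<le>length w. \<Sum>i\<le>j.
    F (tw (l - 1) (take i w) @ G (drop i (take j w)) # drop j w))"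
proof -
  have "circ l F G w = deconc w (\<lambda>p z. deconc p (\<lambda>x y. F (tw (l - 1) x @ G y # z)))"
    unfolding circ_def by (rule deconc_assoc[symmetric])
  also have "\<dots> = (\<Sum>j\<le>length w. \<Sum>i\<le>j. F (tw (l - 1) (take i w) @ G (drop i (take j w)) # drop j w))"
    unfolding deconc_sum by (intro sum.cong) (auto simp: min_def)
  finally show ?thesis .
qed

lemma cup_sum: "cup l F G w = (\<Sum>i\<le>length w. F (tw l (take i w)) \<cdot> G (drop i w))"
  by (simp add: cup_def deconc_sum)

end

section \<open>Hulls of monotone perversities\<close>

text \<open>A sum of GM perversities can grow by more than one per step, but it is still monotone. Hulls of monotone
functions behave as well as those of sums of perversities, and monotone functions are closed under addition.\<close>

definition mono_perv :: "nat \<Rightarrow> perv set" where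
  "mono_perv n = {u. (\<forall>i\<le>2. u i = 0) \<and> (\<forall>i. 1 \<le> i \<and> i < n \<longrightarrow> u i \<le> u (i + 1)) \<and> (\<forall>i>n. u i = 0)}"

lemma GM_mono_perv: "p \<in> GM n \<Longrightarrow> p \<in> mono_perv n"
  by (simp add: GM_def mono_perv_def)

lemma psum_mono_perv: "u \<in> mono_perv n \<Longrightarrow> v \<in> mono_perv n \<Longrightarrow> psum u v \<in> mono_perv n"
  by (auto simp: mono_perv_def psum_def add_mono)

lemma mono_perv_le:
  assumes "u \<in> mono_perv n" "i \<le> j" "j \<le> n"
  shows "u i \<le> u j"
  using assms(2,3)
proof (induction j rule: dec_induct)
  case (step j)
  have "u j \<le> u (Suc j)"
  proof (cases "j = 0")
    case True
    then show ?thesis using assms(1) by (simp add: mono_perv_def)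
  next
    case False
    then have "1 \<le> j \<and> j < n" using step.prems by simp
    then show ?thesis using assms(1) unfolding mono_perv_def by fastforce
  qed
  then show ?case using step by simp
qed simp

lemma GM_slope:
  assumes "p \<in> GM n" "i \<le> j" "j \<le> n"
  shows "p j \<le> p i + (j - i)"
  using assms(2,3)
proof (induction j rule: dec_induct)
  case (step j)
  have "p (Suc j) \<le> p j + 1"
  proof (cases "j = 0")
    case True
    then show ?thesis using assms(1) by (simp add: GM_def)
  next
    case False
    then have "1 \<le> j \<and> j < n" using step.prems by simp
    then show ?thesis using assms(1) unfolding GM_def by fastforce
  qed
  then show ?case using step by simp
qed simp

text \<open>The hull in closed form: a value \<open>u j\<close> forces the value \<open>u j - (j - i)\<close> at \<open>i \<le> j\<close>, because a GM perversity grows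
by at most one per step.\<close>

definition slope_hull :: "nat \<Rightarrow> perv \<Rightarrow> perv" where
  "slope_hull n u i = (if i \<le> n then Max ((\<lambda>j. u j - (j - i)) ` {i..n}) else 0)"

lemma slope_hull_le_iff: "i \<le> n \<Longrightarrow> slope_hull n u i \<le> b \<longleftrightarrow> (\<forall>j\<in>{i..n}. u j - (j - i) \<le> b)"
  by (simp add: slope_hull_def)

lemma slope_hull_ge: "i \<le> j \<Longrightarrow> j \<le> n \<Longrightarrow> u j - (j - i) \<le> slope_hull n u i"
  by (auto simp: slope_hull_def intro!: Max_ge)

lemma slope_hull_GM:
  assumes u: "u \<in> mono_perv n" and top: "u \<le> gm_top n"
  shows "slope_hull n u \<in> GM n"
proof -
  have "u j \<le> j - 2" if "j \<le> n" for j
    using top that by (auto simp: le_fun_def gm_top_def dest: spec[of _ j])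
  then have "slope_hull n u i = 0" if "i \<le> 2" for i
  proof (cases "i \<le> n")
    case True
    have "slope_hull n u i \<le> 0"
      unfolding slope_hull_le_iff[OF True] using \<open>\<And>j. j \<le> n \<Longrightarrow> u j \<le> j - 2\<close> that by fastforce
    then show ?thesis by simp
  qed (simp add: slope_hull_def)
  moreover have "slope_hull n u i \<le> slope_hull n u (i + 1)" if "1 \<le> i" "i < n" for i
  proof -
    have "u j - (j - i) \<le> slope_hull n u (i + 1)" if "i \<le> j" "j \<le> n" for j
    proof (cases "j = i")
      case True
      have "u i \<le> u (i + 1)" using u \<open>1 \<le> i\<close> \<open>i < n\<close> by (simp add: mono_perv_def)
      then show ?thesis using slope_hull_ge[of "i + 1" "i + 1" n u] True \<open>i < n\<close> by simp
    next
      case False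
      then show ?thesis using slope_hull_ge[of "i + 1" j n u] that by simp
    qed
    then show ?thesis using that by (simp add: slope_hull_le_iff)
  qed
  moreover have "slope_hull n u (i + 1) \<le> slope_hull n u i + 1" if "i < n" for i
  proof -
    have "u j - (j - (i + 1)) \<le> slope_hull n u i + 1" if "i + 1 \<le> j" "j \<le> n" for j
      using slope_hull_ge[of i j n u] that by simp
    then show ?thesis using that by (simp add: slope_hull_le_iff)
  qed
  moreover have "slope_hull n u i = 0" if "i > n" for i
    using that by (simp add: slope_hull_def)
  ultimately show ?thesis unfolding GM_def by blast
qed

text \<open>The bound \<open>u j + v j \<le> s j\<close> passes to \<open>i \<le> j\<close>, because \<open>s j \<le> s i + (j - i)\<close> and \<open>v i \<le> v j\<close>. Monotonicity of \<open>v\<close>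
is essential here.\<close>

lemma slope_hull_psum_le:
  assumes u: "u \<in> mono_perv n" and top: "u \<le> gm_top n" and v: "v \<in> mono_perv n" and s: "s \<in> GM n"
    and le: "psum u v \<le> s"
  shows "psum (slope_hull n u) v \<le> s"
proof -
  have "slope_hull n u i + v i \<le> s i" for i
  proof (cases "i \<le> n")
    case True
    have "u j - (j - i) \<le> s i - v i" if "i \<le> j" "j \<le> n" for j
    proof -
      have "u j + v j \<le> s j" using le by (simp add: psum_def le_fun_def)
      then show ?thesis using GM_slope[OF s that] mono_perv_le[OF v that] by simp
    qed
    then have "slope_hull n u i \<le> s i - v i" using True by (simp add: slope_hull_le_iff)
    moreover have "v i \<le> s i" using le[unfolded psum_def le_fun_def, THEN spec, of i] by simp
    ultimately show ?thesis by simp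
  next
    case False
    then show ?thesis using v by (simp add: mono_perv_def slope_hull_def)
  qed
  then show ?thesis by (simp add: le_fun_def psum_def)
qed

lemma zero_mono_perv [simp]: "(\<lambda>i. 0) \<in> mono_perv n"
  by (simp add: mono_perv_def)

lemma psum_zero [simp]: "psum u (\<lambda>i. 0) = u" "psum (\<lambda>i. 0) u = u"
  by (simp_all add: psum_def)

lemma psum_commute: "psum u v = psum v u" by (simp add: psum_def add.commute)
lemma psum_assoc: "psum (psum u v) w = psum u (psum v w)" by (simp add: psum_def add.assoc)
lemma psum_left_commute: "psum u (psum v w) = psum v (psum u w)" by (simp add: psum_def add.left_commute)
lemmas psum_ac = psum_assoc psum_commute psum_left_commute

lemma psum_mono: "u \<le> u' \<Longrightarrow> v \<le> v' \<Longrightarrow> psum u v \<le> psum u' v'"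
  by (simp add: psum_def le_fun_def add_mono)

lemma le_psum: "u \<le> psum u v" "v \<le> psum u v"
  by (simp_all add: psum_def le_fun_def)

lemma gm_zero_GM [simp]: "gm_zero \<in> GM n"
  by (simp add: GM_def gm_zero_def)

lemma gm_top_GM [simp]: "gm_top n \<in> GM n"
  by (auto simp: GM_def gm_top_def)

lemma GM_le_top:
  assumes "p \<in> GM n" shows "p \<le> gm_top n"
proof -
  have "p i \<le> gm_top n i" for i
  proof (cases "i \<le> n \<and> 2 \<le> i")
    case True
    then show ?thesis using GM_slope[OF assms, of 2 i] assms by (simp add: GM_def gm_top_def)
  qed (use assms in \<open>auto simp: GM_def\<close>)
  then show ?thesis by (simp add: le_fun_def)
qed

lemma gm_hull_eq:
  assumes u: "u \<in> mono_perv n" and top: "u \<le> gm_top n"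
  shows "gm_hull n u = slope_hull n u"
proof -
  have ge: "u \<le> slope_hull n u"
  proof (rule le_funI)
    fix i show "u i \<le> slope_hull n u i"
      using slope_hull_ge[of i i n u] u by (cases "i \<le> n") (simp_all add: mono_perv_def)
  qed
  have least: "slope_hull n u \<le> q" if "q \<in> GM n" "u \<le> q" for q
    using slope_hull_psum_le[OF u top zero_mono_perv that(1)] that by simp
  show ?thesis unfolding gm_hull_def
    using slope_hull_GM[OF u top] ge least by (intro the_equality) (auto intro: antisym)
qed

lemma gm_hull_GM: "u \<in> mono_perv n \<Longrightarrow> u \<le> gm_top n \<Longrightarrow> gm_hull n u \<in> GM n"
  by (simp add: gm_hull_eq slope_hull_GM)

lemma gm_hull_ge:
  assumes "u \<in> mono_perv n" "u \<le> gm_top n" shows "u \<le> gm_hull n u"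
proof (rule le_funI)
  fix i show "u i \<le> gm_hull n u i"
    using slope_hull_ge[of i i n u] assms by (cases "i \<le> n") (simp_all add: mono_perv_def gm_hull_eq)
qed

text \<open>The reason for the compatibility of hulls with sums, and for associativity of the sum of perversities.\<close>

lemma gm_hull_psum_le_iff:
  assumes "u \<in> mono_perv n" "u \<le> gm_top n" "v \<in> mono_perv n" "s \<in> GM n"
  shows "psum (gm_hull n u) v \<le> s \<longleftrightarrow> psum u v \<le> s"
  using slope_hull_psum_le[OF assms] gm_hull_ge[OF assms(1,2)] psum_mono[of u "gm_hull n u" v v]
  by (auto simp: gm_hull_eq[OF assms(1,2)] intro: order_trans)

lemma gm_hull_le_iff:
  assumes "u \<in> mono_perv n" "u \<le> gm_top n" "s \<in> GM n"
  shows "gm_hull n u \<le> s \<longleftrightarrow> u \<le> s"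
  using gm_hull_psum_le_iff[OF assms(1,2) zero_mono_perv assms(3)] by simp

lemma gm_hull_cong:
  assumes "\<And>s. s \<in> GM n \<Longrightarrow> u \<le> s \<longleftrightarrow> v \<le> s"
  shows "gm_hull n u = gm_hull n v"
  unfolding gm_hull_def using assms by (intro arg_cong[where f = The] ext) auto

lemma gm_hull_psum:
  assumes "u \<in> mono_perv n" "u \<le> gm_top n" "v \<in> mono_perv n"
  shows "gm_hull n (psum (gm_hull n u) v) = gm_hull n (psum u v)"
  using gm_hull_psum_le_iff[OF assms] by (intro gm_hull_cong) auto

lemma gm_hull_id: "p \<in> GM n \<Longrightarrow> gm_hull n p = p"
  unfolding gm_hull_def by (intro the_equality) (auto intro: antisym)

lemma gm_hull_mono:
  assumes u: "u \<in> mono_perv n" and v: "v \<in> mono_perv n" and "u \<le> v" "v \<le> gm_top n"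
  shows "gm_hull n u \<le> gm_hull n v"
proof -
  have "u \<le> gm_top n" using assms(3,4) by (rule order_trans)
  moreover have "u \<le> gm_hull n v" using assms(3) gm_hull_ge[OF v assms(4)] by (rule order_trans)
  ultimately show ?thesis using gm_hull_le_iff[OF u _ gm_hull_GM[OF v assms(4)]] by blast
qed

section \<open>Quotient modules and free modules\<close>

definition coset :: "('r, 'a, 'y) module_scheme \<Rightarrow> 'a set \<Rightarrow> 'a \<Rightarrow> 'a set" where
  "coset M N x = N +>\<^bsub>M\<^esub> x"

text \<open>The structure maps of a quotient are given by the left hand side.\<close>

lemma coset_image:
  assumes M: "abelian_group M" and M': "abelian_group M'"
    and N: "additive_subgroup N M" and N': "additive_subgroup N' M'"
    and h: "\<And>x. x \<in> carrier M \<Longrightarrow> h x \<in> carrier M'"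
      "\<And>x y. x \<in> carrier M \<Longrightarrow> y \<in> carrier M \<Longrightarrow> h (x \<oplus>\<^bsub>M\<^esub> y) = h x \<oplus>\<^bsub>M'\<^esub> h y"
    and sub: "h ` N \<subseteq> N'" and x: "x \<in> carrier M"
  shows "N' <+>\<^bsub>M'\<^esub> (h ` coset M N x) = coset M' N' (h x)"
proof -
  interpret M: abelian_group M by fact
  interpret M': abelian_group M' by fact
  interpret N: additive_subgroup N M by fact
  interpret N': additive_subgroup N' M' by fact
  show ?thesis
  proof (intro equalityI subsetI)
    fix y assume "y \<in> N' <+>\<^bsub>M'\<^esub> (h ` coset M N x)"
    then obtain a k where a: "a \<in> N'" "k \<in> N" "y = a \<oplus>\<^bsub>M'\<^esub> h (k \<oplus>\<^bsub>M\<^esub> x)"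
      by (auto simp: set_add_def' coset_def a_r_coset_def')
    have k: "k \<in> carrier M" "h k \<in> N'" using a sub N.a_subset by auto
    have "y = (a \<oplus>\<^bsub>M'\<^esub> h k) \<oplus>\<^bsub>M'\<^esub> h x"
      using a k h x N'.a_subset by (simp add: M'.a_assoc subset_iff)
    moreover have "a \<oplus>\<^bsub>M'\<^esub> h k \<in> N'" using a k by simp
    ultimately show "y \<in> coset M' N' (h x)" by (auto simp: coset_def a_r_coset_def')
  next
    fix y assume "y \<in> coset M' N' (h x)"
    then obtain a where a: "a \<in> N'" "y = a \<oplus>\<^bsub>M'\<^esub> h x" by (auto simp: coset_def a_r_coset_def')
    have "x \<in> coset M N x"
      using N.zero_closed x by (auto simp: coset_def a_r_coset_def' intro!: bexI[of _ "\<zero>\<^bsub>M\<^esub>"])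
    then show "y \<in> N' <+>\<^bsub>M'\<^esub> (h ` coset M N x)" using a by (auto simp: set_add_def')
  qed
qed

locale submodule_of = module R M for R :: "('r, 'x) ring_scheme" and M :: "('r, 'a, 'y) module_scheme" +
  fixes N assumes sub: "submodule N R M"
begin

lemma add_sub: "additive_subgroup N M"
  using sub by (simp add: submodule_def additive_subgroup_def)

sublocale N: additive_subgroup N M by (rule add_sub)
sublocale N': abelian_subgroup N M by (rule abelian_subgroupI3) unfold_locales

abbreviation Q where "Q \<equiv> quot_module M N"
abbreviation cls where "cls \<equiv> coset M N"

lemma Q_simps: "carrier Q = a_rcosets\<^bsub>M\<^esub> N" "\<zero>\<^bsub>Q\<^esub> = N" "X \<oplus>\<^bsub>Q\<^esub> Y = X <+>\<^bsub>M\<^esub> Y"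
  "c \<odot>\<^bsub>Q\<^esub> X = N <+>\<^bsub>M\<^esub> ((\<lambda>x. c \<odot>\<^bsub>M\<^esub> x) ` X)"
  by (simp_all add: quot_module_def)

lemma carrier_Q: "carrier Q = cls ` carrier M"
  by (auto simp: Q_simps A_RCOSETS_def' coset_def)

lemma cls_closed [simp, intro]: "x \<in> carrier M \<Longrightarrow> cls x \<in> carrier Q"
  by (simp add: carrier_Q)

lemma cls_zero: "\<zero>\<^bsub>Q\<^esub> = cls \<zero>\<^bsub>M\<^esub>"
  using N.a_subset by (simp add: Q_simps coset_def)

lemma cls_add: "x \<in> carrier M \<Longrightarrow> y \<in> carrier M \<Longrightarrow> cls x \<oplus>\<^bsub>Q\<^esub> cls y = cls (x \<oplus>\<^bsub>M\<^esub> y)"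
  by (simp add: Q_simps coset_def N'.a_rcos_sum)

lemma cls_smult: "c \<in> carrier R \<Longrightarrow> x \<in> carrier M \<Longrightarrow> c \<odot>\<^bsub>Q\<^esub> cls x = cls (c \<odot>\<^bsub>M\<^esub> x)"
  unfolding Q_simps
  by (rule coset_image[OF abelian_group_axioms abelian_group_axioms add_sub add_sub])
     (use submoduleE[OF sub] in \<open>auto simp: smult_r_distr\<close>)

lemma cls_self: "x \<in> carrier M \<Longrightarrow> x \<in> cls x"
  unfolding coset_def by (rule N'.a_rcos_self)

lemma cls_eq_iff:
  assumes "x \<in> carrier M" "y \<in> carrier M"
  shows "cls x = cls y \<longleftrightarrow> x \<ominus>\<^bsub>M\<^esub> y \<in> N"
proof
  assume "cls x = cls y"
  then have "x \<in> cls y" using cls_self[OF assms(1)] by simp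
  then obtain k where k: "k \<in> N" "x = k \<oplus>\<^bsub>M\<^esub> y" by (auto simp: coset_def a_r_coset_def')
  then have "x \<ominus>\<^bsub>M\<^esub> y = k" using N.a_subset assms
    by (auto simp: a_minus_def M.a_assoc M.r_neg)
  with k show "x \<ominus>\<^bsub>M\<^esub> y \<in> N" by simp
next
  assume d: "x \<ominus>\<^bsub>M\<^esub> y \<in> N"
  have "x = (x \<ominus>\<^bsub>M\<^esub> y) \<oplus>\<^bsub>M\<^esub> y" using assms by (simp add: a_minus_def M.a_assoc M.l_neg)
  then have "x \<in> N +>\<^bsub>M\<^esub> y" using d by (auto simp: a_r_coset_def')
  from a_repr_independence[OF this assms(2)] show "cls x = cls y"
    using N.a_subgroup by (simp add: coset_def)
qed

lemma cls_eqD: "x \<in> carrier M \<Longrightarrow> y \<in> cls x \<Longrightarrow> y \<in> carrier M \<and> cls y = cls x"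
proof -
  assume x: "x \<in> carrier M" and y: "y \<in> cls x"
  then show "y \<in> carrier M \<and> cls y = cls x"
    using a_repr_independence[of y N x] N.a_subgroup a_r_coset_subset_G[OF N.a_subset x] by (auto simp: coset_def)
qed

lemma module_Q: "module R Q"
proof (rule moduleI)
  show "cring R" by (rule is_cring)
  show "abelian_group Q"
  proof (rule abelian_groupI)
    fix X Y Z assume "X \<in> carrier Q"
    then obtain x where x: "x \<in> carrier M" "X = cls x" by (auto simp: carrier_Q)
    show "\<zero>\<^bsub>Q\<^esub> \<oplus>\<^bsub>Q\<^esub> X = X" using x by (simp add: cls_zero cls_add)
    show "\<exists>Y\<in>carrier Q. Y \<oplus>\<^bsub>Q\<^esub> X = \<zero>\<^bsub>Q\<^esub>"
      using x by (auto intro!: bexI[of _ "cls (\<ominus>\<^bsub>M\<^esub> x)"] simp: cls_add cls_zero M.l_neg)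
    assume "Y \<in> carrier Q"
    then obtain y where y: "y \<in> carrier M" "Y = cls y" by (auto simp: carrier_Q)
    show "X \<oplus>\<^bsub>Q\<^esub> Y \<in> carrier Q" "X \<oplus>\<^bsub>Q\<^esub> Y = Y \<oplus>\<^bsub>Q\<^esub> X" using x y by (auto simp: cls_add M.a_comm)
    assume "Z \<in> carrier Q"
    then obtain z where z: "z \<in> carrier M" "Z = cls z" by (auto simp: carrier_Q)
    show "X \<oplus>\<^bsub>Q\<^esub> Y \<oplus>\<^bsub>Q\<^esub> Z = X \<oplus>\<^bsub>Q\<^esub> (Y \<oplus>\<^bsub>Q\<^esub> Z)" using x y z by (simp add: cls_add M.a_assoc)
  qed (simp add: cls_zero)
qed (auto simp: carrier_Q cls_smult cls_add smult_l_distr smult_r_distr smult_assoc1)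

lemma cls_minus: "x \<in> carrier M \<Longrightarrow> \<ominus>\<^bsub>Q\<^esub> cls x = cls (\<ominus>\<^bsub>M\<^esub> x)"
proof -
  assume x: "x \<in> carrier M"
  interpret Q: module R Q by (rule module_Q)
  have "cls (\<ominus>\<^bsub>M\<^esub> x) \<oplus>\<^bsub>Q\<^esub> cls x = \<zero>\<^bsub>Q\<^esub>" using x by (simp add: cls_add cls_zero M.l_neg)
  then show "\<ominus>\<^bsub>Q\<^esub> cls x = cls (\<ominus>\<^bsub>M\<^esub> x)" using x by (intro Q.minus_equality) auto
qed

end

lemma submodule_spanI:
  assumes "module R M" "S \<subseteq> carrier M"
  shows "submodule (submodule_span R M S) R M" "S \<subseteq> submodule_span R M S"
proof -
  interpret module R M by fact
  show "S \<subseteq> submodule_span R M S" by (auto simp: submodule_span_def)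
  have "submodule (carrier M) R M" by (rule carrier_is_submodule)
  then have *: "carrier M \<in> {N. submodule N R M \<and> S \<subseteq> N}" using assms(2) by simp
  show "submodule (submodule_span R M S) R M"
  proof (rule submoduleI)
    show "submodule_span R M S \<subseteq> carrier M" using * by (auto simp: submodule_span_def)
    show "\<zero>\<^bsub>M\<^esub> \<in> submodule_span R M S"
    proof -
      have "\<zero>\<^bsub>M\<^esub> \<in> N" if "submodule N R M" for N
        using additive_subgroup.zero_closed[of N M] that by (simp add: submodule_def additive_subgroup_def)
      then show ?thesis by (simp add: submodule_span_def)
    qed
  qed (use submoduleE in \<open>auto simp: submodule_span_def\<close>)
qed

lemma submodule_span_least: "submodule N R M \<Longrightarrow> S \<subseteq> N \<Longrightarrow> submodule_span R M S \<subseteq> N"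
  by (auto simp: submodule_span_def)

lemma free_module_simps:
  "carrier (free_module R W) = {u. (\<forall>w. u w \<in> carrier R) \<and> (\<forall>w. w \<notin> W \<longrightarrow> u w = \<zero>\<^bsub>R\<^esub>) \<and> finite {w. u w \<noteq> \<zero>\<^bsub>R\<^esub>}}"
  "\<zero>\<^bsub>free_module R W\<^esub> = (\<lambda>w. \<zero>\<^bsub>R\<^esub>)" "u \<oplus>\<^bsub>free_module R W\<^esub> v = (\<lambda>w. u w \<oplus>\<^bsub>R\<^esub> v w)"
  "c \<odot>\<^bsub>free_module R W\<^esub> u = (\<lambda>w. c \<otimes>\<^bsub>R\<^esub> u w)"
  by (simp_all add: free_module_def)

lemma module_free_module:
  assumes "cring R" shows "module R (free_module R W)"
proof -
  interpret cring R by fact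
  have fin_add: "finite {w. u w \<oplus>\<^bsub>R\<^esub> v w \<noteq> \<zero>\<^bsub>R\<^esub>}" if "finite {w. u w \<noteq> \<zero>\<^bsub>R\<^esub>}" "finite {w. v w \<noteq> \<zero>\<^bsub>R\<^esub>}"
      for u v :: "'c \<Rightarrow> 'a"
    by (rule finite_subset[OF _ finite_UnI[OF that]]) auto
  have fin_minus: "finite {w. \<ominus>\<^bsub>R\<^esub> u w \<noteq> \<zero>\<^bsub>R\<^esub>}" if "finite {w. u w \<noteq> \<zero>\<^bsub>R\<^esub>}" for u :: "'c \<Rightarrow> 'a"
    by (rule finite_subset[OF _ that]) auto
  have fin_smult: "finite {w. c \<otimes>\<^bsub>R\<^esub> u w \<noteq> \<zero>\<^bsub>R\<^esub>}" if "finite {w. u w \<noteq> \<zero>\<^bsub>R\<^esub>}" "c \<in> carrier R" for c and u :: "'c \<Rightarrow> 'a"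
    by (rule finite_subset[OF _ that(1)]) (use that(2) in auto)
  show ?thesis
  proof (rule moduleI)
    show "abelian_group (free_module R W)"
    proof (rule abelian_groupI)
      fix u assume u: "u \<in> carrier (free_module R W)"
      show "\<exists>v\<in>carrier (free_module R W). v \<oplus>\<^bsub>free_module R W\<^esub> u = \<zero>\<^bsub>free_module R W\<^esub>"
        using u fin_minus[of u] by (intro bexI[of _ "\<lambda>w. \<ominus>\<^bsub>R\<^esub> u w"]) (auto simp: free_module_simps l_neg)
    qed (auto simp: free_module_simps fin_add a_ac)
  qed (auto simp: free_module_simps fin_smult l_distr r_distr m_assoc is_cring)
qed

lemma free_gen_closed: "cring R \<Longrightarrow> w \<in> W \<Longrightarrow> free_gen R w \<in> carrier (free_module R W)"
proof -
  assume "cring R" and w: "w \<in> W"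
  then interpret cring R by simp
  have "finite {v. (if v = w then \<one>\<^bsub>R\<^esub> else \<zero>\<^bsub>R\<^esub>) \<noteq> \<zero>\<^bsub>R\<^esub>}" by (rule finite_subset[of _ "{w}"]) auto
  then show ?thesis using w by (auto simp: free_module_simps free_gen_def)
qed

lemma free_module_induct:
  assumes R: "cring R" and u: "u \<in> carrier (free_module R W)"
    and zero: "P \<zero>\<^bsub>free_module R W\<^esub>"
    and step: "\<And>u c w. u \<in> carrier (free_module R W) \<Longrightarrow> c \<in> carrier R \<Longrightarrow> w \<in> W \<Longrightarrow> P u \<Longrightarrow>
       P (u \<oplus>\<^bsub>free_module R W\<^esub> c \<odot>\<^bsub>free_module R W\<^esub> free_gen R w)"
  shows "P u"
  using u
proof (induction "card {w. u w \<noteq> \<zero>\<^bsub>R\<^esub>}" arbitrary: u)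
  interpret cring R by fact
  case 0
  then have "u = (\<lambda>w. \<zero>\<^bsub>R\<^esub>)" by (auto simp: free_module_simps)
  then show ?case using zero by (simp add: free_module_simps)
next
  interpret cring R by fact
  case (Suc k)
  then obtain w where w: "u w \<noteq> \<zero>\<^bsub>R\<^esub>" by (metis (mono_tags, lifting) card_eq_0_iff empty_Collect_eq nat.simps(3))
  let ?v = "u(w := \<zero>\<^bsub>R\<^esub>)"
  have s: "{x. ?v x \<noteq> \<zero>\<^bsub>R\<^esub>} = {x. u x \<noteq> \<zero>\<^bsub>R\<^esub>} - {w}" by auto
  have fin: "finite {x. u x \<noteq> \<zero>\<^bsub>R\<^esub>}" using Suc.prems by (simp add: free_module_simps)
  have v: "?v \<in> carrier (free_module R W)" using Suc.prems fin s by (auto simp: free_module_simps simp del: fun_upd_apply)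
      (auto simp: free_module_simps)
  have "card {x. ?v x \<noteq> \<zero>\<^bsub>R\<^esub>} = k" unfolding s using Suc.hyps(2) w fin by (simp add: card_Diff_singleton)
  then have "P ?v" using Suc.hyps(1) v by blast
  moreover have "w \<in> W" using w Suc.prems by (auto simp: free_module_simps)
  moreover have "u w \<in> carrier R" using Suc.prems by (auto simp: free_module_simps)
  moreover have "u = ?v \<oplus>\<^bsub>free_module R W\<^esub> u w \<odot>\<^bsub>free_module R W\<^esub> free_gen R w"
    using Suc.prems by (auto simp: free_module_simps free_gen_def fun_eq_iff)
  ultimately show ?case using step[OF v] by metis
qed

section \<open>A universal abelian group\<close>

text \<open>The product of all abelian groups with elements in \<open>'a\<close>. The modules of \<open>A\<close> have different carriers and
operations on the same type; each of them embeds into this one type of class \<open>ab_group_add\<close>, where sums of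
elements of different modules make sense.\<close>

typedef ('r, 'a) total =
  "{F :: ('r, 'a) module \<Rightarrow> 'a. \<forall>M. if abelian_group M then F M \<in> carrier M else F M = undefined}"
  by (rule exI[of _ "\<lambda>M. if abelian_group M then \<zero>\<^bsub>M\<^esub> else undefined"])
     (auto intro: abelian_monoid.zero_closed abelian_group.axioms)

definition total_of :: "(('r, 'a) module \<Rightarrow> 'a) \<Rightarrow> ('r, 'a) total" where
  "total_of F = Abs_total (\<lambda>M. if abelian_group M then F M else undefined)"

lemma Rep_total_of:
  assumes "abelian_group M" "\<And>M. abelian_group M \<Longrightarrow> F M \<in> carrier M"
  shows "Rep_total (total_of F) M = F M"
  using assms by (simp add: total_of_def Abs_total_inverse)

lemma Rep_total_closed: "abelian_group M \<Longrightarrow> Rep_total t M \<in> carrier M"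
  using Rep_total[of t] by (auto dest: spec[of _ M])

lemma total_eqI:
  assumes "\<And>M. abelian_group M \<Longrightarrow> Rep_total t M = Rep_total u M"
  shows "t = u"
proof -
  have "Rep_total t M = Rep_total u M" for M
    using assms[of M] Rep_total[of t] Rep_total[of u] by (cases "abelian_group M") (auto dest!: spec[of _ M])
  then show ?thesis by (simp add: Rep_total_inject[symmetric] fun_eq_iff)
qed

instantiation total :: (type, type) ab_group_add
begin

definition "0 = total_of (\<lambda>M. \<zero>\<^bsub>M\<^esub>)"
definition "t + u = total_of (\<lambda>M. Rep_total t M \<oplus>\<^bsub>M\<^esub> Rep_total u M)"
definition "- t = total_of (\<lambda>M. \<ominus>\<^bsub>M\<^esub> Rep_total t M)"
definition "t - u = (t :: ('a, 'b) total) + - u"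

lemma Rep_total_simps:
  assumes "abelian_group M"
  shows "Rep_total 0 M = \<zero>\<^bsub>M\<^esub>" "Rep_total (t + u) M = Rep_total t M \<oplus>\<^bsub>M\<^esub> Rep_total u M"
    "Rep_total (- t) M = \<ominus>\<^bsub>M\<^esub> Rep_total t M"
  unfolding zero_total_def plus_total_def uminus_total_def
  by (simp_all add: Rep_total_of[OF assms] Rep_total_closed abelian_monoid.zero_closed abelian_group.axioms
      abelian_monoid.a_closed abelian_group.a_inv_closed)

instance
proof
  fix t u v :: "('a, 'b) total"
  show "t + u + v = t + (u + v)"
    by (rule total_eqI)
       (simp add: Rep_total_simps Rep_total_closed abelian_monoid.a_assoc[OF abelian_group.axioms(1)])
  show "t + u = u + t"
    by (rule total_eqI)
       (simp add: Rep_total_simps Rep_total_closed abelian_monoid.a_comm[OF abelian_group.axioms(1)])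
  show "0 + t = t"
    by (rule total_eqI)
       (simp add: Rep_total_simps Rep_total_closed abelian_monoid.l_zero[OF abelian_group.axioms(1)])
  show "- t + t = 0"
    by (rule total_eqI) (simp add: Rep_total_simps Rep_total_closed abelian_group.l_neg)
  show "t - u = t + - u" by (simp add: minus_total_def)
qed

end

text \<open>The element concentrated in the factor \<open>M\<close>.\<close>

definition emb :: "('r, 'a) module \<Rightarrow> 'a \<Rightarrow> ('r, 'a) total" where
  "emb M a = total_of (\<lambda>N. if N = M then a else \<zero>\<^bsub>N\<^esub>)"

lemma Rep_emb:
  assumes "abelian_group N" "a \<in> carrier M"
  shows "Rep_total (emb M a) N = (if N = M then a else \<zero>\<^bsub>N\<^esub>)"
  using assms unfolding emb_def
  by (subst Rep_total_of) (auto intro: abelian_monoid.zero_closed abelian_group.axioms)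

lemma emb_add:
  assumes M: "abelian_group M" and "a \<in> carrier M" "b \<in> carrier M"
  shows "emb M (a \<oplus>\<^bsub>M\<^esub> b) = emb M a + emb M b"
  using assms abelian_monoid.a_closed[OF abelian_group.axioms(1)[OF M], of a b]
  by (intro total_eqI)
     (auto simp: Rep_total_simps Rep_emb abelian_monoid.l_zero[OF abelian_group.axioms(1)]
         abelian_monoid.zero_closed[OF abelian_group.axioms(1)])

text \<open>The group \<open>T\<close> of finitely supported families, indexed by perversity and degree.\<close>

type_synonym ('r, 'a) tmod = "(perv \<times> int) \<Rightarrow>\<^sub>0 ('r, 'a) total"

text \<open>Entries \<open>(u, u', i, t, t')\<close> stand for an element \<open>t\<close> of degree \<open>i\<close> and its image \<open>t'\<close> under the structure map
from perversity \<open>u\<close> to \<open>u'\<close>.\<close>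

type_synonym ('r, 'a) related = "(perv \<times> perv \<times> int \<times> ('r, 'a) tmod \<times> ('r, 'a) tmod) list"

definition vword :: "('r, 'a, 'z) pdga_scheme \<Rightarrow> nat \<Rightarrow> 'a pword \<Rightarrow> bool" where
  "vword A n w \<longleftrightarrow> (\<forall>(p, i, a)\<in>set w. p \<in> GM n \<and> a \<in> carrier (pobj A p i))"

context perverse_dga
begin

lemma mod_A: "p \<in> GM n \<Longrightarrow> module R (pobj A p k)" by (rule obj)
lemma ab_A: "p \<in> GM n \<Longrightarrow> abelian_group (pobj A p k)"
  using mod_A module.axioms(2) by blast
lemma abm_A: "p \<in> GM n \<Longrightarrow> abelian_monoid (pobj A p k)"
  using ab_A abelian_group.axioms(1) by blast

lemmas A_closed = abelian_monoid.zero_closed[OF abm_A] abelian_monoid.a_closed[OF abm_A]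
  abelian_group.a_inv_closed[OF ab_A] module.smult_closed[OF mod_A]

text \<open>A homogeneous element of \<open>A\<close> as an element of \<open>T\<close>.\<close>

definition V :: "perv \<Rightarrow> int \<Rightarrow> 'a \<Rightarrow> ('r, 'a) tmod" where
  "V p i a = Poly_Mapping.single (p, i) (emb (pobj A p i) a)"

definition comp :: "perv \<times> int \<Rightarrow> ('r, 'a) tmod \<Rightarrow> 'a" where
  "comp k t = Rep_total (Poly_Mapping.lookup t k) (pobj A (fst k) (snd k))"

lemma comp_closed: "fst k \<in> GM n \<Longrightarrow> comp k t \<in> carrier (pobj A (fst k) (snd k))"
  by (simp add: comp_def Rep_total_closed ab_A)

lemma comp_add: "fst k \<in> GM n \<Longrightarrow> comp k (t + u) = comp k t \<oplus>\<^bsub>pobj A (fst k) (snd k)\<^esub> comp k u"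
  by (simp add: comp_def lookup_add Rep_total_simps ab_A)

lemma comp_zero: "fst k \<in> GM n \<Longrightarrow> comp k 0 = \<zero>\<^bsub>pobj A (fst k) (snd k)\<^esub>"
  by (simp add: comp_def Rep_total_simps ab_A)

lemma comp_V: "p \<in> GM n \<Longrightarrow> a \<in> carrier (pobj A p i) \<Longrightarrow> comp (p, i) (V p i a) = a"
  by (simp add: comp_def V_def Rep_emb ab_A)

lemma V_add: "p \<in> GM n \<Longrightarrow> a \<in> carrier (pobj A p i) \<Longrightarrow> b \<in> carrier (pobj A p i) \<Longrightarrow>
    V p i (a \<oplus>\<^bsub>pobj A p i\<^esub> b) = V p i a + V p i b"
  by (simp add: V_def emb_add ab_A single_add)

lemma V_zero: "p \<in> GM n \<Longrightarrow> V p i \<zero>\<^bsub>pobj A p i\<^esub> = 0"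
  using V_add[of p "\<zero>\<^bsub>pobj A p i\<^esub>" i "\<zero>\<^bsub>pobj A p i\<^esub>"] A_closed(1)[of p i]
  by (simp add: abelian_monoid.l_zero[OF abm_A])

lemma V_minus: "p \<in> GM n \<Longrightarrow> a \<in> carrier (pobj A p i) \<Longrightarrow> V p i (\<ominus>\<^bsub>pobj A p i\<^esub> a) = - V p i a"
  using V_add[of p "\<ominus>\<^bsub>pobj A p i\<^esub> a" i a] V_zero[of p i]
  by (simp add: A_closed abelian_group.l_neg[OF ab_A] eq_neg_iff_add_eq_0)

lemma V_inj: "p \<in> GM n \<Longrightarrow> a \<in> carrier (pobj A p i) \<Longrightarrow> b \<in> carrier (pobj A p i) \<Longrightarrow> V p i a = V p i b \<Longrightarrow> a = b"
  using comp_V by metis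

text \<open>Families of additive maps on the modules of \<open>A\<close>; these extend to additive maps on \<open>T\<close> that vanish on all other
components.\<close>

definition fiber_additive :: "(perv \<times> int \<Rightarrow> 'a \<Rightarrow> 'b::ab_group_add) \<Rightarrow> bool" where
  "fiber_additive G \<longleftrightarrow> (\<forall>p i. (p \<in> GM n \<longrightarrow> (\<forall>a\<in>carrier (pobj A p i). \<forall>b\<in>carrier (pobj A p i).
      G (p, i) (a \<oplus>\<^bsub>pobj A p i\<^esub> b) = G (p, i) a + G (p, i) b)) \<and> (p \<notin> GM n \<longrightarrow> (\<forall>a. G (p, i) a = 0)))"

lemma fiber_additiveI:
  assumes "\<And>p i a b. p \<in> GM n \<Longrightarrow> a \<in> carrier (pobj A p i) \<Longrightarrow> b \<in> carrier (pobj A p i) \<Longrightarrow>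
      G (p, i) (a \<oplus>\<^bsub>pobj A p i\<^esub> b) = G (p, i) a + G (p, i) b"
    and "\<And>p i a. p \<notin> GM n \<Longrightarrow> G (p, i) a = 0"
  shows "fiber_additive G"
  using assms by (simp add: fiber_additive_def)

definition linext :: "(perv \<times> int \<Rightarrow> 'a \<Rightarrow> 'b::ab_group_add) \<Rightarrow> ('r, 'a) tmod \<Rightarrow> 'b" where
  "linext G t = (\<Sum>k\<in>Poly_Mapping.keys t. G k (comp k t))"

lemma fiber_zero: "fiber_additive G \<Longrightarrow> G k (comp k 0) = 0"
proof (cases "fst k \<in> GM n")
  case True
  assume G: "fiber_additive G"
  let ?z = "\<zero>\<^bsub>pobj A (fst k) (snd k)\<^esub>"
  have "G (fst k, snd k) (?z \<oplus>\<^bsub>pobj A (fst k) (snd k)\<^esub> ?z) = G (fst k, snd k) ?z + G (fst k, snd k) ?z"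
    using G True A_closed(1)[OF True] unfolding fiber_additive_def by blast
  then show ?thesis
    using True A_closed(1)[OF True] by (simp add: comp_zero abelian_monoid.l_zero[OF abm_A])
qed (cases k, simp add: fiber_additive_def)

lemma linext_superset:
  assumes "fiber_additive G" "finite K" "Poly_Mapping.keys t \<subseteq> K"
  shows "linext G t = (\<Sum>k\<in>K. G k (comp k t))"
  unfolding linext_def
proof (rule sum.mono_neutral_left[OF assms(2,3)], rule ballI)
  fix k assume "k \<in> K - Poly_Mapping.keys t"
  then have "comp k t = comp k 0" by (simp add: comp_def in_keys_iff)
  then show "G k (comp k t) = 0" using fiber_zero[OF assms(1)] by simp
qed

lemma additive_linext:
  assumes G: "fiber_additive G"
  shows "additive (linext G)"
  unfolding additive_def
proof (intro allI)
  fix t u :: "('r, 'a) tmod"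
  let ?K = "Poly_Mapping.keys t \<union> Poly_Mapping.keys u"
  have "G k (comp k (t + u)) = G k (comp k t) + G k (comp k u)" for k
    using G comp_closed[of k] by (cases k) (cases "fst k \<in> GM n"; simp add: fiber_additive_def comp_add)
  moreover have "linext G v = (\<Sum>k\<in>?K. G k (comp k v))" if "Poly_Mapping.keys v \<subseteq> ?K" for v
    by (rule linext_superset[OF G _ that]) simp
  ultimately show "linext G (t + u) = linext G t + linext G u"
    using keys_add[of t u] by (simp add: sum.distrib)
qed

lemma linext_V:
  assumes G: "fiber_additive G" and "p \<in> GM n" "a \<in> carrier (pobj A p i)"
  shows "linext G (V p i a) = G (p, i) a"
  using linext_superset[OF G, of "{(p, i)}" "V p i a"] comp_V[OF assms(2,3)] by (simp add: V_def)

definition sc :: "'r \<Rightarrow> ('r, 'a) tmod \<Rightarrow> ('r, 'a) tmod" where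
  "sc c = linext (\<lambda>(p, i) a. if p \<in> GM n then V p i (c \<odot>\<^bsub>pobj A p i\<^esub> a) else 0)"

text \<open>The projection of \<open>T\<close> to the direct sum of the modules of \<open>A\<close>.\<close>

definition cl :: "('r, 'a) tmod \<Rightarrow> ('r, 'a) tmod" where
  "cl = linext (\<lambda>(p, i) a. if p \<in> GM n then V p i a else 0)"

lemma fiber_cl: "fiber_additive (\<lambda>(p, i) a. if p \<in> GM n then V p i a else 0)"
  by (rule fiber_additiveI) (simp_all add: V_add)

lemma fiber_sc: "c \<in> carrier R \<Longrightarrow> fiber_additive (\<lambda>(p, i) a. if p \<in> GM n then V p i (c \<odot>\<^bsub>pobj A p i\<^esub> a) else 0)"
  by (rule fiber_additiveI) (simp_all add: V_add A_closed(4) module.smult_r_distr[OF mod_A])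

lemma additive_cl: "additive cl" unfolding cl_def by (rule additive_linext[OF fiber_cl])
lemma cl_V: "p \<in> GM n \<Longrightarrow> a \<in> carrier (pobj A p i) \<Longrightarrow> cl (V p i a) = V p i a"
  by (simp add: cl_def linext_V[OF fiber_cl])
lemma additive_sc: "c \<in> carrier R \<Longrightarrow> additive (sc c)" unfolding sc_def by (rule additive_linext[OF fiber_sc])
lemma sc_V: "c \<in> carrier R \<Longrightarrow> p \<in> GM n \<Longrightarrow> a \<in> carrier (pobj A p i) \<Longrightarrow> sc c (V p i a) = V p i (c \<odot>\<^bsub>pobj A p i\<^esub> a)"
  by (simp add: sc_def linext_V[OF fiber_sc])

lemma cl_expand: "cl t = (\<Sum>(p, i)\<in>{k \<in> Poly_Mapping.keys t. fst k \<in> GM n}. V p i (comp (p, i) t))"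
proof -
  have "cl t = (\<Sum>k\<in>Poly_Mapping.keys t. if fst k \<in> GM n then V (fst k) (snd k) (comp k t) else 0)"
    unfolding cl_def linext_def by (auto intro!: sum.cong)
  also have "\<dots> = (\<Sum>k\<in>{k \<in> Poly_Mapping.keys t. fst k \<in> GM n}. V (fst k) (snd k) (comp k t))"
    by (rule sum.inter_filter[symmetric]) simp
  finally show ?thesis by (simp add: case_prod_beta)
qed

text \<open>Additive maps on the direct sum of the modules of \<open>A\<close> are determined by their values on homogeneous elements.\<close>

lemma additive_eq_cl:
  assumes "additive f" "additive g"
    and eq: "\<And>p i a. p \<in> GM n \<Longrightarrow> a \<in> carrier (pobj A p i) \<Longrightarrow> f (V p i a) = g (V p i a)"
  shows "f (cl t) = g (cl t)"
  unfolding cl_expand additive_sum[OF assms(1)] additive_sum[OF assms(2)]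
proof (rule sum.cong[OF refl])
  fix k assume "k \<in> {k \<in> Poly_Mapping.keys t. fst k \<in> GM n}"
  then show "f (case k of (p, i) \<Rightarrow> V p i (comp (p, i) t)) = g (case k of (p, i) \<Rightarrow> V p i (comp (p, i) t))"
    using comp_closed[of k t] by (cases k) (simp add: eq)
qed

lemma fiber_out: "fiber_additive G \<Longrightarrow> fst k \<notin> GM n \<Longrightarrow> G k a = 0"
  by (cases k) (simp add: fiber_additive_def)

lemma linext_cl:
  assumes "fiber_additive G"
  shows "linext G (cl t) = linext G t"
proof -
  have "linext G (cl t) = (\<Sum>k\<in>{k \<in> Poly_Mapping.keys t. fst k \<in> GM n}. G k (comp k t))"
    unfolding cl_expand additive_sum[OF additive_linext[OF assms]]
  proof (rule sum.cong[OF refl])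
    fix k assume "k \<in> {k \<in> Poly_Mapping.keys t. fst k \<in> GM n}"
    then show "linext G (case k of (p, i) \<Rightarrow> V p i (comp (p, i) t)) = G k (comp k t)"
      using comp_closed[of k t] by (cases k) (simp add: linext_V[OF assms])
  qed
  also have "\<dots> = linext G t" unfolding linext_def
    by (rule sum.mono_neutral_left) (auto simp: fiber_out[OF assms])
  finally show ?thesis .
qed

lemma cl_cl: "cl (cl t) = cl t"
  using linext_cl[OF fiber_cl, of t] unfolding cl_def[symmetric] .

lemma sc_cl: "c \<in> carrier R \<Longrightarrow> sc c (cl t) = sc c t"
  by (simp add: sc_def linext_cl fiber_sc)

lemma one_R: "\<one>\<^bsub>R\<^esub> \<in> carrier R"
  by (rule cring.cring_simprules(6)[OF cring])

lemma sc_one: "sc \<one>\<^bsub>R\<^esub> = cl"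
proof
  fix t
  have "sc \<one>\<^bsub>R\<^esub> (cl t) = cl (cl t)"
    by (rule additive_eq_cl[OF additive_sc[OF one_R] additive_cl])
       (simp add: sc_V[OF one_R] cl_V module.smult_one[OF mod_A])
  then show "sc \<one>\<^bsub>R\<^esub> t = cl t" by (simp only: sc_cl[OF one_R] cl_cl)
qed

section \<open>The differential graded algebra of all homogeneous elements\<close>

definition sT :: "('r, 'a) tmod \<Rightarrow> ('r, 'a) tmod" where
  "sT t = Poly_Mapping.mapp (\<lambda>k x. sg (snd k) x) t"

lemma lookup_sT: "Poly_Mapping.lookup (sT t) k = sg (snd k) (Poly_Mapping.lookup t k)"
  by (simp add: sT_def lookup_mapp when_def in_keys_iff)

lemma sT_sT: "sT (sT t) = t"
  by (rule poly_mapping_eqI) (simp add: lookup_sT sg_def)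

lemma additive_sT: "additive sT"
  unfolding additive_def by (intro allI poly_mapping_eqI) (simp add: lookup_sT lookup_add sg_add)

lemma sT_V: "sT (V p i a) = sg i (V p i a)"
  by (rule poly_mapping_eqI) (auto simp: lookup_sT V_def lookup_single sg_def when_def)

lemma keys_sT: "Poly_Mapping.keys (sT t) = Poly_Mapping.keys t"
  by (auto simp: in_keys_iff lookup_sT sg_def split: if_splits)

lemma linext_sT:
  assumes "fiber_additive G"
  shows "linext G (sT t) = linext (\<lambda>k a. sg (snd k) (G k a)) t"
proof -
  have "G k (comp k (sT t)) = sg (snd k) (G k (comp k t))" for k
  proof -
    have *: "G k (comp k (- t)) = - G k (comp k t)"
    proof -
      have "G k (comp k (u + t)) = G k (comp k u) + G k (comp k t)" for u
        using assms comp_closed[of k] by (cases k) (cases "fst k \<in> GM n"; simp add: fiber_additive_def comp_add)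
      from this[of "- t"] have "G k (comp k 0) = G k (comp k (- t)) + G k (comp k t)" by simp
      then show ?thesis using fiber_zero[OF assms, of k] by (simp add: eq_neg_iff_add_eq_0)
    qed
    have "comp k (sT t) = (if even (snd k) then comp k t else comp k (- t))"
      by (simp add: comp_def lookup_sT sg_def)
    then show ?thesis using * by (simp add: sg_def)
  qed
  then show ?thesis by (simp add: linext_def keys_sT)
qed

lemma cl_sT: "cl (sT t) = sT (cl t)"
proof -
  have "cl (sT t) = cl (sT (cl t))"
    unfolding cl_def linext_sT[OF fiber_cl]
    by (rule linext_cl[symmetric, unfolded cl_def], rule fiber_additiveI) (simp_all add: V_add sg_add)
  also have "\<dots> = sT (cl t)"
  proof -
    have "(cl \<circ> sT) (cl t) = sT (cl t)"
      by (rule additive_eq_cl)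
         (use additive_cl additive_sT in \<open>simp_all add: additive_def sT_V additive_sg[OF additive_cl] cl_V\<close>)
    then show ?thesis by simp
  qed
  finally show ?thesis .
qed

definition dT :: "('r, 'a) tmod \<Rightarrow> ('r, 'a) tmod" where
  "dT = linext (\<lambda>(p, i) a. if p \<in> GM n then V p (i + 1) (pdiff A p i a) else 0)"

lemma lin_mapsD:
  assumes "h \<in> lin_maps R M N"
  shows "x \<in> carrier M \<Longrightarrow> h x \<in> carrier N"
    and "x \<in> carrier M \<Longrightarrow> y \<in> carrier M \<Longrightarrow> h (x \<oplus>\<^bsub>M\<^esub> y) = h x \<oplus>\<^bsub>N\<^esub> h y"
    and "c \<in> carrier R \<Longrightarrow> x \<in> carrier M \<Longrightarrow> h (c \<odot>\<^bsub>M\<^esub> x) = c \<odot>\<^bsub>N\<^esub> h x"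
  using assms by (auto simp: lin_maps_def hom_def)

lemmas diffD = lin_mapsD[OF diff]
lemmas mapD = lin_mapsD[OF map]

lemma fiber_dT: "fiber_additive (\<lambda>(p, i) a. if p \<in> GM n then V p (i + 1) (pdiff A p i a) else 0)"
  by (rule fiber_additiveI) (simp_all add: V_add diffD)

lemma additive_dT: "additive dT" unfolding dT_def by (rule additive_linext[OF fiber_dT])
lemma dT_cl: "dT (cl t) = dT t" by (simp add: dT_def linext_cl[OF fiber_dT])
lemma dT_V: "p \<in> GM n \<Longrightarrow> a \<in> carrier (pobj A p i) \<Longrightarrow> dT (V p i a) = V p (i + 1) (pdiff A p i a)"
  by (simp add: dT_def linext_V[OF fiber_dT])

lemma mulD:
  assumes "p \<in> GM n" "q \<in> GM n" "psum p q \<le> gm_top n"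
  shows "a \<in> carrier (pobj A p i) \<Longrightarrow> (\<lambda>b. pmul A p q i j a b) \<in> lin_maps R (pobj A q j) (pobj A (gm_add n p q) (i + j))"
    and "b \<in> carrier (pobj A q j) \<Longrightarrow> (\<lambda>a. pmul A p q i j a b) \<in> lin_maps R (pobj A p i) (pobj A (gm_add n p q) (i + j))"
  using mul assms unfolding perverse_product_def by auto

lemma gm_add_GM: "p \<in> GM n \<Longrightarrow> q \<in> GM n \<Longrightarrow> psum p q \<le> gm_top n \<Longrightarrow> gm_add n p q \<in> GM n"
  by (simp add: gm_add_def gm_hull_GM psum_mono_perv GM_mono_perv)

lemmas mul_closed = lin_mapsD(1)[OF mulD(1)]
lemmas mul_addr = lin_mapsD(2)[OF mulD(1)]
lemmas mul_addl = lin_mapsD(2)[OF mulD(2)]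

definition mul1 :: "perv \<Rightarrow> int \<Rightarrow> 'a \<Rightarrow> perv \<times> int \<Rightarrow> 'a \<Rightarrow> ('r, 'a) tmod" where
  "mul1 p i a = (\<lambda>(q, j) b. if p \<in> GM n \<and> q \<in> GM n \<and> psum p q \<le> gm_top n
      then V (gm_add n p q) (i + j) (pmul A p q i j a b) else 0)"

text \<open>Products of homogeneous elements whose perversities add up to more than the top are \<open>0\<close>.\<close>

definition mulT :: "('r, 'a) tmod \<Rightarrow> ('r, 'a) tmod \<Rightarrow> ('r, 'a) tmod" where
  "mulT t u = linext (\<lambda>(p, i) a. if p \<in> GM n then linext (mul1 p i a) u else 0) t"

lemma fiber_mul1: "p \<in> GM n \<Longrightarrow> a \<in> carrier (pobj A p i) \<Longrightarrow> fiber_additive (mul1 p i a)"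
  by (rule fiber_additiveI) (auto simp: mul1_def V_add gm_add_GM mul_closed mul_addr)

lemma fiber_mulT: "fiber_additive (\<lambda>(p, i) a. if p \<in> GM n then linext (mul1 p i a) u else 0)"
proof (rule fiber_additiveI)
  fix p i a b
  assume p: "p \<in> GM n" and ab: "a \<in> carrier (pobj A p i)" "b \<in> carrier (pobj A p i)"
  have "mul1 p i (a \<oplus>\<^bsub>pobj A p i\<^esub> b) k (comp k u) = mul1 p i a k (comp k u) + mul1 p i b k (comp k u)" for k
    using p ab comp_closed[of k u]
    by (cases k) (auto simp: mul1_def V_add[symmetric] gm_add_GM mul_closed mul_addl)
  then show "(case (p, i) of (p, i) \<Rightarrow> \<lambda>a. if p \<in> GM n then linext (mul1 p i a) u else 0) (a \<oplus>\<^bsub>pobj A p i\<^esub> b) =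
    (case (p, i) of (p, i) \<Rightarrow> \<lambda>a. if p \<in> GM n then linext (mul1 p i a) u else 0) a +
    (case (p, i) of (p, i) \<Rightarrow> \<lambda>a. if p \<in> GM n then linext (mul1 p i a) u else 0) b"
    using p by (simp add: linext_def sum.distrib)
qed simp

lemma mulT_V:
  assumes "p \<in> GM n" "a \<in> carrier (pobj A p i)" "q \<in> GM n" "b \<in> carrier (pobj A q j)"
  shows "mulT (V p i a) (V q j b) =
    (if psum p q \<le> gm_top n then V (gm_add n p q) (i + j) (pmul A p q i j a b) else 0)"
  using assms by (simp add: mulT_def linext_V[OF fiber_mulT] linext_V[OF fiber_mul1])
    (simp add: mul1_def)

lemma additive_mulT_left: "additive (\<lambda>t. mulT t u)"
  unfolding mulT_def by (rule additive_linext[OF fiber_mulT])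

lemma mulT_cl_left: "mulT (cl t) u = mulT t u"
  by (simp add: mulT_def linext_cl[OF fiber_mulT])

lemma mulT_sum: "mulT t u = (\<Sum>k\<in>Poly_Mapping.keys t. if fst k \<in> GM n then linext (mul1 (fst k) (snd k) (comp k t)) u else 0)"
  by (simp add: mulT_def linext_def case_prod_beta)

lemma mulT_cl_right: "mulT t (cl u) = mulT t u"
  unfolding mulT_sum by (rule sum.cong[OF refl]) (simp add: linext_cl[OF fiber_mul1[OF _ comp_closed]])

lemma additive_mulT_right: "additive (mulT t)"
  unfolding additive_def
proof (intro allI)
  fix u v
  have "(if fst k \<in> GM n then linext (mul1 (fst k) (snd k) (comp k t)) (u + v) else 0) =
    (if fst k \<in> GM n then linext (mul1 (fst k) (snd k) (comp k t)) u else 0) +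
    (if fst k \<in> GM n then linext (mul1 (fst k) (snd k) (comp k t)) v else 0)" for k
    using additiveD[OF additive_linext[OF fiber_mul1[OF _ comp_closed]]] by simp
  then show "mulT t (u + v) = mulT t u + mulT t v"
    by (simp add: mulT_sum sum.distrib)
qed

lemma additive_eqI:
  assumes "additive f" "additive g" "\<And>t. f (cl t) = f t" "\<And>t. g (cl t) = g t"
    and "\<And>p i a. p \<in> GM n \<Longrightarrow> a \<in> carrier (pobj A p i) \<Longrightarrow> f (V p i a) = g (V p i a)"
  shows "f t = g t"
  using additive_eq_cl[OF assms(1,2,5)] assms(3,4) by metis

lemma additive_compose: "additive f \<Longrightarrow> additive g \<Longrightarrow> additive (\<lambda>t. f (g t))"
  by (simp add: additive_def)

lemma additive_plus: "additive f \<Longrightarrow> additive g \<Longrightarrow> additive (\<lambda>t. f t + g t)"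
  by (simp add: additive_def)

text \<open>This makes the truncated product associative: both bracketings of a triple product are cut off at the same place.\<close>

lemma psum3_iff:
  assumes "p \<in> GM n" "q \<in> GM n" "r \<in> GM n" "psum p q \<le> gm_top n"
  shows "psum (gm_add n p q) r \<le> gm_top n \<longleftrightarrow> psum (psum p q) r \<le> gm_top n"
  unfolding gm_add_def using assms by (intro gm_hull_psum_le_iff) (simp_all add: psum_mono_perv GM_mono_perv)

lemma psum_le_topD: "psum u v \<le> gm_top n \<Longrightarrow> u \<le> gm_top n" "psum u v \<le> gm_top n \<Longrightarrow> v \<le> gm_top n"
  using le_psum order_trans by blast+

lemma gm_add_assoc:
  assumes "p \<in> GM n" "q \<in> GM n" "r \<in> GM n" "psum (psum p q) r \<le> gm_top n"
  shows "gm_add n (gm_add n p q) r = gm_add n p (gm_add n q r)"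
proof -
  have "psum q r \<le> gm_top n" using assms(4) psum_le_topD(2)[of p "psum q r"] by (simp add: psum_assoc)
  then show ?thesis
    using assms psum_le_topD(1)[OF assms(4)] gm_hull_psum[of "psum q r" n p] gm_hull_psum[of "psum p q" n r]
    by (simp add: gm_add_def psum_mono_perv GM_mono_perv psum_commute[of p "gm_hull n _"])
       (simp add: psum_ac)
qed

lemma mulT_assoc: "mulT (mulT t u) v = mulT t (mulT u v)"
proof (rule additive_eqI[where f = "\<lambda>t. mulT (mulT t u) v" and g = "\<lambda>t. mulT t (mulT u v)"])
  fix p i a assume a: "p \<in> GM n" "a \<in> carrier (pobj A p i)"
  show "mulT (mulT (V p i a) u) v = mulT (V p i a) (mulT u v)"
  proof (rule additive_eqI[where f = "\<lambda>u. mulT (mulT (V p i a) u) v" and g = "\<lambda>u. mulT (V p i a) (mulT u v)"])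
    fix q j b assume b: "q \<in> GM n" "b \<in> carrier (pobj A q j)"
    show "mulT (mulT (V p i a) (V q j b)) v = mulT (V p i a) (mulT (V q j b) v)"
    proof (rule additive_eqI[where f = "\<lambda>v. mulT (mulT (V p i a) (V q j b)) v"
          and g = "\<lambda>v. mulT (V p i a) (mulT (V q j b) v)"])
      fix r k c assume c: "r \<in> GM n" "c \<in> carrier (pobj A r k)"
      show "mulT (mulT (V p i a) (V q j b)) (V r k c) = mulT (V p i a) (mulT (V q j b) (V r k c))"
      proof (cases "psum (psum p q) r \<le> gm_top n")
        case True
        then have pq: "psum p q \<le> gm_top n" and qr: "psum q r \<le> gm_top n"
          using psum_le_topD[of "psum p q" r] psum_le_topD[of p "psum q r"] by (simp_all add: psum_assoc)
        have "psum (gm_add n p q) r \<le> gm_top n" "psum p (gm_add n q r) \<le> gm_top n"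
          using psum3_iff[OF a(1) b(1) c(1) pq] psum3_iff[OF b(1) c(1) a(1) qr] True
          by (simp_all add: psum_ac)
        then show ?thesis using a b c pq qr True
          by (simp add: mulT_V gm_add_GM mul_closed mul_assoc gm_add_assoc add.assoc)
      next
        case False
        have "mulT (mulT (V p i a) (V q j b)) (V r k c) = 0"
          using False a b c psum3_iff[OF a(1) b(1) c(1)] additive_zero[OF additive_mulT_left]
          by (simp add: mulT_V gm_add_GM mul_closed)
        moreover have "psum p (gm_add n q r) \<le> gm_top n \<Longrightarrow> psum q r \<le> gm_top n \<Longrightarrow> False"
          using False psum3_iff[OF b(1) c(1) a(1)] by (simp add: psum_ac)
        then have "mulT (V p i a) (mulT (V q j b) (V r k c)) = 0"
          using a b c additive_zero[OF additive_mulT_right]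
          by (auto simp add: mulT_V gm_add_GM mul_closed)
        ultimately show ?thesis by simp
      qed
    qed (simp_all add: additive_compose[OF additive_mulT_right additive_mulT_right] additive_mulT_right mulT_cl_right)
  qed (simp_all add: additive_compose[OF additive_mulT_right additive_mulT_left]
      additive_compose[OF additive_mulT_left additive_mulT_right] mulT_cl_right mulT_cl_left)
qed (simp_all add: additive_compose[OF additive_mulT_left additive_mulT_left] additive_mulT_left mulT_cl_left)

lemma dT_dT: "dT (dT t) = 0"
  by (rule additive_eqI[where f = "\<lambda>t. dT (dT t)" and g = "\<lambda>t. 0"])
     (simp_all add: additive_compose additive_dT dT_cl dT_V diffD diff_diff V_zero additive_def[of "\<lambda>t. 0"] add.assoc)

lemma sT_dT: "sT (dT t) = - dT (sT t)"
proof (rule additive_eqI[where f = "\<lambda>t. sT (dT t)" and g = "\<lambda>t. - dT (sT t)"])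
  show "additive (\<lambda>t. - dT (sT t))" using additive_compose[OF additive_dT additive_sT] by (simp add: additive_def)
  show "- dT (sT (cl t)) = - dT (sT t)" for t by (simp add: cl_sT[symmetric] dT_cl)
qed (simp_all add: additive_compose additive_dT additive_sT dT_cl dT_V sT_V additive_sg[OF additive_dT]
    additive_minus[OF additive_dT] sg_def)

lemma sT_mulT: "sT (mulT t u) = mulT (sT t) (sT u)"
proof (rule additive_eqI[where f = "\<lambda>t. sT (mulT t u)" and g = "\<lambda>t. mulT (sT t) (sT u)"])
  fix p i a assume a: "p \<in> GM n" "a \<in> carrier (pobj A p i)"
  show "sT (mulT (V p i a) u) = mulT (sT (V p i a)) (sT u)"
  proof (rule additive_eqI[where f = "\<lambda>u. sT (mulT (V p i a) u)" and g = "\<lambda>u. mulT (sT (V p i a)) (sT u)"])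
    fix q j b assume b: "q \<in> GM n" "b \<in> carrier (pobj A q j)"
    show "sT (mulT (V p i a) (V q j b)) = mulT (sT (V p i a)) (sT (V q j b))"
      using a b additive_zero[OF additive_sT]
      by (simp add: sT_V additive_sg[OF additive_mulT_left] additive_sg[OF additive_mulT_right] mulT_V)
         (simp add: sg_def)
  qed (simp_all add: additive_compose[OF additive_sT additive_mulT_right]
      additive_compose[OF additive_mulT_right additive_sT]
      mulT_cl_right cl_sT[symmetric])
qed (simp_all add: additive_compose[OF additive_sT additive_mulT_left] additive_compose[OF additive_mulT_left additive_sT]
    mulT_cl_left cl_sT[symmetric])

lemma sgn_mult_V: "p \<in> GM n \<Longrightarrow> a \<in> carrier (pobj A p i) \<Longrightarrow> V p i (sgn_mult (pobj A p i) e a) = sg e (V p i a)"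
  by (simp add: sgn_mult_def V_minus)

lemma sgn_mult_closed: "p \<in> GM n \<Longrightarrow> a \<in> carrier (pobj A p i) \<Longrightarrow> sgn_mult (pobj A p i) e a \<in> carrier (pobj A p i)"
  by (simp add: sgn_mult_def A_closed)

lemma dT_mulT: "dT (mulT t u) = mulT (dT t) u + mulT (sT t) (dT u)"
proof (rule additive_eqI[where f = "\<lambda>t. dT (mulT t u)" and g = "\<lambda>t. mulT (dT t) u + mulT (sT t) (dT u)"])
  fix p i a assume a: "p \<in> GM n" "a \<in> carrier (pobj A p i)"
  show "dT (mulT (V p i a) u) = mulT (dT (V p i a)) u + mulT (sT (V p i a)) (dT u)"
  proof (rule additive_eqI[where f = "\<lambda>u. dT (mulT (V p i a) u)"
      and g = "\<lambda>u. mulT (dT (V p i a)) u + mulT (sT (V p i a)) (dT u)"])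
    fix q j b assume b: "q \<in> GM n" "b \<in> carrier (pobj A q j)"
    show "dT (mulT (V p i a) (V q j b)) = mulT (dT (V p i a)) (V q j b) + mulT (sT (V p i a)) (dT (V q j b))"
    proof (cases "psum p q \<le> gm_top n")
      case True
      have 1: "pmul A p q (i + 1) j (pdiff A p i a) b \<in> carrier (pobj A (gm_add n p q) (i + j + 1))"
        and 2: "pmul A p q i (j + 1) a (pdiff A q j b) \<in> carrier (pobj A (gm_add n p q) (i + j + 1))"
        using mul_closed[OF a(1) b(1) True diffD(1)[OF a] b(2)] mul_closed[OF a(1) b(1) True a(2) diffD(1)[OF b]]
        by (simp_all add: ac_simps)
      show ?thesis using a b True 1 2 gm_add_GM[OF a(1) b(1) True]
        by (simp add: mulT_V dT_V diffD mul_closed sT_V additive_sg[OF additive_mulT_left] diff_mul V_add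
            sgn_mult_V sgn_mult_closed add.assoc add.commute[of 1 j])
    next
      case False
      then show ?thesis using a b
        by (simp add: mulT_V dT_V diffD(1) sT_V additive_sg[OF additive_mulT_left] additive_zero[OF additive_dT])
    qed
  qed (simp_all add: additive_compose[OF additive_dT additive_mulT_right]
      additive_compose[OF additive_mulT_right additive_dT]
      additive_plus additive_mulT_right mulT_cl_right dT_cl)
qed (simp_all add: additive_compose[OF additive_dT additive_mulT_left] additive_compose[OF additive_mulT_left additive_dT]
     additive_compose[OF additive_mulT_left additive_sT] additive_plus mulT_cl_left dT_cl cl_sT[symmetric])

definition eT :: "('r, 'a) tmod" where "eT = V gm_zero 0 (pone A)"

lemma gm_add_zero: "p \<in> GM n \<Longrightarrow> gm_add n gm_zero p = p" "p \<in> GM n \<Longrightarrow> gm_add n p gm_zero = p"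
  by (simp_all add: gm_add_def gm_zero_def gm_hull_id)

lemma psum_gm_zero: "psum gm_zero p = p" "psum p gm_zero = p"
  by (simp_all add: gm_zero_def)

lemma mulT_eT: "mulT t eT = cl t"
  by (rule additive_eqI[OF additive_mulT_left additive_cl mulT_cl_left cl_cl])
     (simp add: eT_def mulT_V one psum_gm_zero GM_le_top gm_add_zero mul_one cl_V)

lemma eT_mulT: "mulT eT t = cl t"
  by (rule additive_eqI[OF additive_mulT_right additive_cl mulT_cl_right cl_cl])
     (simp add: eT_def mulT_V one psum_gm_zero GM_le_top gm_add_zero one_mul cl_V)

text \<open>The Leibniz rule for \<open>1 = 1 \<cdot> 1\<close> reads \<open>d1 = d1 + d1\<close>.\<close>

lemma dT_eT: "dT eT = 0"
proof -
  have "sT eT = eT" by (simp add: eT_def sT_V)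
  moreover have "cl (dT eT) = dT eT"
    using diffD(1)[of gm_zero "pone A" 0] by (simp add: eT_def dT_V one cl_V)
  ultimately show ?thesis
    using dT_mulT[of eT eT] by (simp add: mulT_eT eT_mulT dT_cl)
qed

sublocale dga: signed_dga mulT dT sT cl eT
  by unfold_locales
     (simp_all add: additive_mulT_left additive_mulT_right additive_dT additive_sT mulT_assoc sT_sT sT_mulT sT_dT
       dT_dT dT_mulT mulT_eT eT_mulT dT_eT, simp add: eT_def sT_V)

section \<open>Perverse and graded degrees of multiadditive functions\<close>

abbreviation MP where "MP \<equiv> mono_perv n"

text \<open>\<open>t\<close> is homogeneous of degree \<open>i\<close> and perversity the hull of \<open>u\<close>. For sums \<open>u\<close> beyond the top this forces
\<open>t = 0\<close>, in accordance with the truncated product.\<close>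

definition VS :: "perv \<Rightarrow> int \<Rightarrow> ('r, 'a) tmod \<Rightarrow> bool" where
  "VS u i t \<longleftrightarrow> (if u \<le> gm_top n then \<exists>a\<in>carrier (pobj A (gm_hull n u) i). t = V (gm_hull n u) i a else t = 0)"

text \<open>\<open>t'\<close> is the image of \<open>t\<close> under the structure map from the hull of \<open>u\<close> to the hull of \<open>u'\<close>. Beyond the top the
image is \<open>0\<close>.\<close>

definition PR :: "perv \<Rightarrow> perv \<Rightarrow> int \<Rightarrow> ('r, 'a) tmod \<Rightarrow> ('r, 'a) tmod \<Rightarrow> bool" where
  "PR u u' i t t' \<longleftrightarrow> u \<in> MP \<and> u' \<in> MP \<and> u \<le> u' \<and>
     (if u' \<le> gm_top n
      then \<exists>a\<in>carrier (pobj A (gm_hull n u) i). t = V (gm_hull n u) i a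
             \<and> t' = V (gm_hull n u') i (pmap A (gm_hull n u) (gm_hull n u') i a)
      else t' = 0 \<and> VS u i t)"

lemma VS_closed:
  assumes "u \<in> MP"
  shows VS_zero: "VS u i 0" and VS_add: "VS u i t \<Longrightarrow> VS u i t' \<Longrightarrow> VS u i (t + t')"
    and VS_minus: "VS u i t \<Longrightarrow> VS u i (- t)"
proof -
  note g = gm_hull_GM[OF assms]
  show "VS u i 0" using A_closed(1)[OF g] V_zero[OF g] by (auto simp: VS_def)
  show "VS u i t \<Longrightarrow> VS u i t' \<Longrightarrow> VS u i (t + t')"
    unfolding VS_def using A_closed(2)[OF g] V_add[OF g] by (auto split: if_splits) metis
  show "VS u i t \<Longrightarrow> VS u i (- t)"
    unfolding VS_def using A_closed(3)[OF g] V_minus[OF g] by (auto split: if_splits) metis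
qed

lemma PR_VS:
  assumes "PR u u' i t t'"
  shows "VS u i t" "VS u' i t'"
proof -
  have u: "u \<in> MP" "u' \<in> MP" "u \<le> u'" using assms by (simp_all add: PR_def)
  show "VS u i t" using assms u(3) order_trans[OF u(3)] by (auto simp: PR_def VS_def split: if_splits)
  show "VS u' i t'"
  proof (cases "u' \<le> gm_top n")
    case True
    then have g: "gm_hull n u \<in> GM n" "gm_hull n u' \<in> GM n" "gm_hull n u \<le> gm_hull n u'"
      using u order_trans[OF u(3)] by (simp_all add: gm_hull_GM gm_hull_mono)
    show ?thesis using True assms mapD(1)[OF g] by (auto simp: PR_def VS_def)
  next
    case False
    then show ?thesis using assms by (simp add: PR_def VS_def)
  qed
qed

lemma PR_refl:
  assumes "u \<in> MP" "VS u i t"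
  shows "PR u u i t t"
  using assms gm_hull_GM[of u n] map_id by (auto simp: PR_def VS_def split: if_splits)

lemma PR_V:
  assumes "p \<in> GM n" "p' \<in> GM n" "p \<le> p'" "a \<in> carrier (pobj A p i)"
  shows "PR p p' i (V p i a) (V p' i (pmap A p p' i a))"
  using assms by (auto simp: PR_def GM_mono_perv GM_le_top gm_hull_id)

lemma map_zero: "p \<in> GM n \<Longrightarrow> q \<in> GM n \<Longrightarrow> p \<le> q \<Longrightarrow> pmap A p q k \<zero>\<^bsub>pobj A p k\<^esub> = \<zero>\<^bsub>pobj A q k\<^esub>"
proof -
  assume a: "p \<in> GM n" "q \<in> GM n" "p \<le> q"
  let ?f = "pmap A p q k" and ?z = "\<zero>\<^bsub>pobj A p k\<^esub>"
  have z: "?z \<in> carrier (pobj A p k)" by (rule A_closed(1)[OF a(1)])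
  have "?f ?z \<oplus>\<^bsub>pobj A q k\<^esub> ?f ?z = ?f ?z"
    using mapD(2)[OF a z z] z by (simp add: abelian_monoid.l_zero[OF abm_A[OF a(1)]])
  then have "V q k (?f ?z) + V q k (?f ?z) = V q k (?f ?z)"
    using V_add[OF a(2) mapD(1)[OF a z] mapD(1)[OF a z]] by simp
  then have "V q k (?f ?z) = V q k \<zero>\<^bsub>pobj A q k\<^esub>" by (simp add: V_zero[OF a(2)])
  then show ?thesis using V_inj[OF a(2) mapD(1)[OF a z] A_closed(1)[OF a(2)]] by blast
qed

lemma PR_closed:
  assumes u: "u \<in> MP" "u' \<in> MP" "u \<le> u'"
  shows PR_zero: "PR u u' i 0 0"
    and PR_add: "PR u u' i t t' \<Longrightarrow> PR u u' i x x' \<Longrightarrow> PR u u' i (t + x) (t' + x')"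
proof -
  have g: "gm_hull n u \<in> GM n" "gm_hull n u' \<in> GM n" "gm_hull n u \<le> gm_hull n u'" if "u' \<le> gm_top n"
    using u that order_trans[OF u(3)] by (simp_all add: gm_hull_GM gm_hull_mono)
  show "PR u u' i 0 0"
  proof (cases "u' \<le> gm_top n")
    case True
    note g = g[OF True]
    show ?thesis using u True A_closed(1)[OF g(1)] V_zero[OF g(1)] V_zero[OF g(2)] map_zero[OF g]
      unfolding PR_def by (auto intro!: bexI[of _ "\<zero>\<^bsub>pobj A (gm_hull n u) i\<^esub>"])
  next
    case False
    then show ?thesis using u VS_zero[OF u(1)] by (simp add: PR_def)
  qed
  assume t: "PR u u' i t t'" "PR u u' i x x'"
  show "PR u u' i (t + x) (t' + x')"
  proof (cases "u' \<le> gm_top n")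
    case True
    note g = g[OF True]
    obtain a b where a: "a \<in> carrier (pobj A (gm_hull n u) i)" "t = V (gm_hull n u) i a"
        "t' = V (gm_hull n u') i (pmap A (gm_hull n u) (gm_hull n u') i a)"
      and b: "b \<in> carrier (pobj A (gm_hull n u) i)" "x = V (gm_hull n u) i b"
        "x' = V (gm_hull n u') i (pmap A (gm_hull n u) (gm_hull n u') i b)"
      using t True by (auto simp: PR_def)
    show ?thesis
      unfolding PR_def using u True a b
      by (auto intro!: bexI[of _ "a \<oplus>\<^bsub>pobj A (gm_hull n u) i\<^esub> b"]
          simp: V_add[OF g(1)] V_add[OF g(2)] mapD[OF g] A_closed(2)[OF g(1)])
  next
    case False
    then show ?thesis using t VS_add[OF u(1)] by (simp add: PR_def)
  qed
qed

lemma PR_sc: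
  assumes c: "c \<in> carrier R" and t: "PR u u' i t t'"
  shows "PR u u' i (sc c t) (sc c t')"
proof -
  have u: "u \<in> MP" "u' \<in> MP" "u \<le> u'" using t by (simp_all add: PR_def)
  have VSc: "VS u i (sc c t)"
    using PR_VS(1)[OF t] gm_hull_GM[OF u(1)] A_closed(4) additive_zero[OF additive_sc[OF c]] c
    by (auto simp: VS_def sc_V split: if_splits)
  show ?thesis
  proof (cases "u' \<le> gm_top n")
    case True
    then have g: "gm_hull n u \<in> GM n" "gm_hull n u' \<in> GM n" "gm_hull n u \<le> gm_hull n u'"
      using u order_trans[OF u(3)] by (simp_all add: gm_hull_GM gm_hull_mono)
    obtain a where a: "a \<in> carrier (pobj A (gm_hull n u) i)" "t = V (gm_hull n u) i a"
        "t' = V (gm_hull n u') i (pmap A (gm_hull n u) (gm_hull n u') i a)"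
      using t True by (auto simp: PR_def)
    show ?thesis
      unfolding PR_def using u True a c
      by (auto intro!: bexI[of _ "c \<odot>\<^bsub>pobj A (gm_hull n u) i\<^esub> a"]
          simp: sc_V[OF c g(1)] sc_V[OF c g(2)] mapD[OF g] A_closed(4)[OF g(1)])
  next
    case False
    then show ?thesis using t VSc additive_zero[OF additive_sc[OF c]] by (simp add: PR_def)
  qed
qed

lemma sc_minus: "cl t = t \<Longrightarrow> sc (\<ominus>\<^bsub>R\<^esub> \<one>\<^bsub>R\<^esub>) t = - t"
proof -
  have m: "\<ominus>\<^bsub>R\<^esub> \<one>\<^bsub>R\<^esub> \<in> carrier R" by (rule cring.cring_simprules(3)[OF cring one_R])
  have "additive (\<lambda>t. - cl t)" using additive_cl by (simp add: additive_def)
  moreover have "sc (\<ominus>\<^bsub>R\<^esub> \<one>\<^bsub>R\<^esub>) (V p i a) = - cl (V p i a)" if "p \<in> GM n" "a \<in> carrier (pobj A p i)" for p i a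
    using that module.smult_l_minus[OF mod_A[OF that(1)] one_R that(2)]
    by (simp add: sc_V[OF m] cl_V V_minus module.smult_one[OF mod_A])
  ultimately have "sc (\<ominus>\<^bsub>R\<^esub> \<one>\<^bsub>R\<^esub>) (cl t) = - cl (cl t)" by (intro additive_eq_cl[OF additive_sc[OF m]])
  moreover assume "cl t = t"
  ultimately show ?thesis by simp
qed

lemma VS_cl: "u \<in> MP \<Longrightarrow> VS u i t \<Longrightarrow> cl t = t"
  using gm_hull_GM[of u n] additive_zero[OF additive_cl] by (auto simp: VS_def cl_V split: if_splits)

lemma PR_minus: assumes "PR u u' i t t'" shows "PR u u' i (- t) (- t')"
proof -
  have m: "\<ominus>\<^bsub>R\<^esub> \<one>\<^bsub>R\<^esub> \<in> carrier R" by (rule cring.cring_simprules(3)[OF cring one_R])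
  have "u \<in> MP" "u' \<in> MP" using assms by (simp_all add: PR_def)
  then show ?thesis using PR_sc[OF m assms] PR_VS[OF assms] by (simp add: sc_minus VS_cl)
qed

lemma PR_sg: "PR u u' i t t' \<Longrightarrow> PR u u' i (sg e t) (sg e t')"
  by (simp add: sg_def PR_minus)

lemma PR_deconc:
  assumes "u \<in> MP" "u' \<in> MP" "u \<le> u'" "\<And>x y. x @ y = xs \<Longrightarrow> PR u u' i (F x y) (F' x y)"
  shows "PR u u' i (deconc xs F) (deconc xs F')"
  using assms(4)
proof (induction xs arbitrary: F F')
  case (Cons a xs)
  have "PR u u' i (deconc xs (\<lambda>x y. F (a # x) y)) (deconc xs (\<lambda>x y. F' (a # x) y))"
    by (rule Cons.IH) (use Cons.prems in simp)
  moreover have "PR u u' i (F [] (a # xs)) (F' [] (a # xs))" by (rule Cons.prems) simp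
  ultimately show ?case using PR_add[OF assms(1-3)] by simp
qed simp

lemma VS_sT: "u \<in> MP \<Longrightarrow> VS u i t \<Longrightarrow> sT t = sg i t"
  using additive_zero[OF additive_sT] by (auto simp: VS_def sT_V split: if_splits)

lemma PR_tau:
  assumes "PR u u' i t t'" shows "PR u u' i (dga.tau t) (dga.tau t')"
proof -
  have "u \<in> MP" "u' \<in> MP" using assms by (simp_all add: PR_def)
  then show ?thesis using PR_minus[OF PR_sg[OF assms, of i]] PR_VS[OF assms] by (simp add: dga.tau_def VS_sT)
qed

lemma hull_psum_top: "u \<in> MP \<Longrightarrow> v \<in> MP \<Longrightarrow> u \<le> gm_top n \<Longrightarrow> psum (gm_hull n u) v \<le> gm_top n \<longleftrightarrow> psum u v \<le> gm_top n"
  by (rule gm_hull_psum_le_iff) simp_all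

lemma hull2_psum_top:
  assumes "u \<in> MP" "v \<in> MP" "u \<le> gm_top n" "v \<le> gm_top n"
  shows "psum (gm_hull n u) (gm_hull n v) \<le> gm_top n \<longleftrightarrow> psum u v \<le> gm_top n"
  using assms hull_psum_top[of u "gm_hull n v"] hull_psum_top[of v u] GM_mono_perv[OF gm_hull_GM[of v n]]
  by (simp add: psum_commute)

lemma gm_add_hull:
  assumes "u \<in> MP" "v \<in> MP" "u \<le> gm_top n" "v \<le> gm_top n"
  shows "gm_add n (gm_hull n u) (gm_hull n v) = gm_hull n (psum u v)"
  using assms gm_hull_psum[of u n "gm_hull n v"] gm_hull_psum[of v n u] GM_mono_perv[OF gm_hull_GM[of v n]]
  by (simp add: gm_add_def psum_commute)

lemma VS_mulT:
  assumes "u \<in> MP" "v \<in> MP" "VS u i t" "VS v j x"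
  shows "VS (psum u v) (i + j) (mulT t x)"
proof (cases "u \<le> gm_top n \<and> v \<le> gm_top n")
  case True
  then obtain a b where a: "a \<in> carrier (pobj A (gm_hull n u) i)" "t = V (gm_hull n u) i a"
    and b: "b \<in> carrier (pobj A (gm_hull n v) j)" "x = V (gm_hull n v) j b"
    using assms by (auto simp: VS_def)
  have g: "gm_hull n u \<in> GM n" "gm_hull n v \<in> GM n" using True assms by (simp_all add: gm_hull_GM)
  have "psum (gm_hull n u) (gm_hull n v) \<le> gm_top n \<longleftrightarrow> psum u v \<le> gm_top n"
    "gm_add n (gm_hull n u) (gm_hull n v) = gm_hull n (psum u v)"
    using hull2_psum_top gm_add_hull True assms by auto
  then show ?thesis using a b mulT_V[OF g(1) a(1) g(2) b(1)] mul_closed[OF g _ a(1) b(1)]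
    by (auto simp: VS_def)
next
  case False
  then have "mulT t x = 0" "\<not> psum u v \<le> gm_top n"
    using assms psum_le_topD[of u v] dga.mul_zero by (auto simp: VS_def split: if_splits)
  then show ?thesis by (simp add: VS_def)
qed

text \<open>Naturality of the product, including the case that only the product of the images is truncated.\<close>

lemma PR_mulT:
  assumes t: "PR u u' i t t'" and x: "PR v v' j x x'"
  shows "PR (psum u v) (psum u' v') (i + j) (mulT t x) (mulT t' x')"
proof -
  have u: "u \<in> MP" "u' \<in> MP" "u \<le> u'" and v: "v \<in> MP" "v' \<in> MP" "v \<le> v'"
    using t x by (simp_all add: PR_def)
  have S: "VS (psum u v) (i + j) (mulT t x)" "VS (psum u' v') (i + j) (mulT t' x')"
    using VS_mulT u v PR_VS[OF t] PR_VS[OF x] by auto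
  have le: "psum u v \<le> psum u' v'" using u v by (simp add: psum_mono)
  show ?thesis
  proof (cases "psum u' v' \<le> gm_top n")
    case True
    then have top': "u' \<le> gm_top n" "v' \<le> gm_top n" by (rule psum_le_topD)+
    then have top: "u \<le> gm_top n" "v \<le> gm_top n" using u v order_trans by blast+
    have uv: "psum u v \<le> gm_top n" using le True order_trans by blast
    define p q p' q' where pq: "p = gm_hull n u" "q = gm_hull n v" "p' = gm_hull n u'" "q' = gm_hull n v'"
    obtain a b where a: "a \<in> carrier (pobj A p i)" "t = V p i a" "t' = V p' i (pmap A p p' i a)"
      and b: "b \<in> carrier (pobj A q j)" "x = V q j b" "x' = V q' j (pmap A q q' j b)"
      using t x top' unfolding PR_def pq by auto
    have g: "p \<in> GM n" "q \<in> GM n" "p' \<in> GM n" "q' \<in> GM n" "p \<le> p'" "q \<le> q'"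
      unfolding pq using u v top top' by (simp_all add: gm_hull_GM gm_hull_mono)
    have s: "psum p q \<le> gm_top n" "psum p' q' \<le> gm_top n"
      unfolding pq using uv True hull2_psum_top[OF u(1) v(1) top] hull2_psum_top[OF u(2) v(2) top'] by blast+
    have h: "gm_hull n (psum u v) = gm_add n p q" "gm_hull n (psum u' v') = gm_add n p' q'"
      unfolding pq using gm_add_hull[OF u(1) v(1) top] gm_add_hull[OF u(2) v(2) top'] by simp_all
    have nat: "pmap A (gm_add n p q) (gm_add n p' q') (i + j) (pmul A p q i j a b)
        = pmul A p' q' i j (pmap A p p' i a) (pmap A q q' j b)"
      using mul[unfolded perverse_product_def, THEN conjunct2, THEN bspec, OF g(1), THEN bspec, OF g(2),
          THEN bspec, OF g(3), THEN bspec, OF g(4)] g(5,6) s(2) a(1) b(1) by simp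
    have "mulT t x = V (gm_add n p q) (i + j) (pmul A p q i j a b)"
      unfolding a b using mulT_V[OF g(1) a(1) g(2) b(1)] s by simp
    moreover have "mulT t' x' = V (gm_add n p' q') (i + j)
        (pmap A (gm_add n p q) (gm_add n p' q') (i + j) (pmul A p q i j a b))"
      unfolding a b nat using mulT_V[OF g(3) _ g(4)] s mapD(1)[OF g(1,3,5) a(1)] mapD(1)[OF g(2,4,6) b(1)] by simp
    moreover have "pmul A p q i j a b \<in> carrier (pobj A (gm_add n p q) (i + j))"
      using mul_closed[OF g(1,2) s(1) a(1) b(1)] .
    moreover have "psum u v \<in> MP" "psum u' v' \<in> MP" using u v by (simp_all add: psum_mono_perv)
    ultimately show ?thesis
      unfolding PR_def h using True le by auto
  next
    case False
    then show ?thesis using S le u v by (simp add: PR_def psum_mono_perv VS_def[of "psum u' v'"])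
  qed
qed

lemma PR_dT:
  assumes t: "PR u u' i t t'"
  shows "PR u u' (i + 1) (dT t) (dT t')"
proof -
  have u: "u \<in> MP" "u' \<in> MP" "u \<le> u'" using t by (simp_all add: PR_def)
  have S: "VS u (i + 1) (dT t)"
    using PR_VS(1)[OF t] gm_hull_GM[OF u(1)] diffD(1) additive_zero[OF additive_dT]
    by (auto simp: VS_def dT_V split: if_splits)
  show ?thesis
  proof (cases "u' \<le> gm_top n")
    case True
    then have g: "gm_hull n u \<in> GM n" "gm_hull n u' \<in> GM n" "gm_hull n u \<le> gm_hull n u'"
      using u order_trans[OF u(3)] by (simp_all add: gm_hull_GM gm_hull_mono)
    obtain a where a: "a \<in> carrier (pobj A (gm_hull n u) i)" "t = V (gm_hull n u) i a"
        "t' = V (gm_hull n u') i (pmap A (gm_hull n u) (gm_hull n u') i a)"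
      using t True by (auto simp: PR_def)
    show ?thesis
      unfolding PR_def using u True a
      by (auto intro!: bexI[of _ "pdiff A (gm_hull n u) i a"]
          simp: dT_V[OF g(1)] dT_V[OF g(2)] mapD[OF g] diffD(1)[OF g(1)] diff_map[OF g])
  next
    case False
    then show ?thesis using t S additive_zero[OF additive_dT] by (simp add: PR_def)
  qed
qed

lemma PR_hull:
  assumes "PR u u' i t t'" "v \<in> MP" "v' \<in> MP" "v \<le> v'"
    and "\<And>s. s \<in> GM n \<Longrightarrow> u \<le> s \<longleftrightarrow> v \<le> s" "\<And>s. s \<in> GM n \<Longrightarrow> u' \<le> s \<longleftrightarrow> v' \<le> s"
  shows "PR v v' i t t'"
proof -
  have eq: "gm_hull n v = gm_hull n u" "gm_hull n v' = gm_hull n u'" using assms(5,6) gm_hull_cong by blast+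
  have top: "v \<le> gm_top n \<longleftrightarrow> u \<le> gm_top n" "v' \<le> gm_top n \<longleftrightarrow> u' \<le> gm_top n" using assms(5,6) by simp_all
  show ?thesis using assms(1-4) unfolding PR_def VS_def eq top by blast
qed

definition related :: "('r, 'a) related \<Rightarrow> bool" where
  "related xs \<longleftrightarrow> (\<forall>(u, u', i, t, t') \<in> set xs. PR u u' i t t')"

definition src :: "('r, 'a) related \<Rightarrow> ('r, 'a) tmod list" where
  "src xs = map (\<lambda>(u, u', i, t, t'). t) xs"
definition tgt :: "('r, 'a) related \<Rightarrow> ('r, 'a) tmod list" where
  "tgt xs = map (\<lambda>(u, u', i, t, t'). t') xs"

fun psrc :: "('r, 'a) related \<Rightarrow> perv" where
  "psrc [] = (\<lambda>i. 0)" | "psrc ((u, u', i, t, t') # xs) = psum u (psrc xs)"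
fun ptgt :: "('r, 'a) related \<Rightarrow> perv" where
  "ptgt [] = (\<lambda>i. 0)" | "ptgt ((u, u', i, t, t') # xs) = psum u' (ptgt xs)"
fun rdeg :: "('r, 'a) related \<Rightarrow> int" where
  "rdeg [] = 0" | "rdeg ((u, u', i, t, t') # xs) = (i - 1) + rdeg xs"

lemma psrc_append [simp]: "psrc (xs @ ys) = psum (psrc xs) (psrc ys)"
  by (induction xs rule: psrc.induct) (simp_all add: psum_assoc)
lemma ptgt_append [simp]: "ptgt (xs @ ys) = psum (ptgt xs) (ptgt ys)"
  by (induction xs rule: ptgt.induct) (simp_all add: psum_assoc)
lemma rdeg_append [simp]: "rdeg (xs @ ys) = rdeg xs + rdeg ys"
  by (induction xs rule: rdeg.induct) simp_all
lemma src_simps [simp]: "src [] = []" "src (x # xs) = fst (snd (snd (snd x))) # src xs" "src (xs @ ys) = src xs @ src ys"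
  by (simp_all add: src_def case_prod_beta)
lemma tgt_simps [simp]: "tgt [] = []" "tgt (x # xs) = snd (snd (snd (snd x))) # tgt xs" "tgt (xs @ ys) = tgt xs @ tgt ys"
  by (simp_all add: tgt_def case_prod_beta)
lemma related_simps [simp]: "related []" "related ((u, u', i, t, t') # xs) \<longleftrightarrow> PR u u' i t t' \<and> related xs"
  "related (xs @ ys) \<longleftrightarrow> related xs \<and> related ys"
  by (simp_all add: related_def ball_Un)

lemma related_MP:
  assumes "related xs" shows "psrc xs \<in> MP \<and> ptgt xs \<in> MP \<and> psrc xs \<le> ptgt xs"
  using assms by (induction xs rule: psrc.induct) (auto simp: PR_def psum_mono_perv psum_mono)

text \<open>The twist \<open>tw\<close> of the algebra, applied to both entries of each pair.\<close>

definition rtwist :: "int \<Rightarrow> ('r, 'a) related \<Rightarrow> ('r, 'a) related" where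
  "rtwist e xs = (if even e then xs else map (\<lambda>(u, u', i, t, t'). (u, u', i, dga.tau t, dga.tau t')) xs)"

lemma rtwist_simps [simp]: "psrc (rtwist e xs) = psrc xs" "ptgt (rtwist e xs) = ptgt xs" "rdeg (rtwist e xs) = rdeg xs"
  "src (rtwist e xs) = dga.tw e (src xs)" "tgt (rtwist e xs) = dga.tw e (tgt xs)"
  by (induction xs rule: psrc.induct) (simp_all add: rtwist_def dga.tw_def split: if_splits)

lemma related_rtwist [simp]: "related xs \<Longrightarrow> related (rtwist e xs)"
  by (induction xs rule: psrc.induct) (simp_all add: rtwist_def PR_tau split: if_splits)

text \<open>\<open>F\<close> has degree \<open>m\<close> and perversity \<open>r\<close>, \<open>F'\<close> has degree \<open>m\<close> and perversity \<open>r'\<close>, and the structure maps carry the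
values of \<open>F\<close> to those of \<open>F'\<close>. With \<open>r = r'\<close> and \<open>F = F'\<close> this is compatibility of one cochain with the structure
maps; with \<open>r \<le> r'\<close> it says that \<open>F'\<close> is the image of \<open>F\<close> in perversity \<open>r'\<close>.\<close>

definition natural :: "perv \<Rightarrow> perv \<Rightarrow> int \<Rightarrow> (('r, 'a) tmod list \<Rightarrow> ('r, 'a) tmod)
    \<Rightarrow> (('r, 'a) tmod list \<Rightarrow> ('r, 'a) tmod) \<Rightarrow> bool" where
  "natural r r' m F F' \<longleftrightarrow> r \<in> MP \<and> r' \<in> MP \<and> r \<le> r' \<and>
     (\<forall>xs. related xs \<longrightarrow> PR (psum (psrc xs) r) (psum (ptgt xs) r') (rdeg xs + m) (F (src xs)) (F' (tgt xs)))"

lemma naturalD: "natural r r' m F F' \<Longrightarrow> related xs \<Longrightarrow>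
   PR (psum (psrc xs) r) (psum (ptgt xs) r') (rdeg xs + m) (F (src xs)) (F' (tgt xs))"
  by (simp add: natural_def)

lemma naturalI:
  assumes "r \<in> MP" "r' \<in> MP" "r \<le> r'"
    and "\<And>xs. related xs \<Longrightarrow> PR (psum (psrc xs) r) (psum (ptgt xs) r') (rdeg xs + m) (F (src xs)) (F' (tgt xs))"
  shows "natural r r' m F F'"
  using assms by (simp add: natural_def)

lemma natural_MP: "natural r r' m F F' \<Longrightarrow> r \<in> MP \<and> r' \<in> MP \<and> r \<le> r'"
  by (simp add: natural_def)

lemma natural_PR_MP:
  assumes "related xs" "r \<in> MP" "r' \<in> MP" "r \<le> r'"
  shows "psum (psrc xs) r \<in> MP" "psum (ptgt xs) r' \<in> MP" "psum (psrc xs) r \<le> psum (ptgt xs) r'"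
  using related_MP[OF assms(1)] assms(2-) by (simp_all add: psum_mono_perv psum_mono)

lemma PR_cong: "PR u u' i t t' \<Longrightarrow> u = v \<Longrightarrow> u' = v' \<Longrightarrow> i = j \<Longrightarrow> PR v v' j t t'" by simp

lemma deconc_src: "deconc (src xs) F = deconc xs (\<lambda>x y. F (src x) (src y))"
  and deconc_tgt: "deconc (tgt xs) F = deconc xs (\<lambda>x y. F (tgt x) (tgt y))"
  by (simp_all add: src_def tgt_def deconc_map)

lemma natural_cup:
  assumes F: "natural r r' m F F'" and G: "natural s s' l G G'"
  shows "natural (psum r s) (psum r' s') (m + l) (dga.cup l F G) (dga.cup l F' G')"
proof (rule naturalI)
  show MP: "psum r s \<in> MP" "psum r' s' \<in> MP" "psum r s \<le> psum r' s'"
    using natural_MP[OF F] natural_MP[OF G] by (simp_all add: psum_mono_perv psum_mono)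
  fix xs assume xs: "related xs"
  show "PR (psum (psrc xs) (psum r s)) (psum (ptgt xs) (psum r' s')) (rdeg xs + (m + l))
    (dga.cup l F G (src xs)) (dga.cup l F' G' (tgt xs))"
    unfolding dga.cup_def deconc_src deconc_tgt
  proof (rule PR_deconc)
    fix x y assume "x @ y = xs"
    with xs have x: "related x" and y: "related y" and e: "xs = x @ y" by auto
    show "PR (psum (psrc xs) (psum r s)) (psum (ptgt xs) (psum r' s')) (rdeg xs + (m + l))
      (mulT (F (dga.tw l (src x))) (G (src y))) (mulT (F' (dga.tw l (tgt x))) (G' (tgt y)))"
      using PR_mulT[OF naturalD[OF F related_rtwist[OF x, of l]] naturalD[OF G y]]
      unfolding rtwist_simps by (rule PR_cong) (simp_all add: e psum_ac)
  qed (use natural_PR_MP[OF xs MP] in simp_all)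
qed

lemma natural_insert:
  assumes F: "natural r r' m F F'" and G: "natural s s' l G G'" and x: "related x" "related y" "related z"
  shows "related (x @ (psum (psrc y) s, psum (ptgt y) s', rdeg y + l, G (src y), G' (tgt y)) # z)"
  using naturalD[OF G x(2)] x by simp

lemma natural_circ:
  assumes F: "natural r r' m F F'" and G: "natural s s' l G G'"
  shows "natural (psum r s) (psum r' s') (m + l - 1) (dga.circ l F G) (dga.circ l F' G')"
proof (rule naturalI)
  show MP: "psum r s \<in> MP" "psum r' s' \<in> MP" "psum r s \<le> psum r' s'"
    using natural_MP[OF F] natural_MP[OF G] by (simp_all add: psum_mono_perv psum_mono)
  fix xs assume xs: "related xs"
  show "PR (psum (psrc xs) (psum r s)) (psum (ptgt xs) (psum r' s')) (rdeg xs + (m + l - 1))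
    (dga.circ l F G (src xs)) (dga.circ l F' G' (tgt xs))"
    unfolding dga.circ_def deconc_src deconc_tgt
  proof (intro PR_deconc)
    fix x w y z assume "x @ w = xs" "y @ z = w"
    with xs have x: "related x" and y: "related y" and z: "related z" and e: "xs = x @ y @ z" by auto
    show "PR (psum (psrc xs) (psum r s)) (psum (ptgt xs) (psum r' s')) (rdeg xs + (m + l - 1))
      (F (dga.tw (l - 1) (src x) @ G (src y) # src z)) (F' (dga.tw (l - 1) (tgt x) @ G' (tgt y) # tgt z))"
      using naturalD[OF F natural_insert[OF F G related_rtwist[OF x, of "l - 1"] y z]]
      unfolding src_simps tgt_simps rtwist_simps fst_conv snd_conv
      by (rule PR_cong) (simp_all add: e psum_ac)
  qed (use natural_PR_MP[OF xs MP] in simp_all)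
qed

lemma natural_brace:
  assumes F: "natural r r' m F F'" and G: "natural s s' l G G'" and H: "natural q q' k H H'"
  shows "natural (psum r (psum s q)) (psum r' (psum s' q')) (m + l + k - 2) (dga.brace l k F G H) (dga.brace l k F' G' H')"
proof (rule naturalI)
  show MP: "psum r (psum s q) \<in> MP" "psum r' (psum s' q') \<in> MP" "psum r (psum s q) \<le> psum r' (psum s' q')"
    using natural_MP[OF F] natural_MP[OF G] natural_MP[OF H] by (simp_all add: psum_mono_perv psum_mono)
  fix xs assume xs: "related xs"
  show "PR (psum (psrc xs) (psum r (psum s q))) (psum (ptgt xs) (psum r' (psum s' q'))) (rdeg xs + (m + l + k - 2))
    (dga.brace l k F G H (src xs)) (dga.brace l k F' G' H' (tgt xs))"
    unfolding dga.brace_def deconc_src deconc_tgt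
  proof (intro PR_deconc)
    fix x w y w' z w'' u v assume "x @ w = xs" "y @ w' = w" "z @ w'' = w'" "u @ v = w''"
    with xs have x: "related x" and y: "related y" and z: "related z" and u: "related u" and v: "related v"
      and e: "xs = x @ y @ z @ u @ v" by auto
    let ?g = "(psum (psrc (rtwist (k - 1) y)) s, psum (ptgt (rtwist (k - 1) y)) s', rdeg (rtwist (k - 1) y) + l,
      G (src (rtwist (k - 1) y)), G' (tgt (rtwist (k - 1) y)))"
    let ?h = "(psum (psrc u) q, psum (ptgt u) q', rdeg u + k, H (src u), H' (tgt u))"
    have "related (rtwist (l + k) x @ ?g # rtwist (k - 1) z @ ?h # v)"
      using natural_insert[OF F G related_rtwist[OF x] related_rtwist[OF y, of "k - 1"] related_rtwist[OF z]]
        natural_insert[OF F H related_rtwist[OF x] u v] related_rtwist[OF x] related_rtwist[OF z] by simp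
    from naturalD[OF F this]
    show "PR (psum (psrc xs) (psum r (psum s q))) (psum (ptgt xs) (psum r' (psum s' q'))) (rdeg xs + (m + l + k - 2))
      (F (dga.tw (l + k) (src x) @ G (dga.tw (k - 1) (src y)) # dga.tw (k - 1) (src z) @ H (src u) # src v))
      (F' (dga.tw (l + k) (tgt x) @ G' (dga.tw (k - 1) (tgt y)) # dga.tw (k - 1) (tgt z) @ H' (tgt u) # tgt v))"
      unfolding src_simps tgt_simps rtwist_simps fst_conv snd_conv
      by (rule PR_cong) (simp_all add: e psum_ac)
  qed (use natural_PR_MP[OF xs MP] in simp_all)
qed

lemma natural_mm: "natural gm_zero gm_zero 2 dga.mm dga.mm"
proof (rule naturalI)
  show MP: "gm_zero \<in> MP" "gm_zero \<in> MP" "gm_zero \<le> gm_zero" by (simp_all add: GM_mono_perv)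
  fix xs assume xs: "related xs"
  consider "xs = []" | u u' i t t' where "xs = [(u, u', i, t, t')]"
    | u u' i t t' v v' j x x' where "xs = [(u, u', i, t, t'), (v, v', j, x, x')]" | "length xs \<ge> 3"
    by (cases xs rule: psrc.cases; cases "tl xs" rule: psrc.cases; cases "tl (tl xs)") auto
  then show "PR (psum (psrc xs) gm_zero) (psum (ptgt xs) gm_zero) (rdeg xs + 2) (dga.mm (src xs)) (dga.mm (tgt xs))"
  proof cases
    case 2
    then have "PR u u' i t t'" using xs by simp
    from PR_dT[OF this] 2 show ?thesis by (simp add: psum_gm_zero add.commute)
  next
    case 3
    then have 1: "PR u u' i t t'" and 2: "PR v v' j x x'" using xs by auto
    have "mulT (sT t) x = - mulT (dga.tau t) x" "mulT (sT t') x' = - mulT (dga.tau t') x'"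
      by (simp_all add: dga.tau_def dga.mul_minus)
    then show ?thesis using PR_minus[OF PR_mulT[OF PR_tau[OF 1] 2]] 3 by (simp add: psum_gm_zero)
  next
    case 4
    then have "length (src xs) \<ge> 3" "length (tgt xs) \<ge> 3" by (simp_all add: src_def tgt_def)
    then have "dga.mm (src xs) = 0" "dga.mm (tgt xs) = 0" by (simp_all add: dga.mm_long)
    then show ?thesis using PR_zero[OF natural_PR_MP[OF xs MP]] by simp
  qed (use PR_zero[OF MP] in \<open>simp add: psum_gm_zero\<close>)
qed

lemma natural_add:
  assumes "natural r r' m F F'" "natural r r' m G G'"
  shows "natural r r' m (\<lambda>w. F w + G w) (\<lambda>w. F' w + G' w)"
  using natural_MP[OF assms(1)] naturalD[OF assms(1)] naturalD[OF assms(2)]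
  by (intro naturalI PR_add natural_PR_MP) auto

lemma natural_minus: "natural r r' m F F' \<Longrightarrow> natural r r' m (\<lambda>w. - F w) (\<lambda>w. - F' w)"
  by (simp add: natural_def PR_minus)
lemma natural_sg: "natural r r' m F F' \<Longrightarrow> natural r r' m (\<lambda>w. sg e (F w)) (\<lambda>w. sg e (F' w))"
  by (simp add: natural_def PR_sg)
lemma natural_sc: "c \<in> carrier R \<Longrightarrow> natural r r' m F F' \<Longrightarrow> natural r r' m (\<lambda>w. sc c (F w)) (\<lambda>w. sc c (F' w))"
  by (simp add: natural_def PR_sc)

text \<open>The operations produce the perversity \<open>r + s\<close>; only afterwards is it replaced by its hull \<open>r \<oplus> s\<close>.\<close>

lemma natural_hull:
  assumes "natural r r' m F F'" "r' \<le> gm_top n"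
  shows "natural (gm_hull n r) (gm_hull n r') m F F'"
proof (rule naturalI)
  have r: "r \<in> MP" "r' \<in> MP" "r \<le> r'" using natural_MP[OF assms(1)] by auto
  have top: "r \<le> gm_top n" using r(3) assms(2) by (rule order_trans)
  show MP: "gm_hull n r \<in> MP" "gm_hull n r' \<in> MP" "gm_hull n r \<le> gm_hull n r'"
    using r top assms(2) by (simp_all add: gm_hull_GM GM_mono_perv gm_hull_mono)
  fix xs assume xs: "related xs"
  show "PR (psum (psrc xs) (gm_hull n r)) (psum (ptgt xs) (gm_hull n r')) (rdeg xs + m) (F (src xs)) (F' (tgt xs))"
    using naturalD[OF assms(1) xs]
    by (rule PR_hull)
       (use natural_PR_MP[OF xs MP] related_MP[OF xs] r top assms(2) in
         \<open>simp_all add: psum_commute[of "psrc xs"] psum_commute[of "ptgt xs"] gm_hull_psum_le_iff\<close>)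
qed

section \<open>Word cochains\<close>

abbreviation valid where "valid \<equiv> vword A n"

lemma valid_simps [simp]: "valid []" "valid ((p, i, a) # w) \<longleftrightarrow> p \<in> GM n \<and> a \<in> carrier (pobj A p i) \<and> valid w"
  "valid (x @ y) \<longleftrightarrow> valid x \<and> valid y"
  by (simp_all add: vword_def ball_Un)

definition VW :: "'a pword \<Rightarrow> ('r, 'a) tmod list" where
  "VW w = map (\<lambda>(p, i, a). V p i a) w"

lemma VW_simps [simp]: "VW [] = []" "VW (x # w) = V (fst x) (fst (snd x)) (snd (snd x)) # VW w" "VW (w @ v) = VW w @ VW v"
  by (simp_all add: VW_def case_prod_beta)

lemma word_deg_simps [simp]: "word_deg [] = 0" "word_deg (x # w) = fst (snd x) - 1 + word_deg w"
  "word_deg (w @ v) = word_deg w + word_deg v"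
  by (simp_all add: word_deg_def case_prod_beta)

definition cl_invariant :: "(('r, 'a) tmod list \<Rightarrow> 'b) \<Rightarrow> bool" where
  "cl_invariant F \<longleftrightarrow> (\<forall>x a z. F (x @ cl a # z) = F (x @ a # z))"

text \<open>The letters are replaced by homogeneous ones from left to right.\<close>

lemma multiadditive_eqI:
  assumes F: "multiadditive F" "cl_invariant F" and G: "multiadditive G" "cl_invariant G"
    and eq: "\<And>w. valid w \<Longrightarrow> F (VW w) = G (VW w)"
  shows "F = G"
proof
  fix ts
  have "\<forall>w. valid w \<longrightarrow> F (VW w @ ts) = G (VW w @ ts)"
  proof (induction ts)
    case Nil
    then show ?case using eq by simp
  next
    case (Cons t ts)
    show ?case
    proof (intro allI impI)
      fix w assume w: "valid w"
      have "F (VW w @ cl t # ts) = G (VW w @ cl t # ts)"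
      proof (rule additive_eq_cl[where f = "\<lambda>a. F (VW w @ a # ts)" and g = "\<lambda>a. G (VW w @ a # ts)"])
        fix p i a assume "p \<in> GM n" "a \<in> carrier (pobj A p i)"
        then have "valid (w @ [(p, i, a)])" using w by simp
        with Cons.IH have "F (VW (w @ [(p, i, a)]) @ ts) = G (VW (w @ [(p, i, a)]) @ ts)" by blast
        then show "F (VW w @ V p i a # ts) = G (VW w @ V p i a # ts)" by simp
      qed (use F G in \<open>simp_all add: multiadditive_def\<close>)
      then show "F (VW w @ t # ts) = G (VW w @ t # ts)"
        using F(2) G(2) by (simp add: cl_invariant_def)
    qed
  qed
  from this[rule_format, of "[]"] show "F ts = G ts" by simp
qed

lemma scalar_sc:
  assumes c: "c \<in> carrier R" shows "dga.scalar (sc c)"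
proof -
  note sc = additive_sc[OF c] sc_cl[OF c] sc_V[OF c]
  have cA: "p \<in> GM n \<Longrightarrow> a \<in> carrier (pobj A p i) \<Longrightarrow> c \<odot>\<^bsub>pobj A p i\<^esub> a \<in> carrier (pobj A p i)" for p i a
    using A_closed(4) c by blast
  have d: "dT (sc c t) = sc c (dT t)" for t
    by (rule additive_eqI[where f = "\<lambda>t. dT (sc c t)" and g = "\<lambda>t. sc c (dT t)"])
       (simp_all add: additive_compose additive_dT sc dT_cl dT_V cA diffD c)
  have s: "sT (sc c t) = sc c (sT t)" for t
    by (rule additive_eqI[where f = "\<lambda>t. sT (sc c t)" and g = "\<lambda>t. sc c (sT t)"])
       (simp_all add: additive_compose additive_sT sc cA sT_V additive_sg[OF sc(1)] cl_sT[symmetric])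
  have l: "mulT (sc c t) u = sc c (mulT t u)" for t u
  proof (rule additive_eqI[where f = "\<lambda>t. mulT (sc c t) u" and g = "\<lambda>t. sc c (mulT t u)"])
    fix p i a assume a: "p \<in> GM n" "a \<in> carrier (pobj A p i)"
    show "mulT (sc c (V p i a)) u = sc c (mulT (V p i a) u)"
    proof (rule additive_eqI[where f = "mulT (sc c (V p i a))" and g = "\<lambda>u. sc c (mulT (V p i a) u)"])
      fix q j b assume b: "q \<in> GM n" "b \<in> carrier (pobj A q j)"
      show "mulT (sc c (V p i a)) (V q j b) = sc c (mulT (V p i a) (V q j b))"
        using a b lin_mapsD(3)[OF mulD(2)[OF a(1) b(1) _ b(2)] c a(2)] mul_closed[OF a(1) b(1) _ a(2) b(2)]
          gm_add_GM[OF a(1) b(1)] additive_zero[OF sc(1)]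
        by (auto simp: sc cA mulT_V)
    qed (simp_all add: additive_compose[OF sc(1) additive_mulT_right] additive_mulT_right mulT_cl_right)
  qed (simp_all add: additive_compose[OF sc(1) additive_mulT_left] additive_compose[OF additive_mulT_left sc(1)]
      mulT_cl_left sc)
  have r: "mulT t (sc c u) = sc c (mulT t u)" for t u
  proof (rule additive_eqI[where f = "\<lambda>t. mulT t (sc c u)" and g = "\<lambda>t. sc c (mulT t u)"])
    fix p i a assume a: "p \<in> GM n" "a \<in> carrier (pobj A p i)"
    show "mulT (V p i a) (sc c u) = sc c (mulT (V p i a) u)"
    proof (rule additive_eqI[where f = "\<lambda>u. mulT (V p i a) (sc c u)" and g = "\<lambda>u. sc c (mulT (V p i a) u)"])
      fix q j b assume b: "q \<in> GM n" "b \<in> carrier (pobj A q j)"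
      show "mulT (V p i a) (sc c (V q j b)) = sc c (mulT (V p i a) (V q j b))"
        using a b lin_mapsD(3)[OF mulD(1)[OF a(1) b(1) _ a(2)] c b(2)] mul_closed[OF a(1) b(1) _ a(2) b(2)]
          gm_add_GM[OF a(1) b(1)] additive_zero[OF sc(1)]
        by (auto simp: sc cA mulT_V)
    qed (simp_all add: additive_compose[OF sc(1) additive_mulT_right] additive_compose[OF additive_mulT_right sc(1)]
        mulT_cl_right sc)
  qed (simp_all add: additive_compose[OF sc(1) additive_mulT_left] additive_mulT_left mulT_cl_left)
  show ?thesis unfolding dga.scalar_def using sc(1) d s l r by simp
qed

lemma scalar_cl: "dga.scalar cl"
  using scalar_sc[OF one_R] by (simp add: sc_one)

text \<open>\<open>R\<close>-multilinear functions with values in the direct sum of the modules of \<open>A\<close>. Homogeneity for \<open>1\<close> makes them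
independent of the components of a letter outside this sum.\<close>

definition linear_fun :: "(('r, 'a) tmod list \<Rightarrow> ('r, 'a) tmod) \<Rightarrow> bool" where
  "linear_fun F \<longleftrightarrow> multiadditive F \<and> (\<forall>c\<in>carrier R. dga.homogeneous (sc c) F) \<and> (\<forall>w. cl (F w) = F w)"

lemma linear_funD:
  assumes "linear_fun F"
  shows "multiadditive F" "c \<in> carrier R \<Longrightarrow> dga.homogeneous (sc c) F" "cl (F w) = F w" "cl_invariant F"
proof -
  show "multiadditive F" "c \<in> carrier R \<Longrightarrow> dga.homogeneous (sc c) F" "cl (F w) = F w"
    using assms by (simp_all add: linear_fun_def)
  have "dga.homogeneous cl F" using assms one_R unfolding linear_fun_def sc_one[symmetric] by blast
  then show "cl_invariant F" using assms by (simp add: cl_invariant_def linear_fun_def dga.homogeneous_def)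
qed

lemma cl_dT: "cl (dT t) = dT t"
  using scalar_cl dT_cl by (simp add: dga.scalar_def)

lemma cl_mulT: "cl (mulT t u) = mulT t u"
  using scalar_cl mulT_cl_left[of t u] by (simp add: dga.scalar_def)

lemma linear_cup: "linear_fun F \<Longrightarrow> linear_fun G \<Longrightarrow> linear_fun (dga.cup l F G)"
  unfolding linear_fun_def
  by (intro conjI ballI allI dga.multiadditive_cup dga.homogeneous_cup scalar_sc)
     (simp_all add: dga.cup_def dga.scalar_deconc2[OF scalar_cl] cl_mulT)

lemma linear_circ: "linear_fun F \<Longrightarrow> linear_fun G \<Longrightarrow> linear_fun (dga.circ l F G)"
  unfolding linear_fun_def
  by (intro conjI ballI allI dga.multiadditive_circ dga.homogeneous_circ scalar_sc)
     (simp_all add: dga.circ_def dga.scalar_deconc2[OF scalar_cl])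

lemma linear_brace: "linear_fun F \<Longrightarrow> linear_fun G \<Longrightarrow> linear_fun H \<Longrightarrow> linear_fun (dga.brace l k F G H)"
  unfolding linear_fun_def
  by (intro conjI ballI allI dga.multiadditive_brace dga.homogeneous_brace scalar_sc)
     (simp_all add: dga.brace_def dga.scalar_deconc2[OF scalar_cl])

lemma linear_mm: "linear_fun dga.mm"
  unfolding linear_fun_def
  using dga.multiadditive_mm dga.homogeneous_mm[OF scalar_sc] additive_zero[OF additive_cl]
  by (auto simp: dga.mm_def cl_dT cl_mulT split: list.split)

lemma linear_add: "linear_fun F \<Longrightarrow> linear_fun G \<Longrightarrow> linear_fun (\<lambda>w. F w + G w)"
  by (simp add: linear_fun_def dga.multiadditive_plus additiveD[OF additive_cl] dga.homogeneous_def
      additiveD[OF additive_sc])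

lemma linear_minus: "linear_fun F \<Longrightarrow> linear_fun (\<lambda>w. - F w)"
  by (simp add: linear_fun_def dga.multiadditive_minus additive_minus[OF additive_cl] dga.homogeneous_def
      additive_minus[OF additive_sc])

lemma linear_sg: "linear_fun F \<Longrightarrow> linear_fun (\<lambda>w. sg e (F w))"
  by (cases "even e") (simp_all add: linear_minus)

lemma sc_sc: "c \<in> carrier R \<Longrightarrow> b \<in> carrier R \<Longrightarrow> sc b (sc c t) = sc (b \<otimes>\<^bsub>R\<^esub> c) t"
proof (rule additive_eqI[where f = "\<lambda>t. sc b (sc c t)" and g = "sc (b \<otimes>\<^bsub>R\<^esub> c)"])
  assume c: "c \<in> carrier R" and b: "b \<in> carrier R"
  have bc: "b \<otimes>\<^bsub>R\<^esub> c \<in> carrier R" using cring.cring_simprules(5)[OF cring b c] .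
  show "additive (\<lambda>t. sc b (sc c t))" "additive (sc (b \<otimes>\<^bsub>R\<^esub> c))"
    by (simp_all add: additive_compose additive_sc b c bc)
  show "sc b (sc c (cl t)) = sc b (sc c t)" "sc (b \<otimes>\<^bsub>R\<^esub> c) (cl t) = sc (b \<otimes>\<^bsub>R\<^esub> c) t" for t
    by (simp_all add: sc_cl c bc)
  fix p i a assume a: "p \<in> GM n" "a \<in> carrier (pobj A p i)"
  show "sc b (sc c (V p i a)) = sc (b \<otimes>\<^bsub>R\<^esub> c) (V p i a)"
    using module.smult_assoc1[OF mod_A[OF a(1)] b c a(2)] a b c bc A_closed(4)[OF a(1) c a(2)]
    by (simp add: sc_V)
qed

lemma linear_sc:
  assumes c: "c \<in> carrier R" and F: "linear_fun F"
  shows "linear_fun (\<lambda>w. sc c (F w))"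
  unfolding linear_fun_def
proof (intro conjI ballI allI)
  show "multiadditive (\<lambda>w. sc c (F w))"
    using F by (intro multiadditiveI) (simp add: multi_add linear_funD additiveD[OF additive_sc[OF c]])
  show "dga.homogeneous (sc b) (\<lambda>w. sc c (F w))" if b: "b \<in> carrier R" for b
    unfolding dga.homogeneous_def
    by (simp add: dga.homogeneousD[OF linear_funD(2)[OF F b]] sc_sc b c cring.cring_simprules(14)[OF cring b c])
  show "cl (sc c (F w)) = sc c (F w)" for w
    using sc_sc[OF c one_R, of "F w"] cring.cring_simprules(12)[OF cring c] by (simp add: sc_one)
qed

text \<open>Word cochains of perversity \<open>r\<close> and degree \<open>m\<close>.\<close>

definition wc :: "perv \<Rightarrow> int \<Rightarrow> (('r, 'a) tmod list \<Rightarrow> ('r, 'a) tmod) \<Rightarrow> bool" where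
  "wc r m F \<longleftrightarrow> linear_fun F \<and> natural r r m F F"

text \<open>On homogeneous letters the twist is the Koszul sign of the Hochschild formulas.\<close>

lemma tw_V:
  assumes "multiadditive F"
  shows "F (y @ dga.tw e (VW w) @ z) = sg (e * word_deg w) (F (y @ VW w @ z))"
proof (induction w arbitrary: y)
  case (Cons x w)
  obtain p i a where x: "x = (p, i, a)" by (cases x)
  have "dga.tau (V p i a) = sg (i - 1) (V p i a)" by (simp add: dga.tau_def sT_V sg_def)
  then have "F (y @ dga.tw e (VW (x # w)) @ z) = F (y @ sg (e * (i - 1)) (V p i a) # (dga.tw e (VW w) @ z))"
    by (cases "even e") (simp_all add: x dga.tw_Cons sg_def)
  also have "\<dots> = sg (e * (i - 1)) (F (y @ V p i a # (dga.tw e (VW w) @ z)))"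
    using additive_sg[OF multiadditiveD[OF assms]] by fast
  also have "\<dots> = sg (e * (i - 1)) (sg (e * word_deg w) (F (y @ VW (x # w) @ z)))"
    using Cons.IH[of "y @ [V p i a]"] by (simp add: x)
  also have "\<dots> = sg (e * word_deg (x # w)) (F (y @ VW (x # w) @ z))"
    by (cases "even e"; cases "even i"; cases "even (word_deg w)") (simp_all add: x)
  finally show ?case .
qed (simp add: dga.tw_def)

definition rword :: "'a pword \<Rightarrow> ('r, 'a) related" where
  "rword w = map (\<lambda>(p, i, a). (p, p, i, V p i a, V p i a)) w"

definition sumperv :: "'a pword \<Rightarrow> perv" where
  "sumperv w = psum_list (map fst w)"

lemma sumperv_simps [simp]: "sumperv [] = (\<lambda>i. 0)" "sumperv (x # w) = psum (fst x) (sumperv w)"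
  "sumperv (w @ v) = psum (sumperv w) (sumperv v)"
  by (simp_all add: sumperv_def psum_list_def psum_def fun_eq_iff)

lemma rword_simps [simp]: "src (rword w) = VW w" "tgt (rword w) = VW w" "psrc (rword w) = sumperv w"
  "ptgt (rword w) = sumperv w" "rdeg (rword w) = word_deg w"
  by (induction w) (auto simp: rword_def)

lemma related_rword: "valid w \<Longrightarrow> related (rword w)"
proof (induction w)
  case (Cons x w)
  obtain p i a where x: "x = (p, i, a)" by (cases x)
  then have a: "p \<in> GM n" "a \<in> carrier (pobj A p i)" "valid w" using Cons.prems by auto
  then have "PR p p i (V p i a) (V p i a)" using PR_V[of p p a i] map_id[of p a i] by simp
  then show ?case using Cons.IH a by (simp add: rword_def x)
qed (simp add: rword_def)

lemma sumperv_MP: "valid w \<Longrightarrow> sumperv w \<in> MP"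
  using related_MP[OF related_rword] by fastforce

lemma wc_VS: "wc r m F \<Longrightarrow> valid w \<Longrightarrow> VS (psum (sumperv w) r) (word_deg w + m) (F (VW w))"
  using PR_VS(1)[OF naturalD[OF _ related_rword]] by (fastforce simp: wc_def)

lemma wc_MP: "wc r m F \<Longrightarrow> r \<in> MP"
  using natural_MP by (auto simp: wc_def)

lemma cl_invariant_tau:
  assumes "cl_invariant F" shows "cl_invariant (\<lambda>w. h (F (map dga.tau w)))"
proof -
  have "dga.tau (cl a) = cl (dga.tau a)" for a
    using dga.scalar_tau[OF scalar_cl] by simp
  then show ?thesis using assms by (simp add: cl_invariant_def)
qed

text \<open>The values on homogeneous words are homogeneous, of a degree that determines the parity; multiadditivity extends
this to all words.\<close>

lemma wc_parity:
  assumes F: "wc r m F" shows "dga.parity m F"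
proof -
  have L: "multiadditive F" "cl_invariant F" using F linear_funD by (auto simp: wc_def)
  have "(\<lambda>w. sT (F w)) = (\<lambda>w. sg m (F (map dga.tau w)))"
  proof (rule multiadditive_eqI)
    show "multiadditive (\<lambda>w. sT (F w))"
      using L(1) by (intro multiadditiveI) (simp add: multi_add additiveD[OF additive_sT])
    show "multiadditive (\<lambda>w. sg m (F (map dga.tau w)))"
      using L(1) by (intro multiadditiveI) (simp add: multi_add additiveD[OF dga.additive_tau] sg_add)
    show "cl_invariant (\<lambda>w. sT (F w))" using L(2) by (simp add: cl_invariant_def)
    show "cl_invariant (\<lambda>w. sg m (F (map dga.tau w)))" by (rule cl_invariant_tau[OF L(2)])
    fix w assume w: "valid w"
    have "F (map dga.tau (VW w)) = sg (word_deg w) (F (VW w))"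
      using tw_V[OF L(1), of "[]" 1 w "[]"] by simp
    moreover have "sT (F (VW w)) = sg (word_deg w + m) (F (VW w))"
      using VS_sT[OF _ wc_VS[OF F w]] sumperv_MP[OF w] wc_MP[OF F] by (simp add: psum_mono_perv)
    ultimately show "sT (F (VW w)) = sg m (F (map dga.tau (VW w)))"
      by (cases "even m"; cases "even (word_deg w)") simp_all
  qed
  then show ?thesis by (simp add: dga.parity_def fun_eq_iff)
qed

lemma wc_linear: "wc r m F \<Longrightarrow> linear_fun F" by (simp add: wc_def)
lemma wc_multi: "wc r m F \<Longrightarrow> multiadditive F" using linear_funD wc_linear by blast

lemma wc_cup:
  assumes "wc r m F" "wc s l G" "psum r s \<le> gm_top n"
  shows "wc (gm_add n r s) (m + l) (dga.cup l F G)"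
  using assms natural_hull[OF natural_cup _] by (simp add: wc_def linear_cup gm_add_def)

lemma wc_circ:
  assumes "wc r m F" "wc s l G" "psum r s \<le> gm_top n"
  shows "wc (gm_add n r s) (m + l - 1) (dga.circ l F G)"
  using assms natural_hull[OF natural_circ _] by (simp add: wc_def linear_circ gm_add_def)

lemma wc_brace:
  assumes "wc r m F" "wc s l G" "wc q k H" "psum r (psum s q) \<le> gm_top n"
  shows "wc (gm_hull n (psum r (psum s q))) (m + l + k - 2) (dga.brace l k F G H)"
  using assms natural_hull[OF natural_brace _] by (simp add: wc_def linear_brace)

lemma wc_mm: "wc gm_zero 2 dga.mm"
  by (simp add: wc_def linear_mm natural_mm)

lemma wc_add: "wc r m F \<Longrightarrow> wc r m G \<Longrightarrow> wc r m (\<lambda>w. F w + G w)"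
  by (simp add: wc_def linear_add natural_add)
lemma wc_minus: "wc r m F \<Longrightarrow> wc r m (\<lambda>w. - F w)"
  by (simp add: wc_def linear_minus natural_minus)
lemma wc_sg: "wc r m F \<Longrightarrow> wc r m (\<lambda>w. sg e (F w))"
  by (simp add: wc_def linear_sg natural_sg)
lemma wc_sc: "c \<in> carrier R \<Longrightarrow> wc r m F \<Longrightarrow> wc r m (\<lambda>w. sc c (F w))"
  by (simp add: wc_def linear_sc natural_sc)

lemma wc_zero: "r \<in> MP \<Longrightarrow> wc r m (\<lambda>w. 0)"
  using additive_zero[OF additive_cl] additive_zero[OF additive_sc]
  by (simp add: wc_def linear_fun_def multiadditive_def additive_def dga.homogeneous_def natural_def PR_zero natural_PR_MP)

lemma wc_D:
  assumes F: "wc r m F" and r: "r \<in> GM n"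
  shows "wc r (m + 1) (dga.D m F)"
  unfolding dga.D_alt
  using wc_circ[OF wc_mm F] wc_circ[OF F wc_mm] r
  by (intro wc_add wc_minus wc_sg) (simp_all add: psum_gm_zero GM_le_top gm_add_zero algebra_simps)

lemma wc_brk:
  assumes F: "wc r m F" and G: "wc s l G" and le: "psum r s \<le> gm_top n"
  shows "wc (gm_add n r s) (m + l - 1) (dga.brk m l F G)"
proof -
  have "wc (gm_add n r s) (m + l - 1) (dga.circ m G F)"
    using wc_circ[OF G F] le by (simp add: psum_commute gm_add_def add.commute)
  then show ?thesis unfolding dga.brk_alt by (intro wc_add wc_minus wc_sg wc_circ F G le)
qed

text \<open>The normalised word cochains; \<open>Phi\<close> and \<open>iPhi\<close> below identify them with the reduced Hochschild cochains.\<close>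

definition HCT :: "perv \<Rightarrow> int \<Rightarrow> (('r, 'a) tmod list \<Rightarrow> ('r, 'a) tmod) set" where
  "HCT r m = {F. wc r m F \<and> dga.normal F}"

lemma HCT_D: "F \<in> HCT r m \<Longrightarrow> r \<in> GM n \<Longrightarrow> dga.D m F \<in> HCT r (m + 1)"
  using linear_funD[OF wc_linear]
  by (auto simp: HCT_def wc_D cl_invariant_def intro!: dga.normal_D wc_multi wc_parity)

lemma HCT_cup: "F \<in> HCT r m \<Longrightarrow> G \<in> HCT s l \<Longrightarrow> psum r s \<le> gm_top n \<Longrightarrow> dga.cup l F G \<in> HCT (gm_add n r s) (m + l)"
  by (auto simp: HCT_def wc_cup intro!: dga.normal_cup wc_multi)

lemma HCT_circ: "F \<in> HCT r m \<Longrightarrow> G \<in> HCT s l \<Longrightarrow> psum r s \<le> gm_top n \<Longrightarrow> dga.circ l F G \<in> HCT (gm_add n r s) (m + l - 1)"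
  by (auto simp: HCT_def wc_circ intro!: dga.normal_circ wc_multi)

lemma HCT_brace: "F \<in> HCT r m \<Longrightarrow> G \<in> HCT s l \<Longrightarrow> H \<in> HCT q k \<Longrightarrow> psum r (psum s q) \<le> gm_top n \<Longrightarrow>
    dga.brace l k F G H \<in> HCT (gm_hull n (psum r (psum s q))) (m + l + k - 2)"
  by (auto simp: HCT_def wc_brace intro!: dga.normal_brace wc_multi)

lemma HCT_add: "F \<in> HCT r m \<Longrightarrow> G \<in> HCT r m \<Longrightarrow> (\<lambda>w. F w + G w) \<in> HCT r m"
  by (auto simp: HCT_def wc_add dga.normal_def)
lemma HCT_minus: "F \<in> HCT r m \<Longrightarrow> (\<lambda>w. - F w) \<in> HCT r m"
  by (auto simp: HCT_def wc_minus dga.normal_def)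
lemma HCT_sg: "F \<in> HCT r m \<Longrightarrow> (\<lambda>w. sg e (F w)) \<in> HCT r m"
  by (auto simp: HCT_def wc_sg dga.normal_def)
lemma HCT_sc: "c \<in> carrier R \<Longrightarrow> F \<in> HCT r m \<Longrightarrow> (\<lambda>w. sc c (F w)) \<in> HCT r m"
  by (auto simp: HCT_def wc_sc dga.normal_def additive_zero[OF additive_sc])
lemma HCT_zero: "r \<in> MP \<Longrightarrow> (\<lambda>w. 0) \<in> HCT r m"
  by (simp add: HCT_def wc_zero dga.normal_def)

lemma HCT_brk:
  assumes "F \<in> HCT r m" "G \<in> HCT s l" "psum r s \<le> gm_top n"
  shows "dga.brk m l F G \<in> HCT (gm_add n r s) (m + l - 1)"
proof -
  have "dga.circ m G F \<in> HCT (gm_add n r s) (m + l - 1)"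
    using HCT_circ[OF assms(2,1)] assms(3) by (simp add: psum_commute gm_add_def add.commute)
  then show ?thesis unfolding dga.brk_alt by (intro HCT_add HCT_minus HCT_sg HCT_circ assms)
qed

section \<open>The bar construction by generators and relations\<close>

lemma gm_zero_le: "gm_zero \<le> p" by (simp add: gm_zero_def le_fun_def)

lemma unit_map_closed: "p \<in> GM n \<Longrightarrow> pmap A gm_zero p 0 (pone A) \<in> carrier (pobj A p 0)"
  by (rule mapD(1)[OF gm_zero_GM _ gm_zero_le one])

lemma unit_sub: "p \<in> GM n \<Longrightarrow> submodule (unit_image R A p i) R (pobj A p i)"
proof -
  assume p: "p \<in> GM n"
  note rr = cring.cring_simprules[OF cring]
  show ?thesis
  proof (cases "i = 0")
    case True
    let ?e = "pmap A gm_zero p 0 (pone A)"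
    note e = unit_map_closed[OF p]
    interpret M: module R "pobj A p 0" by (rule mod_A[OF p])
    show ?thesis unfolding True unit_image_def
    proof (rule M.submoduleI, simp_all)
      show "{c \<odot>\<^bsub>pobj A p 0\<^esub> ?e |c. c \<in> carrier R} \<subseteq> carrier (pobj A p 0)" using e by auto
      show "\<exists>c. \<zero>\<^bsub>pobj A p 0\<^esub> = c \<odot>\<^bsub>pobj A p 0\<^esub> ?e \<and> c \<in> carrier R"
        using M.smult_l_null[OF e] rr(2) by metis
      show "\<exists>c. \<ominus>\<^bsub>pobj A p 0\<^esub> a = c \<odot>\<^bsub>pobj A p 0\<^esub> ?e \<and> c \<in> carrier R" if "\<exists>c. a = c \<odot>\<^bsub>pobj A p 0\<^esub> ?e \<and> c \<in> carrier R" for a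
        using that M.smult_l_minus[OF _ e] rr(3) by metis
      show "\<exists>c. a \<oplus>\<^bsub>pobj A p 0\<^esub> b = c \<odot>\<^bsub>pobj A p 0\<^esub> ?e \<and> c \<in> carrier R" if "\<exists>c. a = c \<odot>\<^bsub>pobj A p 0\<^esub> ?e \<and> c \<in> carrier R"
        "\<exists>c. b = c \<odot>\<^bsub>pobj A p 0\<^esub> ?e \<and> c \<in> carrier R" for a b
        using that M.smult_l_distr[OF _ _ e] rr(1) by metis
      show "\<exists>d. a \<odot>\<^bsub>pobj A p 0\<^esub> x = d \<odot>\<^bsub>pobj A p 0\<^esub> ?e \<and> d \<in> carrier R"
          if "a \<in> carrier R" "\<exists>c. x = c \<odot>\<^bsub>pobj A p 0\<^esub> ?e \<and> c \<in> carrier R" for a x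
        using that M.smult_assoc1[OF _ _ e] rr(5) by metis
    qed
  next
    case False
    interpret M: module R "pobj A p i" by (rule mod_A[OF p])
    from False show ?thesis unfolding unit_image_def by (intro M.submoduleI) auto
  qed
qed

lemma sub_unit: "p \<in> GM n \<Longrightarrow> submodule_of R (pobj A p i) (unit_image R A p i)"
  by (simp add: submodule_of_def submodule_of_axioms_def mod_A unit_sub)

abbreviation Z where "Z \<equiv> psusp (reduced R A)"

definition rcls :: "perv \<Rightarrow> int \<Rightarrow> 'a \<Rightarrow> 'a set" where
  "rcls p i a = coset (pobj A p i) (unit_image R A p i) a"

lemma Z_obj: "pobj Z p (i - 1) = quot_module (pobj A p i) (unit_image R A p i)"
  by (simp add: psusp_def reduced_def pquot_def)

lemma Z_carrier: "p \<in> GM n \<Longrightarrow> carrier (pobj Z p (i - 1)) = rcls p i ` carrier (pobj A p i)"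
  unfolding Z_obj rcls_def by (rule submodule_of.carrier_Q[OF sub_unit])

lemma rcls_add: "p \<in> GM n \<Longrightarrow> a \<in> carrier (pobj A p i) \<Longrightarrow> b \<in> carrier (pobj A p i) \<Longrightarrow>
   rcls p i a \<oplus>\<^bsub>pobj Z p (i - 1)\<^esub> rcls p i b = rcls p i (a \<oplus>\<^bsub>pobj A p i\<^esub> b)"
  unfolding Z_obj rcls_def by (rule submodule_of.cls_add[OF sub_unit])

lemma rcls_smult: "p \<in> GM n \<Longrightarrow> c \<in> carrier R \<Longrightarrow> a \<in> carrier (pobj A p i) \<Longrightarrow>
   c \<odot>\<^bsub>pobj Z p (i - 1)\<^esub> rcls p i a = rcls p i (c \<odot>\<^bsub>pobj A p i\<^esub> a)"
  unfolding Z_obj rcls_def by (rule submodule_of.cls_smult[OF sub_unit])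

lemma rcls_map:
  assumes p: "p \<in> GM n" "q \<in> GM n" "p \<le> q" and a: "a \<in> carrier (pobj A p i)"
  shows "pmap Z p q (i - 1) (rcls p i a) = rcls q i (pmap A p q i a)"
proof -
  have *: "pmap Z p q (i - 1) X = unit_image R A q i <+>\<^bsub>pobj A q i\<^esub> (pmap A p q i ` X)" for X
    by (simp add: psusp_def reduced_def pquot_def)
  have z: "gm_zero \<le> p" by (simp add: gm_zero_def le_fun_def)
  have "pmap A p q i ` unit_image R A p i \<subseteq> unit_image R A q i"
    using mapD(3)[OF p _ unit_map_closed[OF p(1)]] map_comp[OF gm_zero_GM p(1,2) z p(3) one] map_zero[OF p, of i]
    by (auto simp: unit_image_def)
  then show ?thesis
    unfolding * rcls_def
    using submodule_of.add_sub[OF sub_unit] p mapD[OF p] a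
    by (intro coset_image) (auto simp: ab_A)
qed

abbreviation TW where "TW p m \<equiv> tensor_words n Z p m"
abbreviation FT where "FT p m \<equiv> free_module R (TW p m)"
abbreviation NT where "NT p m \<equiv> tensor_rels R n Z p m"

text \<open>The word of classes in the suspended reduced algebra.\<close>

definition rw :: "'a pword \<Rightarrow> 'a set pword" where
  "rw w = map (\<lambda>(q, i, a). (q, i - 1, rcls q i a)) w"

lemma rw_simps [simp]: "rw [] = []" "rw (x # w) = (fst x, fst (snd x) - 1, rcls (fst x) (fst (snd x)) (snd (snd x))) # rw w"
  "rw (v @ w) = rw v @ rw w"
  by (simp_all add: rw_def case_prod_beta)

lemma TW_iff: "w \<in> TW p m \<longleftrightarrow> (\<forall>(q, i, x) \<in> set w. q \<in> GM n \<and> x \<in> carrier (pobj Z q i))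
       \<and> psum_list (map fst w) \<le> p \<and> (\<Sum>(q, i, x)\<leftarrow>w. i) = m"
  by (simp add: tensor_words_def)

lemma rw_perv: "psum_list (map fst (rw w)) = sumperv w"
  by (induction w) (simp_all add: psum_list_def psum_def fun_eq_iff sumperv_def)

lemma rw_deg: "(\<Sum>(q, i, x)\<leftarrow>rw w. i) = word_deg w"
  by (induction w) simp_all

lemma rw_letters: "valid w \<Longrightarrow> \<forall>(q, i, x) \<in> set (rw w). q \<in> GM n \<and> x \<in> carrier (pobj Z q i)"
  by (induction w) (auto simp: Z_carrier)

lemma rw_TW: "valid w \<Longrightarrow> sumperv w \<le> p \<Longrightarrow> rw w \<in> TW p (word_deg w)"
  using rw_letters unfolding TW_iff rw_perv rw_deg by blast

lemma rw_surj:
  assumes "\<forall>(q, i, x) \<in> set u. q \<in> GM n \<and> x \<in> carrier (pobj Z q i)"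
  shows "\<exists>w. valid w \<and> rw w = u"
  using assms
proof (induction u)
  case Nil
  then show ?case by (intro exI[of _ "[]"]) simp
next
  case (Cons x u)
  obtain q i X where x: "x = (q, i, X)" by (cases x)
  then have q: "q \<in> GM n" and "X \<in> carrier (pobj Z q i)" using Cons.prems by auto
  then obtain a where a: "a \<in> carrier (pobj A q (i + 1))" "X = rcls q (i + 1) a"
    using Z_carrier[OF q, of "i + 1"] by auto
  obtain w where "valid w" "rw w = u" using Cons by auto
  then show ?case using a q x by (intro exI[of _ "(q, i + 1, a) # w"]) simp
qed

text \<open>Every generator of the bar construction comes from a word in \<open>A\<close>, so all computations can be made with words in
\<open>A\<close> instead of words of cosets.\<close>

lemma TW_surj:
  assumes "u \<in> TW p m"
  obtains w where "valid w" "rw w = u" "sumperv w \<le> p" "word_deg w = m"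
proof -
  have "\<forall>(q, i, x) \<in> set u. q \<in> GM n \<and> x \<in> carrier (pobj Z q i)" using assms unfolding TW_iff by simp
  then obtain w where w: "valid w" "rw w = u" using rw_surj by blast
  have "sumperv w \<le> p" "word_deg w = m"
    using assms unfolding TW_iff w(2)[symmetric] rw_perv rw_deg by simp_all
  then show thesis using that w by blast
qed

lemma mod_FT: "module R (FT p m)" by (rule module_free_module[OF cring])

definition rels :: "perv \<Rightarrow> int \<Rightarrow> ('a set pword \<Rightarrow> 'r) set" where
  "rels p m = {free_gen R (u @ [(q, i, x \<oplus>\<^bsub>pobj Z q i\<^esub> y)] @ v) \<ominus>\<^bsub>FT p m\<^esub>
      (free_gen R (u @ [(q, i, x)] @ v) \<oplus>\<^bsub>FT p m\<^esub> free_gen R (u @ [(q, i, y)] @ v))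
           | u v q i x y. u @ [(q, i, x)] @ v \<in> TW p m \<and> u @ [(q, i, y)] @ v \<in> TW p m}
      \<union> {free_gen R (u @ [(q, i, c \<odot>\<^bsub>pobj Z q i\<^esub> x)] @ v) \<ominus>\<^bsub>FT p m\<^esub> (c \<odot>\<^bsub>FT p m\<^esub> free_gen R (u @ [(q, i, x)] @ v))
           | u v q i c x. c \<in> carrier R \<and> u @ [(q, i, x)] @ v \<in> TW p m}
      \<union> {free_gen R w' \<ominus>\<^bsub>FT p m\<^esub> free_gen R w | w w'. w \<in> TW p m \<and> w' \<in> TW p m \<and>
           list_all2 (\<lambda>(q, i, x) (q', i', x'). q \<le> q' \<and> i' = i \<and> x' = pmap Z q q' i x) w w'}"

lemma NT_span: "NT p m = submodule_span R (FT p m) (rels p m)"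
  by (simp add: tensor_rels_def rels_def tensor_free_def Let_def)

definition push :: "perv \<times> int \<times> 'a \<Rightarrow> perv \<times> int \<times> 'a \<Rightarrow> bool" where
  "push = (\<lambda>(p, i, a) (p', i', a'). p \<le> p' \<and> p' \<in> GM n \<and> i' = i \<and> a' = pmap A p p' i a)"

text \<open>The same reduction for the relations: each is the image of a relation between words in \<open>A\<close>.\<close>

lemma rels_cases:
  assumes "g \<in> rels p m"
  obtains (add) x q i a b z where "valid (x @ (q, i, a) # z)" "valid (x @ (q, i, b) # z)"
      "sumperv (x @ (q, i, a) # z) \<le> p" "word_deg (x @ (q, i, a) # z) = m"
      "g = free_gen R (rw (x @ (q, i, a \<oplus>\<^bsub>pobj A q i\<^esub> b) # z)) \<ominus>\<^bsub>FT p m\<^esub>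
          (free_gen R (rw (x @ (q, i, a) # z)) \<oplus>\<^bsub>FT p m\<^esub> free_gen R (rw (x @ (q, i, b) # z)))"
  | (smult) x q i c a z where "valid (x @ (q, i, a) # z)" "c \<in> carrier R"
      "sumperv (x @ (q, i, a) # z) \<le> p" "word_deg (x @ (q, i, a) # z) = m"
      "g = free_gen R (rw (x @ (q, i, c \<odot>\<^bsub>pobj A q i\<^esub> a) # z)) \<ominus>\<^bsub>FT p m\<^esub>
          (c \<odot>\<^bsub>FT p m\<^esub> free_gen R (rw (x @ (q, i, a) # z)))"
  | (push) w w' where "valid w" "valid w'" "list_all2 push w w'" "sumperv w \<le> p" "sumperv w' \<le> p"
      "word_deg w = m" "word_deg w' = m" "g = free_gen R (rw w') \<ominus>\<^bsub>FT p m\<^esub> free_gen R (rw w)"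
proof -
  have lift: "\<exists>x z a. valid (x @ (q, i + 1, a) # z) \<and> rw x = u \<and> rw z = v \<and> X = rcls q (i + 1) a \<and>
      sumperv (x @ (q, i + 1, a) # z) \<le> p \<and> word_deg (x @ (q, i + 1, a) # z) = m"
    if W: "u @ [(q, i, X)] @ v \<in> TW p m" for u v q i X
  proof -
    have "\<forall>(q, i, x) \<in> set (u @ (q, i, X) # v). q \<in> GM n \<and> x \<in> carrier (pobj Z q i)"
      using W unfolding TW_iff by simp
    then obtain x z where xz: "valid x" "rw x = u" "valid z" "rw z = v" and q: "q \<in> GM n" "X \<in> carrier (pobj Z q i)"
      using rw_surj[of u] rw_surj[of v] by auto
    then obtain a where a: "a \<in> carrier (pobj A q (i + 1))" "X = rcls q (i + 1) a"
      using Z_carrier[OF q(1), of "i + 1"] by auto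
    have r: "rw (x @ (q, i + 1, a) # z) = u @ [(q, i, X)] @ v" using xz a by simp
    have "sumperv (x @ (q, i + 1, a) # z) \<le> p" "word_deg (x @ (q, i + 1, a) # z) = m"
      using W unfolding TW_iff r[symmetric] rw_perv rw_deg by simp_all
    then show ?thesis using xz q a by (intro exI[of _ x] exI[of _ z] exI[of _ a]) simp
  qed
  from assms consider
    u v q i X Y where "g = free_gen R (u @ [(q, i, X \<oplus>\<^bsub>pobj Z q i\<^esub> Y)] @ v) \<ominus>\<^bsub>FT p m\<^esub>
        (free_gen R (u @ [(q, i, X)] @ v) \<oplus>\<^bsub>FT p m\<^esub> free_gen R (u @ [(q, i, Y)] @ v))"
      "u @ [(q, i, X)] @ v \<in> TW p m" "u @ [(q, i, Y)] @ v \<in> TW p m"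
    | u v q i c X where "g = free_gen R (u @ [(q, i, c \<odot>\<^bsub>pobj Z q i\<^esub> X)] @ v) \<ominus>\<^bsub>FT p m\<^esub>
        (c \<odot>\<^bsub>FT p m\<^esub> free_gen R (u @ [(q, i, X)] @ v))"
      "c \<in> carrier R" "u @ [(q, i, X)] @ v \<in> TW p m"
    | w w' where "g = free_gen R w' \<ominus>\<^bsub>FT p m\<^esub> free_gen R w" "w \<in> TW p m" "w' \<in> TW p m"
        "list_all2 (\<lambda>(q, i, x) (q', i', x'). q \<le> q' \<and> i' = i \<and> x' = pmap Z q q' i x) w w'"
    unfolding rels_def by blast
  then show thesis
  proof cases
    case 1
    obtain x z a where a: "valid (x @ (q, i + 1, a) # z)" "rw x = u" "rw z = v" "X = rcls q (i + 1) a"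
        "sumperv (x @ (q, i + 1, a) # z) \<le> p" "word_deg (x @ (q, i + 1, a) # z) = m" using lift[OF 1(2)] by blast
    obtain b where b: "b \<in> carrier (pobj A q (i + 1))" "Y = rcls q (i + 1) b" using lift[OF 1(3)] by auto
    have "X \<oplus>\<^bsub>pobj Z q i\<^esub> Y = rcls q (i + 1) (a \<oplus>\<^bsub>pobj A q (i + 1)\<^esub> b)"
      using rcls_add[of q a "i + 1" b] a b by simp
    then have "g = free_gen R (rw (x @ (q, i + 1, a \<oplus>\<^bsub>pobj A q (i + 1)\<^esub> b) # z)) \<ominus>\<^bsub>FT p m\<^esub>
          (free_gen R (rw (x @ (q, i + 1, a) # z)) \<oplus>\<^bsub>FT p m\<^esub> free_gen R (rw (x @ (q, i + 1, b) # z)))"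
      using 1(1) a b by simp
    then show thesis using add[of x q "i + 1" a z b] a b by simp
  next
    case 2
    obtain x z a where a: "valid (x @ (q, i + 1, a) # z)" "rw x = u" "rw z = v" "X = rcls q (i + 1) a"
        "sumperv (x @ (q, i + 1, a) # z) \<le> p" "word_deg (x @ (q, i + 1, a) # z) = m" using lift[OF 2(3)] by blast
    have "c \<odot>\<^bsub>pobj Z q i\<^esub> X = rcls q (i + 1) (c \<odot>\<^bsub>pobj A q (i + 1)\<^esub> a)"
      using rcls_smult[of q c a "i + 1"] a 2 by simp
    then have "g = free_gen R (rw (x @ (q, i + 1, c \<odot>\<^bsub>pobj A q (i + 1)\<^esub> a) # z)) \<ominus>\<^bsub>FT p m\<^esub>
          (c \<odot>\<^bsub>FT p m\<^esub> free_gen R (rw (x @ (q, i + 1, a) # z)))"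
      using 2(1) a by simp
    then show thesis using smult[of x q "i + 1" a z c] a 2 by simp
  next
    case 3
    obtain w0 where w0: "valid w0" "rw w0 = w" "sumperv w0 \<le> p" "word_deg w0 = m" using TW_surj[OF 3(2)] .
    have gm: "\<forall>(q, i, x) \<in> set w'. q \<in> GM n" using 3(3) unfolding TW_iff by auto
    have "\<exists>w1. valid w1 \<and> rw w1 = w' \<and> list_all2 push w0 w1"
      using 3(4) gm w0(1) unfolding w0(2)[symmetric]
    proof (induction w0 arbitrary: w')
      case Nil
      then show ?case by (intro exI[of _ "[]"]) simp
    next
      case (Cons l w0)
      obtain q i a where l: "l = (q, i, a)" by (cases l)
      from Cons.prems(1) obtain q' v where w': "w' = (q', i - 1, pmap Z q q' (i - 1) (rcls q i a)) # v" and "q \<le> q'"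
        and rest: "list_all2 (\<lambda>(q, i, x) (q', i', x'). q \<le> q' \<and> i' = i \<and> x' = pmap Z q q' i x) (rw w0) v"
        by (auto simp: l list_all2_Cons1)
      have q: "q \<in> GM n" "q' \<in> GM n" "a \<in> carrier (pobj A q i)" using Cons.prems w' l by auto
      obtain w1 where w1: "valid w1" "rw w1 = v" "list_all2 push w0 w1"
        using Cons.IH[OF rest] Cons.prems(2,3) by (auto simp: w' l)
      show ?case
        using w1 w' q \<open>q \<le> q'\<close> mapD(1)[OF q(1,2) \<open>q \<le> q'\<close> q(3)] rcls_map[OF q(1,2) \<open>q \<le> q'\<close> q(3)]
        by (intro exI[of _ "(q', i, pmap A q q' i a) # w1"]) (simp add: l push_def)
    qed
    then obtain w1 where w1: "valid w1" "rw w1 = w'" "list_all2 push w0 w1" by blast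
    have "sumperv w1 \<le> p" "word_deg w1 = m"
      using 3(3) unfolding TW_iff w1(2)[symmetric] rw_perv rw_deg by simp_all
    then show thesis using push[of w0 w1] w0 w1 3(1) by simp
  qed
qed

lemma gen_closed: "valid w \<Longrightarrow> sumperv w \<le> p \<Longrightarrow> word_deg w = m \<Longrightarrow> free_gen R (rw w) \<in> carrier (FT p m)"
  using free_gen_closed[OF cring rw_TW] by blast

lemma rels_carrier: "rels p m \<subseteq> carrier (FT p m)"
proof
  fix g assume "g \<in> rels p m"
  interpret F: module R "FT p m" by (rule mod_FT)
  from \<open>g \<in> rels p m\<close> show "g \<in> carrier (FT p m)"
  proof (cases rule: rels_cases)
    case (add x q i a b z)
    have "valid (x @ (q, i, a \<oplus>\<^bsub>pobj A q i\<^esub> b) # z)" using add A_closed(2) by auto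
    then show ?thesis
      using add gen_closed[of "x @ (q, i, a \<oplus>\<^bsub>pobj A q i\<^esub> b) # z" p m] gen_closed[of "x @ (q, i, a) # z" p m]
        gen_closed[of "x @ (q, i, b) # z" p m] by simp
  next
    case (smult x q i c a z)
    have "valid (x @ (q, i, c \<odot>\<^bsub>pobj A q i\<^esub> a) # z)" using smult A_closed(4) by auto
    then show ?thesis
      using smult gen_closed[of "x @ (q, i, c \<odot>\<^bsub>pobj A q i\<^esub> a) # z" p m] gen_closed[of "x @ (q, i, a) # z" p m] by simp
  next
    case (push w w')
    then show ?thesis using gen_closed[of w p m] gen_closed[of w' p m] by simp
  qed
qed

lemma NT_sub: "submodule (NT p m) R (FT p m)" and rels_NT: "rels p m \<subseteq> NT p m"
  unfolding NT_span using submodule_spanI[OF mod_FT rels_carrier] by simp_all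

lemma sub_NT: "submodule_of R (FT p m) (NT p m)"
  by (simp add: submodule_of_def submodule_of_axioms_def mod_FT NT_sub)

abbreviation BT where "BT p m \<equiv> pobj (bar R n A) p m"

lemma BT_quot: "BT p m = quot_module (FT p m) (NT p m)"
  by (simp add: bar_def tensor_algebra_def pquot_def tensor_free_def)

abbreviation bcls where "bcls p m \<equiv> coset (FT p m) (NT p m)"
abbreviation bw where "bw \<equiv> bar_word R n A"

lemma bw_eq: "bw p w = bcls p (word_deg w) (free_gen R (rw w))"
  by (simp add: bar_word_def Let_def coset_def rw_def rcls_def tensor_free_def)

lemma carrier_BT: "carrier (BT p m) = bcls p m ` carrier (FT p m)"
  unfolding BT_quot by (rule submodule_of.carrier_Q[OF sub_NT])

lemma module_BT: "module R (BT p m)"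
  unfolding BT_quot by (rule submodule_of.module_Q[OF sub_NT])

lemma bw_closed: "valid w \<Longrightarrow> sumperv w \<le> p \<Longrightarrow> bw p w \<in> carrier (BT p (word_deg w))"
  unfolding bw_eq carrier_BT using gen_closed by blast

lemma bw_add:
  assumes v: "valid (x @ (q, i, a) # z)" "b \<in> carrier (pobj A q i)" and le: "sumperv (x @ (q, i, a) # z) \<le> p"
  shows "bw p (x @ (q, i, a \<oplus>\<^bsub>pobj A q i\<^esub> b) # z) =
     bw p (x @ (q, i, a) # z) \<oplus>\<^bsub>BT p (word_deg (x @ (q, i, a) # z))\<^esub> bw p (x @ (q, i, b) # z)"
proof -
  let ?m = "word_deg (x @ (q, i, a) # z)"
  interpret F: submodule_of R "FT p ?m" "NT p ?m" by (rule sub_NT)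
  have q: "q \<in> GM n" "a \<in> carrier (pobj A q i)" using v by auto
  have v': "valid (x @ (q, i, b) # z)" "valid (x @ (q, i, a \<oplus>\<^bsub>pobj A q i\<^esub> b) # z)"
    using v q A_closed(2)[OF q v(2)] by auto
  note c = gen_closed[OF v(1) le refl] gen_closed[OF v'(1), of p ?m] gen_closed[OF v'(2), of p ?m]
  have r: "rcls q i (a \<oplus>\<^bsub>pobj A q i\<^esub> b) = rcls q i a \<oplus>\<^bsub>pobj Z q (i - 1)\<^esub> rcls q i b"
    using rcls_add[OF q v(2)] by simp
  have "free_gen R (rw (x @ (q, i, a \<oplus>\<^bsub>pobj A q i\<^esub> b) # z)) \<ominus>\<^bsub>FT p ?m\<^esub>
     (free_gen R (rw (x @ (q, i, a) # z)) \<oplus>\<^bsub>FT p ?m\<^esub> free_gen R (rw (x @ (q, i, b) # z))) \<in> rels p ?m"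
    unfolding rels_def
    apply (rule UnI1, rule UnI1)
    apply (rule CollectI)
    apply (rule exI[of _ "rw x"], rule exI[of _ "rw z"], rule exI[of _ q], rule exI[of _ "i - 1"],
      rule exI[of _ "rcls q i a"], rule exI[of _ "rcls q i b"])
    using rw_TW[OF v(1) le] rw_TW[OF v'(1), of p] le r by simp
  then have "F.cls (free_gen R (rw (x @ (q, i, a \<oplus>\<^bsub>pobj A q i\<^esub> b) # z))) =
     F.cls (free_gen R (rw (x @ (q, i, a) # z)) \<oplus>\<^bsub>FT p ?m\<^esub> free_gen R (rw (x @ (q, i, b) # z)))"
    using rels_NT le c F.M.a_closed[OF c(1) c(2)] by (subst F.cls_eq_iff) auto
  also have "\<dots> = F.cls (free_gen R (rw (x @ (q, i, a) # z))) \<oplus>\<^bsub>BT p ?m\<^esub> F.cls (free_gen R (rw (x @ (q, i, b) # z)))"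
    using c le unfolding BT_quot by (subst F.cls_add) auto
  finally show ?thesis by (simp add: bw_eq)
qed

lemma bw_smult:
  assumes v: "valid (x @ (q, i, a) # z)" and d: "c \<in> carrier R" and le: "sumperv (x @ (q, i, a) # z) \<le> p"
  shows "bw p (x @ (q, i, c \<odot>\<^bsub>pobj A q i\<^esub> a) # z) =
     c \<odot>\<^bsub>BT p (word_deg (x @ (q, i, a) # z))\<^esub> bw p (x @ (q, i, a) # z)"
proof -
  let ?m = "word_deg (x @ (q, i, a) # z)"
  interpret F: submodule_of R "FT p ?m" "NT p ?m" by (rule sub_NT)
  have q: "q \<in> GM n" "a \<in> carrier (pobj A q i)" using v by auto
  have v': "valid (x @ (q, i, c \<odot>\<^bsub>pobj A q i\<^esub> a) # z)"
    using v q A_closed(4)[OF q(1) d q(2)] by auto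
  note c = gen_closed[OF v(1) le refl] gen_closed[OF v', of p ?m]
  have r: "rcls q i (c \<odot>\<^bsub>pobj A q i\<^esub> a) = c \<odot>\<^bsub>pobj Z q (i - 1)\<^esub> rcls q i a"
    using rcls_smult[OF q(1) d q(2)] by simp
  have "free_gen R (rw (x @ (q, i, c \<odot>\<^bsub>pobj A q i\<^esub> a) # z)) \<ominus>\<^bsub>FT p ?m\<^esub>
     (c \<odot>\<^bsub>FT p ?m\<^esub> free_gen R (rw (x @ (q, i, a) # z))) \<in> rels p ?m"
    unfolding rels_def
    apply (rule UnI1, rule UnI2)
    apply (rule CollectI)
    apply (rule exI[of _ "rw x"], rule exI[of _ "rw z"], rule exI[of _ q], rule exI[of _ "i - 1"],
      rule exI[of _ c], rule exI[of _ "rcls q i a"])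
    using rw_TW[OF v(1) le] d le r by simp
  then have "F.cls (free_gen R (rw (x @ (q, i, c \<odot>\<^bsub>pobj A q i\<^esub> a) # z))) =
     F.cls (c \<odot>\<^bsub>FT p ?m\<^esub> free_gen R (rw (x @ (q, i, a) # z)))"
    using rels_NT le c F.smult_closed[OF d c(1)] by (subst F.cls_eq_iff) auto
  also have "\<dots> = c \<odot>\<^bsub>BT p ?m\<^esub> F.cls (free_gen R (rw (x @ (q, i, a) # z)))"
    using c le d unfolding BT_quot by (subst F.cls_smult) auto
  finally show ?thesis by (simp add: bw_eq)
qed

lemma push_words:
  assumes "valid w" "list_all2 push w w'"
  shows "valid w' \<and> word_deg w' = word_deg w \<and> sumperv w \<le> sumperv w' \<and>
    list_all2 (\<lambda>(q, i, x) (q', i', x'). q \<le> q' \<and> i' = i \<and> x' = pmap Z q q' i x) (rw w) (rw w')"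
  using assms(2,1)
proof (induction rule: list_all2_induct)
  case (Cons l w l' w')
  obtain q i a where l: "l = (q, i, a)" by (cases l)
  obtain q' a' where l': "l' = (q', i, a')" and p: "q \<le> q'" "q' \<in> GM n" "a' = pmap A q q' i a"
    using Cons.hyps(1) by (cases l') (simp add: l push_def)
  have q: "q \<in> GM n" "a \<in> carrier (pobj A q i)" using Cons.prems l by auto
  show ?case using Cons.IH Cons.prems l l' p mapD(1)[OF q(1) p(2,1) q(2)] rcls_map[OF q(1) p(2,1) q(2)]
    by (simp add: psum_mono)
qed simp

lemma bw_push:
  assumes v: "valid w" and w': "list_all2 push w w'" and le: "sumperv w' \<le> p"
  shows "bw p w' = bw p w"
proof -
  let ?m = "word_deg w"
  interpret F: submodule_of R "FT p ?m" "NT p ?m" by (rule sub_NT)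
  note pw = push_words[OF v w']
  have le': "sumperv w \<le> p" using pw le order_trans by blast
  have c: "free_gen R (rw w) \<in> carrier (FT p ?m)" "free_gen R (rw w') \<in> carrier (FT p ?m)"
    using gen_closed[OF v le' refl] gen_closed[of w' p ?m] pw le by auto
  have "free_gen R (rw w') \<ominus>\<^bsub>FT p ?m\<^esub> free_gen R (rw w) \<in> rels p ?m"
    unfolding rels_def
    apply (rule UnI2)
    apply (rule CollectI)
    apply (rule exI[of _ "rw w"], rule exI[of _ "rw w'"])
    using rw_TW[OF v le'] rw_TW[of w' p] pw le by simp
  then have "F.cls (free_gen R (rw w')) = F.cls (free_gen R (rw w))"
    using rels_NT c by (subst F.cls_eq_iff) auto
  then show ?thesis using pw by (simp add: bw_eq)
qed

lemma TW_mono: "p \<le> p' \<Longrightarrow> TW p m \<subseteq> TW p' m"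
  unfolding tensor_words_def using order_trans by blast

lemma FT_mono: "p \<le> p' \<Longrightarrow> carrier (FT p m) \<subseteq> carrier (FT p' m)"
  using TW_mono[of p p' m] by (auto simp: free_module_simps)

lemma FT_minus: "u \<in> carrier (FT p m) \<Longrightarrow> \<ominus>\<^bsub>FT p m\<^esub> u = (\<lambda>w. \<ominus>\<^bsub>R\<^esub> u w)"
proof -
  assume u: "u \<in> carrier (FT p m)"
  interpret F: module R "FT p m" by (rule mod_FT)
  note R_minus = cring.cring_simprules(3)[OF cring]
  have fin: "finite {w. \<ominus>\<^bsub>R\<^esub> u w \<noteq> \<zero>\<^bsub>R\<^esub>}"
    by (rule finite_subset[of _ "{w. u w \<noteq> \<zero>\<^bsub>R\<^esub>}"]) (use u in \<open>auto simp: free_module_simps\<close>)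
  have "(\<lambda>w. \<ominus>\<^bsub>R\<^esub> u w) \<in> carrier (FT p m)" using u fin by (auto simp: free_module_simps)
  moreover have "(\<lambda>w. \<ominus>\<^bsub>R\<^esub> u w) \<oplus>\<^bsub>FT p m\<^esub> u = \<zero>\<^bsub>FT p m\<^esub>"
    using u by (auto simp: free_module_simps fun_eq_iff cring.cring_simprules(9)[OF cring])
  ultimately show ?thesis using u by (intro F.minus_equality) auto
qed

lemma NT_mono:
  assumes p: "p \<le> p'"
  shows "NT p m \<subseteq> NT p' m"
proof -
  interpret F: module R "FT p m" by (rule mod_FT)
  interpret F': submodule_of R "FT p' m" "NT p' m" by (rule sub_NT)
  have eq: "\<zero>\<^bsub>FT p m\<^esub> = \<zero>\<^bsub>FT p' m\<^esub>" "x \<oplus>\<^bsub>FT p m\<^esub> y = x \<oplus>\<^bsub>FT p' m\<^esub> y" "c \<odot>\<^bsub>FT p m\<^esub> x = c \<odot>\<^bsub>FT p' m\<^esub> x" for x y c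
    by (simp_all add: free_module_simps)
  have minus: "\<ominus>\<^bsub>FT p m\<^esub> x = \<ominus>\<^bsub>FT p' m\<^esub> x" if "x \<in> carrier (FT p m)" for x
    using FT_minus[OF that] FT_minus[OF subsetD[OF FT_mono[OF p] that]] by simp
  have sub: "submodule (NT p' m \<inter> carrier (FT p m)) R (FT p m)"
  proof (rule F.submoduleI)
    show "\<ominus>\<^bsub>FT p m\<^esub> a \<in> NT p' m \<inter> carrier (FT p m)" if "a \<in> NT p' m \<inter> carrier (FT p m)" for a
      using that minus[of a] F.a_inv_closed[of a] F'.submoduleE(3)[OF NT_sub, of a] by auto
    show "c \<odot>\<^bsub>FT p m\<^esub> x \<in> NT p' m \<inter> carrier (FT p m)" if "c \<in> carrier R" "x \<in> NT p' m \<inter> carrier (FT p m)" for c x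
      using that F'.submoduleE(4)[OF NT_sub, of c x] F.smult_closed[of c x] by (simp add: eq)
  qed (use F'.N.zero_closed F.zero_closed F'.N.a_closed F.a_closed in \<open>auto simp: eq\<close>)
  have "rels p m \<subseteq> NT p' m \<inter> carrier (FT p m)"
  proof
    fix g assume g: "g \<in> rels p m"
    have gc: "g \<in> carrier (FT p m)" using g rels_carrier by blast
    have min: "x \<ominus>\<^bsub>FT p m\<^esub> y = x \<ominus>\<^bsub>FT p' m\<^esub> y" if "y \<in> carrier (FT p m)" for x y
      using minus[OF that] by (simp add: a_minus_def eq)
    from g have "g \<in> rels p' m"
    proof (cases rule: rels_cases)
      case (add x q i a b z)
      then have "free_gen R (rw (x @ (q, i, a) # z)) \<oplus>\<^bsub>FT p m\<^esub> free_gen R (rw (x @ (q, i, b) # z)) \<in> carrier (FT p m)"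
        using gen_closed[of "x @ (q, i, a) # z" p m] gen_closed[of "x @ (q, i, b) # z" p m] F.a_closed by simp
      then have "g = free_gen R (rw (x @ (q, i, a \<oplus>\<^bsub>pobj A q i\<^esub> b) # z)) \<ominus>\<^bsub>FT p' m\<^esub>
          (free_gen R (rw (x @ (q, i, a) # z)) \<oplus>\<^bsub>FT p' m\<^esub> free_gen R (rw (x @ (q, i, b) # z)))"
        using add(5) min by (simp add: eq)
      moreover have "rw (x @ (q, i, a) # z) \<in> TW p' m" "rw (x @ (q, i, b) # z) \<in> TW p' m"
        using add p rw_TW[of "x @ (q, i, a) # z" p'] rw_TW[of "x @ (q, i, b) # z" p'] by auto
      ultimately show ?thesis unfolding rels_def using rcls_add[of q a i b] add(1,2)
        apply -
        apply (rule UnI1, rule UnI1)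
        apply (rule CollectI)
        apply (rule exI[of _ "rw x"], rule exI[of _ "rw z"], rule exI[of _ q], rule exI[of _ "i - 1"],
          rule exI[of _ "rcls q i a"], rule exI[of _ "rcls q i b"])
        by simp
    next
      case (smult x q i c a z)
      then have "c \<odot>\<^bsub>FT p m\<^esub> free_gen R (rw (x @ (q, i, a) # z)) \<in> carrier (FT p m)"
        using gen_closed[of "x @ (q, i, a) # z" p m] F.smult_closed by simp
      then have "g = free_gen R (rw (x @ (q, i, c \<odot>\<^bsub>pobj A q i\<^esub> a) # z)) \<ominus>\<^bsub>FT p' m\<^esub>
          (c \<odot>\<^bsub>FT p' m\<^esub> free_gen R (rw (x @ (q, i, a) # z)))"
        using smult(5) min by (simp add: eq)
      moreover have "rw (x @ (q, i, a) # z) \<in> TW p' m"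
        using smult p rw_TW[of "x @ (q, i, a) # z" p'] by auto
      ultimately show ?thesis unfolding rels_def using rcls_smult[of q c a i] smult(1,2)
        apply -
        apply (rule UnI1, rule UnI2)
        apply (rule CollectI)
        apply (rule exI[of _ "rw x"], rule exI[of _ "rw z"], rule exI[of _ q], rule exI[of _ "i - 1"],
          rule exI[of _ c], rule exI[of _ "rcls q i a"])
        by simp
    next
      case (push w w')
      then have "g = free_gen R (rw w') \<ominus>\<^bsub>FT p' m\<^esub> free_gen R (rw w)"
        using min gen_closed[of w p m] by simp
      moreover have "rw w \<in> TW p' m" "rw w' \<in> TW p' m"
        using push p rw_TW[of w p'] rw_TW[of w' p'] by auto
      ultimately show ?thesis unfolding rels_def using push_words[OF push(1,3)] by blast
    qed
    then show "g \<in> NT p' m \<inter> carrier (FT p m)" using rels_NT gc by blast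
  qed
  then show ?thesis using submodule_span_least[OF sub] unfolding NT_span by blast
qed

lemma bar_map:
  assumes "p \<le> p'" "u \<in> carrier (FT p m)"
  shows "pmap (bar R n A) p p' m (bcls p m u) = bcls p' m u"
proof -
  have *: "pmap (bar R n A) p p' m X = NT p' m <+>\<^bsub>FT p' m\<^esub> ((\<lambda>u. u) ` X)" for X
    by (simp add: bar_def tensor_algebra_def pquot_def tensor_free_def)
  note ab = module.axioms(2)[OF mod_FT]
  show ?thesis unfolding *
    by (rule coset_image[OF ab ab submodule_of.add_sub[OF sub_NT] submodule_of.add_sub[OF sub_NT]])
       (use subsetD[OF FT_mono[OF assms(1)]] NT_mono[OF assms(1)] assms(2) in \<open>auto simp: free_module_simps(3)\<close>)
qed

lemma bar_map_bw: "valid w \<Longrightarrow> sumperv w \<le> p \<Longrightarrow> p \<le> p' \<Longrightarrow> pmap (bar R n A) p p' (word_deg w) (bw p w) = bw p' w"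
  unfolding bw_eq by (rule bar_map) (simp_all add: gen_closed)

section \<open>From Hochschild cochains to multiadditive functions\<close>

text \<open>The perversity in which a cochain of perversity \<open>r\<close> takes its value on \<open>w\<close>.\<close>

definition wtag :: "perv \<Rightarrow> 'a pword \<Rightarrow> perv" where
  "wtag r w = gm_hull n (psum (sumperv w) r)"

definition good :: "perv \<Rightarrow> 'a pword \<Rightarrow> bool" where
  "good r w \<longleftrightarrow> valid w \<and> psum (sumperv w) r \<le> gm_top n"

lemma hoch_words_iff: "w \<in> hoch_words n A r \<longleftrightarrow> good r w"
  by (simp add: hoch_words_def good_def vword_def sumperv_def)

lemma word_perv_eq: "word_perv n w = gm_hull n (sumperv w)"
  by (simp add: word_perv_def sumperv_def)

lemma good_GM:
  assumes "good r w" "r \<in> MP"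
  shows "sumperv w \<in> MP" "sumperv w \<le> gm_top n" "gm_hull n (sumperv w) \<in> GM n" "wtag r w \<in> GM n"
    "psum (gm_hull n (sumperv w)) r \<le> wtag r w" "gm_add n (word_perv n w) r = wtag r w" "sumperv w \<le> gm_hull n (sumperv w)"
proof -
  show a: "sumperv w \<in> MP" "sumperv w \<le> gm_top n"
    using assms sumperv_MP psum_le_topD(1)[of "sumperv w" r] by (auto simp: good_def)
  show "gm_hull n (sumperv w) \<in> GM n" "wtag r w \<in> GM n" "sumperv w \<le> gm_hull n (sumperv w)"
    using a assms by (simp_all add: gm_hull_GM wtag_def good_def psum_mono_perv gm_hull_ge)
  show "psum (gm_hull n (sumperv w)) r \<le> wtag r w"
    using a assms by (subst gm_hull_psum_le_iff)
      (simp_all add: wtag_def gm_hull_GM good_def psum_mono_perv gm_hull_ge)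
  show "gm_add n (word_perv n w) r = wtag r w"
    using a assms by (simp add: gm_add_def word_perv_eq wtag_def gm_hull_psum)
qed

abbreviation HCo where "HCo r m \<equiv> pobj (HC R n A) r m"

lemma HCo_iff: "f \<in> carrier (HCo r m) \<longleftrightarrow>
  f \<in> (\<Pi>\<^sub>E (p, q, k, x) \<in> hom_dom n (bar R n A) r. carrier (pobj A q (k + m))) \<and>
  (\<forall>p\<in>GM n. \<forall>q\<in>GM n. \<forall>k. psum p r \<le> q \<longrightarrow> (\<lambda>x. f (p, q, k, x)) \<in> lin_maps R (BT p k) (pobj A q (k + m))) \<and>
  (\<forall>p\<in>GM n. \<forall>q\<in>GM n. \<forall>p'\<in>GM n. \<forall>q'\<in>GM n. \<forall>k. \<forall>x\<in>carrier (BT p' k).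
     p' \<le> p \<and> psum p r \<le> q \<and> q \<le> q' \<longrightarrow>
     f (p', q', k, x) = pmap A q q' (k + m) (f (p, q, k, pmap (bar R n A) p' p k x)))"
  by (simp add: HC_def internal_hom_def)

lemma HCo_lin:
  assumes "f \<in> carrier (HCo r m)" "p \<in> GM n" "q \<in> GM n" "psum p r \<le> q"
  shows "(\<lambda>x. f (p, q, k, x)) \<in> lin_maps R (BT p k) (pobj A q (k + m))"
  using assms unfolding HCo_iff by blast

lemma HCo_nat:
  assumes "f \<in> carrier (HCo r m)" "p \<in> GM n" "q \<in> GM n" "p' \<in> GM n" "q' \<in> GM n" "x \<in> carrier (BT p' k)"
    "p' \<le> p" "psum p r \<le> q" "q \<le> q'"
  shows "f (p', q', k, x) = pmap A q q' (k + m) (f (p, q, k, pmap (bar R n A) p' p k x))"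
  using assms unfolding HCo_iff by blast

definition cv :: "perv \<Rightarrow> int \<Rightarrow> ('r, 'a) cochain \<Rightarrow> 'a pword \<Rightarrow> 'a" where
  "cv r m f w = elt (hval R n A r m f w)"

lemma hval_eq:
  assumes "good r w" "r \<in> MP"
  shows "hval R n A r m f w = (wtag r w, word_deg w + m, cv r m f w)"
    and "cv r m f w = f (gm_hull n (sumperv w), wtag r w, word_deg w, bw (gm_hull n (sumperv w)) w)"
  using good_GM[OF assms] by (simp_all add: cv_def elt_def hval_def Let_def word_perv_eq)

text \<open>By naturality the values in smallest perversity determine all others.\<close>

lemma cv_general:
  assumes f: "f \<in> carrier (HCo r m)" and r: "r \<in> MP" and w: "valid w"
    and p: "p \<in> GM n" "q \<in> GM n" "sumperv w \<le> p" "psum p r \<le> q"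
  shows "f (p, q, word_deg w, bw p w) = pmap A (wtag r w) q (word_deg w + m) (cv r m f w)"
    and "good r w" and "wtag r w \<le> q"
proof -
  have le: "psum (sumperv w) r \<le> q" using p psum_mono[OF p(3) order_refl[of r]] by (auto intro: order_trans)
  show g: "good r w" using le GM_le_top[OF p(2)] w by (auto simp: good_def intro: order_trans)
  note gg = good_GM[OF g r]
  let ?wp = "gm_hull n (sumperv w)"
  show wq: "wtag r w \<le> q" unfolding wtag_def
    using le g p(2) gg(1) r by (subst gm_hull_le_iff) (simp_all add: good_def psum_mono_perv)
  have wp: "?wp \<le> p" using gg p by (simp add: gm_hull_le_iff)
  have b: "bw ?wp w \<in> carrier (BT ?wp (word_deg w))" using bw_closed[OF w gg(7)] .
  have bp: "bw p w \<in> carrier (BT p (word_deg w))" using bw_closed[OF w p(3)] .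
  have "f (?wp, q, word_deg w, bw ?wp w) = pmap A q q (word_deg w + m)
      (f (p, q, word_deg w, pmap (bar R n A) ?wp p (word_deg w) (bw ?wp w)))"
    using HCo_nat[OF f p(1,2) gg(3) p(2) b wp p(4)] by simp
  also have "\<dots> = f (p, q, word_deg w, bw p w)"
    using bar_map_bw[OF w gg(7) wp] lin_mapsD(1)[OF HCo_lin[OF f p(1,2,4)] bp] map_id[OF p(2)] by simp
  finally have 1: "f (?wp, q, word_deg w, bw ?wp w) = f (p, q, word_deg w, bw p w)" .
  have "f (?wp, q, word_deg w, bw ?wp w) = pmap A (wtag r w) q (word_deg w + m)
      (f (?wp, wtag r w, word_deg w, pmap (bar R n A) ?wp ?wp (word_deg w) (bw ?wp w)))"
    using HCo_nat[OF f gg(3,4,3) p(2) b order_refl gg(5) wq] .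
  then show "f (p, q, word_deg w, bw p w) = pmap A (wtag r w) q (word_deg w + m) (cv r m f w)"
    using 1 hval_eq(2)[OF g r] bar_map_bw[OF w gg(7) order_refl] by simp
qed

lemma cv_closed:
  assumes f: "f \<in> carrier (HCo r m)" and r: "r \<in> MP" and g: "good r w"
  shows "cv r m f w \<in> carrier (pobj A (wtag r w) (word_deg w + m))"
  using lin_mapsD(1)[OF HCo_lin[OF f good_GM(3,4,5)[OF g r]] bw_closed] good_GM[OF g r] g hval_eq(2)[OF g r]
  by (simp add: good_def)

lemma cv_add:
  assumes f: "f \<in> carrier (HCo r m)" and r: "r \<in> MP" and g: "good r (x @ (q, i, a) # z)" and b: "b \<in> carrier (pobj A q i)"
  shows "cv r m f (x @ (q, i, a \<oplus>\<^bsub>pobj A q i\<^esub> b) # z) = cv r m f (x @ (q, i, a) # z)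
    \<oplus>\<^bsub>pobj A (wtag r (x @ (q, i, a) # z)) (word_deg (x @ (q, i, a) # z) + m)\<^esub> cv r m f (x @ (q, i, b) # z)"
proof -
  have v: "valid (x @ (q, i, a) # z)" and q: "q \<in> GM n" "a \<in> carrier (pobj A q i)" using g by (auto simp: good_def)
  have g2: "good r (x @ (q, i, b) # z)" and g3: "good r (x @ (q, i, a \<oplus>\<^bsub>pobj A q i\<^esub> b) # z)"
    using g b A_closed(2)[OF q b] by (simp_all add: good_def)
  note gg = good_GM[OF g r]
  have v2: "valid (x @ (q, i, b) # z)" using g2 by (simp add: good_def)
  have e: "sumperv (x @ (q, i, b) # z) = sumperv (x @ (q, i, a) # z)" "word_deg (x @ (q, i, b) # z)
      = word_deg (x @ (q, i, a) # z)"
    "sumperv (x @ (q, i, a \<oplus>\<^bsub>pobj A q i\<^esub> b) # z) = sumperv (x @ (q, i, a) # z)"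
    "word_deg (x @ (q, i, a \<oplus>\<^bsub>pobj A q i\<^esub> b) # z) = word_deg (x @ (q, i, a) # z)" by simp_all
  have t: "wtag r (x @ (q, i, b) # z) = wtag r (x @ (q, i, a) # z)"
     "wtag r (x @ (q, i, a \<oplus>\<^bsub>pobj A q i\<^esub> b) # z) = wtag r (x @ (q, i, a) # z)" by (simp_all add: wtag_def)
  show ?thesis
    unfolding hval_eq(2)[OF g r] hval_eq(2)[OF g2 r] hval_eq(2)[OF g3 r] e t
    unfolding bw_add[OF v b gg(7)]
    by (rule lin_mapsD(2)[OF HCo_lin[OF f gg(3,4,5)] bw_closed[OF v gg(7)] bw_closed[OF v2, unfolded e, OF gg(7)]])
qed

lemma cv_smult:
  assumes f: "f \<in> carrier (HCo r m)" and r: "r \<in> MP" and g: "good r (x @ (q, i, a) # z)" and c: "c \<in> carrier R"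
  shows "cv r m f (x @ (q, i, c \<odot>\<^bsub>pobj A q i\<^esub> a) # z) =
    c \<odot>\<^bsub>pobj A (wtag r (x @ (q, i, a) # z)) (word_deg (x @ (q, i, a) # z) + m)\<^esub> cv r m f (x @ (q, i, a) # z)"
proof -
  have v: "valid (x @ (q, i, a) # z)" and q: "q \<in> GM n" "a \<in> carrier (pobj A q i)" using g by (auto simp: good_def)
  have g3: "good r (x @ (q, i, c \<odot>\<^bsub>pobj A q i\<^esub> a) # z)"
    using g A_closed(4)[OF q(1) c q(2)] by (simp add: good_def)
  note gg = good_GM[OF g r]
  have e: "sumperv (x @ (q, i, c \<odot>\<^bsub>pobj A q i\<^esub> a) # z) = sumperv (x @ (q, i, a) # z)"
    "word_deg (x @ (q, i, c \<odot>\<^bsub>pobj A q i\<^esub> a) # z) = word_deg (x @ (q, i, a) # z)" by simp_all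
  have t: "wtag r (x @ (q, i, c \<odot>\<^bsub>pobj A q i\<^esub> a) # z) = wtag r (x @ (q, i, a) # z)" by (simp add: wtag_def)
  show ?thesis
    unfolding hval_eq(2)[OF g r] hval_eq(2)[OF g3 r] e t
    unfolding bw_smult[OF v c gg(7)]
    by (rule lin_mapsD(3)[OF HCo_lin[OF f gg(3,4,5)] c bw_closed[OF v gg(7)]])
qed

lemma push_good:
  assumes w: "valid w" "list_all2 push w w'" and g: "good r' w'" and r: "r \<in> MP" "r' \<in> MP" "r \<le> r'"
  shows "good r w" "wtag r w \<le> wtag r' w'" "valid w'" "word_deg w' = word_deg w" "sumperv w \<le> sumperv w'"
proof -
  note pw = push_words[OF w]
  have le: "psum (sumperv w) r \<le> psum (sumperv w') r'" using pw r by (simp add: psum_mono)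
  then show "good r w" using w g by (auto simp: good_def intro: order_trans)
  show "wtag r w \<le> wtag r' w'"
    unfolding wtag_def using le g r sumperv_MP w(1) pw by (intro gm_hull_mono) (auto simp: good_def psum_mono_perv)
qed (use push_words[OF w] in auto)

lemma cv_push:
  assumes f: "f \<in> carrier (HCo r m)" and r: "r \<in> MP" and w: "valid w" "list_all2 push w w'" and g: "good r w'"
  shows "cv r m f w' = pmap A (wtag r w) (wtag r w') (word_deg w + m) (cv r m f w)"
proof -
  note pg = push_good[OF w g r r order_refl] and gg = good_GM[OF g r]
  have "cv r m f w' = f (gm_hull n (sumperv w'), wtag r w', word_deg w, bw (gm_hull n (sumperv w')) w)"
    using hval_eq(2)[OF g r] bw_push[OF w gg(7)] pg by simp
  also have "\<dots> = pmap A (wtag r w) (wtag r w') (word_deg w + m) (cv r m f w)"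
    by (rule cv_general(1)[OF f r w(1) gg(3,4) _ gg(5)]) (use pg(5) gg(7) order_trans in blast)
  finally show ?thesis .
qed

lemma rcls_one: "rcls gm_zero 0 (pone A) = rcls gm_zero 0 \<zero>\<^bsub>pobj A gm_zero 0\<^esub>"
proof -
  interpret U: submodule_of R "pobj A gm_zero 0" "unit_image R A gm_zero 0" by (rule sub_unit) simp
  have "pone A = \<one>\<^bsub>R\<^esub> \<odot>\<^bsub>pobj A gm_zero 0\<^esub> pmap A gm_zero gm_zero 0 (pone A)"
    using map_id[OF gm_zero_GM one] U.smult_one[OF one] by simp
  then have "pone A \<in> unit_image R A gm_zero 0" using one_R by (auto simp: unit_image_def)
  moreover have "pone A \<ominus>\<^bsub>pobj A gm_zero 0\<^esub> \<zero>\<^bsub>pobj A gm_zero 0\<^esub> = pone A" using one by (simp add: a_minus_def)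
  ultimately show ?thesis unfolding rcls_def using one by (subst U.cls_eq_iff) simp_all
qed

lemma bw_cong: "rw w = rw w' \<Longrightarrow> word_deg w = word_deg w' \<Longrightarrow> bw p w = bw p w'"
  by (simp add: bw_eq)

text \<open>The values of a cochain on words, as elements of \<open>T\<close>, extended by \<open>0\<close> to the words that exceed the top.\<close>

definition LT :: "perv \<Rightarrow> int \<Rightarrow> ('r, 'a) cochain \<Rightarrow> 'a pword \<Rightarrow> ('r, 'a) tmod" where
  "LT r m f w = (if good r w then V (wtag r w) (word_deg w + m) (cv r m f w) else 0)"

definition letter_linear :: "('a pword \<Rightarrow> ('r, 'a) tmod) \<Rightarrow> bool" where
  "letter_linear L \<longleftrightarrow>
    (\<forall>x q i a z. q \<notin> GM n \<longrightarrow> L (x @ (q, i, a) # z) = 0) \<and>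
    (\<forall>x z q i. q \<in> GM n \<longrightarrow> (\<forall>a\<in>carrier (pobj A q i). \<forall>b\<in>carrier (pobj A q i).
      L (x @ (q, i, a \<oplus>\<^bsub>pobj A q i\<^esub> b) # z) = L (x @ (q, i, a) # z) + L (x @ (q, i, b) # z))) \<and>
    (\<forall>x z q i. q \<in> GM n \<longrightarrow> (\<forall>a\<in>carrier (pobj A q i). \<forall>c\<in>carrier R.
      L (x @ (q, i, c \<odot>\<^bsub>pobj A q i\<^esub> a) # z) = sc c (L (x @ (q, i, a) # z)))) \<and>
    (\<forall>w. cl (L w) = L w)"

lemma LT_linear:
  assumes f: "f \<in> carrier (HCo r m)" and r: "r \<in> MP"
  shows "letter_linear (LT r m f)"
  unfolding letter_linear_def
proof (intro conjI allI ballI impI)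
  fix x q i a z assume "q \<notin> GM n"
  then show "LT r m f (x @ (q, i, a) # z) = 0" by (simp add: LT_def good_def)
next
  fix x z q i a b
  assume q: "q \<in> GM n" and a: "a \<in> carrier (pobj A q i)" and b: "b \<in> carrier (pobj A q i)"
  let ?w = "x @ (q, i, a) # z" and ?w2 = "x @ (q, i, b) # z" and ?w3 = "x @ (q, i, a \<oplus>\<^bsub>pobj A q i\<^esub> b) # z"
  have e: "good r ?w2 = good r ?w" "good r ?w3 = good r ?w" "wtag r ?w2 = wtag r ?w" "wtag r ?w3 = wtag r ?w"
    "word_deg ?w2 = word_deg ?w" "word_deg ?w3 = word_deg ?w"
    using q a b A_closed(2)[OF q a b] by (simp_all add: good_def wtag_def)
  show "LT r m f ?w3 = LT r m f ?w + LT r m f ?w2"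
  proof (cases "good r ?w")
    case True
    then have g2: "good r ?w2" using e by simp
    show ?thesis
      unfolding LT_def e using True cv_add[OF f r True b]
          V_add[OF good_GM(4)[OF True r] cv_closed[OF f r True] cv_closed[OF f r g2, unfolded e]]
      by simp
  qed (simp add: LT_def e del: word_deg_simps)
next
  fix x z q i a c
  assume q: "q \<in> GM n" and a: "a \<in> carrier (pobj A q i)" and c: "c \<in> carrier R"
  let ?w = "x @ (q, i, a) # z" and ?w3 = "x @ (q, i, c \<odot>\<^bsub>pobj A q i\<^esub> a) # z"
  have e: "good r ?w3 = good r ?w" "wtag r ?w3 = wtag r ?w" "word_deg ?w3 = word_deg ?w"
    using q a A_closed(4)[OF q c a] by (simp_all add: good_def wtag_def)
  show "LT r m f ?w3 = sc c (LT r m f ?w)"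
  proof (cases "good r ?w")
    case True
    show ?thesis
      unfolding LT_def e using True cv_smult[OF f r True c] sc_V[OF c good_GM(4)[OF True r] cv_closed[OF f r True]] by simp
  next
    case False
    then show ?thesis unfolding LT_def e by (simp add: additive_zero[OF additive_sc[OF c]])
  qed
next
  fix w show "cl (LT r m f w) = LT r m f w"
    using cl_V[OF good_GM(4)[OF _ r] cv_closed[OF f r]] additive_zero[OF additive_cl] by (simp add: LT_def)
qed

lemma letter_linear_prefix: "letter_linear L \<Longrightarrow> letter_linear (\<lambda>w. L (x # w))"
  unfolding letter_linear_def by (metis append_Cons)

text \<open>The multilinear extension of a function on words of homogeneous elements, one letter after the other.\<close>

fun mext :: "('a pword \<Rightarrow> ('r, 'a) tmod) \<Rightarrow> ('r, 'a) tmod list \<Rightarrow> ('r, 'a) tmod" where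
  "mext L [] = L []"
| "mext L (t # ts) = linext (\<lambda>k a. mext (\<lambda>w. L ((fst k, snd k, a) # w)) ts) t"

lemma mext_add: "mext (\<lambda>w. L w + L' w) ts = mext L ts + mext L' ts"
  by (induction ts arbitrary: L L') (simp_all add: linext_def sum.distrib)

lemma mext_zero: "mext (\<lambda>w. 0) ts = 0"
  by (induction ts) (simp_all add: linext_def)

lemma mext_additive: "additive h \<Longrightarrow> mext (\<lambda>w. h (L w)) ts = h (mext L ts)"
  by (induction ts arbitrary: L) (simp_all add: linext_def additive_sum)

lemma mext_fiber:
  assumes L: "letter_linear L"
  shows "fiber_additive (\<lambda>k a. mext (\<lambda>w. L ((fst k, snd k, a) # w)) ts)"
proof (rule fiber_additiveI)
  fix p i a b assume "p \<in> GM n" "a \<in> carrier (pobj A p i)" "b \<in> carrier (pobj A p i)"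
  then have "L ([] @ (p, i, a \<oplus>\<^bsub>pobj A p i\<^esub> b) # w) = L ([] @ (p, i, a) # w) + L ([] @ (p, i, b) # w)" for w
    using L unfolding letter_linear_def by blast
  then show "mext (\<lambda>w. L ((fst (p, i), snd (p, i), a \<oplus>\<^bsub>pobj A p i\<^esub> b) # w)) ts =
     mext (\<lambda>w. L ((fst (p, i), snd (p, i), a) # w)) ts + mext (\<lambda>w. L ((fst (p, i), snd (p, i), b) # w)) ts"
    by (simp add: mext_add)
next
  fix p i a assume "p \<notin> GM n"
  then have "L ([] @ (p, i, a) # w) = 0" for w using L unfolding letter_linear_def by blast
  then show "mext (\<lambda>w. L ((fst (p, i), snd (p, i), a) # w)) ts = 0" by (simp add: mext_zero)
qed

lemma mext_VW: "letter_linear L \<Longrightarrow> valid w \<Longrightarrow> mext L (VW w) = L w"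
proof (induction w arbitrary: L)
  case (Cons x w)
  obtain p i a where x: "x = (p, i, a)" by (cases x)
  then have "p \<in> GM n" "a \<in> carrier (pobj A p i)" "valid w" using Cons.prems by auto
  then show ?case using Cons.IH[OF letter_linear_prefix[OF Cons.prems(1)], of x]
    by (simp add: x linext_V[OF mext_fiber[OF Cons.prems(1)]])
qed simp

lemma mext_linear:
  assumes "letter_linear L" shows "linear_fun (mext L)"
proof -
  have multi: "mext L (x @ (a + b) # z) = mext L (x @ a # z) + mext L (x @ b # z)" if "letter_linear L" for L x a b z
    using that
  proof (induction x arbitrary: L)
    case Nil
    then show ?case using additiveD[OF additive_linext[OF mext_fiber]] by simp
  next
    case (Cons t x)
    then show ?case by (simp add: letter_linear_prefix linext_def sum.distrib)
  qed
  have homog: "mext L (x @ sc c a # z) = sc c (mext L (x @ a # z))" if "letter_linear L" "c \<in> carrier R" for L x a z c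
    using that(1)
  proof (induction x arbitrary: L)
    case Nil
    let ?G = "\<lambda>k a. mext (\<lambda>w. L ((fst k, snd k, a) # w)) z"
    note G = mext_fiber[OF Nil, of z]
    have "linext ?G (sc c a) = sc c (linext ?G a)"
    proof (rule additive_eqI[where f = "\<lambda>a. linext ?G (sc c a)" and g = "\<lambda>a. sc c (linext ?G a)"])
      fix p i a assume a: "p \<in> GM n" "a \<in> carrier (pobj A p i)"
      have "L ([] @ (p, i, c \<odot>\<^bsub>pobj A p i\<^esub> a) # w) = sc c (L ([] @ (p, i, a) # w))" for w
        using Nil a that(2) unfolding letter_linear_def by blast
      then show "linext ?G (sc c (V p i a)) = sc c (linext ?G (V p i a))"
        using a that(2) A_closed(4)[OF a(1) that(2) a(2)]
        by (simp add: sc_V linext_V[OF G] mext_additive[OF additive_sc])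
    qed (use that(2) in \<open>simp_all add: additive_compose additive_linext[OF G] additive_sc linext_cl[OF G] sc_cl\<close>)
    then show ?case by simp
  next
    case (Cons t x)
    then show ?case using that(2) by (simp add: letter_linear_prefix linext_def additive_sum[OF additive_sc])
  qed
  have cl: "cl (mext L w) = mext L w" for w
  proof -
    have "(\<lambda>w. cl (L w)) = L" using assms by (simp add: letter_linear_def fun_eq_iff)
    then show ?thesis using mext_additive[OF additive_cl, of L w] by simp
  qed
  show ?thesis
    unfolding linear_fun_def using multi[OF assms] homog[OF assms] cl
    by (auto intro: multiadditiveI simp: dga.homogeneous_def)
qed

lemma PR_src_refl: "PR u u' i t t' \<Longrightarrow> PR u u i t t"
proof -
  assume t: "PR u u' i t t'"
  then have "u \<in> MP" by (simp add: PR_def)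
  then show "PR u u i t t" using PR_VS(1)[OF t] by (rule PR_refl)
qed

text \<open>Related pairs are given by hulls of monotone functions, and the words in \<open>A\<close> are those with GM perversities. A list
of related pairs below the top is turned into words by replacing each monotone function by its hull, which changes
no comparison with a GM perversity. If an entry lies beyond the top it is \<open>0\<close>.\<close>

lemma naturalI_words:
  assumes F: "multiadditive F" and F': "multiadditive F'" and r: "r \<in> MP" "r' \<in> MP" "r \<le> r'"
    and W: "\<And>w w'. valid w \<Longrightarrow> list_all2 push w w' \<Longrightarrow>
      PR (psum (sumperv w) r) (psum (sumperv w') r') (word_deg w + m) (F (VW w)) (F' (VW w'))"
  shows "natural r r' m F F'"
proof (rule naturalI[OF r])
  have push_refl: "list_all2 push w w" if "valid w" for w
    using that map_id by (induction w) (auto simp: push_def)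
  have all: "\<exists>w w'. valid w \<and> list_all2 push w w' \<and> src xs = VW w \<and> tgt xs = VW w' \<and> rdeg xs = word_deg w \<and>
      (\<forall>v\<in>MP. \<forall>s\<in>GM n. (psum (sumperv w) v \<le> s \<longleftrightarrow> psum (psrc xs) v \<le> s) \<and> (psum (sumperv w') v \<le> s \<longleftrightarrow> psum (ptgt xs) v \<le> s))"
    if "related xs" "\<forall>(u, u', i, t, t') \<in> set xs. u' \<le> gm_top n" for xs
    using that
  proof (induction xs)
    case Nil
    then show ?case by (intro exI[of _ "[]"]) simp
  next
    case (Cons l xs)
    obtain u u' i t t' where l: "l = (u, u', i, t, t')" by (cases l)
    have PR: "PR u u' i t t'" and top: "u' \<le> gm_top n" using Cons.prems l by auto
    then have u: "u \<in> MP" "u' \<in> MP" "u \<le> u'" "u \<le> gm_top n" by (auto simp: PR_def intro: order_trans)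
    obtain a where a: "a \<in> carrier (pobj A (gm_hull n u) i)" "t = V (gm_hull n u) i a"
      "t' = V (gm_hull n u') i (pmap A (gm_hull n u) (gm_hull n u') i a)" using PR top by (auto simp: PR_def)
    obtain w w' where w: "valid w" "list_all2 push w w'" "src xs = VW w" "tgt xs = VW w'" "rdeg xs = word_deg w"
      and eq: "\<And>v s. v \<in> MP \<Longrightarrow> s \<in> GM n \<Longrightarrow> (psum (sumperv w) v \<le> s \<longleftrightarrow> psum (psrc xs) v \<le> s)
          \<and> (psum (sumperv w') v \<le> s \<longleftrightarrow> psum (ptgt xs) v \<le> s)"
      using Cons.IH Cons.prems l by (auto simp: related_def)
    have g: "gm_hull n u \<in> GM n" "gm_hull n u' \<in> GM n" "gm_hull n u \<le> gm_hull n u'"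
      using u top by (simp_all add: gm_hull_GM gm_hull_mono)
    have MP: "psrc xs \<in> MP" "ptgt xs \<in> MP" using related_MP[of xs] Cons.prems l by auto
    have "psum (psum (gm_hull n u) (sumperv w)) v \<le> s \<longleftrightarrow> psum (psum u (psrc xs)) v \<le> s"
      "psum (psum (gm_hull n u') (sumperv w')) v \<le> s \<longleftrightarrow> psum (psum u' (ptgt xs)) v \<le> s" if vs: "v \<in> MP" "s \<in> GM n" for v s
    proof -
      have "psum (psum (gm_hull n u) (sumperv w)) v \<le> s \<longleftrightarrow> psum (sumperv w) (psum (gm_hull n u) v) \<le> s"
        by (simp add: psum_ac)
      also have "\<dots> \<longleftrightarrow> psum (psrc xs) (psum (gm_hull n u) v) \<le> s"
        using eq vs g by (simp add: psum_mono_perv GM_mono_perv)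
      also have "\<dots> \<longleftrightarrow> psum (gm_hull n u) (psum (psrc xs) v) \<le> s" by (simp add: psum_ac)
      also have "\<dots> \<longleftrightarrow> psum u (psum (psrc xs) v) \<le> s"
        by (rule gm_hull_psum_le_iff) (use u vs MP in \<open>simp_all add: psum_mono_perv\<close>)
      finally show "psum (psum (gm_hull n u) (sumperv w)) v \<le> s \<longleftrightarrow> psum (psum u (psrc xs)) v \<le> s" by (simp add: psum_assoc)
      have "psum (psum (gm_hull n u') (sumperv w')) v \<le> s \<longleftrightarrow> psum (sumperv w') (psum (gm_hull n u') v) \<le> s"
        by (simp add: psum_ac)
      also have "\<dots> \<longleftrightarrow> psum (ptgt xs) (psum (gm_hull n u') v) \<le> s"
        using eq vs g by (simp add: psum_mono_perv GM_mono_perv)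
      also have "\<dots> \<longleftrightarrow> psum (gm_hull n u') (psum (ptgt xs) v) \<le> s" by (simp add: psum_ac)
      also have "\<dots> \<longleftrightarrow> psum u' (psum (ptgt xs) v) \<le> s"
        by (rule gm_hull_psum_le_iff) (use u top vs MP in \<open>simp_all add: psum_mono_perv\<close>)
      finally show "psum (psum (gm_hull n u') (sumperv w')) v \<le> s \<longleftrightarrow> psum (psum u' (ptgt xs)) v \<le> s" by (simp add: psum_assoc)
    qed
    then show ?case using w a g l
      by (intro exI[of _ "(gm_hull n u, i, a) # w"]
          exI[of _ "(gm_hull n u', i, pmap A (gm_hull n u) (gm_hull n u') i a) # w'"])
         (simp add: push_def)
  qed
  have good: "PR (psum (psrc xs) r) (psum (ptgt xs) r') (rdeg xs + m) (F (src xs)) (F' (tgt xs))"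
    if xs: "related xs" and top: "\<forall>(u, u', i, t, t') \<in> set xs. u' \<le> gm_top n" for xs
  proof -
    obtain w w' where w: "valid w" "list_all2 push w w'" "src xs = VW w" "tgt xs = VW w'" "rdeg xs = word_deg w"
      and eq: "\<And>v s. v \<in> MP \<Longrightarrow> s \<in> GM n \<Longrightarrow> (psum (sumperv w) v \<le> s \<longleftrightarrow> psum (psrc xs) v \<le> s)
          \<and> (psum (sumperv w') v \<le> s \<longleftrightarrow> psum (ptgt xs) v \<le> s)"
      using all[OF xs top] by blast
    show ?thesis unfolding w
      by (rule PR_hull[OF W[OF w(1,2)]]) (use natural_PR_MP[OF xs r] eq r in simp_all)
  qed
  have VSgood: "VS (psum (psrc xs) r) (rdeg xs + m) (F (src xs))" if xs: "related xs" for xs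
  proof -
    let ?ys = "map (\<lambda>(u, u', i, t, t'). (u, u, i, t, t)) xs"
    have ys: "related ?ys" "psrc ?ys = psrc xs" "ptgt ?ys = psrc xs" "rdeg ?ys = rdeg xs" "src ?ys = src xs"
      using xs PR_src_refl by (induction xs rule: psrc.induct) auto
    show ?thesis
    proof (cases "\<forall>(u, u', i, t, t') \<in> set ?ys. u' \<le> gm_top n")
      case True
      from PR_VS(1)[OF good[OF ys(1) True]] show ?thesis using ys by simp
    next
      case False
      then obtain l where l: "l \<in> set xs" "\<not> fst l \<le> gm_top n" by auto
      then obtain x z where x: "xs = x @ l # z" by (meson split_list)
      obtain u u' i t t' where lu: "l = (u, u', i, t, t')" by (cases l)
      have "VS u i t" using xs PR_VS(1) unfolding x lu by auto
      then have "t = 0" using l lu by (simp add: VS_def)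
      then have "F (src xs) = 0" using multi_zero[OF F] by (simp add: x lu)
      then show ?thesis using VS_zero natural_PR_MP(1)[OF xs r] by simp
    qed
  qed
  fix xs assume xs: "related xs"
  show "PR (psum (psrc xs) r) (psum (ptgt xs) r') (rdeg xs + m) (F (src xs)) (F' (tgt xs))"
  proof (cases "\<forall>(u, u', i, t, t') \<in> set xs. u' \<le> gm_top n")
    case True
    then show ?thesis by (rule good[OF xs])
  next
    case False
    then obtain l where l: "l \<in> set xs" "\<not> fst (snd l) \<le> gm_top n" by auto
    then obtain x z where x: "xs = x @ l # z" by (meson split_list)
    obtain u u' i t t' where lu: "l = (u, u', i, t, t')" by (cases l)
    have "VS u' i t'" using xs PR_VS(2) unfolding x lu by auto
    then have "t' = 0" using l lu by (simp add: VS_def)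
    then have "F' (tgt xs) = 0" using multi_zero[OF F'] by (simp add: x lu)
    moreover have "psum (ptgt xs) r' = psum u' (psum (ptgt x) (psum (ptgt z) r'))"
      by (simp add: x lu psum_ac)
    then have "\<not> psum (ptgt xs) r' \<le> gm_top n"
      using l(2) psum_le_topD(1)[of u'] by (auto simp: lu)
    ultimately show ?thesis using VSgood[OF xs] natural_PR_MP[OF xs r] by (simp add: PR_def)
  qed
qed

definition Phi :: "perv \<Rightarrow> int \<Rightarrow> ('r, 'a) cochain \<Rightarrow> ('r, 'a) tmod list \<Rightarrow> ('r, 'a) tmod" where
  "Phi r m f = mext (LT r m f)"

lemma Phi_linear: "f \<in> carrier (HCo r m) \<Longrightarrow> r \<in> MP \<Longrightarrow> linear_fun (Phi r m f)"
  by (simp add: Phi_def mext_linear LT_linear)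

lemma Phi_VW: "f \<in> carrier (HCo r m) \<Longrightarrow> r \<in> MP \<Longrightarrow> valid w \<Longrightarrow> Phi r m f (VW w) = LT r m f w"
  by (simp add: Phi_def mext_VW LT_linear)

lemma PR_LT:
  assumes f: "f \<in> carrier (HCo r m)" "f' \<in> carrier (HCo r' m)" and r: "r \<in> MP" "r' \<in> MP" "r \<le> r'"
    and w: "valid w" "list_all2 push w w'"
    and eq: "good r' w' \<Longrightarrow> cv r' m f' w' = pmap A (wtag r w) (wtag r' w') (word_deg w + m) (cv r m f w)"
  shows "PR (psum (sumperv w) r) (psum (sumperv w') r') (word_deg w + m) (LT r m f w) (LT r' m f' w')"
proof -
  note pw = push_words[OF w]
  have MP: "psum (sumperv w) r \<in> MP" "psum (sumperv w') r' \<in> MP" "psum (sumperv w) r \<le> psum (sumperv w') r'"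
    using pw w(1) sumperv_MP r by (simp_all add: psum_mono_perv psum_mono)
  have VS: "VS (psum (sumperv w) r) (word_deg w + m) (LT r m f w)"
    using cv_closed[OF f(1) r(1), of w] w(1) by (auto simp: VS_def LT_def wtag_def good_def)
  show ?thesis
  proof (cases "good r' w'")
    case True
    note pg = push_good[OF w True r]
    show ?thesis
      unfolding PR_def LT_def
      using MP True pg cv_closed[OF f(1) r(1) pg(1)] eq[OF True] by (auto simp: good_def wtag_def)
  next
    case False
    then have "\<not> psum (sumperv w') r' \<le> gm_top n" using pw by (simp add: good_def)
    then show ?thesis using False VS MP by (simp add: PR_def LT_def[of r'])
  qed
qed

lemma Phi_wc:
  assumes f: "f \<in> carrier (HCo r m)" and r: "r \<in> MP"
  shows "wc r m (Phi r m f)"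
proof -
  have "natural r r m (Phi r m f) (Phi r m f)"
  proof (rule naturalI_words[OF linear_funD(1) linear_funD(1)])
    fix w w' assume w: "valid w" "list_all2 push w w'"
    then have "valid w'" using push_words by blast
    then show "PR (psum (sumperv w) r) (psum (sumperv w') r) (word_deg w + m) (Phi r m f (VW w)) (Phi r m f (VW w'))"
      using PR_LT[OF f f r r order_refl w cv_push[OF f r w]] Phi_VW[OF f r] w(1) by simp
  qed (use Phi_linear[OF f r] r in simp_all)
  then show ?thesis using Phi_linear[OF f r] by (simp add: wc_def)
qed

text \<open>The unit has the same class in the reduced algebra as \<open>0\<close>.\<close>

lemma Phi_normal:
  assumes f: "f \<in> carrier (HCo r m)" and r: "r \<in> MP"
  shows "dga.normal (Phi r m f)"
proof -
  let ?F = "Phi r m f"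
  note L = linear_funD[OF Phi_linear[OF f r]]
  have words: "?F (VW x @ eT # VW z) = 0" if x: "valid x" and z: "valid z" for x z
  proof -
    let ?w = "x @ (gm_zero, 0, pone A) # z" and ?y = "x @ (gm_zero, 0, \<zero>\<^bsub>pobj A gm_zero 0\<^esub>) # z"
    have z0: "\<zero>\<^bsub>pobj A gm_zero 0\<^esub> \<in> carrier (pobj A gm_zero 0)" by (rule A_closed(1)) simp
    have v: "valid ?w" "valid ?y" using x z one z0 by simp_all
    have e: "good r ?y = good r ?w" "wtag r ?y = wtag r ?w" "word_deg ?y = word_deg ?w" "sumperv ?y = sumperv ?w"
      using v by (simp_all add: good_def wtag_def)
    have "bw p ?y = bw p ?w" for p by (rule bw_cong) (simp_all add: rcls_one)
    then have "good r ?w \<Longrightarrow> cv r m f ?y = cv r m f ?w"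
      using hval_eq(2)[of r ?y m f] hval_eq(2)[of r ?w m f] r unfolding e by simp
    then have "LT r m f ?w = LT r m f ?y" unfolding LT_def e by simp
    also have "\<dots> = ?F (VW x @ V gm_zero 0 \<zero>\<^bsub>pobj A gm_zero 0\<^esub> # VW z)"
      using Phi_VW[OF f r v(2)] by simp
    also have "\<dots> = 0" using multi_zero[OF L(1)] by (simp add: V_zero)
    finally show ?thesis using Phi_VW[OF f r v(1)] by (simp add: eT_def)
  qed
  have "(\<lambda>ts. ?F (VW x @ eT # ts)) = (\<lambda>ts. 0)" if x: "valid x" for x
  proof (rule multiadditive_eqI)
    show "multiadditive (\<lambda>ts. ?F (VW x @ eT # ts))"
      by (rule multiadditiveI) (use multi_add[OF L(1), of "VW x @ eT # _"] in simp)
    show "cl_invariant (\<lambda>ts. ?F (VW x @ eT # ts))"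
      unfolding cl_invariant_def
    proof (intro allI)
      fix y a z
      show "?F (VW x @ eT # y @ cl a # z) = ?F (VW x @ eT # y @ a # z)"
        using L(4)[unfolded cl_invariant_def, rule_format, of "VW x @ eT # y" a z] by simp
    qed
  qed (use words[OF x] in \<open>simp_all add: multiadditive_def additive_def cl_invariant_def\<close>)
  then have *: "?F (VW x @ eT # z) = 0" if "valid x" for x z using that by (metis (no_types))
  have "(\<lambda>ts. ?F (ts @ eT # z)) = (\<lambda>ts. 0)" for z
  proof (rule multiadditive_eqI)
    show "multiadditive (\<lambda>ts. ?F (ts @ eT # z))"
      by (rule multiadditiveI) (simp add: multi_add[OF L(1)])
    show "cl_invariant (\<lambda>ts. ?F (ts @ eT # z))"
      using L(4) by (simp add: cl_invariant_def)
  qed (use * in \<open>simp_all add: multiadditive_def additive_def cl_invariant_def\<close>)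
  then show ?thesis unfolding dga.normal_def by (metis (no_types))
qed

lemma Phi_HCT: "f \<in> carrier (HCo r m) \<Longrightarrow> r \<in> MP \<Longrightarrow> Phi r m f \<in> HCT r m"
  by (simp add: HCT_def Phi_wc Phi_normal)

section \<open>From multiadditive functions to Hochschild cochains\<close>

text \<open>The structure maps to perversity \<open>q\<close>, from all smaller perversities at once.\<close>

definition pT :: "perv \<Rightarrow> ('r, 'a) tmod \<Rightarrow> ('r, 'a) tmod" where
  "pT q = linext (\<lambda>(p, i) a. if p \<in> GM n \<and> q \<in> GM n \<and> p \<le> q then V q i (pmap A p q i a) else 0)"

lemma fiber_pT: "fiber_additive (\<lambda>(p, i) a. if p \<in> GM n \<and> q \<in> GM n \<and> p \<le> q then V q i (pmap A p q i a) else 0)"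
  by (rule fiber_additiveI) (simp_all add: V_add[symmetric] mapD)

lemma additive_pT: "additive (pT q)" unfolding pT_def by (rule additive_linext[OF fiber_pT])
lemma pT_cl: "pT q (cl t) = pT q t" by (simp add: pT_def linext_cl[OF fiber_pT])
lemma pT_V: "p \<in> GM n \<Longrightarrow> q \<in> GM n \<Longrightarrow> p \<le> q \<Longrightarrow> a \<in> carrier (pobj A p i) \<Longrightarrow> pT q (V p i a) = V q i (pmap A p q i a)"
  unfolding pT_def by (subst linext_V[OF fiber_pT]) simp_all
lemma pT_V0: "p \<in> GM n \<Longrightarrow> \<not> (q \<in> GM n \<and> p \<le> q) \<Longrightarrow> a \<in> carrier (pobj A p i) \<Longrightarrow> pT q (V p i a) = 0"
  unfolding pT_def by (subst linext_V[OF fiber_pT]) auto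

lemma pT_sc: "c \<in> carrier R \<Longrightarrow> pT q (sc c t) = sc c (pT q t)"
proof (rule additive_eqI[where f = "\<lambda>t. pT q (sc c t)" and g = "\<lambda>t. sc c (pT q t)"])
  assume c: "c \<in> carrier R"
  fix p i a assume a: "p \<in> GM n" "a \<in> carrier (pobj A p i)"
  note ca = A_closed(4)[OF a(1) c a(2)]
  show "pT q (sc c (V p i a)) = sc c (pT q (V p i a))"
  proof (cases "q \<in> GM n \<and> p \<le> q")
    case True
    then show ?thesis using a c ca mapD[OF a(1), of q] by (simp add: sc_V pT_V)
  next
    case False
    then show ?thesis using a c ca by (simp add: sc_V pT_V0 additive_zero[OF additive_sc])
  qed
qed (simp_all add: additive_compose additive_pT additive_sc pT_cl sc_cl)

lemma cl_pT: "cl (pT q t) = pT q t"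
  using pT_sc[OF one_R, of q t] by (simp add: sc_one pT_cl)

lemma VS_pT:
  assumes t: "VS u i t" "u \<in> MP" and q: "q \<in> GM n" "u \<le> q"
  shows "VS q i (pT q t)"
    and "q' \<in> GM n \<Longrightarrow> q \<le> q' \<Longrightarrow> pT q' (pT q t) = pT q' t"
proof -
  have top: "u \<le> gm_top n" using q GM_le_top order_trans by blast
  have g: "gm_hull n u \<in> GM n" "gm_hull n u \<le> q" using t q top by (simp_all add: gm_hull_GM gm_hull_le_iff)
  obtain a where a: "a \<in> carrier (pobj A (gm_hull n u) i)" "t = V (gm_hull n u) i a"
    using t top by (auto simp: VS_def)
  show "VS q i (pT q t)"
    using a g q mapD(1)[OF g(1) q(1) g(2) a(1)] by (auto simp: VS_def pT_V GM_le_top gm_hull_id)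
  show "q' \<in> GM n \<Longrightarrow> q \<le> q' \<Longrightarrow> pT q' (pT q t) = pT q' t"
    using a g q mapD(1)[OF g(1) q(1) g(2) a(1)] map_comp[OF g(1) q(1) _ g(2) _ a(1)] order_trans[OF g(2), of q']
    by (simp add: pT_V)
qed

lemma PR_pT:
  assumes t: "PR u u' i t t'" and q: "q \<in> GM n" "u' \<le> q"
  shows "pT q t' = pT q t"
proof -
  have u: "u \<in> MP" "u' \<in> MP" "u \<le> u'" using t by (simp_all add: PR_def)
  have top: "u' \<le> gm_top n" using q GM_le_top order_trans by blast
  have g: "gm_hull n u \<in> GM n" "gm_hull n u' \<in> GM n" "gm_hull n u \<le> gm_hull n u'" "gm_hull n u' \<le> q"
    using u top q order_trans[OF u(3) top] gm_hull_mono[OF u top] gm_hull_le_iff[OF u(2) top q(1)]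
    by (simp_all add: gm_hull_GM)
  obtain a where a: "a \<in> carrier (pobj A (gm_hull n u) i)" "t = V (gm_hull n u) i a"
        "t' = V (gm_hull n u') i (pmap A (gm_hull n u) (gm_hull n u') i a)"
    using t top by (auto simp: PR_def)
  show ?thesis
    using a g q mapD(1)[OF g(1-3) a(1)] map_comp[OF g(1,2) q(1) g(3,4) a(1)] order_trans[OF g(3,4)]
    by (simp add: pT_V)
qed

lemma pT_id: "VS q i t \<Longrightarrow> q \<in> GM n \<Longrightarrow> pT q t = t"
  using map_id by (auto simp: VS_def GM_le_top gm_hull_id pT_V)

lemma VS_comp: "VS q i t \<Longrightarrow> q \<in> GM n \<Longrightarrow> V q i (comp (q, i) t) = t \<and> comp (q, i) t \<in> carrier (pobj A q i)"
  by (auto simp: VS_def GM_le_top gm_hull_id comp_V)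

lemma VS_sc: "u \<in> MP \<Longrightarrow> c \<in> carrier R \<Longrightarrow> VS u i t \<Longrightarrow> VS u i (sc c t)"
  using PR_VS(1)[OF PR_sc[OF _ PR_refl]] by blast

lemma VS_sum: "u \<in> MP \<Longrightarrow> (\<And>k. k \<in> K \<Longrightarrow> VS u i (f k)) \<Longrightarrow> VS u i (\<Sum>k\<in>K. f k)"
  by (induction K rule: infinite_finite_induct) (simp_all add: VS_zero VS_add)

lemma PR_zero_src:
  assumes "PR u u' i 0 t'" shows "t' = 0"
proof (cases "u' \<le> gm_top n")
  case True
  have u: "u \<in> MP" "u' \<in> MP" "u \<le> u'" using assms by (simp_all add: PR_def)
  have g: "gm_hull n u \<in> GM n" "gm_hull n u' \<in> GM n" "gm_hull n u \<le> gm_hull n u'"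
    using u True order_trans[OF u(3)] by (simp_all add: gm_hull_GM gm_hull_mono)
  obtain a where a: "a \<in> carrier (pobj A (gm_hull n u) i)" "0 = V (gm_hull n u) i a"
        "t' = V (gm_hull n u') i (pmap A (gm_hull n u) (gm_hull n u') i a)"
    using assms True by (auto simp: PR_def)
  have "a = \<zero>\<^bsub>pobj A (gm_hull n u) i\<^esub>"
    using V_inj[OF g(1) a(1) A_closed(1)[OF g(1)]] a(2) V_zero[OF g(1)] by simp
  then show ?thesis using a map_zero[OF g] V_zero[OF g(2)] by simp
next
  case False
  then show ?thesis using assms by (simp add: PR_def)
qed

lemma sc_add_left: "b \<in> carrier R \<Longrightarrow> c \<in> carrier R \<Longrightarrow> sc (b \<oplus>\<^bsub>R\<^esub> c) t = sc b t + sc c t"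
proof (rule additive_eqI[where f = "sc (b \<oplus>\<^bsub>R\<^esub> c)" and g = "\<lambda>t. sc b t + sc c t"])
  assume c: "b \<in> carrier R" "c \<in> carrier R"
  have bc: "b \<oplus>\<^bsub>R\<^esub> c \<in> carrier R" using cring.cring_simprules(1)[OF cring c] .
  show "additive (sc (b \<oplus>\<^bsub>R\<^esub> c))" "additive (\<lambda>t. sc b t + sc c t)" using c bc by (simp_all add: additive_sc additive_plus)
  show "sc (b \<oplus>\<^bsub>R\<^esub> c) (cl t) = sc (b \<oplus>\<^bsub>R\<^esub> c) t" "sc b (cl t) + sc c (cl t) = sc b t + sc c t" for t
    using c bc by (simp_all add: sc_cl)
  fix p i a assume a: "p \<in> GM n" "a \<in> carrier (pobj A p i)"
  show "sc (b \<oplus>\<^bsub>R\<^esub> c) (V p i a) = sc b (V p i a) + sc c (V p i a)"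
    using a c bc module.smult_l_distr[OF mod_A[OF a(1)] c a(2)] A_closed(4)[OF a(1) _ a(2)]
    by (simp add: sc_V V_add)
qed

lemma sc_zero_left: "sc \<zero>\<^bsub>R\<^esub> t = 0"
proof -
  have z: "\<zero>\<^bsub>R\<^esub> \<in> carrier R" by (rule cring.cring_simprules(2)[OF cring])
  have "sc (\<zero>\<^bsub>R\<^esub> \<oplus>\<^bsub>R\<^esub> \<zero>\<^bsub>R\<^esub>) t = sc \<zero>\<^bsub>R\<^esub> t + sc \<zero>\<^bsub>R\<^esub> t" by (rule sc_add_left[OF z z])
  then show ?thesis using cring.cring_simprules(8)[OF cring z] by simp
qed

lemma HCT_normal_words:
  assumes F: "F \<in> HCT r m" and x: "valid x" "valid z" "q \<in> GM n"
  shows "F (VW x @ V q 0 (pmap A gm_zero q 0 (pone A)) # VW z) = 0"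
proof -
  have F': "natural r r m F F" "dga.normal F" using F by (simp_all add: HCT_def wc_def)
  let ?xs = "rword x @ (gm_zero, q, 0, eT, V q 0 (pmap A gm_zero q 0 (pone A))) # rword z"
  have "related ?xs" using x PR_V[OF gm_zero_GM x(3) gm_zero_le one] related_rword by (simp add: eT_def)
  from naturalD[OF F'(1) this] have "PR (psum (psrc ?xs) r) (psum (ptgt ?xs) r) (rdeg ?xs + m) 0
     (F (VW x @ V q 0 (pmap A gm_zero q 0 (pone A)) # VW z))"
    using dga.normalD[OF F'(2)] by simp
  then show ?thesis by (rule PR_zero_src)
qed

text \<open>A normalised word cochain factors through the reduced algebra: letters of the same class differ by a multiple of
the unit.\<close>

lemma HCT_rw:
  assumes F: "F \<in> HCT r m" and "valid w" "valid w'" "rw w = rw w'"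
  shows "F (VW w) = F (VW w')"
proof -
  have L: "linear_fun F" using F by (simp add: HCT_def wc_def)
  have letter: "F (VW x @ V q i a # VW z) = F (VW x @ V q i b # VW z)"
    if x: "valid x" "valid z" "q \<in> GM n" and a: "a \<in> carrier (pobj A q i)" "b \<in> carrier (pobj A q i)"
        and eq: "rcls q i a = rcls q i b"
    for x z q i a b
  proof -
    interpret U: submodule_of R "pobj A q i" "unit_image R A q i" by (rule sub_unit[OF x(3)])
    let ?k = "a \<ominus>\<^bsub>pobj A q i\<^esub> b"
    have k: "?k \<in> unit_image R A q i" using eq a unfolding rcls_def by (simp add: U.cls_eq_iff)
    have kc: "?k \<in> carrier (pobj A q i)" using a by simp
    have "a = ?k \<oplus>\<^bsub>pobj A q i\<^esub> b" using a by (simp add: a_minus_def U.M.a_assoc U.M.l_neg)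
    then have "V q i a = V q i ?k + V q i b" using V_add[OF x(3) kc a(2)] by simp
    then have "F (VW x @ V q i a # VW z) = F (VW x @ V q i ?k # VW z) + F (VW x @ V q i b # VW z)"
      using multi_add[OF linear_funD(1)[OF L]] by simp
    moreover have "F (VW x @ V q i ?k # VW z) = 0"
    proof (cases "i = 0")
      case True
      then obtain c where c: "c \<in> carrier R" "?k = c \<odot>\<^bsub>pobj A q 0\<^esub> pmap A gm_zero q 0 (pone A)"
        using k by (auto simp: unit_image_def)
      then have "V q i ?k = sc c (V q 0 (pmap A gm_zero q 0 (pone A)))"
        using True sc_V[OF c(1) x(3) unit_map_closed[OF x(3)]] by simp
      then show ?thesis
        using dga.homogeneousD[OF linear_funD(2)[OF L c(1)]] HCT_normal_words[OF F x]
            additive_zero[OF additive_sc[OF c(1)]] by simp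
    next
      case False
      then have "?k = \<zero>\<^bsub>pobj A q i\<^esub>" using k by (simp add: unit_image_def)
      then show ?thesis using multi_zero[OF linear_funD(1)[OF L]] V_zero[OF x(3)] by simp
    qed
    ultimately show ?thesis by simp
  qed
  have "F (VW (x @ w)) = F (VW (x @ w'))" if "valid x" for x
    using assms(2-4) that
  proof (induction w arbitrary: x w')
    case Nil
    then show ?case by (simp add: rw_def)
  next
    case (Cons l w)
    obtain q i a where l: "l = (q, i, a)" by (cases l)
    from Cons.prems(3) l obtain b v where w': "w' = (q, i, b) # v" and eq: "rcls q i a = rcls q i b" "rw w = rw v"
      by (cases w') auto
    have v: "valid w" "valid v" "q \<in> GM n" "a \<in> carrier (pobj A q i)" "b \<in> carrier (pobj A q i)"
      using Cons.prems l w' by auto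
    have "F (VW (x @ l # w)) = F (VW ((x @ [(q, i, b)]) @ w))" using letter[OF Cons.prems(4) v(1,3-5) eq(1)] l by simp
    also have "\<dots> = F (VW ((x @ [(q, i, b)]) @ v))"
        using Cons.IH[OF v(1,2) eq(2), of "x @ [(q, i, b)]"] Cons.prems(4) v by simp
    finally show ?case using w' by simp
  qed
  from this[of "[]"] show ?thesis by simp
qed

definition rep :: "'a set pword \<Rightarrow> 'a pword" where
  "rep u = (SOME w. valid w \<and> rw w = u)"

lemma rep_rw: "valid w \<Longrightarrow> valid (rep (rw w)) \<and> rw (rep (rw w)) = rw w"
  unfolding rep_def by (rule someI[of "\<lambda>v. valid v \<and> rw v = rw w"]) simp

lemma HCT_rep: "F \<in> HCT r m \<Longrightarrow> valid w \<Longrightarrow> F (VW (rep (rw w))) = F (VW w)"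
  using HCT_rw rep_rw by metis

text \<open>The linear extension of \<open>F\<close> to the free module on words of classes, with values moved to perversity \<open>q\<close>.\<close>

definition Psi :: "(('r, 'a) tmod list \<Rightarrow> ('r, 'a) tmod) \<Rightarrow> perv \<Rightarrow> ('a set pword \<Rightarrow> 'r) \<Rightarrow> ('r, 'a) tmod" where
  "Psi F q u = (\<Sum>w | u w \<noteq> \<zero>\<^bsub>R\<^esub>. sc (u w) (pT q (F (VW (rep w)))))"

lemma Psi_superset:
  assumes "finite K" "{w. u w \<noteq> \<zero>\<^bsub>R\<^esub>} \<subseteq> K"
  shows "Psi F q u = (\<Sum>w\<in>K. sc (u w) (pT q (F (VW (rep w)))))"
  unfolding Psi_def by (rule sum.mono_neutral_left) (use assms sc_zero_left in auto)

lemma Psi_zero: "Psi F q \<zero>\<^bsub>FT p k\<^esub> = 0"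
  by (simp add: Psi_def free_module_simps)

lemma Psi_add:
  assumes u: "u \<in> carrier (FT p k)" and v: "v \<in> carrier (FT p k)"
  shows "Psi F q (u \<oplus>\<^bsub>FT p k\<^esub> v) = Psi F q u + Psi F q v"
proof -
  let ?K = "{w. u w \<noteq> \<zero>\<^bsub>R\<^esub>} \<union> {w. v w \<noteq> \<zero>\<^bsub>R\<^esub>}"
  have K: "finite ?K" "{w. (u \<oplus>\<^bsub>FT p k\<^esub> v) w \<noteq> \<zero>\<^bsub>R\<^esub>} \<subseteq> ?K"
    using u v cring.cring_simprules(8)[OF cring cring.cring_simprules(2)[OF cring]] by (auto simp: free_module_simps)
  have R: "u w \<in> carrier R" "v w \<in> carrier R" for w using u v by (auto simp: free_module_simps)
  show ?thesis
    using Psi_superset[OF K] Psi_superset[OF K(1), of u] Psi_superset[OF K(1), of v]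
    by (simp add: free_module_simps sc_add_left R sum.distrib)
qed

lemma Psi_smult:
  assumes u: "u \<in> carrier (FT p k)" and c: "c \<in> carrier R"
  shows "Psi F q (c \<odot>\<^bsub>FT p k\<^esub> u) = sc c (Psi F q u)"
proof -
  let ?K = "{w. u w \<noteq> \<zero>\<^bsub>R\<^esub>}"
  have z: "c \<otimes>\<^bsub>R\<^esub> \<zero>\<^bsub>R\<^esub> = \<zero>\<^bsub>R\<^esub>" using c cring.cring_simprules(27)[OF cring c] by simp
  have K: "finite ?K" "{w. (c \<odot>\<^bsub>FT p k\<^esub> u) w \<noteq> \<zero>\<^bsub>R\<^esub>} \<subseteq> ?K"
    using u z by (auto simp: free_module_simps)
  have R: "u w \<in> carrier R" for w using u by (auto simp: free_module_simps)
  show ?thesis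
    using Psi_superset[OF K] Psi_superset[OF K(1), of u]
    by (simp add: free_module_simps sc_sc[symmetric] R c additive_sum[OF additive_sc[OF c]])
qed

lemma Psi_minus:
  assumes u: "u \<in> carrier (FT p k)" and v: "v \<in> carrier (FT p k)"
  shows "Psi F q (u \<ominus>\<^bsub>FT p k\<^esub> v) = Psi F q u - Psi F q v"
proof -
  interpret M: module R "FT p k" by (rule mod_FT)
  have "Psi F q (u \<ominus>\<^bsub>FT p k\<^esub> v) + Psi F q v = Psi F q ((u \<ominus>\<^bsub>FT p k\<^esub> v) \<oplus>\<^bsub>FT p k\<^esub> v)"
    using Psi_add u v by simp
  also have "(u \<ominus>\<^bsub>FT p k\<^esub> v) \<oplus>\<^bsub>FT p k\<^esub> v = u" using u v by (simp add: a_minus_def M.a_assoc M.l_neg)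
  finally show ?thesis by (simp add: eq_diff_eq)
qed

lemma Psi_gen:
  assumes F: "F \<in> HCT r m" and w: "valid w"
  shows "Psi F q (free_gen R (rw w)) = pT q (F (VW w))"
proof -
  have "Psi F q (free_gen R (rw w)) = (\<Sum>v\<in>{rw w}. sc (free_gen R (rw w) v) (pT q (F (VW (rep v)))))"
    by (rule Psi_superset) (auto simp: free_gen_def)
  then show ?thesis using HCT_rep[OF F w] by (simp add: free_gen_def sc_one cl_pT)
qed

lemma Psi_VS:
  assumes F: "F \<in> HCT r m" and q: "q \<in> GM n" "psum p r \<le> q" and u: "u \<in> carrier (FT p k)"
  shows "VS q (k + m) (Psi F q u)"
    and "q' \<in> GM n \<Longrightarrow> q \<le> q' \<Longrightarrow> pT q' (Psi F q u) = Psi F q' u"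
proof -
  have R: "u w \<in> carrier R" for w using u by (auto simp: free_module_simps)
  have 1: "VS q (k + m) (pT q (F (VW (rep w))))"
    and 2: "q' \<in> GM n \<Longrightarrow> q \<le> q' \<Longrightarrow> pT q' (pT q (F (VW (rep w)))) = pT q' (F (VW (rep w)))" if "u w \<noteq> \<zero>\<^bsub>R\<^esub>" for w
  proof -
    have "w \<in> TW p k" using that u by (auto simp: free_module_simps)
    then obtain v where v: "valid v" "rw v = w" "sumperv v \<le> p" "word_deg v = k" by (rule TW_surj)
    have "psum (sumperv v) r \<le> q" using q(2) psum_mono[OF v(3) order_refl] order_trans by blast
    moreover have "VS (psum (sumperv v) r) (k + m) (F (VW v))" "r \<in> MP"
      using wc_VS[of r m F v] wc_MP[of r m F] F v by (simp_all add: HCT_def)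
    ultimately show "VS q (k + m) (pT q (F (VW (rep w))))"
        "q' \<in> GM n \<Longrightarrow> q \<le> q' \<Longrightarrow> pT q' (pT q (F (VW (rep w)))) = pT q' (F (VW (rep w)))"
      using VS_pT q(1) sumperv_MP[OF v(1)] HCT_rep[OF F v(1)] v(2) by (simp_all add: psum_mono_perv)
  qed
  show "VS q (k + m) (Psi F q u)"
    unfolding Psi_def using q(1) R 1 by (intro VS_sum VS_sc) (simp_all add: GM_mono_perv)
  show "q' \<in> GM n \<Longrightarrow> q \<le> q' \<Longrightarrow> pT q' (Psi F q u) = Psi F q' u"
    unfolding Psi_def additive_sum[OF additive_pT] by (rule sum.cong) (simp_all add: pT_sc R 2)
qed

text \<open>Multilinearity of \<open>F\<close> disposes of the first two kinds of relations, naturality of the third.\<close>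

lemma Psi_NT:
  assumes F: "F \<in> HCT r m" and q: "q \<in> GM n" "psum p r \<le> q" and u: "u \<in> NT p k"
  shows "Psi F q u = 0"
proof -
  interpret M: module R "FT p k" by (rule mod_FT)
  let ?K = "{u \<in> carrier (FT p k). Psi F q u = 0}"
  have L: "linear_fun F" "natural r r m F F" using F by (simp_all add: HCT_def wc_def)
  have "submodule ?K R (FT p k)"
  proof (rule M.submoduleI)
    show "\<ominus>\<^bsub>FT p k\<^esub> a \<in> ?K" if "a \<in> ?K" for a
      using that Psi_minus[of "\<zero>\<^bsub>FT p k\<^esub>" p k a F q] Psi_zero[of F q p k] by (simp add: a_minus_def)
  qed (auto simp: Psi_zero Psi_add Psi_smult additive_zero[OF additive_sc])
  moreover have "rels p k \<subseteq> ?K"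
  proof
    fix g assume g: "g \<in> rels p k"
    have gc: "g \<in> carrier (FT p k)" using g rels_carrier by blast
    from g have "Psi F q g = 0"
    proof (cases rule: rels_cases)
      case (add x q' i a b z)
      let ?w = "x @ (q', i, a) # z" and ?w2 = "x @ (q', i, b) # z" and ?w3 = "x @ (q', i, a \<oplus>\<^bsub>pobj A q' i\<^esub> b) # z"
      have qq: "q' \<in> GM n" "a \<in> carrier (pobj A q' i)" "b \<in> carrier (pobj A q' i)" using add by auto
      have v3: "valid ?w3" using add A_closed(2)[OF qq] by simp
      have c: "free_gen R (rw ?w) \<in> carrier (FT p k)" "free_gen R (rw ?w2) \<in> carrier (FT p k)" "free_gen R (rw ?w3) \<in>
          carrier (FT p k)"
        using add gen_closed[of ?w p k] gen_closed[of ?w2 p k] gen_closed[OF v3, of p k] by simp_all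
      have "F (VW ?w3) = F (VW ?w) + F (VW ?w2)"
        using multi_add[OF linear_funD(1)[OF L(1)]] V_add[OF qq] by simp
      then show ?thesis unfolding add(5)
        using c add(1,2) v3 by (subst Psi_minus, simp_all only: M.a_closed Psi_add Psi_gen[OF F]
            additiveD[OF additive_pT]) simp_all
    next
      case (smult x q' i c a z)
      let ?w = "x @ (q', i, a) # z" and ?w3 = "x @ (q', i, c \<odot>\<^bsub>pobj A q' i\<^esub> a) # z"
      have qq: "q' \<in> GM n" "a \<in> carrier (pobj A q' i)" using smult by auto
      have v3: "valid ?w3" using smult A_closed(4)[OF qq(1) smult(2) qq(2)] by simp
      have c: "free_gen R (rw ?w) \<in> carrier (FT p k)" "free_gen R (rw ?w3) \<in> carrier (FT p k)"
        using smult gen_closed[of ?w p k] gen_closed[OF v3, of p k] by simp_all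
      have "F (VW ?w3) = sc c (F (VW ?w))"
        using dga.homogeneousD[OF linear_funD(2)[OF L(1) smult(2)]] sc_V[OF smult(2) qq] by (simp flip: sc_V[OF smult(2) qq])
      then show ?thesis unfolding smult(5)
        using c smult(1,2) v3 by (subst Psi_minus, simp_all only: M.smult_closed Psi_smult Psi_gen[OF F] pT_sc) simp_all
    next
      case (push w w')
      have c: "free_gen R (rw w) \<in> carrier (FT p k)" "free_gen R (rw w') \<in> carrier (FT p k)"
        using push gen_closed[of w p k] gen_closed[of w' p k] by simp_all
      have "\<exists>xs. related xs \<and> src xs = VW w \<and> tgt xs = VW w' \<and> ptgt xs = sumperv w'"
        using push(3,1)
      proof (induction rule: list_all2_induct)
        case Nil
        then show ?case by (intro exI[of _ "[]"]) simp
      next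
        case (Cons l w l' w')
        obtain q i a where l: "l = (q, i, a)" by (cases l)
        obtain q' a' where l': "l' = (q', i, a')" and p: "q \<le> q'" "q' \<in> GM n" "a' = pmap A q q' i a"
          using Cons.hyps(1) by (cases l') (simp add: l push_def)
        have q: "q \<in> GM n" "a \<in> carrier (pobj A q i)" using Cons.prems l by auto
        obtain xs where "related xs" "src xs = VW w" "tgt xs = VW w'" "ptgt xs = sumperv w'"
          using Cons.IH Cons.prems by (cases l) auto
        then show ?case using PR_V[OF q(1) p(2,1) q(2)] l l' p
          by (intro exI[of _ "(q, q', i, V q i a, V q' i a') # xs"]) simp
      qed
      then obtain xs where xs: "related xs" "src xs = VW w" "tgt xs = VW w'" "ptgt xs = sumperv w'" by blast
      have "psum (ptgt xs) r \<le> q" using push xs q(2) psum_mono[OF _ order_refl] order_trans by metis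
      from PR_pT[OF naturalD[OF L(2) xs(1)] q(1) this] have "pT q (F (VW w')) = pT q (F (VW w))" by (simp add: xs)
      then show ?thesis unfolding push(8)
        using c push(1,2) by (subst Psi_minus, simp_all only: Psi_gen[OF F]) simp_all
    qed
    then show "g \<in> ?K" using gc by simp
  qed
  ultimately have "NT p k \<subseteq> ?K" unfolding NT_span by (rule submodule_span_least)
  then show ?thesis using u by blast
qed

text \<open>The choice of a representative is harmless by \<open>Psi_NT\<close>.\<close>

definition iPhi :: "perv \<Rightarrow> int \<Rightarrow> (('r, 'a) tmod list \<Rightarrow> ('r, 'a) tmod) \<Rightarrow> ('r, 'a) cochain" where
  "iPhi r m F = (\<lambda>(p, q, k, X) \<in> hom_dom n (bar R n A) r. comp (q, k + m) (Psi F q (SOME u. u \<in> X)))"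

lemma iPhi_eval:
  assumes F: "F \<in> HCT r m" and p: "p \<in> GM n" "q \<in> GM n" "psum p r \<le> q" and u: "u \<in> carrier (FT p k)"
  shows "V q (k + m) (iPhi r m F (p, q, k, bcls p k u)) = Psi F q u"
    and "iPhi r m F (p, q, k, bcls p k u) \<in> carrier (pobj A q (k + m))"
proof -
  interpret B: submodule_of R "FT p k" "NT p k" by (rule sub_NT)
  let ?v = "SOME v. v \<in> bcls p k u"
  have "?v \<in> bcls p k u" by (rule someI[of "\<lambda>v. v \<in> bcls p k u", OF B.cls_self[OF u]])
  then have v: "?v \<in> carrier (FT p k)" "bcls p k ?v = bcls p k u" using B.cls_eqD[OF u] by auto
  then have "?v \<ominus>\<^bsub>FT p k\<^esub> u \<in> NT p k" using B.cls_eq_iff[OF v(1) u] by simp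
  then have "Psi F q (?v \<ominus>\<^bsub>FT p k\<^esub> u) = 0" by (rule Psi_NT[OF F p(2,3)])
  then have "Psi F q ?v = Psi F q u" unfolding Psi_minus[OF v(1) u] by simp
  moreover have "bcls p k u \<in> carrier (BT p k)" using u by (simp add: carrier_BT)
  ultimately have e: "iPhi r m F (p, q, k, bcls p k u) = comp (q, k + m) (Psi F q u)"
    using p by (simp add: iPhi_def hom_dom_def)
  show "V q (k + m) (iPhi r m F (p, q, k, bcls p k u)) = Psi F q u"
    "iPhi r m F (p, q, k, bcls p k u) \<in> carrier (pobj A q (k + m))"
    unfolding e using VS_comp[OF Psi_VS(1)[OF F p(2,3) u] p(2)] by auto
qed

lemma mod_coset: "X \<in> carrier (BT p k) \<Longrightarrow> \<exists>u\<in>carrier (FT p k). X = bcls p k u"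
  by (auto simp: carrier_BT)

lemma iPhi_HCo:
  assumes F: "F \<in> HCT r m"
  shows "iPhi r m F \<in> carrier (HCo r m)"
  unfolding HCo_iff
proof (intro conjI ballI allI impI)
  show "iPhi r m F \<in> (\<Pi>\<^sub>E (p, q, k, x) \<in> hom_dom n (bar R n A) r. carrier (pobj A q (k + m)))"
  proof (rule PiE_I)
    fix y assume "y \<in> hom_dom n (bar R n A) r"
    then obtain p q k X where y: "y = (p, q, k, X)" "p \<in> GM n" "q \<in> GM n" "psum p r \<le> q" "X \<in> carrier (BT p k)"
      by (auto simp: hom_dom_def)
    then show "iPhi r m F y \<in> (case y of (p, q, k, x) \<Rightarrow> carrier (pobj A q (k + m)))"
      using iPhi_eval(2)[OF F y(2-4)] mod_coset[OF y(5)] by auto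
  qed (simp add: iPhi_def)
next
  fix p q k assume p: "p \<in> GM n" "q \<in> GM n" "psum p r \<le> q"
  interpret B: submodule_of R "FT p k" "NT p k" by (rule sub_NT)
  note ev = iPhi_eval[OF F p] and inj = V_inj[OF p(2)]
  show "(\<lambda>x. iPhi r m F (p, q, k, x)) \<in> lin_maps R (BT p k) (pobj A q (k + m))"
    unfolding lin_maps_def hom_def
  proof (intro CollectI conjI ballI funcsetI, simp_all)
    fix X assume X: "X \<in> carrier (BT p k)"
    then obtain u where u: "u \<in> carrier (FT p k)" "X = bcls p k u" using mod_coset by blast
    show "iPhi r m F (p, q, k, X) \<in> carrier (pobj A q (k + m))" using ev u by simp
    show "iPhi r m F (p, q, k, c \<odot>\<^bsub>BT p k\<^esub> X) = c \<odot>\<^bsub>pobj A q (k + m)\<^esub> iPhi r m F (p, q, k, X)" if c: "c \<in> carrier R" for c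
    proof (rule inj)
      have cu: "c \<odot>\<^bsub>FT p k\<^esub> u \<in> carrier (FT p k)" using u c by simp
      have e: "c \<odot>\<^bsub>BT p k\<^esub> X = bcls p k (c \<odot>\<^bsub>FT p k\<^esub> u)" using u c unfolding BT_quot by (simp add: B.cls_smult)
      show "iPhi r m F (p, q, k, c \<odot>\<^bsub>BT p k\<^esub> X) \<in> carrier (pobj A q (k + m))" using ev(2)[OF cu] e by simp
      show "c \<odot>\<^bsub>pobj A q (k + m)\<^esub> iPhi r m F (p, q, k, X) \<in> carrier (pobj A q (k + m))"
        using A_closed(4)[OF p(2) c ev(2)[OF u(1)]] u by simp
      show "V q (k + m) (iPhi r m F (p, q, k, c \<odot>\<^bsub>BT p k\<^esub> X)) = V q (k + m) (c \<odot>\<^bsub>pobj A q (k + m)\<^esub> iPhi r m F (p, q, k, X))"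
        unfolding e ev(1)[OF cu] using Psi_smult[OF u(1) c] sc_V[OF c p(2) ev(2)[OF u(1)]] ev(1)[OF u(1)] u(2) by simp
    qed
    fix Y assume "Y \<in> carrier (BT p k)"
    then obtain v where v: "v \<in> carrier (FT p k)" "Y = bcls p k v" using mod_coset by blast
    show "iPhi r m F (p, q, k, X \<oplus>\<^bsub>BT p k\<^esub> Y) = iPhi r m F (p, q, k, X) \<oplus>\<^bsub>pobj A q (k + m)\<^esub> iPhi r m F (p, q, k, Y)"
    proof (rule inj)
      have cu: "u \<oplus>\<^bsub>FT p k\<^esub> v \<in> carrier (FT p k)" using u v by simp
      have e: "X \<oplus>\<^bsub>BT p k\<^esub> Y = bcls p k (u \<oplus>\<^bsub>FT p k\<^esub> v)" using u v unfolding BT_quot by (simp add: B.cls_add)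
      show "iPhi r m F (p, q, k, X \<oplus>\<^bsub>BT p k\<^esub> Y) \<in> carrier (pobj A q (k + m))" using ev(2)[OF cu] e by simp
      show "iPhi r m F (p, q, k, X) \<oplus>\<^bsub>pobj A q (k + m)\<^esub> iPhi r m F (p, q, k, Y) \<in> carrier (pobj A q (k + m))"
        using A_closed(2)[OF p(2) ev(2)[OF u(1)] ev(2)[OF v(1)]] u v by simp
      show "V q (k + m) (iPhi r m F (p, q, k, X \<oplus>\<^bsub>BT p k\<^esub> Y))
          = V q (k + m) (iPhi r m F (p, q, k, X) \<oplus>\<^bsub>pobj A q (k + m)\<^esub> iPhi r m F (p, q, k, Y))"
        unfolding e ev(1)[OF cu]
        using Psi_add[OF u(1) v(1)] V_add[OF p(2) ev(2)[OF u(1)] ev(2)[OF v(1)]] ev(1)[OF u(1)] ev(1)[OF v(1)] u(2)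
            v(2) by simp
    qed
  qed
next
  fix p q p' q' k X
  assume p: "p \<in> GM n" "q \<in> GM n" "p' \<in> GM n" "q' \<in> GM n" and X: "X \<in> carrier (BT p' k)"
    and le: "p' \<le> p \<and> psum p r \<le> q \<and> q \<le> q'"
  obtain u where u: "u \<in> carrier (FT p' k)" "X = bcls p' k u" using mod_coset[OF X] by blast
  have u': "u \<in> carrier (FT p k)" using FT_mono[of p' p k] le u by auto
  have le': "psum p' r \<le> q'" using le psum_mono[of p' p r r] order_trans by (metis order_refl)
  have qq: "psum p r \<le> q" "q \<le> q'" using le by auto
  note e1 = iPhi_eval[OF F p(3,4) le' u(1)] and e2 = iPhi_eval[OF F p(1,2) qq(1) u']
  have pm: "pmap A q q' (k + m) (iPhi r m F (p, q, k, bcls p k u)) \<in> carrier (pobj A q' (k + m))"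
    by (rule mapD(1)[OF p(2,4) qq(2) e2(2)])
  have "V q' (k + m) (iPhi r m F (p', q', k, X)) = pT q' (Psi F q u)"
    using e1(1) u(2) Psi_VS(2)[OF F p(2) qq(1) u' p(4) qq(2)] by simp
  also have "\<dots> = V q' (k + m) (pmap A q q' (k + m) (iPhi r m F (p, q, k, bcls p k u)))"
    unfolding e2(1)[symmetric] by (rule pT_V[OF p(2,4) qq(2) e2(2)])
  finally show "iPhi r m F (p', q', k, X) = pmap A q q' (k + m) (iPhi r m F (p, q, k, pmap (bar R n A) p' p k X))"
    using V_inj[OF p(4) _ pm] e1(2) u(2) bar_map[OF _ u(1), of p] le by simp
qed

lemma LT_iPhi:
  assumes F: "F \<in> HCT r m" and w: "valid w"
  shows "LT r m (iPhi r m F) w = F (VW w)"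
proof -
  have r: "r \<in> MP" using F wc_MP by (auto simp: HCT_def)
  have VSw: "VS (psum (sumperv w) r) (word_deg w + m) (F (VW w))"
    using F w wc_VS by (auto simp: HCT_def)
  show ?thesis
  proof (cases "good r w")
    case True
    note g = good_GM[OF True r]
    note ev = iPhi_eval[OF F g(3,4,5) gen_closed[OF w g(7) refl]]
    have le: "psum (sumperv w) r \<le> wtag r w"
      unfolding wtag_def using True r g(1) by (intro gm_hull_ge) (simp_all add: good_def psum_mono_perv)
    have "LT r m (iPhi r m F) w = pT (wtag r w) (F (VW w))"
      unfolding LT_def hval_eq(2)[OF True r] bw_eq using True ev(1) Psi_gen[OF F w] by simp
    also have "\<dots> = F (VW w)"
    proof -
      have "VS (wtag r w) (word_deg w + m) (F (VW w))"
        using VSw True g(4) by (simp add: VS_def good_def GM_le_top gm_hull_id wtag_def)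
      then show ?thesis using g(4) by (rule pT_id)
    qed
    finally show ?thesis .
  next
    case False
    then show ?thesis using VSw w by (simp add: LT_def VS_def good_def)
  qed
qed

lemma Phi_iPhi:
  assumes F: "F \<in> HCT r m"
  shows "Phi r m (iPhi r m F) = F"
proof -
  have r: "r \<in> MP" and L: "linear_fun F" using F wc_MP by (auto simp: HCT_def wc_def)
  note f = iPhi_HCo[OF F]
  show ?thesis
    by (rule multiadditive_eqI)
       (use linear_funD[OF L] linear_funD[OF Phi_linear[OF f r]] Phi_VW[OF f r] LT_iPhi[OF F] in simp_all)
qed

text \<open>The bar construction is generated by words, and cochains are linear and natural.\<close>

lemma HCo_eqI:
  assumes f: "f \<in> carrier (HCo r m)" and g: "g \<in> carrier (HCo r m)" and r: "r \<in> MP"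
    and eq: "\<And>w. good r w \<Longrightarrow> cv r m f w = cv r m g w"
  shows "f = g"
proof
  fix y
  show "f y = g y"
  proof (cases "y \<in> hom_dom n (bar R n A) r")
    case True
    then obtain p q k X where y: "y = (p, q, k, X)" "p \<in> GM n" "q \<in> GM n" "psum p r \<le> q" "X \<in> carrier (BT p k)"
      by (auto simp: hom_dom_def)
    interpret B: submodule_of R "FT p k" "NT p k" by (rule sub_NT)
    obtain u where u: "u \<in> carrier (FT p k)" "X = bcls p k u" using mod_coset[OF y(5)] by blast
    note lf = lin_mapsD[OF HCo_lin[OF f y(2-4)]] and lg = lin_mapsD[OF HCo_lin[OF g y(2-4)]]
    have "f (p, q, k, bcls p k u) = g (p, q, k, bcls p k u)"
    proof (rule free_module_induct[OF cring u(1), where P = "\<lambda>u. f (p, q, k, bcls p k u) = g (p, q, k, bcls p k u)"])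
      have z: "\<zero>\<^bsub>FT p k\<^esub> = \<zero>\<^bsub>R\<^esub> \<odot>\<^bsub>FT p k\<^esub> \<zero>\<^bsub>FT p k\<^esub>" by simp
      have zc: "\<zero>\<^bsub>R\<^esub> \<in> carrier R" by (rule cring.cring_simprules(2)[OF cring])
      have b: "bcls p k \<zero>\<^bsub>FT p k\<^esub> = \<zero>\<^bsub>R\<^esub> \<odot>\<^bsub>BT p k\<^esub> bcls p k \<zero>\<^bsub>FT p k\<^esub>"
        unfolding BT_quot by (subst B.cls_smult) (simp_all add: zc)
      have bc: "bcls p k \<zero>\<^bsub>FT p k\<^esub> \<in> carrier (BT p k)" unfolding BT_quot by simp
      show "f (p, q, k, bcls p k \<zero>\<^bsub>FT p k\<^esub>) = g (p, q, k, bcls p k \<zero>\<^bsub>FT p k\<^esub>)"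
        using lf(3)[OF zc bc] lg(3)[OF zc bc] b module.smult_l_null[OF mod_A[OF y(3)]] lf(1)[OF bc] lg(1)[OF bc] by simp
    next
      fix u c v
      assume 2: "u \<in> carrier (FT p k)" "c \<in> carrier R" "v \<in> TW p k" "f (p, q, k, bcls p k u) = g (p, q, k, bcls p k u)"
      obtain w where w: "valid w" "rw w = v" "sumperv w \<le> p" "word_deg w = k" using TW_surj[OF 2(3)] .
      have bwv: "bcls p k (free_gen R v) = bw p w" using w by (simp add: bw_eq)
      have c: "bcls p k u \<in> carrier (BT p k)" "bw p w \<in> carrier (BT p k)" using 2 bw_closed[OF w(1,3)] w
          by (simp_all add: carrier_BT)
      have gc: "free_gen R v \<in> carrier (FT p k)" using gen_closed[OF w(1,3,4)] w by simp
      have "bcls p k (u \<oplus>\<^bsub>FT p k\<^esub> c \<odot>\<^bsub>FT p k\<^esub> free_gen R v) = bcls p k u \<oplus>\<^bsub>BT p k\<^esub> c \<odot>\<^bsub>BT p k\<^esub> bw p w"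
        unfolding bwv[symmetric] BT_quot using 2 gc by (simp add: B.cls_add B.cls_smult)
      moreover have "c \<odot>\<^bsub>BT p k\<^esub> bw p w \<in> carrier (BT p k)" using module.smult_closed[OF module_BT 2(2) c(2)] .
      moreover have "f (p, q, k, bw p w) = g (p, q, k, bw p w)"
        using cv_general[OF f r w(1) y(2,3) w(3) y(4)] cv_general[OF g r w(1) y(2,3) w(3) y(4)] eq[of w] w(4) by simp
      ultimately show "f (p, q, k, bcls p k (u \<oplus>\<^bsub>FT p k\<^esub> c \<odot>\<^bsub>FT p k\<^esub> free_gen R v)) =
          g (p, q, k, bcls p k (u \<oplus>\<^bsub>FT p k\<^esub> c \<odot>\<^bsub>FT p k\<^esub> free_gen R v))" using lf(2,3) lg(2,3) c 2 by simp
    qed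
    then show ?thesis using y u by simp
  next
    case False
    show ?thesis
      using PiE_arb[OF conjunct1[OF f[unfolded HCo_iff]] False] PiE_arb[OF conjunct1[OF g[unfolded HCo_iff]] False] by simp
  qed
qed

lemma LT_eq_cv:
  assumes "f \<in> carrier (HCo r m)" "g \<in> carrier (HCo r m)" "r \<in> MP" "good r w" "LT r m f w = LT r m g w"
  shows "cv r m f w = cv r m g w"
  using assms V_inj[OF good_GM(4)[OF assms(4,3)] cv_closed[OF assms(1,3,4)] cv_closed[OF assms(2,3,4)]] by (simp add: LT_def)

lemma Phi_inj:
  assumes f: "f \<in> carrier (HCo r m)" and g: "g \<in> carrier (HCo r m)" and r: "r \<in> MP" and eq: "Phi r m f = Phi r m g"
  shows "f = g"
proof (rule HCo_eqI[OF f g r])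
  fix w assume w: "good r w"
  then have "LT r m f w = LT r m g w" using Phi_VW[OF f r] Phi_VW[OF g r] eq by (simp add: good_def)
  then show "cv r m f w = cv r m g w" using LT_eq_cv f g r w by blast
qed

lemma iPhi_Phi: "f \<in> carrier (HCo r m) \<Longrightarrow> r \<in> MP \<Longrightarrow> iPhi r m (Phi r m f) = f"
  by (rule Phi_inj[OF iPhi_HCo[OF Phi_HCT] _ _ Phi_iPhi[OF Phi_HCT]])

text \<open>The operations on cochains are prescribed by their values on words. It suffices to compare these values, inside
\<open>T\<close>, with a known word cochain.\<close>

lemma cochain_of_eq:
  assumes F: "F \<in> HCT r m"
    and phi: "\<And>w. good r w \<Longrightarrow> phi w \<in> carrier (pobj A (wtag r w) (word_deg w + m))
        \<and> V (wtag r w) (word_deg w + m) (phi w) = F (VW w)"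
  shows "cochain_of R n A r m phi = iPhi r m F"
proof -
  have r: "r \<in> MP" using F wc_MP by (auto simp: HCT_def)
  note f = iPhi_HCo[OF F]
  have cvphi: "cv r m (iPhi r m F) w = phi w" if w: "good r w" for w
  proof (rule V_inj[OF good_GM(4)[OF w r] cv_closed[OF f r w]])
    show "phi w \<in> carrier (pobj A (wtag r w) (word_deg w + m))" using phi w by blast
    show "V (wtag r w) (word_deg w + m) (cv r m (iPhi r m F) w) = V (wtag r w) (word_deg w + m) (phi w)"
      using LT_iPhi[OF F, of w] phi[OF w] w by (simp add: LT_def good_def)
  qed
  show ?thesis unfolding cochain_of_def
  proof (rule the_equality)
    show "iPhi r m F \<in> carrier (HCo r m) \<and> (\<forall>w\<in>hoch_words n A r. elt (hval R n A r m (iPhi r m F) w) = phi w)"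
      using f cvphi by (auto simp: cv_def hoch_words_iff)
    fix g assume g: "g \<in> carrier (HCo r m) \<and> (\<forall>w\<in>hoch_words n A r. elt (hval R n A r m g w) = phi w)"
    show "g = iPhi r m F"
      by (rule HCo_eqI[OF _ f r]) (use g cvphi in \<open>auto simp: cv_def hoch_words_iff\<close>)
  qed
qed

section \<open>The Hochschild operations as operations on multiadditive functions\<close>

text \<open>The letter of a word as an element of \<open>T\<close>.\<close>

definition lt :: "perv \<times> int \<times> 'a \<Rightarrow> ('r, 'a) tmod" where
  "lt x = V (fst x) (fst (snd x)) (elt x)"

lemma VW_lt: "VW w = map lt w"
  by (simp add: VW_def lt_def elt_def case_prod_beta)

lemma VW_take: "take i (VW w) = VW (take i w)" "drop i (VW w) = VW (drop i w)" "length (VW w) = length w"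
  "i < length w \<Longrightarrow> VW w ! i = lt (w ! i)" "w \<noteq> [] \<Longrightarrow> hd (VW w) = lt (hd w)" "w \<noteq> [] \<Longrightarrow> last (VW w) = lt (last w)"
  "tl (VW w) = VW (tl w)" "butlast (VW w) = VW (butlast w)" "VW w = [] \<longleftrightarrow> w = []"
  by (simp_all add: VW_lt take_map drop_map hd_map last_map map_tl map_butlast)

lemma valid_single: "valid [x] \<longleftrightarrow> fst x \<in> GM n \<and> elt x \<in> carrier (pobj A (fst x) (fst (snd x)))"
  by (cases x) (simp add: elt_def)

lemma V_finsum:
  assumes p: "p \<in> GM n" and f: "f \<in> I \<rightarrow> carrier (pobj A p k)" and fin: "finite I"
  shows "V p k (finsum (pobj A p k) f I) = (\<Sum>i\<in>I. V p k (f i)) \<and> finsum (pobj A p k) f I \<in> carrier (pobj A p k)"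
proof -
  interpret abelian_group "pobj A p k" by (rule ab_A[OF p])
  show ?thesis using fin f
  proof (induction I rule: finite_induct)
    case (insert i I)
    then show ?case by (simp add: V_add[OF p] Pi_iff)
  qed (simp add: V_zero[OF p])
qed

lemma wtag_hull:
  assumes rs: "r \<in> GM n" "s \<in> GM n" "psum r s \<le> gm_top n"
  shows "good (gm_add n r s) w \<longleftrightarrow> good (psum r s) w" "valid w \<Longrightarrow> wtag (gm_add n r s) w = wtag (psum r s) w"
proof -
  have MP: "psum r s \<in> MP" using rs by (simp add: psum_mono_perv GM_mono_perv)
  have "psum (gm_hull n (psum r s)) u \<le> gm_top n \<longleftrightarrow> psum (psum r s) u \<le> gm_top n"
    "gm_hull n (psum (gm_hull n (psum r s)) u) = gm_hull n (psum (psum r s) u)" if "u \<in> MP" for u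
    using hull_psum_top gm_hull_psum MP rs(3) that by auto
  then show "good (gm_add n r s) w \<longleftrightarrow> good (psum r s) w" "valid w \<Longrightarrow> wtag (gm_add n r s) w = wtag (psum r s) w"
    using sumperv_MP[of w] by (auto simp: good_def wtag_def gm_add_def psum_commute[of "sumperv w"])
qed

lemma hval_letter:
  assumes f: "f \<in> carrier (HCo r m)" and r: "r \<in> MP" and g: "good r w"
  shows "fst (hval R n A r m f w) = wtag r w" "fst (snd (hval R n A r m f w)) = word_deg w + m"
    "lt (hval R n A r m f w) = Phi r m f (VW w)" "valid [hval R n A r m f w]"
    "elt (hval R n A r m f w) \<in> carrier (pobj A (wtag r w) (word_deg w + m))"
  using hval_eq(1)[OF g r] cv_closed[OF f r g] Phi_VW[OF f r, of w] g good_GM(4)[OF g r]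
  by (simp_all add: lt_def elt_def LT_def good_def)

lemma good_psum:
  assumes "good (psum r s) (x @ y @ z)"
  shows "good r (x @ z)" "good s y" "valid x" "valid y" "valid z"
proof -
  have v: "valid x" "valid y" "valid z" using assms by (simp_all add: good_def)
  have "psum (sumperv (x @ z)) r \<le> psum (sumperv (x @ y @ z)) (psum r s)"
    "psum (sumperv y) s \<le> psum (sumperv (x @ y @ z)) (psum r s)"
    by (simp_all add: psum_def le_fun_def)
  then show "good r (x @ z)" "good s y" using assms v order_trans by (auto simp: good_def)
  show "valid x" "valid y" "valid z" by (rule v)+
qed

text \<open>A value \<open>g[y]\<close> used as a letter has the hull of \<open>y + s\<close> as perversity. Replacing \<open>y + s\<close> by this hull does not
change the perversity of the word.\<close>

lemma good_insert:
  assumes g: "good (psum r s) (x @ y @ z)" and rs: "r \<in> MP" "s \<in> MP" and l: "valid [l]" "fst l = wtag s y"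
  shows "good r (x @ l # z)" "wtag r (x @ l # z) = wtag (psum r s) (x @ y @ z)"
proof -
  note gp = good_psum[OF g]
  have MP: "sumperv x \<in> MP" "sumperv y \<in> MP" "sumperv z \<in> MP" using gp sumperv_MP by auto
  have u: "psum (sumperv y) s \<in> MP" "psum (sumperv y) s \<le> gm_top n" using MP rs gp(2)
      by (simp_all add: psum_mono_perv good_def)
  have v: "psum (sumperv x) (psum (sumperv z) r) \<in> MP" using MP rs by (simp add: psum_mono_perv)
  have e1: "psum (sumperv (x @ l # z)) r = psum (gm_hull n (psum (sumperv y) s)) (psum (sumperv x) (psum (sumperv z) r))"
    using l by (simp add: wtag_def psum_ac)
  have e2: "psum (sumperv (x @ y @ z)) (psum r s) = psum (psum (sumperv y) s) (psum (sumperv x) (psum (sumperv z) r))"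
    by (simp add: psum_ac)
  have "valid (x @ l # z)" using gp l by (cases l) simp
  then show "good r (x @ l # z)"
    using g hull_psum_top[OF u(1) v u(2)] unfolding good_def e1 e2 by simp
  show "wtag r (x @ l # z) = wtag (psum r s) (x @ y @ z)"
    unfolding wtag_def e1 e2 by (rule gm_hull_psum[OF u v])
qed

lemma hval_insert:
  assumes f: "f \<in> carrier (HCo r m)" and g: "g \<in> carrier (HCo s l)" and rs: "r \<in> MP" "s \<in> MP"
    and w: "good (psum r s) (x @ y @ z)"
  defines "h \<equiv> hval R n A r m f (x @ hval R n A s l g y # z)"
  shows "lt h = Phi r m f (VW x @ Phi s l g (VW y) # VW z)" "fst h = wtag (psum r s) (x @ y @ z)"
    "fst (snd h) = word_deg (x @ y @ z) + (m + l - 1)" "valid [h]"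
proof -
  note gp = good_psum[OF w]
  note hg = hval_letter[OF g rs(2) gp(2)]
  note gi = good_insert[OF w rs hg(4,1)]
  note hf = hval_letter[OF f rs(1) gi(1)]
  show "lt h = Phi r m f (VW x @ Phi s l g (VW y) # VW z)" unfolding h_def hf(3) by (simp add: VW_lt hg(3))
  show "fst h = wtag (psum r s) (x @ y @ z)" "fst (snd h) = word_deg (x @ y @ z) + (m + l - 1)" "valid [h]"
    unfolding h_def using hf gi hg by simp_all
qed

lemma hmul_letter:
  assumes "valid [a]" "valid [b]" "psum (fst a) (fst b) \<le> gm_top n"
  shows "lt (hmul n A a b) = mulT (lt a) (lt b)" "fst (hmul n A a b) = gm_add n (fst a) (fst b)"
    "fst (snd (hmul n A a b)) = fst (snd a) + fst (snd b)" "valid [hmul n A a b]"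
proof -
  obtain p i x where a: "a = (p, i, x)" by (cases a)
  obtain q j y where b: "b = (q, j, y)" by (cases b)
  have *: "p \<in> GM n" "x \<in> carrier (pobj A p i)" "q \<in> GM n" "y \<in> carrier (pobj A q j)" "psum p q \<le> gm_top n"
    using assms by (simp_all add: a b)
  show "lt (hmul n A a b) = mulT (lt a) (lt b)" "fst (hmul n A a b) = gm_add n (fst a) (fst b)"
    "fst (snd (hmul n A a b)) = fst (snd a) + fst (snd b)" "valid [hmul n A a b]"
    using * mul_closed[OF *(1,3,5,2,4)] gm_add_GM[OF *(1,3,5)] by (simp_all add: a b hmul_def lt_def elt_def mulT_V)
qed

lemma hdiff_letter:
  assumes "valid [a]"
  shows "lt (hdiff A a) = dT (lt a)" "fst (hdiff A a) = fst a" "fst (snd (hdiff A a)) = fst (snd a) + 1" "valid [hdiff A a]"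
proof -
  obtain p i x where a: "a = (p, i, x)" by (cases a)
  have *: "p \<in> GM n" "x \<in> carrier (pobj A p i)" using assms by (simp_all add: a)
  show "lt (hdiff A a) = dT (lt a)" "fst (hdiff A a) = fst a" "fst (snd (hdiff A a)) = fst (snd a) + 1" "valid [hdiff A a]"
    using * diffD(1)[OF *] by (simp_all add: a hdiff_def lt_def elt_def dT_V)
qed

lemma sgn_elt:
  assumes "valid [x]" "fst x = p" "fst (snd x) = k"
  shows "V p k (sgn_mult (pobj A p k) e (elt x)) = sg e (lt x)" "sgn_mult (pobj A p k) e (elt x) \<in> carrier (pobj A p k)"
    "V p k (elt x) = lt x" "elt x \<in> carrier (pobj A p k)"
  using assms sgn_mult_V[of p "elt x" k e] sgn_mult_closed[of p "elt x" k e] by (simp_all add: valid_single lt_def)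

lemma hoch_cup_eq:
  assumes f: "f \<in> carrier (HCo r m)" and g: "g \<in> carrier (HCo s l)" and rs: "r \<in> GM n" "s \<in> GM n" "psum r s \<le> gm_top n"
  shows "hoch_cup R n A r s m l f g = iPhi (gm_add n r s) (m + l) (dga.cup l (Phi r m f) (Phi s l g))"
proof -
  let ?F = "Phi r m f" and ?G = "Phi s l g"
  note MP = rs(1,2)[THEN GM_mono_perv]
  have F: "?F \<in> HCT r m" and G: "?G \<in> HCT s l" using Phi_HCT f g MP by auto
  have FM: "multiadditive ?F" using F wc_multi by (auto simp: HCT_def)
  have MPrs: "gm_add n r s \<in> MP" using gm_add_GM[OF rs] GM_mono_perv by blast
  show ?thesis unfolding hoch_cup_def
  proof (rule cochain_of_eq[OF HCT_cup[OF F G rs(3)]])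
    fix w assume w: "good (gm_add n r s) w"
    have v: "valid w" using w by (simp add: good_def)
    have w': "good (psum r s) w" using w wtag_hull(1)[OF rs] by simp
    let ?p = "wtag (gm_add n r s) w" and ?k = "word_deg w + (m + l)"
    have p: "?p \<in> GM n" using good_GM(4)[OF w MPrs] .
    let ?x = "\<lambda>i. hmul n A (hval R n A r m f (take i w)) (hval R n A s l g (drop i w))"
    have x: "valid [?x i] \<and> fst (?x i) = ?p \<and> fst (snd (?x i)) = ?k \<and> lt (?x i)
        = mulT (?F (VW (take i w))) (?G (VW (drop i w)))" for i
    proof -
      let ?a = "take i w" and ?b = "drop i w"
      have gw: "good (psum r s) (?a @ ?b @ [])" "good (psum s r) ([] @ ?a @ ?b)" using w' by (simp_all add: psum_commute)
      have ga: "good r ?a" and gb: "good s ?b" using good_psum(1,2)[OF gw(1)] by simp_all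
      note ha = hval_letter[OF f MP(1) ga] and hb = hval_letter[OF g MP(2) gb]
      have ab: "sumperv w = psum (sumperv ?a) (sumperv ?b)" "word_deg w = word_deg ?a + word_deg ?b"
        using sumperv_simps(3)[of ?a ?b] word_deg_simps(3)[of ?a ?b] by simp_all
      have u: "psum (sumperv ?a) r \<in> MP" "psum (sumperv ?b) s \<in> MP" "psum (sumperv ?a) r \<le> gm_top n" "psum
          (sumperv ?b) s \<le> gm_top n"
        using ga gb MP sumperv_MP by (auto simp: good_def psum_mono_perv)
      have e: "psum (psum (sumperv ?a) r) (psum (sumperv ?b) s) = psum (sumperv w) (psum r s)" by (simp add: ab psum_ac)
      have le: "psum (wtag r ?a) (wtag s ?b) \<le> gm_top n"
        using hull2_psum_top[OF u] w' unfolding e wtag_def by (simp add: good_def)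
      have t: "gm_add n (wtag r ?a) (wtag s ?b) = ?p"
        using gm_add_hull[OF u] wtag_hull(2)[OF rs v] unfolding e wtag_def by simp
      note hm = hmul_letter[OF ha(4) hb(4), unfolded ha(1) hb(1), OF le]
      show ?thesis using hm ha hb t ab by simp
    qed
    have "V ?p ?k (\<Oplus>\<^bsub>pobj A ?p ?k\<^esub> i \<in> {..length w}. sgn_mult (pobj A ?p ?k) (l * word_deg (take i w)) (elt (?x i))) =
       (\<Sum>i\<le>length w. V ?p ?k (sgn_mult (pobj A ?p ?k) (l * word_deg (take i w)) (elt (?x i)))) \<and>
       (\<Oplus>\<^bsub>pobj A ?p ?k\<^esub> i \<in> {..length w}. sgn_mult (pobj A ?p ?k) (l * word_deg (take i w)) (elt (?x i))) \<in> carrier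
           (pobj A ?p ?k)"
      using x sgn_elt(2) by (intro V_finsum[OF p]) auto
    moreover have "V ?p ?k (sgn_mult (pobj A ?p ?k) (l * word_deg (take i w)) (elt (?x i))) =
        mulT (?F (dga.tw l (take i (VW w)))) (?G (drop i (VW w)))" for i
    proof -
      have "?F (dga.tw l (VW (take i w))) = sg (l * word_deg (take i w)) (?F (VW (take i w)))"
        using tw_V[OF FM, of "[]" l "take i w" "[]"] by simp
      then show ?thesis using x[of i] sgn_elt(1)[of "?x i" ?p ?k] by (simp add: VW_take dga.sg_mul)
    qed
    ultimately show "(let M = pobj A (gm_add n (word_perv n w) (gm_add n r s)) (word_deg w + (m + l))
         in \<Oplus>\<^bsub>M\<^esub>i\<in>{..length w}. sgn_mult M (l * word_deg (take i w)) (elt (?x i))) \<in> carrier (pobj A ?p ?k) \<and>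
        V ?p ?k (let M = pobj A (gm_add n (word_perv n w) (gm_add n r s)) (word_deg w + (m + l))
         in \<Oplus>\<^bsub>M\<^esub>i\<in>{..length w}. sgn_mult M (l * word_deg (take i w)) (elt (?x i))) = dga.cup l ?F ?G (VW w)"
      unfolding good_GM(6)[OF w MPrs] Let_def dga.cup_sum by (simp add: VW_take(3))
  qed
qed

lemma hoch_circ_eq:
  assumes f: "f \<in> carrier (HCo r m)" and g: "g \<in> carrier (HCo s l)" and rs: "r \<in> GM n" "s \<in> GM n" "psum r s \<le> gm_top n"
  shows "hoch_circ R n A r s m l f g = iPhi (gm_add n r s) (m + l - 1) (dga.circ l (Phi r m f) (Phi s l g))"
proof -
  let ?F = "Phi r m f" and ?G = "Phi s l g"
  note MP = rs(1,2)[THEN GM_mono_perv]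
  have F: "?F \<in> HCT r m" and G: "?G \<in> HCT s l" using Phi_HCT f g MP by auto
  have FM: "multiadditive ?F" using F wc_multi by (auto simp: HCT_def)
  have MPrs: "gm_add n r s \<in> MP" using gm_add_GM[OF rs] GM_mono_perv by blast
  show ?thesis unfolding hoch_circ_def
  proof (rule cochain_of_eq[OF HCT_circ[OF F G rs(3)]])
    fix w assume w: "good (gm_add n r s) w"
    have v: "valid w" using w by (simp add: good_def)
    have w': "good (psum r s) w" using w wtag_hull(1)[OF rs] by simp
    let ?p = "wtag (gm_add n r s) w" and ?k = "word_deg w + (m + l - 1)"
    have p: "?p \<in> GM n" using good_GM(4)[OF w MPrs] .
    let ?x = "\<lambda>i j. hval R n A r m f (take i w @ [hval R n A s l g (drop i (take j w))] @ drop j w)"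
    have x: "valid [?x i j] \<and> fst (?x i j) = ?p \<and> fst (snd (?x i j)) = ?k \<and>
        lt (?x i j) = ?F (VW (take i w) @ ?G (VW (drop i (take j w))) # VW (drop j w))" if "i \<le> j" for i j
    proof -
      have e: "take i w @ drop i (take j w) @ drop j w = w"
        using that by (metis append_assoc append_take_drop_id min.absorb1 take_take)
      note h = hval_insert[OF f g MP, of "take i w" "drop i (take j w)" "drop j w", unfolded e, OF w']
      show ?thesis using h wtag_hull(2)[OF rs v] by simp
    qed
    let ?S = "\<lambda>i j. sgn_mult (pobj A ?p ?k) ((l - 1) * word_deg (take i w)) (elt (?x i j))"
    have inner: "V ?p ?k (\<Oplus>\<^bsub>pobj A ?p ?k\<^esub> i \<in> {..j}. ?S i j) = (\<Sum>i\<le>j. V ?p ?k (?S i j)) \<and>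
       (\<Oplus>\<^bsub>pobj A ?p ?k\<^esub> i \<in> {..j}. ?S i j) \<in> carrier (pobj A ?p ?k)" for j
      using x sgn_elt(2) by (intro V_finsum[OF p]) auto
    have "V ?p ?k (\<Oplus>\<^bsub>pobj A ?p ?k\<^esub> j \<in> {..length w}. \<Oplus>\<^bsub>pobj A ?p ?k\<^esub> i \<in> {..j}. ?S i j) =
        (\<Sum>j\<le>length w. V ?p ?k (\<Oplus>\<^bsub>pobj A ?p ?k\<^esub> i \<in> {..j}. ?S i j)) \<and>
       (\<Oplus>\<^bsub>pobj A ?p ?k\<^esub> j \<in> {..length w}. \<Oplus>\<^bsub>pobj A ?p ?k\<^esub> i \<in> {..j}. ?S i j) \<in> carrier (pobj A ?p ?k)"
      using inner by (intro V_finsum[OF p]) auto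
    moreover have "V ?p ?k (?S i j) =
        ?F (dga.tw (l - 1) (take i (VW w)) @ ?G (drop i (take j (VW w))) # drop j (VW w))" if "i \<le> j" for i j
      using x[OF that] sgn_elt(1)[of "?x i j" ?p ?k]
          tw_V[OF FM, of "[]" "l - 1" "take i w" "?G (VW (drop i (take j w))) # VW (drop j w)"]
      by (simp add: VW_take)
    ultimately show "(let M = pobj A (gm_add n (word_perv n w) (gm_add n r s)) (word_deg w + (m + l - 1))
         in \<Oplus>\<^bsub>M\<^esub>j\<in>{..length w}. \<Oplus>\<^bsub>M\<^esub>i\<in>{..j}. sgn_mult M ((l - 1) * word_deg (take i w)) (elt (?x i j))) \<in> carrier
             (pobj A ?p ?k) \<and>
        V ?p ?k (let M = pobj A (gm_add n (word_perv n w) (gm_add n r s)) (word_deg w + (m + l - 1))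
         in \<Oplus>\<^bsub>M\<^esub>j\<in>{..length w}. \<Oplus>\<^bsub>M\<^esub>i\<in>{..j}. sgn_mult M ((l - 1) * word_deg (take i w)) (elt (?x i j)))
             = dga.circ l ?F ?G (VW w)"
      unfolding good_GM(6)[OF w MPrs] Let_def dga.circ_sum using inner by (simp add: VW_take(3))
  qed
qed

section \<open>The module of Hochschild cochains\<close>

lemma HCo_simps:
  "f \<oplus>\<^bsub>HCo r m\<^esub> g = (\<lambda>(p, q, k, x) \<in> hom_dom n (bar R n A) r. f (p, q, k, x) \<oplus>\<^bsub>pobj A q (k + m)\<^esub> g (p, q, k, x))"
  "c \<odot>\<^bsub>HCo r m\<^esub> f = (\<lambda>(p, q, k, x) \<in> hom_dom n (bar R n A) r. c \<odot>\<^bsub>pobj A q (k + m)\<^esub> f (p, q, k, x))"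
  "\<zero>\<^bsub>HCo r m\<^esub> = (\<lambda>(p, q, k, x) \<in> hom_dom n (bar R n A) r. \<zero>\<^bsub>pobj A q (k + m)\<^esub>)"
  by (simp_all add: HC_def internal_hom_def)

lemma HCo_ext:
  assumes F: "F \<in> HCT r m"
    and eq: "\<And>p q k u. p \<in> GM n \<Longrightarrow> q \<in> GM n \<Longrightarrow> psum p r \<le> q \<Longrightarrow> u \<in> carrier (FT p k) \<Longrightarrow>
      f (p, q, k, bcls p k u) \<in> carrier (pobj A q (k + m)) \<and> V q (k + m) (f (p, q, k, bcls p k u)) = Psi F q u"
  shows "(\<lambda>y \<in> hom_dom n (bar R n A) r. f y) = iPhi r m F"
proof
  fix y
  show "(\<lambda>y \<in> hom_dom n (bar R n A) r. f y) y = iPhi r m F y"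
  proof (cases "y \<in> hom_dom n (bar R n A) r")
    case True
    then obtain p q k X where y: "y = (p, q, k, X)" "p \<in> GM n" "q \<in> GM n" "psum p r \<le> q" "X \<in> carrier (BT p k)"
      by (auto simp: hom_dom_def)
    obtain u where u: "u \<in> carrier (FT p k)" "X = bcls p k u" using mod_coset[OF y(5)] by blast
    have "f y = iPhi r m F y"
      using V_inj[OF y(3), of "f y" "k + m" "iPhi r m F y"] iPhi_eval[OF F y(2-4) u(1)] eq[OF y(2-4) u(1)] y(1) u(2) by simp
    then show ?thesis using True by simp
  qed (simp add: iPhi_def)
qed

lemma Psi_plus: "u \<in> carrier (FT p k) \<Longrightarrow> Psi (\<lambda>w. F w + G w) q u = Psi F q u + Psi G q u"
proof -
  assume u: "u \<in> carrier (FT p k)"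
  have R: "u w \<in> carrier R" for w using u by (auto simp: free_module_simps)
  show ?thesis
    by (simp add: Psi_def additiveD[OF additive_pT] additiveD[OF additive_sc[OF R]] sum.distrib)
qed

lemma Psi_scale: "u \<in> carrier (FT p k) \<Longrightarrow> c \<in> carrier R \<Longrightarrow> Psi (\<lambda>w. sc c (F w)) q u = sc c (Psi F q u)"
proof -
  assume u: "u \<in> carrier (FT p k)" and c: "c \<in> carrier R"
  have R: "u w \<in> carrier R" for w using u by (auto simp: free_module_simps)
  show ?thesis
    by (simp add: Psi_def additive_sum[OF additive_sc[OF c]] pT_sc[OF c] sc_sc R c cring.cring_simprules(14)[OF cring R c])
qed

lemma HCo_add:
  assumes F: "F \<in> HCT r m" and G: "G \<in> HCT r m"
  shows "iPhi r m F \<oplus>\<^bsub>HCo r m\<^esub> iPhi r m G = iPhi r m (\<lambda>w. F w + G w)"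
  unfolding HCo_simps
  by (rule HCo_ext[OF HCT_add[OF F G]])
     (simp add: A_closed(2) iPhi_eval[OF F] iPhi_eval[OF G] V_add Psi_plus)

lemma HCo_smult:
  assumes F: "F \<in> HCT r m" and c: "c \<in> carrier R"
  shows "c \<odot>\<^bsub>HCo r m\<^esub> iPhi r m F = iPhi r m (\<lambda>w. sc c (F w))"
  unfolding HCo_simps
  by (rule HCo_ext[OF HCT_sc[OF c F]])
     (simp add: A_closed(4) c iPhi_eval[OF F] sc_V[symmetric] Psi_scale)

lemma HCo_zero:
  assumes r: "r \<in> MP"
  shows "\<zero>\<^bsub>HCo r m\<^esub> = iPhi r m (\<lambda>w. 0)"
  unfolding HCo_simps
proof (rule HCo_ext[OF HCT_zero[OF r]])
  fix p q k u assume u: "q \<in> GM n" "u \<in> carrier (FT p k)"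
  have R: "u w \<in> carrier R" for w using u by (auto simp: free_module_simps)
  show "(case (p, q, k, bcls p k u) of (p, q, k, x) \<Rightarrow> \<zero>\<^bsub>pobj A q (k + m)\<^esub>) \<in> carrier (pobj A q (k + m)) \<and>
       V q (k + m) (case (p, q, k, bcls p k u) of (p, q, k, x) \<Rightarrow> \<zero>\<^bsub>pobj A q (k + m)\<^esub>) = Psi (\<lambda>w. 0) q u"
    using u by (simp add: A_closed(1) V_zero Psi_def additive_zero[OF additive_pT] additive_zero[OF additive_sc[OF R]])
qed

lemma carrier_HCo: "r \<in> MP \<Longrightarrow> carrier (HCo r m) = iPhi r m ` HCT r m"
  using iPhi_HCo Phi_HCT iPhi_Phi by (auto simp: image_iff) metis

lemma iPhi_inj: "F \<in> HCT r m \<Longrightarrow> G \<in> HCT r m \<Longrightarrow> iPhi r m F = iPhi r m G \<Longrightarrow> F = G"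
  using Phi_iPhi by metis

lemma HCT_cl: "F \<in> HCT r m \<Longrightarrow> cl (F w) = F w"
  by (auto simp: HCT_def wc_def linear_fun_def)

lemma module_HCo:
  assumes r: "r \<in> MP" shows "module R (HCo r m)"
proof (rule moduleI)
  note rr = cring.cring_simprules[OF cring]
  have ex: "\<exists>F\<in>HCT r m. f = iPhi r m F" if "f \<in> carrier (HCo r m)" for f using that carrier_HCo[OF r] by auto
  show "cring R" by (rule cring)
  show "abelian_group (HCo r m)"
  proof (rule abelian_groupI)
    fix f g h assume "f \<in> carrier (HCo r m)"
    then obtain F where F: "F \<in> HCT r m" "f = iPhi r m F" using ex by blast
    show "\<zero>\<^bsub>HCo r m\<^esub> \<oplus>\<^bsub>HCo r m\<^esub> f = f" using F r by (simp add: HCo_zero HCo_add HCT_zero)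
    show "\<exists>g\<in>carrier (HCo r m). g \<oplus>\<^bsub>HCo r m\<^esub> f = \<zero>\<^bsub>HCo r m\<^esub>"
      using F r HCT_minus[OF F(1)] by (intro bexI[of _ "iPhi r m (\<lambda>w. - F w)"]) (simp_all add: HCo_zero HCo_add iPhi_HCo)
    assume "g \<in> carrier (HCo r m)"
    then obtain G where G: "G \<in> HCT r m" "g = iPhi r m G" using ex by blast
    show "f \<oplus>\<^bsub>HCo r m\<^esub> g \<in> carrier (HCo r m)" "f \<oplus>\<^bsub>HCo r m\<^esub> g = g \<oplus>\<^bsub>HCo r m\<^esub> f"
      using F G by (simp_all add: HCo_add iPhi_HCo HCT_add add.commute)
    assume "h \<in> carrier (HCo r m)"
    then obtain H where H: "H \<in> HCT r m" "h = iPhi r m H" using ex by blast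
    show "f \<oplus>\<^bsub>HCo r m\<^esub> g \<oplus>\<^bsub>HCo r m\<^esub> h = f \<oplus>\<^bsub>HCo r m\<^esub> (g \<oplus>\<^bsub>HCo r m\<^esub> h)"
      using F G H by (simp add: HCo_add HCT_add add.assoc)
  qed (simp add: HCo_zero[OF r] iPhi_HCo HCT_zero r)
  show "\<one>\<^bsub>R\<^esub> \<odot>\<^bsub>HCo r m\<^esub> f = f" if "f \<in> carrier (HCo r m)" for f
    using ex[OF that] HCT_cl by (auto simp: HCo_smult one_R sc_one)
  fix c f assume c: "c \<in> carrier R" and "f \<in> carrier (HCo r m)"
  then obtain F where F: "F \<in> HCT r m" "f = iPhi r m F" using ex by blast
  show "c \<odot>\<^bsub>HCo r m\<^esub> f \<in> carrier (HCo r m)" using F c by (simp add: HCo_smult iPhi_HCo HCT_sc)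
  fix g assume "g \<in> carrier (HCo r m)"
  then obtain G where G: "G \<in> HCT r m" "g = iPhi r m G" using ex by blast
  show "c \<odot>\<^bsub>HCo r m\<^esub> (f \<oplus>\<^bsub>HCo r m\<^esub> g) = c \<odot>\<^bsub>HCo r m\<^esub> f \<oplus>\<^bsub>HCo r m\<^esub> c \<odot>\<^bsub>HCo r m\<^esub> g"
    using F G c by (simp add: HCo_smult HCo_add HCT_sc HCT_add additiveD[OF additive_sc])
next
  have ex: "\<exists>F\<in>HCT r m. f = iPhi r m F" if "f \<in> carrier (HCo r m)" for f using that carrier_HCo[OF r] by auto
  fix c b f assume c: "c \<in> carrier R" "b \<in> carrier R" and "f \<in> carrier (HCo r m)"
  then obtain F where F: "F \<in> HCT r m" "f = iPhi r m F" using ex by blast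
  show "(c \<oplus>\<^bsub>R\<^esub> b) \<odot>\<^bsub>HCo r m\<^esub> f = c \<odot>\<^bsub>HCo r m\<^esub> f \<oplus>\<^bsub>HCo r m\<^esub> b \<odot>\<^bsub>HCo r m\<^esub> f"
    using F c cring.cring_simprules(1)[OF cring c] by (simp add: HCo_smult HCo_add HCT_sc sc_add_left)
  show "(c \<otimes>\<^bsub>R\<^esub> b) \<odot>\<^bsub>HCo r m\<^esub> f = c \<odot>\<^bsub>HCo r m\<^esub> (b \<odot>\<^bsub>HCo r m\<^esub> f)"
    using F c cring.cring_simprules(5)[OF cring c] by (simp add: HCo_smult HCT_sc sc_sc)
qed

lemma HCo_minus:
  assumes r: "r \<in> MP" and F: "F \<in> HCT r m"
  shows "\<ominus>\<^bsub>HCo r m\<^esub> iPhi r m F = iPhi r m (\<lambda>w. - F w)"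
proof -
  interpret M: module R "HCo r m" by (rule module_HCo[OF r])
  show ?thesis
    using F HCT_minus[OF F] by (intro M.minus_equality) (simp_all add: HCo_add HCo_zero[OF r] iPhi_HCo)
qed

lemma HCo_sgn:
  assumes r: "r \<in> MP" and F: "F \<in> HCT r m"
  shows "sgn_mult (HCo r m) e (iPhi r m F) = iPhi r m (\<lambda>w. sg e (F w))"
  using HCo_minus[OF assms] by (simp add: sgn_mult_def sg_def)

lemma hoch_bracket_eq:
  assumes f: "f \<in> carrier (HCo r m)" and g: "g \<in> carrier (HCo s l)" and rs: "r \<in> GM n" "s \<in> GM n" "psum r s \<le> gm_top n"
  shows "hoch_bracket R n A r s m l f g = iPhi (gm_add n r s) (m + l - 1) (dga.brk m l (Phi r m f) (Phi s l g))"
proof -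
  let ?F = "Phi r m f" and ?G = "Phi s l g" and ?t = "gm_add n r s" and ?d = "m + l - 1"
  have F: "?F \<in> HCT r m" and G: "?G \<in> HCT s l" using Phi_HCT f g rs GM_mono_perv by auto
  have t: "?t \<in> MP" using gm_add_GM[OF rs] GM_mono_perv by blast
  have sr: "psum s r \<le> gm_top n" "gm_add n s r = ?t" "l + m - 1 = ?d" using rs by (simp_all add: psum_commute gm_add_def)
  have FG: "dga.circ l ?F ?G \<in> HCT ?t ?d" and GF: "dga.circ m ?G ?F \<in> HCT ?t ?d"
    using HCT_circ[OF F G rs(3)] HCT_circ[OF G F sr(1)] unfolding sr by simp_all
  have "hoch_circ R n A s r l m g f = iPhi ?t ?d (dga.circ m ?G ?F)"
    using hoch_circ_eq[OF g f rs(2,1) sr(1)] unfolding sr .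
  then show ?thesis
    unfolding hoch_bracket_def Let_def hoch_circ_eq[OF f g rs] a_minus_def dga.brk_alt
    by (simp add: HCo_sgn[OF t GF] HCo_minus[OF t HCT_sg[OF GF]] HCo_add[OF FG HCT_minus[OF HCT_sg[OF GF]]])
qed

lemma V_diff:
  assumes "p \<in> GM n" "a \<in> carrier (pobj A p k)" "b \<in> carrier (pobj A p k)"
  shows "V p k (a \<ominus>\<^bsub>pobj A p k\<^esub> b) = V p k a - V p k b" "a \<ominus>\<^bsub>pobj A p k\<^esub> b \<in> carrier (pobj A p k)"
  using assms A_closed(2,3) by (simp_all add: a_minus_def V_add V_minus)

text \<open>The first and the last term of the Hochschild differential are the cup products with the identity cochain in
\<open>m \<circ> f\<close>. The terms with \<open>da\<^sub>i\<close> and with \<open>a\<^sub>i\<^sub>-\<^sub>1a\<^sub>i\<close> form \<open>f \<circ> m\<close>.\<close>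

lemma hoch_D_eq:
  assumes f: "f \<in> carrier (HCo r m)" and r: "r \<in> GM n"
  shows "hoch_D R n A r m f = iPhi r (m + 1) (dga.D m (Phi r m f))"
proof -
  let ?F = "Phi r m f"
  note MP = GM_mono_perv[OF r]
  have F: "?F \<in> HCT r m" using Phi_HCT f MP by auto
  have FM: "multiadditive ?F" "dga.parity m ?F" using F wc_multi wc_parity by (auto simp: HCT_def)
  show ?thesis unfolding hoch_D_def
  proof (rule cochain_of_eq[OF HCT_D[OF F r]])
    fix w assume w: "good r w"
    have v: "valid w" using w by (simp add: good_def)
    let ?p = "wtag r w" and ?k = "word_deg w + m + 1"
    let ?M = "pobj A ?p ?k"
    have p: "?p \<in> GM n" using good_GM(4)[OF w MP] .
    note hw = hval_letter[OF f MP w] and gp = good_GM(6)[OF w MP]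
    have vi: "valid [w ! i]" if "i < length w" for i using v that by (simp add: vword_def)
    define t0 where "t0 = hdiff A (hval R n A r m f w)"
    have t0: "valid [t0]" "fst t0 = ?p" "fst (snd t0) = ?k" "lt t0 = dT (?F (VW w))"
      unfolding t0_def using hdiff_letter[OF hw(4)] hw by simp_all
    define t1 where "t1 i = hval R n A r m f (take i w @ [hdiff A (w ! i)] @ drop (i + 1) w)" for i
    have t1: "valid [t1 i]" "fst (t1 i) = ?p" "fst (snd (t1 i)) = ?k"
      "lt (t1 i) = ?F (VW (take i w) @ dT (lt (w ! i)) # VW (drop (i + 1) w))" if i: "i < length w" for i
    proof -
      note hd = hdiff_letter[OF vi[OF i]]
      let ?w = "take i w @ hdiff A (w ! i) # drop (i + 1) w"
      have e: "w = take i w @ w ! i # drop (i + 1) w" using i by (simp add: id_take_nth_drop)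
      have s: "sumperv ?w = sumperv w" "word_deg ?w = word_deg w + 1"
        using hd arg_cong[OF e, of sumperv] arg_cong[OF e, of word_deg] by simp_all
      have "valid (take i w)" "valid (drop (i + 1) w)"
        using v by (auto simp: vword_def dest: in_set_takeD in_set_dropD)
      then have "valid ?w" using hd(4) by (cases "hdiff A (w ! i)") simp
      then have g: "good r ?w" using w s by (simp add: good_def)
      have "wtag r ?w = ?p" using s by (simp add: wtag_def)
      then show "valid [t1 i]" "fst (t1 i) = ?p" "fst (snd (t1 i)) = ?k"
        "lt (t1 i) = ?F (VW (take i w) @ dT (lt (w ! i)) # VW (drop (i + 1) w))"
        unfolding t1_def using hval_letter[OF f MP g] s hd(1) by (simp_all add: VW_lt)
    qed
    define t2 where "t2 i = hval R n A r m f (take (i - 1) w @ [hmul n A (w ! (i - 1)) (w ! i)] @ drop (i + 1) w)" for i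
    have t2: "valid [t2 i]" "fst (t2 i) = ?p" "fst (snd (t2 i)) = ?k"
      "lt (t2 i) = ?F (VW (take (i - 1) w) @ mulT (lt (w ! (i - 1))) (lt (w ! i)) # VW (drop (i + 1) w))"
          if i: "i \<in> {1..<length w}" for i
    proof -
      let ?a = "w ! (i - 1)" and ?b = "w ! i"
      have ab: "valid [?a]" "valid [?b]" using i vi by auto
      have "i - 1 < length w" using i by auto
      then have "drop (i - 1) w = ?a # ?b # drop (i + 1) w"
          using i Cons_nth_drop_Suc[of "i - 1" w] Cons_nth_drop_Suc[of i w] by simp
      then have e: "w = take (i - 1) w @ [?a, ?b] @ drop (i + 1) w" using append_take_drop_id[of "i - 1" w] by simp
      have r0: "psum r gm_zero = r" by (rule psum_gm_zero)
      have g: "good (psum r gm_zero) (take (i - 1) w @ [?a, ?b] @ drop (i + 1) w)"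
        unfolding r0 e[symmetric] by (rule w)
      have le: "psum (fst ?a) (fst ?b) \<le> gm_top n"
        using good_psum(2)[OF g] by (simp add: good_def psum_gm_zero)
      note hm = hmul_letter[OF ab le]
      have fm: "fst (hmul n A ?a ?b) = wtag gm_zero [?a, ?b]"
        using hm(2) by (simp add: wtag_def psum_gm_zero gm_add_def)
      note gi = good_insert[OF g MP GM_mono_perv[OF gm_zero_GM] hm(4) fm, unfolded r0, folded e]
      have deg: "word_deg (take (i - 1) w @ hmul n A ?a ?b # drop (i + 1) w) = word_deg w + 1"
        using hm(3) arg_cong[OF e, of word_deg] by simp
      show "valid [t2 i]" "fst (t2 i) = ?p" "fst (snd (t2 i)) = ?k"
        "lt (t2 i) = ?F (VW (take (i - 1) w) @ mulT (lt (w ! (i - 1))) (lt (w ! i)) # VW (drop (i + 1) w))"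
        unfolding t2_def using hval_letter[OF f MP gi(1)] gi(2) deg hm(1) by (simp_all add: VW_lt)
    qed
    define t3 where "t3 = hmul n A (hd w) (hval R n A r m f (tl w))"
    define t4 where "t4 = hmul n A (hval R n A r m f (butlast w)) (last w)"
    have product: "valid [hmul n A a (hval R n A r m f y)] \<and> fst (hmul n A a (hval R n A r m f y)) = ?p \<and>
        fst (snd (hmul n A a (hval R n A r m f y))) = ?k \<and> lt (hmul n A a (hval R n A r m f y)) = mulT (lt a) (?F (VW y))"
      "valid [hmul n A (hval R n A r m f y) a] \<and> fst (hmul n A (hval R n A r m f y) a) = ?p \<and>
        fst (snd (hmul n A (hval R n A r m f y) a)) = ?k \<and> lt (hmul n A (hval R n A r m f y) a) = mulT (?F (VW y)) (lt a)"
      if a: "valid [a]" and y: "valid y" and s: "sumperv w = psum (fst a) (sumperv y)"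
          and deg: "word_deg w = fst (snd a) - 1 + word_deg y" for a y
    proof -
      have gy: "good r y"
        using w y psum_le_topD(2)[of "fst a" "psum (sumperv y) r"] by (simp add: good_def s psum_assoc)
      note hy = hval_letter[OF f MP gy]
      have u: "fst a \<in> MP" "fst a \<le> gm_top n" "fst a \<in> GM n" "psum (sumperv y) r \<in> MP" "psum (sumperv y) r \<le> gm_top n"
        using a y MP gy sumperv_MP by (simp_all add: valid_single GM_mono_perv GM_le_top psum_mono_perv good_def)
      have e: "psum (fst a) (psum (sumperv y) r) = psum (sumperv w) r" by (simp add: s psum_assoc)
      have le: "psum (fst a) (wtag r y) \<le> gm_top n"
        using hull2_psum_top[OF u(1,4,2,5)] w u(3) by (simp add: e wtag_def good_def gm_hull_id)
      have t: "gm_add n (fst a) (wtag r y) = ?p"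
        using gm_add_hull[OF u(1,4,2,5)] u(3) by (simp add: e wtag_def gm_hull_id)
      have le': "psum (wtag r y) (fst a) \<le> gm_top n" "gm_add n (wtag r y) (fst a) = ?p"
        using le t by (simp_all add: psum_commute gm_add_def)
      show "valid [hmul n A a (hval R n A r m f y)] \<and> fst (hmul n A a (hval R n A r m f y)) = ?p \<and>
        fst (snd (hmul n A a (hval R n A r m f y))) = ?k \<and> lt (hmul n A a (hval R n A r m f y)) = mulT (lt a) (?F (VW y))"
        using hmul_letter[OF a hy(4), unfolded hy(1), OF le] hy t deg by simp
      show "valid [hmul n A (hval R n A r m f y) a] \<and> fst (hmul n A (hval R n A r m f y) a) = ?p \<and>
        fst (snd (hmul n A (hval R n A r m f y) a)) = ?k \<and> lt (hmul n A (hval R n A r m f y) a) = mulT (?F (VW y)) (lt a)"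
        using hmul_letter[OF hy(4) a, unfolded hy(1), OF le'(1)] hy le' deg by simp
    qed
    have t3: "valid [t3]" "fst t3 = ?p" "fst (snd t3) = ?k" "lt t3 = mulT (lt (hd w)) (?F (VW (tl w)))" if "w \<noteq> []"
    proof -
      have "valid [hd w]" "valid (tl w)" "sumperv w = psum (fst (hd w)) (sumperv (tl w))" "word_deg w
          = fst (snd (hd w)) - 1 + word_deg (tl w)"
        using that v by (cases w; auto simp: vword_def)+
      from product(1)[OF this] show "valid [t3]" "fst t3 = ?p" "fst (snd t3) = ?k" "lt t3
          = mulT (lt (hd w)) (?F (VW (tl w)))"
        unfolding t3_def by auto
    qed
    have t4: "valid [t4]" "fst t4 = ?p" "fst (snd t4) = ?k" "lt t4 = mulT (?F (VW (butlast w))) (lt (last w))" if "w \<noteq> []"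
    proof -
      have "valid [last w]" "valid (butlast w)" "sumperv w = psum (fst (last w)) (sumperv (butlast w))" "word_deg w
          = fst (snd (last w)) - 1 + word_deg (butlast w)"
        using that v by (cases w rule: rev_cases; auto simp: vword_def psum_commute)+
      from product(2)[OF this] show "valid [t4]" "fst t4 = ?p" "fst (snd t4) = ?k" "lt t4
          = mulT (?F (VW (butlast w))) (lt (last w))"
        unfolding t4_def by auto
    qed
    have S1: "V ?p ?k (\<Oplus>\<^bsub>?M\<^esub> i \<in> {..<length w}. sgn_mult ?M (word_deg (take i w) + m) (elt (t1 i))) =
         (\<Sum>i<length w. sg (word_deg (take i w) + m) (lt (t1 i))) \<and>
       (\<Oplus>\<^bsub>?M\<^esub> i \<in> {..<length w}. sgn_mult ?M (word_deg (take i w) + m) (elt (t1 i))) \<in> carrier ?M"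
      using V_finsum[OF p, of "\<lambda>i. sgn_mult ?M (word_deg (take i w) + m) (elt (t1 i))" "{..<length w}" ?k]
        sgn_elt[OF t1(1-3)] by (auto intro!: sum.cong)
    have S2: "V ?p ?k (\<Oplus>\<^bsub>?M\<^esub> i \<in> {1..<length w}. sgn_mult ?M (word_deg (take i w) + m) (elt (t2 i))) =
         (\<Sum>i\<in>{1..<length w}. sg (word_deg (take i w) + m) (lt (t2 i))) \<and>
       (\<Oplus>\<^bsub>?M\<^esub> i \<in> {1..<length w}. sgn_mult ?M (word_deg (take i w) + m) (elt (t2 i))) \<in> carrier ?M"
      using V_finsum[OF p, of "\<lambda>i. sgn_mult ?M (word_deg (take i w) + m) (elt (t2 i))" "{1..<length w}" ?k]
        sgn_elt[OF t2(1-3)] by (auto intro!: sum.cong)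
    have d0: "V ?p ?k (hoch_d0 R n A r m f w) = dT (?F (VW w)) + (\<Sum>i<length w. sg (word_deg (take i w) + m) (lt (t1 i)))"
      "hoch_d0 R n A r m f w \<in> carrier ?M"
      unfolding hoch_d0_def gp Let_def t0_def[symmetric] t1_def[symmetric]
      using S1 sgn_elt(3,4)[OF t0(1-3)] t0(4) by (simp_all add: V_add[OF p] A_closed(2)[OF p])
    have d1: "V ?p ?k (hoch_d1 R n A r m f w) = (if w = [] then 0 else
        - sg ((fst (snd (hd w)) + 1) * m) (lt t3) + sg (word_deg (butlast w) + m) (lt t4)
         - (\<Sum>i\<in>{1..<length w}. sg (word_deg (take i w) + m) (lt (t2 i)))) \<and> hoch_d1 R n A r m f w \<in> carrier ?M"
    proof (cases "w = []")
      case True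
      then show ?thesis unfolding hoch_d1_def gp Let_def using V_zero[OF p] A_closed(1)[OF p] by simp
    next
      case False
      note e3 = sgn_elt[OF t3(1-3)[OF False]] and e4 = sgn_elt[OF t4(1-3)[OF False]]
      show ?thesis
        unfolding hoch_d1_def gp Let_def t2_def[symmetric] t3_def[symmetric] t4_def[symmetric]
        using S2 e3 e4 False by (simp add: V_diff[OF p] V_add[OF p] V_minus[OF p] A_closed(2,3)[OF p])
    qed
    have D: "dga.D m ?F (VW w) = dT (?F (VW w)) + (\<Sum>i<length w. sg (word_deg (take i w) + m) (lt (t1 i))) +
       (if w = [] then 0 else - sg ((fst (snd (hd w)) + 1) * m) (lt t3) + sg (word_deg (butlast w) + m) (lt t4)
         - (\<Sum>i\<in>{1..<length w}. sg (word_deg (take i w) + m) (lt (t2 i))))"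
    proof -
      have tw1: "?F (map dga.tau (VW x) @ z) = sg (word_deg x) (?F (VW x @ z))" for x z
        using tw_V[OF FM(1), of "[]" 1 x z] by simp
      have tw0: "?F (map dga.tau (VW x)) = sg (word_deg x) (?F (VW x))" for x
        using tw1[of x "[]"] by simp
      have sl: "sT (lt x) = sg (fst (snd x)) (lt x)" for x by (simp add: lt_def sT_V)
      have a: "dga.cup m dga.idc ?F (VW w) = (if w = [] then 0 else sg ((fst (snd (hd w)) + 1) * m) (lt t3))"
      proof (cases "w = []")
        case False
        then have "hd (dga.tw m (VW w)) = sg ((fst (snd (hd w)) + 1) * m) (lt (hd w))"
          by (cases w; cases "even m") (auto simp: dga.tau_def sl[unfolded lt_def elt_def] sg_def VW_simps lt_def elt_def)
        then show ?thesis using False t3(4) by (simp add: dga.cup_idc_left VW_take dga.sg_mul)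
      qed (simp add: dga.cup_idc_left)
      have b: "dga.cup 1 ?F dga.idc (VW w) = (if w = [] then 0 else sg (word_deg (butlast w)) (lt t4))"
        using t4(4) by (simp add: dga.cup_idc_right VW_take tw0 dga.sg_mul)
      have c1: "(\<Sum>i<length (VW w). ?F (dga.tw 1 (take i (VW w)) @ dT (VW w ! i) # drop (i + 1) (VW w))) =
          (\<Sum>i<length w. sg (word_deg (take i w)) (lt (t1 i)))"
        by (rule sum.cong) (simp_all add: VW_take tw1 t1(4))
      have c2: "(\<Sum>i\<in>{1..<length (VW w)}. ?F (dga.tw 1 (take (i - 1) (VW w)) @ mulT (sT (VW w ! (i - 1))) (VW w ! i) #
          drop (i + 1) (VW w))) =
          - (\<Sum>i\<in>{1..<length w}. sg (word_deg (take i w)) (lt (t2 i)))"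
        unfolding sum_negf[symmetric]
      proof (rule sum.cong)
        fix i assume i: "i \<in> {1..<length w}"
        have il: "i - 1 < length w" "i < length w" using i by auto
        then have "take i w = take (i - 1) w @ [w ! (i - 1)]"
          using i take_Suc_conv_app_nth[of "i - 1" w] by simp
        then have "word_deg (take i w) = word_deg (take (i - 1) w) + (fst (snd (w ! (i - 1))) - 1)" by simp
        moreover have "?F (VW (take (i - 1) w) @ sg e (mulT (lt (w ! (i - 1))) (lt (w ! i))) # VW (drop (i + 1) w))
            = sg e (lt (t2 i))" for e
          using additive_sg[OF multiadditiveD[OF FM(1)]] t2(4)[OF i] by simp
        ultimately show "?F (dga.tw 1 (take (i - 1) (VW w)) @ mulT (sT (VW w ! (i - 1))) (VW w ! i) # drop (i + 1) (VW w)) =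
            - sg (word_deg (take i w)) (lt (t2 i))"
          unfolding VW_take(1,2) VW_take(4)[OF il(1)] VW_take(4)[OF il(2)] sl dga.sg_mul
          by (simp add: tw1 del: One_nat_def) (simp add: sg_def)
      qed (simp add: VW_take)
      have c: "dga.circ 2 ?F dga.mm (VW w) = (\<Sum>i<length w. sg (word_deg (take i w)) (lt (t1 i)))
          - (\<Sum>i\<in>{1..<length w}. sg (word_deg (take i w)) (lt (t2 i)))"
        unfolding dga.circ_mm_right[OF FM(1)] c1 c2 by simp
      have sgsum: "sg e (sum g I) = (\<Sum>i\<in>I. sg e (g i))" for e :: int and g :: "nat \<Rightarrow> ('r, 'a) tmod" and I
        by (simp add: sg_def sum_negf)
      have sgsg: "sg e (sg e' x) = sg (e' + e) x" for e e' and x :: "('r, 'a) tmod" by (simp add: sg_def)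
      have sgm': "sg (e + (m - 1)) x = - sg (e + m) x" for e and x :: "('r, 'a) tmod" by (simp add: sg_def)
      have sgm: "sg (m - 1) x = - sg m x" for x :: "('r, 'a) tmod" by (simp add: sg_def)
      have sgd: "sg e (x - y) = sg e x - sg e y" for e and x y :: "('r, 'a) tmod" by (simp add: sg_def)
      show ?thesis
        unfolding dga.D_def dga.circ_mm[OF FM(2)] a b c sgm sgd sgsum sgsg
        by (cases "w = []") (simp_all add: sgsg sgm' sum_negf)
    qed
    have k: "word_deg w + (m + 1) = ?k" by simp
    show "hoch_d0 R n A r m f w \<oplus>\<^bsub>pobj A (gm_add n (word_perv n w) r) (word_deg w + m + 1)\<^esub> hoch_d1 R n A r m f w
       \<in> carrier (pobj A ?p (word_deg w + (m + 1))) \<and>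
      V ?p (word_deg w + (m + 1)) (hoch_d0 R n A r m f w
          \<oplus>\<^bsub>pobj A (gm_add n (word_perv n w) r) (word_deg w + m + 1)\<^esub> hoch_d1 R n A r m f w)
       = dga.D m ?F (VW w)"
      unfolding gp k D using d0 d1 by (simp add: V_add[OF p] A_closed(2)[OF p])
  qed
qed

section \<open>Hochschild cohomology\<close>

text \<open>The word cochains that correspond to cocycles.\<close>

definition ZT :: "perv \<Rightarrow> int \<Rightarrow> (('r, 'a) tmod list \<Rightarrow> ('r, 'a) tmod) set" where
  "ZT r m = {F \<in> HCT r m. \<forall>w. dga.D m F w = 0}"

lemma ZT_D: "F \<in> ZT r m \<Longrightarrow> dga.D m F w = 0" and ZT_HCT: "F \<in> ZT r m \<Longrightarrow> F \<in> HCT r m"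
  by (simp_all add: ZT_def)

lemma HCT_facts: "F \<in> HCT r m \<Longrightarrow> multiadditive F \<and> dga.parity m F \<and> linear_fun F"
  using wc_multi wc_parity by (auto simp: HCT_def wc_def)

lemma ZT_D_fun: "F \<in> ZT r m \<Longrightarrow> dga.D m F = (\<lambda>w. 0)"
  by (rule ext) (rule ZT_D)
lemma ZT_iff: "F \<in> ZT r m \<longleftrightarrow> F \<in> HCT r m \<and> dga.D m F = (\<lambda>w. 0)"
  by (auto simp: ZT_def fun_eq_iff)

abbreviation CZ where "CZ r m \<equiv> pobj (hoch_cocycles R n A) r m"

lemma CZ_simps: "carrier (CZ r m) = {f \<in> carrier (HCo r m). hoch_D R n A r m f = \<zero>\<^bsub>HCo r (m + 1)\<^esub>}"
  "f \<oplus>\<^bsub>CZ r m\<^esub> g = f \<oplus>\<^bsub>HCo r m\<^esub> g" "c \<odot>\<^bsub>CZ r m\<^esub> f = c \<odot>\<^bsub>HCo r m\<^esub> f" "\<zero>\<^bsub>CZ r m\<^esub> = \<zero>\<^bsub>HCo r m\<^esub>"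
  by (simp_all add: hoch_cocycles_def)

lemma hoch_D_iPhi: "F \<in> HCT r m \<Longrightarrow> r \<in> GM n \<Longrightarrow> hoch_D R n A r m (iPhi r m F) = iPhi r (m + 1) (dga.D m F)"
  by (simp add: hoch_D_eq iPhi_HCo Phi_iPhi)

lemma carrier_CZ: "r \<in> GM n \<Longrightarrow> carrier (CZ r m) = iPhi r m ` ZT r m"
proof -
  assume r: "r \<in> GM n"
  note MP = GM_mono_perv[OF r]
  have "hoch_D R n A r m (iPhi r m F) = \<zero>\<^bsub>HCo r (m + 1)\<^esub> \<longleftrightarrow> F \<in> ZT r m" if F: "F \<in> HCT r m" for F
    using iPhi_inj[OF HCT_D[OF F r] HCT_zero[OF MP]] F
    by (auto simp: hoch_D_iPhi[OF F r] HCo_zero[OF MP] ZT_iff)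
  then show ?thesis unfolding CZ_simps carrier_HCo[OF MP] using ZT_HCT by blast
qed

lemma ZT_add: "F \<in> ZT r m \<Longrightarrow> G \<in> ZT r m \<Longrightarrow> (\<lambda>w. F w + G w) \<in> ZT r m"
  by (simp add: ZT_def HCT_add dga.D_add)
lemma ZT_minus: "F \<in> ZT r m \<Longrightarrow> (\<lambda>w. - F w) \<in> ZT r m"
  by (simp add: ZT_def HCT_minus dga.D_minus)
lemma ZT_sg: "F \<in> ZT r m \<Longrightarrow> (\<lambda>w. sg e (F w)) \<in> ZT r m"
  by (cases "even e") (simp_all add: ZT_minus)
lemma ZT_sc: "c \<in> carrier R \<Longrightarrow> F \<in> ZT r m \<Longrightarrow> (\<lambda>w. sc c (F w)) \<in> ZT r m"
  by (simp add: ZT_def HCT_sc dga.D_scalar[OF scalar_sc] additive_zero[OF additive_sc])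
lemma D_zero: "dga.D m (\<lambda>w. 0) w = 0"
  using dga.D_add[of m "\<lambda>w. 0" "\<lambda>w. 0" w] by simp
lemma D_fun: "dga.D m (\<lambda>w. F w + G w) = (\<lambda>w. dga.D m F w + dga.D m G w)"
    "dga.D m (\<lambda>w. - F w) = (\<lambda>w. - dga.D m F w)"
    "c \<in> carrier R \<Longrightarrow> dga.D m (\<lambda>w. sc c (F w)) = (\<lambda>w. sc c (dga.D m F w))"
  by (rule ext, simp add: dga.D_add dga.D_minus dga.D_scalar[OF scalar_sc])+
lemma D_zero_fun: "dga.D m (\<lambda>w. 0) = (\<lambda>w. 0)"
  by (rule ext) (rule D_zero)
lemma ZT_zero: "r \<in> MP \<Longrightarrow> (\<lambda>w. 0) \<in> ZT r m"
  by (simp add: ZT_def HCT_zero D_zero)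
lemma ZT_boundary: "K \<in> HCT r (m - 1) \<Longrightarrow> r \<in> GM n \<Longrightarrow> dga.D (m - 1) K \<in> ZT r m"
  using HCT_D[of K r "m - 1"] HCT_facts[of K r "m - 1"] dga.D_D[of K "m - 1"] by (simp add: ZT_def)

lemma sub_CZ: "r \<in> GM n \<Longrightarrow> submodule (carrier (CZ r m)) R (HCo r m)"
proof -
  assume r: "r \<in> GM n"
  note MP = GM_mono_perv[OF r]
  interpret M: module R "HCo r m" by (rule module_HCo[OF MP])
  show ?thesis unfolding carrier_CZ[OF r]
  proof (rule M.submoduleI)
    show "iPhi r m ` ZT r m \<subseteq> carrier (HCo r m)" using iPhi_HCo ZT_HCT by blast
    show "\<zero>\<^bsub>HCo r m\<^esub> \<in> iPhi r m ` ZT r m" using HCo_zero[OF MP] ZT_zero[OF MP] by simp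
  qed (auto simp: HCo_minus[OF MP] HCo_add HCo_smult ZT_HCT ZT_minus ZT_add ZT_sc)
qed

lemma module_CZ: "r \<in> GM n \<Longrightarrow> module R (CZ r m)"
  using submodule.submodule_is_module[OF sub_CZ module_HCo[OF GM_mono_perv], of r m]
  by (simp add: hoch_cocycles_def)

abbreviation BZ where "BZ r m \<equiv> hoch_boundaries R n A r m"

lemma BZ_eq: "r \<in> GM n \<Longrightarrow> BZ r m = (\<lambda>K. iPhi r m (dga.D (m - 1) K)) ` HCT r (m - 1)"
  using hoch_D_iPhi[of _ r "m - 1"] by (auto simp: hoch_boundaries_def carrier_HCo GM_mono_perv image_image)

lemma CZ_ops:
  assumes r: "r \<in> GM n" and F: "F \<in> ZT r m" and G: "G \<in> ZT r m"
  shows "iPhi r m F \<oplus>\<^bsub>CZ r m\<^esub> iPhi r m G = iPhi r m (\<lambda>w. F w + G w)"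
    "c \<in> carrier R \<Longrightarrow> c \<odot>\<^bsub>CZ r m\<^esub> iPhi r m F = iPhi r m (\<lambda>w. sc c (F w))"
    "\<ominus>\<^bsub>CZ r m\<^esub> iPhi r m F = iPhi r m (\<lambda>w. - F w)"
    "iPhi r m F \<ominus>\<^bsub>CZ r m\<^esub> iPhi r m G = iPhi r m (\<lambda>w. F w - G w)"
    "\<zero>\<^bsub>CZ r m\<^esub> = iPhi r m (\<lambda>w. 0)"
proof -
  interpret M: module R "CZ r m" by (rule module_CZ[OF r])
  have add: "iPhi r m F \<oplus>\<^bsub>CZ r m\<^esub> iPhi r m G = iPhi r m (\<lambda>w. F w + G w)" if "F \<in> ZT r m" "G \<in> ZT r m" for F G
    using that by (simp add: CZ_simps HCo_add ZT_HCT)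
  show "c \<in> carrier R \<Longrightarrow> c \<odot>\<^bsub>CZ r m\<^esub> iPhi r m F = iPhi r m (\<lambda>w. sc c (F w))"
    using F by (simp add: CZ_simps HCo_smult ZT_HCT)
  show z: "\<zero>\<^bsub>CZ r m\<^esub> = iPhi r m (\<lambda>w. 0)" by (simp add: CZ_simps HCo_zero GM_mono_perv r)
  have m: "\<ominus>\<^bsub>CZ r m\<^esub> iPhi r m F = iPhi r m (\<lambda>w. - F w)" if "F \<in> ZT r m" for F
    using that ZT_minus[OF that] by (intro M.minus_equality) (auto simp: add z carrier_CZ[OF r])
  show "iPhi r m F \<oplus>\<^bsub>CZ r m\<^esub> iPhi r m G = iPhi r m (\<lambda>w. F w + G w)" by (rule add[OF F G])
  show "\<ominus>\<^bsub>CZ r m\<^esub> iPhi r m F = iPhi r m (\<lambda>w. - F w)" by (rule m[OF F])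
  show "iPhi r m F \<ominus>\<^bsub>CZ r m\<^esub> iPhi r m G = iPhi r m (\<lambda>w. F w - G w)"
    using add[OF F ZT_minus[OF G]] by (simp add: a_minus_def m[OF G])
qed

lemma sub_BZ: "r \<in> GM n \<Longrightarrow> submodule (BZ r m) R (CZ r m)"
proof -
  assume r: "r \<in> GM n"
  interpret M: module R "CZ r m" by (rule module_CZ[OF r])
  note b = ZT_boundary[OF _ r]
  show ?thesis unfolding BZ_eq[OF r]
  proof (rule M.submoduleI)
    show "(\<lambda>K. iPhi r m (dga.D (m - 1) K)) ` HCT r (m - 1) \<subseteq> carrier (CZ r m)"
      using b by (auto simp: carrier_CZ[OF r])
    show "\<zero>\<^bsub>CZ r m\<^esub> \<in> (\<lambda>K. iPhi r m (dga.D (m - 1) K)) ` HCT r (m - 1)"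
      using CZ_ops(5)[OF r ZT_zero ZT_zero, of m] HCT_zero[OF GM_mono_perv[OF r]] GM_mono_perv[OF r]
      by (intro image_eqI[of _ _ "\<lambda>w. 0"]) (simp_all add: D_zero_fun)
    fix a assume "a \<in> (\<lambda>K. iPhi r m (dga.D (m - 1) K)) ` HCT r (m - 1)"
    then obtain K where K: "K \<in> HCT r (m - 1)" "a = iPhi r m (dga.D (m - 1) K)" by blast
    show "\<ominus>\<^bsub>CZ r m\<^esub> a \<in> (\<lambda>K. iPhi r m (dga.D (m - 1) K)) ` HCT r (m - 1)"
      using CZ_ops(3)[OF r b[OF K(1)] b[OF K(1)]] K HCT_minus[OF K(1)]
      by (intro image_eqI[of _ _ "\<lambda>w. - K w"]) (simp_all add: D_fun)
    show "c \<odot>\<^bsub>CZ r m\<^esub> a \<in> (\<lambda>K. iPhi r m (dga.D (m - 1) K)) ` HCT r (m - 1)" if c: "c \<in> carrier R" for c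
      using CZ_ops(2)[OF r b[OF K(1)] b[OF K(1)] c] K HCT_sc[OF c K(1)]
      by (intro image_eqI[of _ _ "\<lambda>w. sc c (K w)"]) (simp_all add: D_fun c)
    fix a' assume "a' \<in> (\<lambda>K. iPhi r m (dga.D (m - 1) K)) ` HCT r (m - 1)"
    then obtain K' where K': "K' \<in> HCT r (m - 1)" "a' = iPhi r m (dga.D (m - 1) K')" by blast
    show "a \<oplus>\<^bsub>CZ r m\<^esub> a' \<in> (\<lambda>K. iPhi r m (dga.D (m - 1) K)) ` HCT r (m - 1)"
      using CZ_ops(1)[OF r b[OF K(1)] b[OF K'(1)]] K K' HCT_add[OF K(1) K'(1)]
      by (intro image_eqI[of _ _ "\<lambda>w. K w + K' w"]) (simp_all add: D_fun)
  qed
qed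

lemma sub_HH: "r \<in> GM n \<Longrightarrow> submodule_of R (CZ r m) (BZ r m)"
  by (simp add: submodule_of_def submodule_of_axioms_def module_CZ sub_BZ)

abbreviation HHo where "HHo r m \<equiv> pobj (HH R n A) r m"

lemma HHo_quot: "HHo r m = quot_module (CZ r m) (BZ r m)"
  by (simp add: HH_def pquot_def)

definition hc :: "perv \<Rightarrow> int \<Rightarrow> (('r, 'a) tmod list \<Rightarrow> ('r, 'a) tmod) \<Rightarrow> ('r, 'a) cochain set" where
  "hc r m F = hoch_class R n A r m (iPhi r m F)"

lemma hc_coset: "hc r m F = coset (CZ r m) (BZ r m) (iPhi r m F)"
  by (simp add: hc_def hoch_class_def coset_def)

lemma carrier_HHo: "r \<in> GM n \<Longrightarrow> carrier (HHo r m) = hc r m ` ZT r m"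
  unfolding HHo_quot hc_coset[abs_def] by (simp add: submodule_of.carrier_Q[OF sub_HH] carrier_CZ image_image)

lemma HHoE:
  assumes "X \<in> carrier (HHo r m)" "r \<in> GM n"
  obtains F where "F \<in> ZT r m" "X = hc r m F"
  using assms carrier_HHo by blast

lemma HHo_ops:
  assumes r: "r \<in> GM n" and F: "F \<in> ZT r m"
  shows hc_closed: "hc r m F \<in> carrier (HHo r m)"
    and hc_add: "G \<in> ZT r m \<Longrightarrow> hc r m F \<oplus>\<^bsub>HHo r m\<^esub> hc r m G = hc r m (\<lambda>w. F w + G w)"
    and hc_smult: "c \<in> carrier R \<Longrightarrow> c \<odot>\<^bsub>HHo r m\<^esub> hc r m F = hc r m (\<lambda>w. sc c (F w))"
    and hc_minus: "\<ominus>\<^bsub>HHo r m\<^esub> hc r m F = hc r m (\<lambda>w. - F w)"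
    and hc_sgn: "sgn_mult (HHo r m) e (hc r m F) = hc r m (\<lambda>w. sg e (F w))"
    and hc_diff: "G \<in> ZT r m \<Longrightarrow> hc r m F \<ominus>\<^bsub>HHo r m\<^esub> hc r m G = hc r m (\<lambda>w. F w - G w)"
proof -
  interpret Q: submodule_of R "CZ r m" "BZ r m" by (rule sub_HH[OF r])
  have c: "iPhi r m F \<in> carrier (CZ r m)" if "F \<in> ZT r m" for F using that carrier_CZ[OF r] by blast
  note ops = CZ_ops[OF r]
  show "hc r m F \<in> carrier (HHo r m)" using carrier_HHo[OF r] F by blast
  show add: "hc r m F \<oplus>\<^bsub>HHo r m\<^esub> hc r m G = hc r m (\<lambda>w. F w + G w)" if "G \<in> ZT r m" for G
    unfolding HHo_quot hc_coset using Q.cls_add[OF c c] ops(1) F that by simp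
  show "c \<in> carrier R \<Longrightarrow> c \<odot>\<^bsub>HHo r m\<^esub> hc r m F = hc r m (\<lambda>w. sc c (F w))"
    unfolding HHo_quot hc_coset using Q.cls_smult[OF _ c] ops(2) F by simp
  have minus: "\<ominus>\<^bsub>HHo r m\<^esub> hc r m F = hc r m (\<lambda>w. - F w)" if "F \<in> ZT r m" for F
    unfolding HHo_quot hc_coset using Q.cls_minus[OF c] ops(3)[OF that that] that by simp
  show "\<ominus>\<^bsub>HHo r m\<^esub> hc r m F = hc r m (\<lambda>w. - F w)" by (rule minus[OF F])
  show "sgn_mult (HHo r m) e (hc r m F) = hc r m (\<lambda>w. sg e (F w))"
    using minus[OF F] by (simp add: sgn_mult_def sg_def)
  show "hc r m F \<ominus>\<^bsub>HHo r m\<^esub> hc r m G = hc r m (\<lambda>w. F w - G w)" if "G \<in> ZT r m" for G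
    using add[OF ZT_minus[OF that]] by (simp add: a_minus_def minus[OF that])
qed

lemma hc_eq_iff:
  assumes r: "r \<in> GM n" and F: "F \<in> ZT r m" and G: "G \<in> ZT r m"
  shows "hc r m F = hc r m G \<longleftrightarrow> (\<exists>K\<in>HCT r (m - 1). \<forall>w. F w = G w + dga.D (m - 1) K w)"
proof -
  interpret Q: submodule_of R "CZ r m" "BZ r m" by (rule sub_HH[OF r])
  have c: "iPhi r m F \<in> carrier (CZ r m)" if "F \<in> ZT r m" for F using that carrier_CZ[OF r] by blast
  have FG: "(\<lambda>w. F w - G w) \<in> HCT r m" using HCT_add[OF ZT_HCT[OF F] HCT_minus[OF ZT_HCT[OF G]]] by simp
  have "hc r m F = hc r m G \<longleftrightarrow> iPhi r m (\<lambda>w. F w - G w) \<in> BZ r m"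
    unfolding hc_coset using Q.cls_eq_iff[OF c[OF F] c[OF G]] CZ_ops(4)[OF r F G] by simp
  also have "\<dots> \<longleftrightarrow> (\<exists>K\<in>HCT r (m - 1). (\<lambda>w. F w - G w) = dga.D (m - 1) K)"
    unfolding BZ_eq[OF r] using iPhi_inj[OF FG ZT_HCT[OF ZT_boundary[OF _ r]]] by (auto simp: image_iff)
  also have "\<dots> \<longleftrightarrow> (\<exists>K\<in>HCT r (m - 1). \<forall>w. F w = G w + dga.D (m - 1) K w)"
    by (simp add: fun_eq_iff diff_eq_eq add.commute)
  finally show ?thesis .
qed

lemma hc_eqI:
  "r \<in> GM n \<Longrightarrow> F \<in> ZT r m \<Longrightarrow> G \<in> ZT r m \<Longrightarrow> K \<in> HCT r (m - 1) \<Longrightarrow> (\<And>w. F w = G w + dga.D (m - 1) K w) \<Longrightarrow> hc r m F = hc r m G"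
  using hc_eq_iff by blast

section \<open>Change of perversity\<close>

text \<open>Structure maps are functions, so the image of a cochain in a larger perversity is unique. Structure maps of
cohomology are computed by exhibiting a natural pair.\<close>

lemma natural_unique:
  assumes "natural r r' m F G" "natural r r' m F H" "linear_fun G" "linear_fun H"
  shows "G = H"
proof (rule multiadditive_eqI)
  have uniq: "t' = t''" if a: "PR u u' i t t'" "PR u u' i t t''" for u u' i t t' t''
  proof (cases "u' \<le> gm_top n")
    case True
    have u: "u \<in> MP" "u \<le> gm_top n" using a(1) True by (auto simp: PR_def intro: order_trans)
    show ?thesis using a True V_inj[OF gm_hull_GM[OF u]] by (auto simp: PR_def)
  next
    case False
    then show ?thesis using a by (simp add: PR_def)
  qed
  fix w assume "valid w"
  from uniq[OF naturalD[OF assms(1) related_rword[OF this]] naturalD[OF assms(2) related_rword[OF this]]]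
  show "G (VW w) = H (VW w)" by simp
qed (use assms(3,4) linear_funD in auto)

abbreviation res where "res r f \<equiv> restrict f (hom_dom n (bar R n A) r)"

lemma res_HCo:
  assumes f: "f \<in> carrier (HCo r m)" and r: "r \<le> r'"
  shows "res r' f \<in> carrier (HCo r' m)"
proof -
  have le: "psum p r \<le> q" if "psum p r' \<le> q" for p q
    using that psum_mono[OF order_refl r] order_trans by blast
  then have dom: "hom_dom n (bar R n A) r' \<subseteq> hom_dom n (bar R n A) r" by (auto simp: hom_dom_def)
  have val: "res r' f (p, q, k, x) = f (p, q, k, x)" if "p \<in> GM n" "q \<in> GM n" "psum p r' \<le> q" "x \<in> carrier (BT p k)"
      for p q k x
    using that by (simp add: hom_dom_def)
  show ?thesis unfolding HCo_iff
  proof (intro conjI ballI allI impI)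
    show "res r' f \<in> (\<Pi>\<^sub>E (p, q, k, x) \<in> hom_dom n (bar R n A) r'. carrier (pobj A q (k + m)))"
      using f dom unfolding HCo_iff by (auto simp: PiE_iff)
    fix p q k assume p: "p \<in> GM n" "q \<in> GM n" "psum p r' \<le> q"
    interpret B: module R "BT p k" by (rule module_BT)
    show "(\<lambda>x. res r' f (p, q, k, x)) \<in> lin_maps R (BT p k) (pobj A q (k + m))"
      using HCo_lin[OF f p(1,2) le[OF p(3)], of k] val[OF p]
      by (auto simp: lin_maps_def hom_def Pi_iff)
  next
    fix p q p' q' k x
    assume p: "p \<in> GM n" "q \<in> GM n" "p' \<in> GM n" "q' \<in> GM n" and x: "x \<in> carrier (BT p' k)"
      and l: "p' \<le> p \<and> psum p r' \<le> q \<and> q \<le> q'"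
    have l': "psum p' r' \<le> q'" using l psum_mono[of p' p r' r'] order_trans by (metis order_refl)
    obtain u where u: "u \<in> carrier (FT p' k)" "x = bcls p' k u" using mod_coset[OF x] by blast
    have "pmap (bar R n A) p' p k x \<in> carrier (BT p k)"
      using bar_map[of p' p u k] u l FT_mono[of p' p k] by (auto simp: carrier_BT)
    then show "res r' f (p', q', k, x) = pmap A q q' (k + m) (res r' f (p, q, k, pmap (bar R n A) p' p k x))"
      using val[OF p(3,4) l' x] val[OF p(1,2)] l HCo_nat[OF f p x] le by auto
  qed
qed

lemma cv_res:
  assumes f: "f \<in> carrier (HCo r m)" and r: "r \<in> MP" "r' \<in> MP" "r \<le> r'"
    and w: "valid w" "list_all2 push w w'" and g: "good r' w'"
  shows "cv r' m (res r' f) w' = pmap A (wtag r w) (wtag r' w') (word_deg w + m) (cv r m f w)"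
proof -
  note pg = push_good[OF w g r] and gg = good_GM[OF g r(2)]
  have b: "bw (gm_hull n (sumperv w')) w' \<in> carrier (BT (gm_hull n (sumperv w')) (word_deg w'))"
    using bw_closed[OF pg(3) gg(7)] .
  have "cv r' m (res r' f) w' = f (gm_hull n (sumperv w'), wtag r' w', word_deg w, bw (gm_hull n (sumperv w')) w)"
    using hval_eq(2)[OF g r(2)] bw_push[OF w gg(7)] pg gg b by (simp add: hom_dom_def)
  also have "\<dots> = pmap A (wtag r w) (wtag r' w') (word_deg w + m) (cv r m f w)"
  proof (rule cv_general(1)[OF f r(1) w(1) gg(3,4)])
    show "sumperv w \<le> gm_hull n (sumperv w')" using pg(5) gg(7) by (rule order_trans)
    show "psum (gm_hull n (sumperv w')) r \<le> wtag r' w'"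
      using psum_mono[OF order_refl r(3)] gg(5) by (rule order_trans)
  qed
  finally show ?thesis .
qed

lemma Phi_res:
  assumes f: "f \<in> carrier (HCo r m)" and r: "r \<in> MP" "r' \<in> MP" "r \<le> r'"
  shows "natural r r' m (Phi r m f) (Phi r' m (res r' f))"
proof (rule naturalI_words)
  note g = res_HCo[OF f r(3)]
  show "multiadditive (Phi r m f)" "multiadditive (Phi r' m (res r' f))"
    using linear_funD(1) Phi_linear f g r by blast+
  fix w w' assume w: "valid w" "list_all2 push w w'"
  then have "valid w'" using push_words by blast
  then show "PR (psum (sumperv w) r) (psum (sumperv w') r') (word_deg w + m) (Phi r m f (VW w))
      (Phi r' m (res r' f) (VW w'))"
    using PR_LT[OF f g r w cv_res[OF f r w]] Phi_VW[OF f r(1) w(1)] Phi_VW[OF g r(2)] by simp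
qed (use r in simp_all)

text \<open>Restriction of a cochain to fewer pairs of perversities, in terms of word cochains.\<close>

definition rT :: "perv \<Rightarrow> perv \<Rightarrow> int \<Rightarrow> (('r, 'a) tmod list \<Rightarrow> ('r, 'a) tmod) \<Rightarrow> ('r, 'a) tmod list \<Rightarrow> ('r, 'a) tmod" where
  "rT r r' m F = Phi r' m (res r' (iPhi r m F))"

lemma rT_props:
  assumes F: "F \<in> HCT r m" and r: "r \<in> MP" "r' \<in> MP" "r \<le> r'"
  shows "rT r r' m F \<in> HCT r' m" "natural r r' m F (rT r r' m F)" "res r' (iPhi r m F) = iPhi r' m (rT r r' m F)"
proof -
  note g = res_HCo[OF iPhi_HCo[OF F] r(3)]
  show "rT r r' m F \<in> HCT r' m" unfolding rT_def by (rule Phi_HCT[OF g r(2)])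
  show "natural r r' m F (rT r r' m F)" unfolding rT_def using Phi_res[OF iPhi_HCo[OF F] r] by (simp add: Phi_iPhi[OF F])
  show "res r' (iPhi r m F) = iPhi r' m (rT r r' m F)" unfolding rT_def by (rule iPhi_Phi[OF g r(2), symmetric])
qed

lemma rT_eq:
  assumes F: "F \<in> HCT r m" and r: "r \<in> MP" "r' \<in> MP" "r \<le> r'" and G: "natural r r' m F G" "linear_fun G"
  shows "rT r r' m F = G"
  by (rule natural_unique[OF rT_props(2)[OF F r] G(1) _ G(2)]) (use rT_props(1)[OF F r] HCT_facts in blast)

lemma natural_D:
  assumes F: "natural r r' m F F'" and r: "r \<in> GM n" "r' \<in> GM n"
  shows "natural r r' (m + 1) (dga.D m F) (dga.D m F')"
proof -
  have "natural (psum gm_zero r) (psum gm_zero r') (2 + m - 1) (dga.circ m dga.mm F) (dga.circ m dga.mm F')"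
    "natural (psum r gm_zero) (psum r' gm_zero) (m + 2 - 1) (dga.circ 2 F dga.mm) (dga.circ 2 F' dga.mm)"
    by (rule natural_circ[OF natural_mm F], rule natural_circ[OF F natural_mm])
  then have "natural r r' (m + 1) (dga.circ m dga.mm F) (dga.circ m dga.mm F')"
    "natural r r' (m + 1) (dga.circ 2 F dga.mm) (dga.circ 2 F' dga.mm)"
    by (simp_all add: psum_gm_zero algebra_simps)
  then show ?thesis unfolding dga.D_alt by (intro natural_add natural_minus natural_sg)
qed

lemma rT_D:
  assumes F: "F \<in> HCT r m" and r: "r \<in> GM n" "r' \<in> GM n" "r \<le> r'"
  shows "rT r r' (m + 1) (dga.D m F) = dga.D m (rT r r' m F)"
proof (rule rT_eq)
  note MP = r(1,2)[THEN GM_mono_perv] r(3)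
  note p = rT_props[OF F MP]
  show "dga.D m F \<in> HCT r (m + 1)" "r \<in> MP" "r' \<in> MP" "r \<le> r'" using HCT_D[OF F r(1)] MP by auto
  show "natural r r' (m + 1) (dga.D m F) (dga.D m (rT r r' m F))" by (rule natural_D[OF p(2) r(1,2)])
  show "linear_fun (dga.D m (rT r r' m F))" using HCT_D[OF p(1) r(2)] HCT_facts by blast
qed

lemma rT_ZT: "F \<in> ZT r m \<Longrightarrow> r \<in> GM n \<Longrightarrow> r' \<in> GM n \<Longrightarrow> r \<le> r' \<Longrightarrow> rT r r' m F \<in> ZT r' m"
proof -
  assume F: "F \<in> ZT r m" and r: "r \<in> GM n" "r' \<in> GM n" "r \<le> r'"
  note MP = r(1,2)[THEN GM_mono_perv] r(3)
  have "dga.D m F = (\<lambda>w. 0)" using F by (simp add: ZT_def fun_eq_iff)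
  then have "dga.D m (rT r r' m F) = rT r r' (m + 1) (\<lambda>w. 0)" using rT_D[OF ZT_HCT[OF F] r] by simp
  also have "\<dots> = (\<lambda>w. 0)"
    by (rule rT_eq[OF HCT_zero MP]) (use MP HCT_facts[OF HCT_zero[OF MP(2)]] in \<open>auto simp: natural_def PR_zero
        natural_PR_MP\<close>)
  finally show "rT r r' m F \<in> ZT r' m" using rT_props(1)[OF ZT_HCT[OF F] MP] by (simp add: ZT_def)
qed

lemma HH_map:
  assumes F: "F \<in> ZT r m" and r: "r \<in> GM n" "r' \<in> GM n" "r \<le> r'"
  shows "pmap (HH R n A) r r' m (hc r m F) = hc r' m (rT r r' m F)"
proof -
  note MP = r(1,2)[THEN GM_mono_perv] r(3)
  have *: "pmap (HH R n A) r r' m X = BZ r' m <+>\<^bsub>CZ r' m\<^esub> (res r' ` X)" for X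
    by (simp add: HH_def pquot_def hoch_cocycles_def HC_def internal_hom_def)
  have e: "res r' (iPhi r m G) = iPhi r' m (rT r r' m G)" if "G \<in> ZT r m" for G
    using rT_props(3)[OF ZT_HCT[OF that] MP] .
  have add: "rT r r' m (\<lambda>w. G w + H w) = (\<lambda>w. rT r r' m G w + rT r r' m H w)" if "G \<in> ZT r m" "H \<in> ZT r m" for G H
    using rT_props[OF ZT_HCT[OF that(1)] MP] rT_props[OF ZT_HCT[OF that(2)] MP] HCT_facts
    by (intro rT_eq[OF ZT_HCT[OF ZT_add[OF that]] MP] natural_add linear_add) auto
  have "BZ r' m <+>\<^bsub>CZ r' m\<^esub> (res r' ` coset (CZ r m) (BZ r m) (iPhi r m F))
      = coset (CZ r' m) (BZ r' m) (res r' (iPhi r m F))"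
  proof (rule coset_image)
    show "abelian_group (CZ r m)" "abelian_group (CZ r' m)" using module_CZ r module.axioms(2) by blast+
    show "additive_subgroup (BZ r m) (CZ r m)" "additive_subgroup (BZ r' m) (CZ r' m)"
      using submodule_of.add_sub[OF sub_HH] r by blast+
    show "res r' x \<in> carrier (CZ r' m)" if "x \<in> carrier (CZ r m)" for x
      using that r rT_ZT e by (auto simp: carrier_CZ)
    show "res r' (x \<oplus>\<^bsub>CZ r m\<^esub> y) = res r' x \<oplus>\<^bsub>CZ r' m\<^esub> res r' y" if "x \<in> carrier (CZ r m)" "y \<in> carrier (CZ r m)" for x y
    proof -
      obtain G H where G: "G \<in> ZT r m" "x = iPhi r m G" and H: "H \<in> ZT r m" "y = iPhi r m H"
        using \<open>x \<in> carrier (CZ r m)\<close> \<open>y \<in> carrier (CZ r m)\<close> by (auto simp: carrier_CZ[OF r(1)])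
      show ?thesis unfolding G(2) H(2) CZ_ops(1)[OF r(1) G(1) H(1)] e[OF ZT_add[OF G(1) H(1)]] e[OF G(1)] e[OF H(1)]
        add[OF G(1) H(1)] CZ_ops(1)[OF r(2) rT_ZT[OF G(1) r] rT_ZT[OF H(1) r]] ..
    qed
    show "res r' ` BZ r m \<subseteq> BZ r' m"
    proof
      fix y assume "y \<in> res r' ` BZ r m"
      then obtain K where K: "K \<in> HCT r (m - 1)" "y = res r' (iPhi r m (dga.D (m - 1) K))" by (auto simp: BZ_eq[OF r(1)])
      have "y = iPhi r' m (dga.D (m - 1) (rT r r' (m - 1) K))"
        unfolding K(2) e[OF ZT_boundary[OF K(1) r(1)]] using rT_D[OF K(1) r] by simp
      then show "y \<in> BZ r' m" using rT_props(1)[OF K(1) MP] by (auto simp: BZ_eq[OF r(2)])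
    qed
    show "iPhi r m F \<in> carrier (CZ r m)" using F carrier_CZ[OF r(1)] by blast
  qed
  then show ?thesis unfolding * hc_coset e[OF F] .
qed

lemma perverse_module_HH: "perverse_module R n (HH R n A)"
proof (rule perverse_module.intro)
  show "cring R" by (rule cring)
  fix p k assume p: "p \<in> GM n"
  show "module R (HHo p k)" unfolding HHo_quot by (rule submodule_of.module_Q[OF sub_HH[OF p]])
  show "pmap (HH R n A) p p k x = x" if x: "x \<in> carrier (HHo p k)" for x
  proof -
    obtain F where F: "F \<in> ZT p k" "x = hc p k F" by (rule HHoE[OF x p])
    have "wc p k F" using ZT_HCT[OF F(1)] by (simp add: HCT_def)
    then have "natural p p k F F" "linear_fun F" by (simp_all add: wc_def)
    then have "rT p p k F = F" by (rule rT_eq[OF ZT_HCT[OF F(1)] GM_mono_perv[OF p] GM_mono_perv[OF p] order_refl])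

    then show ?thesis using HH_map[OF F(1) p p order_refl] F by simp
  qed
next
  fix p q k assume p: "p \<in> GM n" "q \<in> GM n" "p \<le> q"
  note MP = p(1,2)[THEN GM_mono_perv] p(3)
  note m = HH_map[OF _ p]
  have add: "rT p q k (\<lambda>w. G w + H w) = (\<lambda>w. rT p q k G w + rT p q k H w)" if "G \<in> ZT p k" "H \<in> ZT p k" for G H
    using rT_props[OF ZT_HCT[OF that(1)] MP] rT_props[OF ZT_HCT[OF that(2)] MP] HCT_facts
    by (intro rT_eq[OF ZT_HCT[OF ZT_add[OF that]] MP] natural_add linear_add) auto
  have scl: "rT p q k (\<lambda>w. sc c (G w)) = (\<lambda>w. sc c (rT p q k G w))" if "G \<in> ZT p k" "c \<in> carrier R" for G c
    using rT_props[OF ZT_HCT[OF that(1)] MP] HCT_facts that(2)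
    by (intro rT_eq[OF ZT_HCT[OF ZT_sc[OF that(2,1)]] MP] natural_sc linear_sc) auto
  show "pmap (HH R n A) p q k \<in> lin_maps R (HHo p k) (HHo q k)"
    unfolding lin_maps_def hom_def
  proof (intro CollectI conjI ballI funcsetI, simp_all)
    fix x assume "x \<in> carrier (HHo p k)"
    then obtain F where F: "F \<in> ZT p k" "x = hc p k F" using p(1) by (rule HHoE)
    note zF = rT_ZT[OF F(1) p]
    show "pmap (HH R n A) p q k x \<in> carrier (HHo q k)" using m F hc_closed[OF p(2) zF] by simp
    show "pmap (HH R n A) p q k (c \<odot>\<^bsub>HHo p k\<^esub> x) = c \<odot>\<^bsub>HHo q k\<^esub> pmap (HH R n A) p q k x" if c: "c \<in> carrier R" for c
      unfolding F(2) hc_smult[OF p(1) F(1) c] m[OF ZT_sc[OF c F(1)]] m[OF F(1)] scl[OF F(1) c] hc_smult[OF p(2) zF c] ..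
    fix y assume "y \<in> carrier (HHo p k)"
    then obtain G where G: "G \<in> ZT p k" "y = hc p k G" using p(1) by (rule HHoE)
    show "pmap (HH R n A) p q k (x \<oplus>\<^bsub>HHo p k\<^esub> y) = pmap (HH R n A) p q k x \<oplus>\<^bsub>HHo q k\<^esub> pmap (HH R n A) p q k y"
      unfolding F(2) G(2) hc_add[OF p(1) F(1) G(1)] m[OF ZT_add[OF F(1) G(1)]] m[OF F(1)] m[OF G(1)]
        add[OF F(1) G(1)] hc_add[OF p(2) zF rT_ZT[OF G(1) p]] ..
  qed
next
  fix p q r k x assume p: "p \<in> GM n" "q \<in> GM n" "r \<in> GM n" "p \<le> q" "q \<le> r" and x: "x \<in> carrier (HHo p k)"
  obtain F where F: "F \<in> ZT p k" "x = hc p k F" using x p(1) by (rule HHoE)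
  have pr: "p \<le> r" using p by auto
  have f: "F \<in> HCT p k" by (rule ZT_HCT[OF F(1)])
  note MP = p(1-3)[THEN GM_mono_perv]
  have "rT q r k (rT p q k F) = rT p r k F"
  proof -
    note a = rT_props[OF f MP(1,2) p(4)]
    have res: "res r (res q (iPhi p k F)) = res r (iPhi p k F)"
      using psum_mono[OF order_refl p(5)] by (auto simp: restrict_def fun_eq_iff hom_dom_def intro: order_trans)
    have "rT q r k (rT p q k F) = Phi r k (res r (iPhi q k (rT p q k F)))" by (rule rT_def)
    also have "\<dots> = rT p r k F" unfolding a(3)[symmetric] res by (rule rT_def[symmetric])
    finally show ?thesis .
  qed
  then show "pmap (HH R n A) q r k (pmap (HH R n A) p q k x) = pmap (HH R n A) p r k x"
    using F HH_map[OF F(1) p(1,2,4)] HH_map[OF rT_ZT[OF F(1) p(1,2,4)] p(2,3,5)] HH_map[OF F(1) p(1,3) pr] by simp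
qed

section \<open>Products on cohomology\<close>

text \<open>What is needed of an operation \<open>b m l\<close> on cochains of degrees \<open>m\<close> and \<open>l\<close> to induce a natural bilinear product of
degree \<open>e\<close> on cohomology: it preserves normalised word cochains, satisfies a Leibniz formula for \<open>D\<close>, and is
bilinear and natural.\<close>

definition chain_product :: "int \<Rightarrow> (int \<Rightarrow> int \<Rightarrow> (('r, 'a) tmod list \<Rightarrow> ('r, 'a) tmod) \<Rightarrow> (('r, 'a) tmod list \<Rightarrow> ('r, 'a) tmod)
    \<Rightarrow> ('r, 'a) tmod list \<Rightarrow> ('r, 'a) tmod) \<Rightarrow> bool" where
  "chain_product e b \<longleftrightarrow> (\<forall>r\<in>GM n. \<forall>s\<in>GM n. psum r s \<le> gm_top n \<longrightarrow> (\<forall>m l. \<forall>F\<in>HCT r m. \<forall>G\<in>HCT s l.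
     b m l F G \<in> HCT (gm_add n r s) (m + l + e) \<and>
     dga.D (m + l + e) (b m l F G) = (\<lambda>w. b (m + 1) l (dga.D m F) G w + sg (m + e) (b m (l + 1) F (dga.D l G) w)) \<and>
     (\<forall>F'\<in>HCT r m. b m l (\<lambda>w. F w + F' w) G = (\<lambda>w. b m l F G w + b m l F' G w)) \<and>
     (\<forall>G'\<in>HCT s l. b m l F (\<lambda>w. G w + G' w) = (\<lambda>w. b m l F G w + b m l F G' w)) \<and>
     (\<forall>c\<in>carrier R. b m l (\<lambda>w. sc c (F w)) G = (\<lambda>w. sc c (b m l F G w)) \<and>
                     b m l F (\<lambda>w. sc c (G w)) = (\<lambda>w. sc c (b m l F G w))) \<and>
     (\<forall>r'\<in>GM n. \<forall>s'\<in>GM n. \<forall>F' G'. psum r' s' \<le> gm_top n \<longrightarrow> natural r r' m F F' \<longrightarrow> natural s s' l G G' \<longrightarrow>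
        natural (gm_add n r s) (gm_add n r' s') (m + l + e) (b m l F G) (b m l F' G'))))"

lemma chain_productD:
  assumes "chain_product e b" "r \<in> GM n" "s \<in> GM n" "psum r s \<le> gm_top n" "F \<in> HCT r m" "G \<in> HCT s l"
  shows "b m l F G \<in> HCT (gm_add n r s) (m + l + e)"
    and "dga.D (m + l + e) (b m l F G) = (\<lambda>w. b (m + 1) l (dga.D m F) G w + sg (m + e) (b m (l + 1) F (dga.D l G) w))"
    and "F' \<in> HCT r m \<Longrightarrow> b m l (\<lambda>w. F w + F' w) G = (\<lambda>w. b m l F G w + b m l F' G w)"
    and "G' \<in> HCT s l \<Longrightarrow> b m l F (\<lambda>w. G w + G' w) = (\<lambda>w. b m l F G w + b m l F G' w)"
    and "c \<in> carrier R \<Longrightarrow> b m l (\<lambda>w. sc c (F w)) G = (\<lambda>w. sc c (b m l F G w))"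
    and "c \<in> carrier R \<Longrightarrow> b m l F (\<lambda>w. sc c (G w)) = (\<lambda>w. sc c (b m l F G w))"
    and "r' \<in> GM n \<Longrightarrow> s' \<in> GM n \<Longrightarrow> psum r' s' \<le> gm_top n \<Longrightarrow> natural r r' m F F' \<Longrightarrow> natural s s' l G G' \<Longrightarrow>
        natural (gm_add n r s) (gm_add n r' s') (m + l + e) (b m l F G) (b m l F' G')"
  using assms(1)[unfolded chain_product_def, rule_format, OF assms(2-)] by blast+

lemma natural_gm_add:
  assumes "natural (psum r s) (psum r' s') m F F'" "psum r' s' \<le> gm_top n"
  shows "natural (gm_add n r s) (gm_add n r' s') m F F'"
  unfolding gm_add_def by (rule natural_hull[OF assms])

lemma HCT_hom: "F \<in> HCT r m \<Longrightarrow> c \<in> carrier R \<Longrightarrow> dga.homogeneous (sc c) F"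
  using HCT_facts linear_funD(2) by blast

lemma chain_product_cup: "chain_product 0 (\<lambda>m l. dga.cup l)"
  unfolding chain_product_def
proof (intro ballI allI impI conjI)
  fix r s m l F G
  assume rs: "r \<in> GM n" "s \<in> GM n" "psum r s \<le> gm_top n" and F: "F \<in> HCT r m" and G: "G \<in> HCT s l"
  show "dga.cup l F G \<in> HCT (gm_add n r s) (m + l + 0)" using HCT_cup[OF F G rs(3)] by simp
  show "dga.D (m + l + 0) (dga.cup l F G) = (\<lambda>w. dga.cup l (dga.D m F) G w + sg (m + 0) (dga.cup (l + 1) F (dga.D l G) w))"
    using dga.D_cup[of F m l G] HCT_facts[OF F] HCT_facts[OF G] by (simp add: fun_eq_iff)
  show "dga.cup l (\<lambda>w. F w + F' w) G = (\<lambda>w. dga.cup l F G w + dga.cup l F' G w)" for F'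
    by (rule ext) (rule dga.cup_add_left)
  show "dga.cup l F (\<lambda>w. G w + G' w) = (\<lambda>w. dga.cup l F G w + dga.cup l F G' w)" for G'
    by (rule ext) (rule dga.cup_add_right)
  fix c assume c: "c \<in> carrier R"
  show "dga.cup l (\<lambda>w. sc c (F w)) G = (\<lambda>w. sc c (dga.cup l F G w))" "dga.cup l F (\<lambda>w. sc c (G w))
      = (\<lambda>w. sc c (dga.cup l F G w))"
    by (rule ext, rule dga.scalar_cup[OF scalar_sc[OF c]])+
next
  fix r s m l F G r' s' F' G'
  assume "natural r r' m F F'" "natural s s' l G G'" "psum r' s' \<le> gm_top n"
  then show "natural (gm_add n r s) (gm_add n r' s') (m + l + 0) (dga.cup l F G) (dga.cup l F' G')"
    using natural_gm_add[OF natural_cup] by simp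
qed

lemma gm_add_commute: "gm_add n p q = gm_add n q p"
  by (simp add: gm_add_def psum_commute)

lemma chain_product_brk: "chain_product (- 1) dga.brk"
  unfolding chain_product_def
proof (intro ballI allI impI conjI)
  fix r s m l F G
  assume rs: "r \<in> GM n" "s \<in> GM n" "psum r s \<le> gm_top n" and F: "F \<in> HCT r m" and G: "G \<in> HCT s l"
  note f = HCT_facts[OF F] and g = HCT_facts[OF G]
  show "dga.brk m l F G \<in> HCT (gm_add n r s) (m + l + - 1)" using HCT_brk[OF F G rs(3)] by simp
  show "dga.D (m + l + - 1) (dga.brk m l F G) = (\<lambda>w. dga.brk (m + 1) l (dga.D m F) G w
      + sg (m + - 1) (dga.brk m (l + 1) F (dga.D l G) w))"
    using dga.D_brk[of F m G l] f g by (simp add: fun_eq_iff)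
  show "dga.brk m l (\<lambda>w. F w + F' w) G = (\<lambda>w. dga.brk m l F G w + dga.brk m l F' G w)" for F'
    by (rule ext) (rule dga.brk_add; use f g in blast)
  show "dga.brk m l F (\<lambda>w. G w + G' w) = (\<lambda>w. dga.brk m l F G w + dga.brk m l F G' w)" for G'
    by (rule ext) (rule dga.brk_add; use f g in blast)
  fix c assume c: "c \<in> carrier R"
  show "dga.brk m l (\<lambda>w. sc c (F w)) G = (\<lambda>w. sc c (dga.brk m l F G w))" "dga.brk m l F (\<lambda>w. sc c (G w))
      = (\<lambda>w. sc c (dga.brk m l F G w))"
    by (rule ext, rule dga.scalar_brk[OF scalar_sc[OF c]], rule HCT_hom[OF _ c], rule F G)+
next
  fix r s m l F G r' s' F' G'
  assume F: "natural r r' m F F'" and G: "natural s s' l G G'" and le: "psum r' s' \<le> gm_top n"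
  have "natural (gm_add n r s) (gm_add n r' s') (m + l - 1) (dga.circ l F G) (dga.circ l F' G')"
    by (rule natural_gm_add[OF natural_circ[OF F G] le])
  moreover have "natural (gm_add n r s) (gm_add n r' s') (m + l - 1) (dga.circ m G F) (dga.circ m G' F')"
    using natural_gm_add[OF natural_circ[OF G F]] le by (simp add: psum_commute gm_add_commute add.commute)
  ultimately show "natural (gm_add n r s) (gm_add n r' s') (m + l + - 1) (dga.brk m l F G) (dga.brk m l F' G')"
    unfolding dga.brk_alt by (intro natural_add natural_minus natural_sg) simp_all
qed

definition cocycle_of :: "perv \<Rightarrow> int \<Rightarrow> ('r, 'a) cochain set \<Rightarrow> ('r, 'a) tmod list \<Rightarrow> ('r, 'a) tmod" where
  "cocycle_of p i X = (SOME F. F \<in> ZT p i \<and> hc p i F = X)"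

text \<open>The product of classes is the class of the product of chosen cocycles; \<open>induced_hc\<close> shows independence of the
choice.\<close>

definition induced where
  "induced e b p q i j X Y = hc (gm_add n p q) (i + j + e) (b i j (cocycle_of p i X) (cocycle_of q j Y))"

context
  fixes e :: int and b
  assumes b: "chain_product e b"
begin

lemma product_ZT:
  assumes pq: "p \<in> GM n" "q \<in> GM n" "psum p q \<le> gm_top n" and F: "F \<in> ZT p i" and G: "G \<in> ZT q j"
  shows "b i j F G \<in> ZT (gm_add n p q) (i + j + e)"
proof -
  have z: "b (i + 1) j (\<lambda>w. 0) G = (\<lambda>w. 0)"
    using chain_productD(3)[OF b pq HCT_zero ZT_HCT[OF G] HCT_zero, of "i + 1"] GM_mono_perv[OF pq(1)]
    by (simp add: fun_eq_iff)
  have z': "b i (j + 1) F (\<lambda>w. 0) = (\<lambda>w. 0)"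
    using chain_productD(4)[OF b pq ZT_HCT[OF F] HCT_zero HCT_zero, of "j + 1"] GM_mono_perv[OF pq(2)]
    by (simp add: fun_eq_iff)
  show ?thesis
    using chain_productD(1,2)[OF b pq ZT_HCT[OF F] ZT_HCT[OF G]] unfolding ZT_iff ZT_D_fun[OF F] ZT_D_fun[OF G] z z' by simp
qed

text \<open>A product of a boundary \<open>DK\<close> and a cocycle is the boundary of the product of \<open>K\<close> with the cocycle.\<close>

lemma hc_left:
  assumes pq: "p \<in> GM n" "q \<in> GM n" "psum p q \<le> gm_top n" and F: "F \<in> ZT p i" "F' \<in> ZT p i" "hc p i F' = hc p i F"
      and G: "G \<in> ZT q j"
  shows "hc (gm_add n p q) (i + j + e) (b i j F' G) = hc (gm_add n p q) (i + j + e) (b i j F G)"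
proof -
  have ij: "i - 1 + j + e = i + j + e - 1" by simp
  obtain K where K: "K \<in> HCT p (i - 1)" "\<And>w. F' w = F w + dga.D (i - 1) K w"
    using F(3) unfolding hc_eq_iff[OF pq(1) F(2,1)] by blast
  note bd = ZT_boundary[OF K(1) pq(1)]
  have z': "b (i - 1) (j + 1) K (\<lambda>w. 0) = (\<lambda>w. 0)"
    using chain_productD(4)[OF b pq K(1) HCT_zero HCT_zero, of "j + 1"] GM_mono_perv[OF pq(2)]
    by (simp add: fun_eq_iff)
  have "F' = (\<lambda>w. F w + dga.D (i - 1) K w)" using K(2) by (rule ext)
  then have 1: "b i j F' G = (\<lambda>w. b i j F G w + b i j (dga.D (i - 1) K) G w)"
    using chain_productD(3)[OF b pq ZT_HCT[OF F(1)] ZT_HCT[OF G] ZT_HCT[OF bd]] by simp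
  have "dga.D (i + j + e - 1) (b (i - 1) j K G) = b i j (dga.D (i - 1) K) G"
    using chain_productD(2)[OF b pq K(1) ZT_HCT[OF G]] by (simp add: ZT_D_fun[OF G] z' ij)
  then show ?thesis
    using 1 chain_productD(1)[OF b pq K(1) ZT_HCT[OF G]] gm_add_GM[OF pq] product_ZT[OF pq F(1) G] product_ZT[OF pq F(2) G]
    by (intro hc_eqI[where K = "b (i - 1) j K G"]) (simp_all add: ij)
qed

lemma hc_right:
  assumes pq: "p \<in> GM n" "q \<in> GM n" "psum p q \<le> gm_top n" and F: "F \<in> ZT p i"
      and G: "G \<in> ZT q j" "G' \<in> ZT q j" "hc q j G' = hc q j G"
  shows "hc (gm_add n p q) (i + j + e) (b i j F G') = hc (gm_add n p q) (i + j + e) (b i j F G)"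
proof -
  have ij: "i + (j - 1) + e = i + j + e - 1" by simp
  obtain K where K: "K \<in> HCT q (j - 1)" "\<And>w. G' w = G w + dga.D (j - 1) K w"
    using G(3) unfolding hc_eq_iff[OF pq(2) G(2,1)] by blast
  note bd = ZT_boundary[OF K(1) pq(2)]
  have z': "b (i + 1) (j - 1) (\<lambda>w. 0) K = (\<lambda>w. 0)"
    using chain_productD(3)[OF b pq HCT_zero K(1) HCT_zero, of "i + 1"] GM_mono_perv[OF pq(1)]
    by (simp add: fun_eq_iff)
  have "G' = (\<lambda>w. G w + dga.D (j - 1) K w)" using K(2) by (rule ext)
  then have 1: "b i j F G' = (\<lambda>w. b i j F G w + b i j F (dga.D (j - 1) K) w)"
    using chain_productD(4)[OF b pq ZT_HCT[OF F] ZT_HCT[OF G(1)] ZT_HCT[OF bd]] by simp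
  \<comment> \<open>the sign in the Leibniz formula is absorbed in the primitive\<close>
  have 2: "dga.D (i + j + e - 1) (b i (j - 1) F K) = (\<lambda>w. sg (i + e) (b i j F (dga.D (j - 1) K) w))"
    using chain_productD(2)[OF b pq ZT_HCT[OF F] K(1)] by (simp add: ZT_D_fun[OF F] z' ij)
  have 3: "dga.D (i + j + e - 1) (\<lambda>w. sg (i + e) (b i (j - 1) F K w)) w = b i j F (dga.D (j - 1) K) w" for w
    using fun_cong[OF 2, of w] by (cases "even (i + e)") (simp_all add: sg_def dga.D_minus)
  show ?thesis
    using 1 3 chain_productD(1)[OF b pq ZT_HCT[OF F] K(1)] gm_add_GM[OF pq] product_ZT[OF pq F G(1)] product_ZT[OF pq F G(2)]
    by (intro hc_eqI[where K = "\<lambda>w. sg (i + e) (b i (j - 1) F K w)"] HCT_sg) (simp_all add: ij)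
qed

lemma induced_hc:
  assumes pq: "p \<in> GM n" "q \<in> GM n" "psum p q \<le> gm_top n" and F: "F \<in> ZT p i" and G: "G \<in> ZT q j"
  shows "induced e b p q i j (hc p i F) (hc q j G) = hc (gm_add n p q) (i + j + e) (b i j F G)"
proof -
  have s: "cocycle_of r k (hc r k H) \<in> ZT r k \<and> hc r k (cocycle_of r k (hc r k H)) = hc r k H" if "H \<in> ZT r k" for r k H
    unfolding cocycle_of_def by (rule someI[of _ H]) (simp add: that)
  show ?thesis unfolding induced_def
    using hc_left[OF pq F _ _ G] hc_right[OF pq _ G] s[OF F] s[OF G] by metis
qed

lemma induced_product: "perverse_product R n (HH R n A) e (induced e b)"
  unfolding perverse_product_def
proof (intro conjI ballI allI impI)
  fix p q i j assume pq: "p \<in> GM n" "q \<in> GM n" "psum p q \<le> gm_top n"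
  note t = gm_add_GM[OF pq] and z = product_ZT[OF pq] and ih = induced_hc[OF pq] and bd = chain_productD[OF b pq]
  fix X assume "X \<in> carrier (HHo p i)"
  then obtain F where F: "F \<in> ZT p i" "X = hc p i F" using HHoE[OF _ pq(1)] by metis
  show "(\<lambda>Y. induced e b p q i j X Y) \<in> lin_maps R (HHo q j) (HHo (gm_add n p q) (i + j + e))"
    unfolding lin_maps_def hom_def
  proof (intro CollectI conjI ballI funcsetI, simp_all)
    fix Y assume "Y \<in> carrier (HHo q j)"
    then obtain G where G: "G \<in> ZT q j" "Y = hc q j G" using HHoE[OF _ pq(2)] by metis
    show "induced e b p q i j X Y \<in> carrier (HHo (gm_add n p q) (i + j + e))"
      unfolding F(2) G(2) ih[OF F(1) G(1)] by (rule hc_closed[OF t z[OF F(1) G(1)]])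
    show "induced e b p q i j X (c \<odot>\<^bsub>HHo q j\<^esub> Y) = c \<odot>\<^bsub>HHo (gm_add n p q) (i + j + e)\<^esub> induced e b p q i j X Y"
      if c: "c \<in> carrier R" for c
      unfolding F(2) G(2) ih[OF F(1) G(1)] hc_smult[OF pq(2) G(1) c] ih[OF F(1) ZT_sc[OF c G(1)]]
        hc_smult[OF t z[OF F(1) G(1)] c] bd(6)[OF ZT_HCT[OF F(1)] ZT_HCT[OF G(1)] c] ..
    fix Y' assume "Y' \<in> carrier (HHo q j)"
    then obtain G' where G': "G' \<in> ZT q j" "Y' = hc q j G'" using HHoE[OF _ pq(2)] by metis
    show "induced e b p q i j X (Y \<oplus>\<^bsub>HHo q j\<^esub> Y') = induced e b p q i j X Y
        \<oplus>\<^bsub>HHo (gm_add n p q) (i + j + e)\<^esub> induced e b p q i j X Y'"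
      unfolding F(2) G(2) G'(2) hc_add[OF pq(2) G(1) G'(1)] ih[OF F(1) ZT_add[OF G(1) G'(1)]] ih[OF F(1) G(1)]
          ih[OF F(1) G'(1)]
        hc_add[OF t z[OF F(1) G(1)] z[OF F(1) G'(1)]] bd(4)[OF ZT_HCT[OF F(1)] ZT_HCT[OF G(1)] ZT_HCT[OF G'(1)]] ..
  qed
next
  fix p q i j assume pq: "p \<in> GM n" "q \<in> GM n" "psum p q \<le> gm_top n"
  note t = gm_add_GM[OF pq] and z = product_ZT[OF pq] and ih = induced_hc[OF pq] and bd = chain_productD[OF b pq]
  fix Y assume "Y \<in> carrier (HHo q j)"
  then obtain G where G: "G \<in> ZT q j" "Y = hc q j G" using HHoE[OF _ pq(2)] by metis
  show "(\<lambda>X. induced e b p q i j X Y) \<in> lin_maps R (HHo p i) (HHo (gm_add n p q) (i + j + e))"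
    unfolding lin_maps_def hom_def
  proof (intro CollectI conjI ballI funcsetI, simp_all)
    fix X assume "X \<in> carrier (HHo p i)"
    then obtain F where F: "F \<in> ZT p i" "X = hc p i F" using HHoE[OF _ pq(1)] by metis
    show "induced e b p q i j X Y \<in> carrier (HHo (gm_add n p q) (i + j + e))"
      unfolding F(2) G(2) ih[OF F(1) G(1)] by (rule hc_closed[OF t z[OF F(1) G(1)]])
    show "induced e b p q i j (c \<odot>\<^bsub>HHo p i\<^esub> X) Y = c \<odot>\<^bsub>HHo (gm_add n p q) (i + j + e)\<^esub> induced e b p q i j X Y"
      if c: "c \<in> carrier R" for c
      unfolding F(2) G(2) ih[OF F(1) G(1)] hc_smult[OF pq(1) F(1) c] ih[OF ZT_sc[OF c F(1)] G(1)]
        hc_smult[OF t z[OF F(1) G(1)] c] bd(5)[OF ZT_HCT[OF F(1)] ZT_HCT[OF G(1)] c] ..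
    fix X' assume "X' \<in> carrier (HHo p i)"
    then obtain F' where F': "F' \<in> ZT p i" "X' = hc p i F'" using HHoE[OF _ pq(1)] by metis
    show "induced e b p q i j (X \<oplus>\<^bsub>HHo p i\<^esub> X') Y = induced e b p q i j X Y
        \<oplus>\<^bsub>HHo (gm_add n p q) (i + j + e)\<^esub> induced e b p q i j X' Y"
      unfolding F(2) G(2) F'(2) hc_add[OF pq(1) F(1) F'(1)] ih[OF ZT_add[OF F(1) F'(1)] G(1)] ih[OF F(1) G(1)]
          ih[OF F'(1) G(1)]
        hc_add[OF t z[OF F(1) G(1)] z[OF F'(1) G(1)]] bd(3)[OF ZT_HCT[OF F(1)] ZT_HCT[OF G(1)] ZT_HCT[OF F'(1)]] ..
  qed
next
  fix p q p' q' i j X Y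
  assume pq: "p \<in> GM n" "q \<in> GM n" and pq': "p' \<in> GM n" "q' \<in> GM n"
    and le: "p \<le> p' \<and> q \<le> q' \<and> psum p' q' \<le> gm_top n"
    and X: "X \<in> carrier (HHo p i)" and Y: "Y \<in> carrier (HHo q j)"
  have top: "psum p q \<le> gm_top n" using psum_mono[of p p' q q'] le order_trans by blast
  have top': "psum p' q' \<le> gm_top n" and pp: "p \<le> p'" "q \<le> q'" using le by auto
  obtain F where F: "F \<in> ZT p i" "X = hc p i F" using HHoE[OF X pq(1)] by metis
  obtain G where G: "G \<in> ZT q j" "Y = hc q j G" using HHoE[OF Y pq(2)] by metis
  note fg = ZT_HCT[OF F(1)] ZT_HCT[OF G(1)]
  note rF = rT_props[OF fg(1) pq(1)[THEN GM_mono_perv] pq'(1)[THEN GM_mono_perv] pp(1)]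
  note rG = rT_props[OF fg(2) pq(2)[THEN GM_mono_perv] pq'(2)[THEN GM_mono_perv] pp(2)]
  note zF = rT_ZT[OF F(1) pq(1) pq'(1) pp(1)] and zG = rT_ZT[OF G(1) pq(2) pq'(2) pp(2)]
  note t = gm_add_GM[OF pq top] and t' = gm_add_GM[OF pq' top']
  have nat: "natural (gm_add n p q) (gm_add n p' q') (i + j + e) (b i j F G) (b i j (rT p p' i F) (rT q q' j G))"
    by (rule chain_productD(7)[OF b pq top fg pq' top' rF(2) rG(2)])
  have "rT (gm_add n p q) (gm_add n p' q') (i + j + e) (b i j F G) = b i j (rT p p' i F) (rT q q' j G)"
    using natural_MP[OF nat] HCT_facts[OF chain_productD(1)[OF b pq' top' rF(1) rG(1)]]
    by (intro rT_eq[OF chain_productD(1)[OF b pq top fg] _ _ _ nat]) auto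
  then show "pmap (HH R n A) (gm_add n p q) (gm_add n p' q') (i + j + e) (induced e b p q i j X Y) =
      induced e b p' q' i j (pmap (HH R n A) p p' i X) (pmap (HH R n A) q q' j Y)"
    unfolding F(2) G(2) HH_map[OF F(1) pq(1) pq'(1) pp(1)] HH_map[OF G(1) pq(2) pq'(2) pp(2)]
      induced_hc[OF pq top F(1) G(1)] induced_hc[OF pq' top' zF zG]
    using HH_map[OF product_ZT[OF pq top F(1) G(1)] t t'] natural_MP[OF nat] by simp
qed

lemma induced_hoch_induces:
  assumes op: "\<And>r s m l F G. r \<in> GM n \<Longrightarrow> s \<in> GM n \<Longrightarrow> psum r s \<le> gm_top n \<Longrightarrow> F \<in> HCT r m \<Longrightarrow> G \<in> HCT s l \<Longrightarrow>
      \<beta> r s m l (iPhi r m F) (iPhi s l G) = iPhi (gm_add n r s) (m + l + e) (b m l F G)"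
  shows "hoch_induces R n A e \<beta> (induced e b)"
  unfolding hoch_induces_def
proof (intro ballI impI allI)
  fix r s m l f g
  assume rs: "r \<in> GM n" "s \<in> GM n" "psum r s \<le> gm_top n" and f: "f \<in> carrier (CZ r m)" and g: "g \<in> carrier (CZ s l)"
  obtain F where F: "F \<in> ZT r m" "f = iPhi r m F" using f carrier_CZ[OF rs(1)] by blast
  obtain G where G: "G \<in> ZT s l" "g = iPhi s l G" using g carrier_CZ[OF rs(2)] by blast
  have eq: "\<beta> r s m l f g = iPhi (gm_add n r s) (m + l + e) (b m l F G)"
    unfolding F(2) G(2) by (rule op[OF rs ZT_HCT[OF F(1)] ZT_HCT[OF G(1)]])
  show "\<beta> r s m l f g \<in> carrier (CZ (gm_add n r s) (m + l + e)) \<and>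
      induced e b r s m l (hoch_class R n A r m f) (hoch_class R n A s l g) =
      hoch_class R n A (gm_add n r s) (m + l + e) (\<beta> r s m l f g)"
    unfolding eq using product_ZT[OF rs F(1) G(1)] induced_hc[OF rs F(1) G(1)]
    by (simp add: carrier_CZ[OF gm_add_GM[OF rs]] hc_def F(2) G(2))
qed

end

abbreviation cupH where "cupH \<equiv> induced 0 (\<lambda>m l. dga.cup l)"
abbreviation brkH where "brkH \<equiv> induced (- 1) dga.brk"

lemma cup_induces: "hoch_induces R n A 0 (hoch_cup R n A) cupH"
  by (rule induced_hoch_induces[OF chain_product_cup]) (simp add: hoch_cup_eq iPhi_HCo Phi_iPhi)

lemma brk_induces: "hoch_induces R n A (- 1) (hoch_bracket R n A) brkH"
  by (rule induced_hoch_induces[OF chain_product_brk]) (simp add: hoch_bracket_eq iPhi_HCo Phi_iPhi)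

lemma cupH_hc:
  assumes "p \<in> GM n" "q \<in> GM n" "psum p q \<le> gm_top n" "F \<in> ZT p i" "G \<in> ZT q j" "t = gm_add n p q" "d = i + j"
  shows "cupH p q i j (hc p i F) (hc q j G) = hc t d (dga.cup j F G)" "dga.cup j F G \<in> ZT t d"
  using induced_hc[OF chain_product_cup assms(1-5)] product_ZT[OF chain_product_cup assms(1-5)] assms(6,7) by simp_all

lemma brkH_hc:
  assumes "p \<in> GM n" "q \<in> GM n" "psum p q \<le> gm_top n" "F \<in> ZT p i" "G \<in> ZT q j" "t = gm_add n p q" "d = i + j - 1"
  shows "brkH p q i j (hc p i F) (hc q j G) = hc t d (dga.brk i j F G)" "dga.brk i j F G \<in> ZT t d"
  using induced_hc[OF chain_product_brk assms(1-5)] product_ZT[OF chain_product_brk assms(1-5)] assms(6,7) by simp_all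

text \<open>All sums of two or three of the perversities \<open>p\<close>, \<open>q\<close>, \<open>r\<close> that occur in the Gerstenhaber identities.\<close>

lemma triple_perv:
  assumes p: "p \<in> GM n" "q \<in> GM n" "r \<in> GM n" and le: "psum (psum p q) r \<le> gm_top n"
  shows "psum p q \<le> gm_top n" "psum q r \<le> gm_top n" "psum p r \<le> gm_top n"
    "gm_add n p q \<in> GM n" "gm_add n q r \<in> GM n" "gm_add n p r \<in> GM n"
    "psum (gm_add n p q) r \<le> gm_top n" "psum p (gm_add n q r) \<le> gm_top n" "psum q (gm_add n p r) \<le> gm_top n"
    "gm_add n (gm_add n p q) r = gm_add n p (gm_add n q r)" "gm_add n (gm_add n p q) r = gm_add n q (gm_add n p r)"
    "gm_add n (gm_add n p q) r = gm_hull n (psum p (psum q r))" "psum p (psum q r) \<le> gm_top n"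
    "gm_add n (gm_add n p q) r \<in> GM n"
proof -
  have le2: "psum (psum q r) p \<le> gm_top n" "psum (psum p r) q \<le> gm_top n" "psum (psum q p) r \<le> gm_top n" using le
      by (simp_all add: psum_ac)
  show a: "psum p q \<le> gm_top n" "psum q r \<le> gm_top n" "psum p r \<le> gm_top n"
    using psum_le_topD(1)[OF le] psum_le_topD(1)[OF le2(1)] psum_le_topD(1)[OF le2(2)] .
  show g: "gm_add n p q \<in> GM n" "gm_add n q r \<in> GM n" "gm_add n p r \<in> GM n" using gm_add_GM p a by auto
  show s: "psum (gm_add n p q) r \<le> gm_top n" "psum p (gm_add n q r) \<le> gm_top n" "psum q (gm_add n p r) \<le> gm_top n"
    using psum3_iff[OF p a(1)] psum3_iff[OF p(2,3,1) a(2)] psum3_iff[OF p(1,3,2) a(3)] le le2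
    by (simp_all add: psum_commute[of _ "gm_add n q r"] psum_commute[of _ "gm_add n p r"])
  show "gm_add n (gm_add n p q) r = gm_add n p (gm_add n q r)" by (rule gm_add_assoc[OF p le])
  show "gm_add n (gm_add n p q) r = gm_add n q (gm_add n p r)"
    using gm_add_assoc[OF p(2,1,3) le2(3)] by (simp add: gm_add_commute)
  show "gm_add n (gm_add n p q) r = gm_hull n (psum p (psum q r))"
    using gm_hull_psum[of "psum p q" n r] p a(1) by (simp add: gm_add_def psum_mono_perv GM_mono_perv psum_assoc)
  show "psum p (psum q r) \<le> gm_top n" using le by (simp add: psum_assoc)
  show "gm_add n (gm_add n p q) r \<in> GM n" by (rule gm_add_GM[OF g(1) p(3) s(1)])
qed

text \<open>Antisymmetry, the Jacobi identity and associativity hold for cochains. Commutativity and the Leibniz rule hold up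
to the boundaries of \<open>F \<circ> G\<close> and of \<open>F{G, H}\<close>.\<close>

lemma gerstenhaber_HH: "perverse_gerstenhaber R n (HH R n A) cupH brkH"
proof (rule perverse_gerstenhaber.intro[OF perverse_module_HH], rule perverse_gerstenhaber_axioms.intro)
  show "perverse_product R n (HH R n A) 0 cupH" by (rule induced_product[OF chain_product_cup])
  show "perverse_product R n (HH R n A) (- 1) brkH" by (rule induced_product[OF chain_product_brk])
next
  fix p q i j f g
  assume p: "p \<in> GM n" "q \<in> GM n" "psum p q \<le> gm_top n" and f: "f \<in> carrier (HHo p i)" and g: "g \<in> carrier (HHo q j)"
  obtain F where F: "F \<in> ZT p i" "f = hc p i F" using HHoE[OF f p(1)] by metis
  obtain G where G: "G \<in> ZT q j" "g = hc q j G" using HHoE[OF g p(2)] by metis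
  note fact = HCT_facts[OF ZT_HCT[OF F(1)]] HCT_facts[OF ZT_HCT[OF G(1)]]
  have p': "psum q p \<le> gm_top n" using p(3) by (simp add: psum_commute)
  note t = gm_add_GM[OF p] and qp = gm_add_commute[of p q] and ij = add.commute[of i j]
  note c1 = cupH_hc[OF p F(1) G(1) refl refl] and c2 = cupH_hc[OF p(2,1) p' G(1) F(1) qp ij]
  have z: "dga.circ j (\<lambda>w. 0) G w = 0" "dga.circ (j + 1) F (\<lambda>w. 0) w = 0" for w
    using dga.circ_add_left[of j "\<lambda>w. 0" "\<lambda>w. 0" G w] dga.circ_add_right[of F "j + 1" "\<lambda>w. 0" "\<lambda>w. 0" w] fact by simp_all
  show "cupH p q i j f g = sgn_mult (HHo (gm_add n p q) (i + j)) (i * j) (cupH q p j i g f)"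
    unfolding F(2) G(2) c1(1) c2(1) hc_sgn[OF t c2(2)]
  proof (rule hc_eqI[OF t c1(2) ZT_sg[OF c2(2)]])
    \<comment> \<open>the homotopy of \<open>D_circ\<close>, with the sign that isolates the product \<open>F \<union> G\<close>\<close>
    show "(\<lambda>w. - sg i (dga.circ j F G w)) \<in> HCT (gm_add n p q) (i + j - 1)"
      by (intro HCT_minus HCT_sg HCT_circ ZT_HCT F G p)
    have "dga.D (i + j - 1) (\<lambda>w. - sg i (dga.circ j F G w)) w = - sg i (dga.D (i + j - 1) (dga.circ j F G) w)" for w
      by (cases "even i") (simp_all add: dga.D_minus)
    then show "dga.cup j F G w = sg (i * j) (dga.cup i G F w) + dga.D (i + j - 1) (\<lambda>w. - sg i (dga.circ j F G w)) w" for w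
      using dga.D_circ[of F i j G w] fact z
      by (cases "even i"; cases "even j") (simp_all add: ZT_D_fun[OF F(1)] ZT_D_fun[OF G(1)])
  qed
  have ij': "i + j - 1 = j + i - 1" by simp
  note b1 = brkH_hc[OF p F(1) G(1) refl refl] and b2 = brkH_hc[OF p(2,1) p' G(1) F(1) qp ij']
  show "brkH p q i j f g = \<ominus>\<^bsub>HHo (gm_add n p q) (i + j - 1)\<^esub> sgn_mult (HHo (gm_add n p q) (i + j - 1))
      ((i - 1) * (j - 1)) (brkH q p j i g f)"
    unfolding F(2) G(2) b1(1) b2(1) hc_sgn[OF t b2(2)] hc_minus[OF t ZT_sg[OF b2(2)]]
    by (rule arg_cong[of _ _ "hc (gm_add n p q) (i + j - 1)"], rule ext)
       (cases "even i"; cases "even j"; simp add: dga.brk_def)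
next
  fix p q r i j k f g h
  assume p: "p \<in> GM n" "q \<in> GM n" "r \<in> GM n" and le: "psum (psum p q) r \<le> gm_top n"
    and f: "f \<in> carrier (HHo p i)" and g: "g \<in> carrier (HHo q j)" and h: "h \<in> carrier (HHo r k)"
  obtain F where F: "F \<in> ZT p i" "f = hc p i F" using HHoE[OF f p(1)] by metis
  obtain G where G: "G \<in> ZT q j" "g = hc q j G" using HHoE[OF g p(2)] by metis
  obtain H where H: "H \<in> ZT r k" "h = hc r k H" using HHoE[OF h p(3)] by metis
  note tp = triple_perv[OF p le]
  let ?t = "gm_add n (gm_add n p q) r"
  note fact = HCT_facts[OF ZT_HCT[OF F(1)]] HCT_facts[OF ZT_HCT[OF G(1)]] HCT_facts[OF ZT_HCT[OF H(1)]]
  note fg = cupH_hc[OF p(1,2) tp(1) F(1) G(1) refl refl] and gh = cupH_hc[OF p(2,3) tp(2) G(1) H(1) refl refl]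
  note bfg = brkH_hc[OF p(1,2) tp(1) F(1) G(1) refl refl] and bgh = brkH_hc[OF p(2,3) tp(2) G(1) H(1) refl refl]
    and bfh = brkH_hc[OF p(1,3) tp(3) F(1) H(1) refl refl]
  have d: "i + j + k = i + (j + k)" "i + j + k - 2 = i + j - 1 + k - 1" "i + j + k - 2 = i + (j + k - 1) - 1"
    "i + j + k - 2 = j + (i + k - 1) - 1" "i + j + k - 1 = i + (j + k) - 1" "i + j + k - 1 = i + j - 1 + k"
    "i + j + k - 1 = j + (i + k - 1)" by simp_all
  show "cupH (gm_add n p q) r (i + j) k (cupH p q i j f g) h = cupH p (gm_add n q r) i (j + k) f (cupH q r j k g h)"
    unfolding F(2) G(2) H(2) fg(1) gh(1) cupH_hc(1)[OF tp(4) p(3) tp(7) fg(2) H(1) refl refl]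
      cupH_hc(1)[OF p(1) tp(5,8) F(1) gh(2) tp(10) d(1)]
    by (rule arg_cong[of _ _ "hc ?t (i + j + k)"], rule ext, rule dga.cup_assoc[symmetric])
  fix M
  {
    assume M: "M = HHo ?t (i + j + k - 2)"
    note x = brkH_hc[OF tp(4) p(3) tp(7) bfg(2) H(1) refl d(2)] and y = brkH_hc[OF p(1) tp(5,8) F(1) bgh(2) tp(10) d(3)]
      and z = brkH_hc[OF p(2) tp(6,9) G(1) bfh(2) tp(11) d(4)]
    show "brkH (gm_add n p q) r (i + j - 1) k (brkH p q i j f g) h =
        brkH p (gm_add n q r) i (j + k - 1) f (brkH q r j k g h)
        \<ominus>\<^bsub>M\<^esub> sgn_mult M ((i - 1) * (j - 1)) (brkH q (gm_add n p r) j (i + k - 1) g (brkH p r i k f h))"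
      unfolding M F(2) G(2) H(2) bfg(1) bgh(1) bfh(1) x(1) y(1) z(1) hc_sgn[OF tp(14) z(2)]
          hc_diff[OF tp(14) y(2) ZT_sg[OF z(2)]]
      by (rule arg_cong[of _ _ "hc ?t (i + j + k - 2)"], rule ext, rule dga.jacobi) (use fact in auto)
  next
    assume M: "M = HHo ?t (i + j + k - 1)"
    note x = brkH_hc[OF p(1) tp(5,8) F(1) gh(2) tp(10) d(5)] and y = cupH_hc[OF tp(4) p(3) tp(7) bfg(2) H(1) refl d(6)]
      and z = cupH_hc[OF p(2) tp(6,9) G(1) bfh(2) tp(11) d(7)]
    have K: "dga.brace j k F G H \<in> HCT ?t (i + j + k - 1 - 1)"
      using HCT_brace[OF F(1)[THEN ZT_HCT] G(1)[THEN ZT_HCT] H(1)[THEN ZT_HCT] tp(13)] by (simp add: tp(12) add.assoc)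
    have brace: "dga.D (i + j + k - 1 - 1) (\<lambda>w. sg (i + j - 1) (dga.brace j k F G H w)) w =
        sg (i + j - 1) (dga.D (i + j + k - 2) (dga.brace j k F G H) w)" for w
      by (cases "even (i + j)") (simp_all add: dga.D_minus add.assoc)
    show "brkH p (gm_add n q r) i (j + k) f (cupH q r j k g h) =
        cupH (gm_add n p q) r (i + j - 1) k (brkH p q i j f g) h
        \<oplus>\<^bsub>M\<^esub> sgn_mult M ((i - 1) * j) (cupH q (gm_add n p r) j (i + k - 1) g (brkH p r i k f h))"
      unfolding M F(2) G(2) H(2) bfg(1) gh(1) bfh(1) x(1) y(1) z(1) hc_sgn[OF tp(14) z(2)]
          hc_add[OF tp(14) y(2) ZT_sg[OF z(2)]]
    proof (rule hc_eqI[OF tp(14) x(2) ZT_add[OF y(2) ZT_sg[OF z(2)]] HCT_sg[OF K]])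
      show "dga.brk i (j + k) F (dga.cup k G H) w = dga.cup k (dga.brk i j F G) H w +
          sg ((i - 1) * j) (dga.cup (i + k - 1) G (dga.brk i k F H) w) +
          dga.D (i + j + k - 1 - 1) (\<lambda>w. sg (i + j - 1) (dga.brace j k F G H w)) w" for w
        unfolding brace by (rule dga.brk_cup) (use fact ZT_D F G H in auto)
    qed
  }
qed

end

theorem theoremA:
  fixes R :: "('r, 'x) ring_scheme" and n :: nat and A :: "('r, 'a, 'z) pdga_scheme"
  assumes "cring R" and "perverse_dga R n A"
  shows "\<exists>cup bracket.
      hoch_induces R n A 0 (hoch_cup R n A) cup \<and>
      hoch_induces R n A (- 1) (hoch_bracket R n A) bracket \<and>
      perverse_gerstenhaber R n (HH R n A) cup bracket"
  using perverse_dga.cup_induces[OF assms(2)] perverse_dga.brk_induces[OF assms(2)]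
    perverse_dga.gerstenhaber_HH[OF assms(2)] by blast

end
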